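(* Let $d\le 3$, let $T>0$, let $A$ be a nonempty finite subset of $\{z\in\mathbb Z^d:z_i\le0,\ i=1,\dots,d\}$, let $b\in\mathcal B$, and let $H^n:[0,T]\times\mathbb T_n^d\to\mathbb R$ be uniformly bounded in $n$. Assume $\lim_{n\to\infty}H_n(0)/n^{d/2}=0$. Then for any $s<t$ in $[0,T]$ and any $\lambda>0$, \[ \lim_{n\to\infty}\mathbb P_n\Big(\Big|\int_s^t\frac1{n^{d/2}}\sum_{x\in\mathbb T_n^d}\omega_{x+A}(s')\,\omega_{x+b}(s')\,H^n_{s'}(x)\,ds'\Big|>\lambda\Big)=0. \] Moreover, for any $K>0$ this convergence is uniform over all sequences $(H^n)$ with $\sup_n\|H^n\|_\infty\le K$.
   Context: Setting: $F:\mathbb T^d\to\mathbb R^d$ smooth; $\mathbb T_n^d=\mathbb Z^d/n\mathbb Z^d$, $\mathcal B=\{e_1,\dots,e_d\}$, $\Omega_n=\{0,1\}^{\mathbb T_n^d}$; $F_b^n(x)=F(\tfrac xn+\tfrac b{2n})\cdot b$; rates $r_n(x,x+b)=n^2\max\{\tfrac12,1+\tfrac1nF^n_b(x)\}$, $r_n(x+b,x)=n^2\max\{\tfrac12,1-\tfrac1nF_b^n(x)\}$, $r_n=0$ for non-neighbours; $\eta^n(\cdot)$ is the Markov chain with generator $L_nf(\eta)=\sum_{x,y}r_n(x,y)\eta_x(1-\eta_y)(f(\eta^{x,y})-f(\eta))$ ($\eta^{x,y}$: values at $x,y$ exchanged), arbitrary initial law; $\mathbb P_n$ its law. $u_0:\mathbb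 T^d\to(0,1)$ is $C^\infty$ with values in $[\varepsilon_0,1-\varepsilon_0]$ for some $\varepsilon_0>0$, $u$ solves $\partial_tu=\Delta u-2\nabla\cdot(u(1-u)F)$, $u(0)=u_0$; $u^n_x(t)=u(t,x/n)$; $\mu_t^n=\bigotimes_x\mathrm{Bern}(u_x^n(t))$; $H_n(t)$ is the relative entropy of the law of $\eta^n(t)$ w.r.t. $\mu_t^n$. At time $s'$, $\omega_x(s')=(\eta^n_x(s')-u^n_x(s'))/(u^n_x(s')(1-u^n_x(s')))$ and $\omega_{x+A}(s')=\prod_{y\in A}\omega_{x+y}(s')$. *)

theory Defs
  imports "HOL-Probability.Probability"
begin

definition smooth_fun :: "('a::euclidean_space \<Rightarrow> real) \<Rightarrow> bool" where
  "smooth_fun g \<longleftrightarrow> (\<exists>S. g \<in> S \<and> (\<forall>h\<in>S. continuous_on UNIV h \<and>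
     (\<forall>v\<in>Basis. \<exists>h'\<in>S. \<forall>x. ((\<lambda>t. h (x + t *\<^sub>R v)) has_real_derivative h' x) (at 0))))"

definition pd :: "'d::finite \<Rightarrow> (real^'d \<Rightarrow> real) \<Rightarrow> real^'d \<Rightarrow> real" where
  "pd i g x = deriv (\<lambda>h. g (x + h *\<^sub>R axis i 1)) 0"

text \<open>Canonical representatives of the discrete torus.\<close>
definition box :: "nat \<Rightarrow> (int^'d::finite) set" where
  "box n = {x. \<forall>i. 0 \<le> x$i \<and> x$i < int n}"

definition tmod :: "nat \<Rightarrow> int^'d::finite \<Rightarrow> int^'d" where
  "tmod n x = (\<chi> i. x$i mod int n)"

text \<open>Configurations: n-periodic 0/1 functions on Z^d (True = occupied).\<close>
definition Omega :: "nat \<Rightarrow> (int^'d::finite \<Rightarrow> bool) set" where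
  "Omega n = {\<xi>. \<forall>x. \<xi> x = \<xi> (tmod n x)}"

definition basisZ :: "(int^'d::finite) set" where
  "basisZ = range (\<lambda>i. axis i 1)"

definition ivec :: "int^'d::finite \<Rightarrow> real^'d" where
  "ivec x = (\<chi> i. real_of_int (x$i))"

definition xr :: "nat \<Rightarrow> int^'d::finite \<Rightarrow> real^'d" where
  "xr n x = (\<chi> i. real_of_int (x$i) / real n)"

definition swap :: "nat \<Rightarrow> (int^'d::finite \<Rightarrow> bool) \<Rightarrow> int^'d \<Rightarrow> int^'d \<Rightarrow> (int^'d \<Rightarrow> bool)" where
  "swap n \<xi> x y = (\<lambda>z. if tmod n z = tmod n x then \<xi> y
                        else if tmod n z = tmod n y then \<xi> x else \<xi> z)"

definition Fbn :: "(real^'d::finite \<Rightarrow> real^'d) \<Rightarrow> nat \<Rightarrow> int^'d \<Rightarrow> int^'d \<Rightarrow> real" where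
  "Fbn F n b x = inner (F (xr n x + (1 / (2 * real n)) *\<^sub>R ivec b)) (ivec b)"

text \<open>r_n(x,x+b) = n^2 max{1/2, 1 + F_b^n(x)/n}, r_n(x+b,x) = n^2 max{1/2, 1 - F_b^n(x)/n},
  r_n = 0 for non-neighbours (for n >= 3 at most one summand is nonzero).\<close>
definition rate :: "(real^'d::finite \<Rightarrow> real^'d) \<Rightarrow> nat \<Rightarrow> int^'d \<Rightarrow> int^'d \<Rightarrow> real" where
  "rate F n x y = (\<Sum>b\<in>basisZ.
      (if tmod n y = tmod n (x + b) then real n ^ 2 * max (1/2) (1 + Fbn F n b x / real n) else 0)
    + (if tmod n x = tmod n (y + b) then real n ^ 2 * max (1/2) (1 - Fbn F n b y / real n) else 0))"

definition Lgen :: "(real^'d::finite \<Rightarrow> real^'d) \<Rightarrow> nat \<Rightarrow> ((int^'d \<Rightarrow> bool) \<Rightarrow> real)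
                     \<Rightarrow> (int^'d \<Rightarrow> bool) \<Rightarrow> real" where
  "Lgen F n f \<xi> = (\<Sum>x\<in>box n. \<Sum>y\<in>box n.
      rate F n x y * (if \<xi> x \<and> \<not> \<xi> y then 1 else 0) * (f (swap n \<xi> x y) - f \<xi>))"

definition Qmat :: "(real^'d::finite \<Rightarrow> real^'d) \<Rightarrow> nat \<Rightarrow> (int^'d \<Rightarrow> bool) \<Rightarrow> (int^'d \<Rightarrow> bool) \<Rightarrow> real" where
  "Qmat F n \<xi> \<zeta> = Lgen F n (\<lambda>\<xi>'. if \<xi>' = \<zeta> then 1 else 0) \<xi>"

fun qpow :: "(real^'d::finite \<Rightarrow> real^'d) \<Rightarrow> nat \<Rightarrow> nat \<Rightarrow> (int^'d \<Rightarrow> bool) \<Rightarrow> (int^'d \<Rightarrow> bool) \<Rightarrow> real" where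
  "qpow F n 0 \<xi> \<zeta> = (if \<xi> = \<zeta> then 1 else 0)"
| "qpow F n (Suc k) \<xi> \<zeta> = (\<Sum>\<zeta>'\<in>Omega n. qpow F n k \<xi> \<zeta>' * Qmat F n \<zeta>' \<zeta>)"

definition ptrans :: "(real^'d::finite \<Rightarrow> real^'d) \<Rightarrow> nat \<Rightarrow> real \<Rightarrow> (int^'d \<Rightarrow> bool) \<Rightarrow> (int^'d \<Rightarrow> bool) \<Rightarrow> real" where
  "ptrans F n t \<xi> \<zeta> = (\<Sum>k. t ^ k / fact k * qpow F n k \<xi> \<zeta>)"

text \<open>eta is a continuous-time Markov chain on Omega n with generator L_n (arbitrary initial law):
  right-continuous (piecewise constant) paths and the finite-dimensional distributions
  given by the transition function exp(tQ).\<close>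
definition is_ctmc :: "(real^'d::finite \<Rightarrow> real^'d) \<Rightarrow> nat \<Rightarrow> 'w measure
                        \<Rightarrow> (real \<Rightarrow> 'w \<Rightarrow> (int^'d \<Rightarrow> bool)) \<Rightarrow> bool" where
  "is_ctmc F n M \<eta> \<longleftrightarrow> prob_space M
    \<and> (\<forall>t\<ge>0. \<eta> t \<in> M \<rightarrow>\<^sub>M count_space UNIV)
    \<and> (\<forall>t\<ge>0. \<forall>\<omega>\<in>space M. \<eta> t \<omega> \<in> Omega n)
    \<and> (\<forall>\<omega>\<in>space M. \<forall>t\<ge>0. \<exists>\<delta>>0. \<forall>s. t \<le> s \<and> s < t + \<delta> \<longrightarrow> \<eta> s \<omega> = \<eta> t \<omega>)
    \<and> (\<forall>k (ts::nat \<Rightarrow> real) xs. 0 \<le> ts 0 \<and> (\<forall>j<k. ts j < ts (Suc j)) \<and> (\<forall>j\<le>k. xs j \<in> Omega n) \<longrightarrow>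
         measure M {\<omega>\<in>space M. \<forall>j\<le>k. \<eta> (ts j) \<omega> = xs j}
         = measure M {\<omega>\<in>space M. \<eta> (ts 0) \<omega> = xs 0}
           * (\<Prod>j<k. ptrans F n (ts (Suc j) - ts j) (xs j) (xs (Suc j))))"

definition mu_prod :: "(real \<Rightarrow> real^'d::finite \<Rightarrow> real) \<Rightarrow> nat \<Rightarrow> real \<Rightarrow> (int^'d \<Rightarrow> bool) \<Rightarrow> real" where
  "mu_prod u n t \<xi> = (\<Prod>x\<in>box n. if \<xi> x then u t (xr n x) else 1 - u t (xr n x))"

definition rel_entropy :: "nat \<Rightarrow> ((int^'d::finite \<Rightarrow> bool) \<Rightarrow> real) \<Rightarrow> ((int^'d \<Rightarrow> bool) \<Rightarrow> real) \<Rightarrow> real" where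
  "rel_entropy n p q = (\<Sum>\<xi>\<in>Omega n. p \<xi> * ln (p \<xi> / q \<xi>))"

definition Hent :: "(real \<Rightarrow> real^'d::finite \<Rightarrow> real) \<Rightarrow> nat \<Rightarrow> 'w measure
                     \<Rightarrow> (real \<Rightarrow> 'w \<Rightarrow> (int^'d \<Rightarrow> bool)) \<Rightarrow> real \<Rightarrow> real" where
  "Hent u n M \<eta> t = rel_entropy n (\<lambda>\<xi>. measure M {\<omega>\<in>space M. \<eta> t \<omega> = \<xi>}) (mu_prod u n t)"

definition omg :: "(real \<Rightarrow> real^'d::finite \<Rightarrow> real) \<Rightarrow> nat \<Rightarrow> (int^'d \<Rightarrow> bool) \<Rightarrow> real \<Rightarrow> int^'d \<Rightarrow> real" where
  "omg u n \<xi> t z = ((if \<xi> z then 1 else 0) - u t (xr n z)) / (u t (xr n z) * (1 - u t (xr n z)))"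

definition integrand :: "(real \<Rightarrow> real^'d::finite \<Rightarrow> real) \<Rightarrow> nat \<Rightarrow> (int^'d) set \<Rightarrow> int^'d
     \<Rightarrow> (real \<Rightarrow> int^'d \<Rightarrow> real) \<Rightarrow> (int^'d \<Rightarrow> bool) \<Rightarrow> real \<Rightarrow> real" where
  "integrand u n A b H \<xi> t = (1 / real n powr (real CARD('d) / 2)) *
     (\<Sum>x\<in>box n. (\<Prod>a\<in>A. omg u n \<xi> t (x + a)) * omg u n \<xi> t (x + b) * H t x)"

definition bad_prob :: "(real \<Rightarrow> real^'d::finite \<Rightarrow> real) \<Rightarrow> nat \<Rightarrow> 'w measure
     \<Rightarrow> (real \<Rightarrow> 'w \<Rightarrow> (int^'d \<Rightarrow> bool)) \<Rightarrow> (int^'d) set \<Rightarrow> int^'d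
     \<Rightarrow> (real \<Rightarrow> int^'d \<Rightarrow> real) \<Rightarrow> real \<Rightarrow> real \<Rightarrow> real \<Rightarrow> real" where
  "bad_prob u n M \<eta> A b H s t lam = measure M {\<omega>\<in>space M.
     \<bar>set_lebesgue_integral lborel {s..t} (\<lambda>s'. integrand u n A b H (\<eta> s' \<omega>) s')\<bar> > lam}"

end

theory Submission
  imports Defs
begin

text \<open>
  The proof is a relative entropy argument of Jara--Menezes type. Let f be a density with respect to the
  product measure at time t, and h(f) its entropy. Replacing the factor \<open>\<omega>\<^bsub>x+b\<^esub>\<close> by its average over a box
  anchored at \<open>x + b\<close> (which never meets \<open>x + A\<close>, as A lies in the negative orthant) costs a
  fraction of the Dirichlet form plus squares of averages of products of \<open>\<omega>\<close>, and the latter have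
  exponential moments by decoupling and Hanson--Wright type bounds. Hence the quadratic field tested
  against f is at most \<open>\<kappa> n\<^sup>2\<close> times the Dirichlet form plus \<open>C (h(f) + n\<^bsup>d/2-1/10\<^esup>)\<close>. The equation for u
  cancels the terms linear in \<open>\<omega>\<close> in the entropy production up to \<open>O(1/n)\<close>, so the production is of the
  same quadratic form.

  Exponential moments of the time integral are controlled through the logarithm of an
  \<open>L\<^sup>p\<close> norm of the Feynman--Kac flow relative to \<open>\<mu>\<^sub>t\<close>, with an exponent p that decreases towards 1:
  the decrease of p produces a negative entropy term which absorbs \<open>C h(f)\<close>, so the
  norm grows by \<open>O(n\<^bsup>d/2-1/10\<^esup>) = o(n\<^bsup>d/2\<^esup>)\<close>. The entropy inequality transfers this from the product initial
  law to the true one, at the price of \<open>H\<^sub>n(0) = o(n\<^bsup>d/2\<^esup>)\<close>. The flow is first discretised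
  in time for fixed n; the discretisation is removed by right continuity of the paths.
\<close>

section \<open>Exponential moments under product measures\<close>

text \<open>The restriction d <= 3 means n^(d-2) = o(n^(d/2)): already the first lengthening of a
  block costs at least n^(d-2). Cubic blocks of side m would pay n^(d-2) m for the replacement and
  n^d / m^d for the final average, and in d = 3 both are o(n^(3/2)) only if m is at once far below
  and far above n^(1/2). Hence one side is m = n^((7-d)/10) and the others are M = n^(3/5); in d = 3
  the error is n^(7/5), which is where the 1/10 comes from. The exponent is p = 1/(1-s) with s(t) =
  exp(-C t)/2, the solution of s' = -C s. The derivative of the log norm contains s times the
  entropy production and s' times the entropy, so the term C s h(f) of the first is cancelled
  exactly by the second. Starting at s = 1/2 keeps p <= 2, the range in which the geometric means
  produced by the tilted generator still yield a Dirichlet form. The observable is multiplied by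
  exp(-C T)/2 <= s(t), so that it equals s(t) times a field whose coefficients are still bounded by
  K.\<close>

definition wt :: "'s set \<Rightarrow> ('s \<Rightarrow> real) \<Rightarrow> 's set \<Rightarrow> real" where
  "wt I p S = (\<Prod>z\<in>I. if z \<in> S then p z else 1 - p z)"

text \<open>Configurations on a finite site set are coded as the subset of occupied sites, so that
  an expectation under independent Bernoulli variables is a finite sum to which the expansion of a
  product of sums over subsets applies.\<close>

definition EE :: "'s set \<Rightarrow> ('s \<Rightarrow> real) \<Rightarrow> ('s set \<Rightarrow> real) \<Rightarrow> real" where
  "EE I p g = (\<Sum>S\<in>Pow I. wt I p S * g S)"

lemma EE_prod:
  assumes "finite I"
  shows "EE I p (\<lambda>S. \<Prod>z\<in>I. g z (z \<in> S)) = (\<Prod>z\<in>I. p z * g z True + (1 - p z) * g z False)"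
proof -
  have "EE I p (\<lambda>S. \<Prod>z\<in>I. g z (z \<in> S))
      = (\<Sum>S\<in>Pow I. (\<Prod>z\<in>S. p z * g z True) * (\<Prod>z\<in>I-S. (1 - p z) * g z False))"
    unfolding EE_def wt_def
  proof (rule sum.cong[OF refl])
    fix S assume "S \<in> Pow I"
    then have S: "S \<subseteq> I" by auto
    have "(\<Prod>z\<in>I. if z \<in> S then p z else 1 - p z) * (\<Prod>z\<in>I. g z (z \<in> S))
        = (\<Prod>z\<in>I. if z \<in> S then p z * g z True else (1 - p z) * g z False)"
      unfolding prod.distrib[symmetric] by (intro prod.cong refl) auto
    also have "\<dots> = (\<Prod>z\<in>S. if z \<in> S then p z * g z True else (1 - p z) * g z False)
       * (\<Prod>z\<in>I-S. if z \<in> S then p z * g z True else (1 - p z) * g z False)"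
      by (subst prod.subset_diff[OF S assms]) (rule mult.commute)
    also have "\<dots> = (\<Prod>z\<in>S. p z * g z True) * (\<Prod>z\<in>I-S. (1 - p z) * g z False)"
      by (intro arg_cong2[where f="(*)"] prod.cong) auto
    finally show "(\<Prod>z\<in>I. if z \<in> S then p z else 1 - p z) * (\<Prod>z\<in>I. g z (z \<in> S))
       = (\<Prod>z\<in>S. p z * g z True) * (\<Prod>z\<in>I-S. (1 - p z) * g z False)" .
  qed
  then show ?thesis by (simp only: prod_add[OF assms])
qed

lemma EE_const: "finite I \<Longrightarrow> EE I p (\<lambda>_. c) = c"
  using EE_prod[of I p "\<lambda>_ _. 1"] unfolding EE_def by (simp add: sum_distrib_right[symmetric])

text \<open>Fubini for the product law. The outer sum freezes the configuration outside
  \<open>J\<close>, which stands in for conditioning in \<open>lin_exp\<close>.\<close>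

lemma EE_split:
  assumes "finite I" "J \<subseteq> I"
  shows "EE I p g = EE (I - J) p (\<lambda>S2. EE J p (\<lambda>S1. g (S1 \<union> S2)))"
proof -
  have "EE (I - J) p (\<lambda>S2. EE J p (\<lambda>S1. g (S1 \<union> S2)))
     = (\<Sum>(S2,S1)\<in>Pow (I-J) \<times> Pow J. wt (I-J) p S2 * wt J p S1 * g (S1 \<union> S2))"
    unfolding EE_def sum.cartesian_product[symmetric] by (simp add: sum_distrib_left mult.assoc)
  also have "\<dots> = (\<Sum>S\<in>Pow I. wt I p S * g S)"
  proof (rule sum.reindex_bij_witness[where j="\<lambda>(S2,S1). S1 \<union> S2" and i="\<lambda>S. (S - J, S \<inter> J)"])
    fix a assume a: "a \<in> Pow (I-J) \<times> Pow J"
    obtain S2 S1 where a2: "a = (S2,S1)" by (cases a)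
    have S: "S2 \<subseteq> I - J" "S1 \<subseteq> J" using a a2 by auto
    have "wt I p (S1 \<union> S2) = wt (I-J) p (S1 \<union> S2) * wt J p (S1 \<union> S2)"
      unfolding wt_def using prod.subset_diff[OF assms(2,1)] .
    moreover have "wt (I-J) p (S1 \<union> S2) = wt (I-J) p S2" unfolding wt_def
      using S by (intro prod.cong refl) auto
    moreover have "wt J p (S1 \<union> S2) = wt J p S1" unfolding wt_def
      using S by (intro prod.cong refl) auto
    ultimately show "wt I p (case a of (S2, S1) \<Rightarrow> S1 \<union> S2) * g (case a of (S2, S1) \<Rightarrow> S1 \<union> S2)
        = (case a of (S2, S1) \<Rightarrow> wt (I - J) p S2 * wt J p S1 * g (S1 \<union> S2))"
      using a2 by simp
  qed (use assms in auto)
  finally show ?thesis unfolding EE_def by simp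
qed

lemma wt_nonneg: "(\<And>z. z \<in> I \<Longrightarrow> 0 \<le> p z \<and> p z \<le> 1) \<Longrightarrow> 0 \<le> wt I p S"
  unfolding wt_def by (intro prod_nonneg) auto

lemma EE_mono:
  assumes "\<And>z. z \<in> I \<Longrightarrow> 0 \<le> p z \<and> p z \<le> 1" "\<And>S. S \<subseteq> I \<Longrightarrow> g S \<le> h S"
  shows "EE I p g \<le> EE I p h"
  unfolding EE_def using assms wt_nonneg[of I p] by (intro sum_mono mult_left_mono) auto

lemma EE_cong: "(\<And>S. S \<subseteq> I \<Longrightarrow> g S = h S) \<Longrightarrow> EE I p g = EE I p h"
  unfolding EE_def by (intro sum.cong) auto

lemma EE_cmult: "EE I p (\<lambda>S. c * g S) = c * EE I p g"
  unfolding EE_def by (simp add: sum_distrib_left mult_ac)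

lemma EE_sum: "EE I p (\<lambda>S. \<Sum>a\<in>B. g a S) = (\<Sum>a\<in>B. EE I p (g a))"
  unfolding EE_def sum_distrib_left by (rule sum.swap)

lemma EE_sqrt:
  assumes "finite I" "\<And>z. z \<in> I \<Longrightarrow> 0 \<le> p z \<and> p z \<le> 1"
  shows "(EE I p g)\<^sup>2 \<le> EE I p (\<lambda>S. (g S)\<^sup>2)"
proof -
  define e where "e = EE I p g"
  have "0 \<le> EE I p (\<lambda>S. (g S - e)\<^sup>2)"
    using EE_mono[where I=I and p=p and g="\<lambda>_. 0" and h="\<lambda>S. (g S - e)\<^sup>2", OF assms(2)] EE_const[OF assms(1), of p 0] by simp
  also have "EE I p (\<lambda>S. (g S - e)\<^sup>2) = EE I p (\<lambda>S. (g S)\<^sup>2) - 2 * e * EE I p g + EE I p (\<lambda>_. e\<^sup>2)"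
    unfolding EE_def sum_distrib_left sum_subtractf[symmetric] sum.distrib[symmetric]
    by (intro sum.cong refl) (simp add: power2_eq_square algebra_simps)
  also have "\<dots> = EE I p (\<lambda>S. (g S)\<^sup>2) - e\<^sup>2"
    unfolding EE_const[OF assms(1)] using e_def by (simp add: power2_eq_square)
  finally show ?thesis using e_def by simp
qed

text \<open>Chosen so that a centred average removes the linear term and leaves exactly the
  exponential of a square, without a prefactor that would accumulate over a product of
  sites.\<close>

lemma exp_le_square: "exp (y::real) \<le> y + exp (y\<^sup>2)"
proof -
  have sq: "1 + y\<^sup>2 \<le> exp (y\<^sup>2)" by (rule exp_ge_add_one_self)
  consider "y > 1" | "0 \<le> y" "y \<le> 1" | "y < 0" by linarith
  then show ?thesis
  proof cases
    case 1
    then have "y \<le> y\<^sup>2" by (simp add: power2_eq_square)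
    then have "exp y \<le> exp (y\<^sup>2)" by simp
    then show ?thesis using 1 by linarith
  next
    case 2 then show ?thesis using exp_bound[of y] sq by linarith
  next
    case 3
    \<comment> \<open>For negative y the bound exp y <= 1 + y + y^2 is obtained through the
      reciprocal: the product of 1 + y + y^2 with the quadratic lower bound of exp (-y) is 1 plus
      terms that are all nonnegative.\<close>
    have a: "1 - y + y\<^sup>2/2 \<le> exp (-y)" using exp_lower_Taylor_quadratic[of "-y"] 3 by simp
    have "1 + y\<^sup>2/2 - y^3/2 + y^4/2 = (1+y+y\<^sup>2) * (1 - y + y\<^sup>2/2)"
      by (simp add: power2_eq_square power3_eq_cube power4_eq_xxxx field_simps)
    moreover have "y^3 \<le> 0" using 3 by (simp add: power3_eq_cube mult_nonneg_nonpos)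
    moreover have "0 \<le> y^4" by simp
    ultimately have "1 \<le> (1+y+y\<^sup>2) * (1 - y + y\<^sup>2/2)"
      using zero_le_power2[of y] by linarith
    also have "\<dots> \<le> (1+y+y\<^sup>2) * exp (-y)"
    proof (rule mult_left_mono[OF a])
      have "1+y+y\<^sup>2 = (y+1/2)\<^sup>2 + 3/4" by (simp add: power2_eq_square field_simps)
      then show "0 \<le> 1+y+y\<^sup>2" by (metis add_nonneg_nonneg zero_le_power2 divide_nonneg_nonneg zero_le_numeral)
    qed
    finally have "exp y \<le> 1+y+y\<^sup>2" by (simp add: exp_minus field_simps)
    then show ?thesis using sq by linarith
  qed
qed

text \<open>Only centring and boundedness of the one-site variables \<open>om z\<close> are kept;
  the normalised occupation variables are the later instance.\<close>

locale bern =
  fixes I :: "'s set" and p :: "'s \<Rightarrow> real" and om :: "'s \<Rightarrow> bool \<Rightarrow> real" and M :: real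
  assumes finI: "finite I"
    and p01: "\<And>z. z \<in> I \<Longrightarrow> 0 \<le> p z \<and> p z \<le> 1"
    and mean0: "\<And>z. z \<in> I \<Longrightarrow> p z * om z True + (1 - p z) * om z False = 0"
    and omM: "\<And>z b. z \<in> I \<Longrightarrow> \<bar>om z b\<bar> \<le> M"
    and M1: "1 \<le> M"
begin

lemma two_point:
  assumes "z \<in> I"
  shows "p z * exp (c * om z True) + (1 - p z) * exp (c * om z False) \<le> exp (M\<^sup>2 * c\<^sup>2)"
proof -
  have b: "exp (c * om z b) \<le> c * om z b + exp (M\<^sup>2 * c\<^sup>2)" for b
  proof -
    have "(om z b)\<^sup>2 \<le> M\<^sup>2" using omM[OF assms, of b] M1 by (metis abs_le_square_iff abs_of_nonneg order_trans zero_le_one)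
    then have "(c * om z b)\<^sup>2 \<le> M\<^sup>2 * c\<^sup>2" unfolding power_mult_distrib by (simp add: mult_right_mono mult.commute[of "c\<^sup>2"])
    then show ?thesis using exp_le_square[of "c * om z b"] by (smt (verit) exp_le_cancel_iff)
  qed
  have "p z * exp (c * om z True) + (1 - p z) * exp (c * om z False)
     \<le> p z * (c * om z True + exp (M\<^sup>2 * c\<^sup>2)) + (1 - p z) * (c * om z False + exp (M\<^sup>2 * c\<^sup>2))"
    using p01[OF assms] b by (intro add_mono mult_left_mono) auto
  also have "\<dots> = c * (p z * om z True + (1 - p z) * om z False) + exp (M\<^sup>2 * c\<^sup>2)"
    by (simp add: algebra_simps)
  finally show ?thesis using mean0[OF assms] by simp
qed

text \<open>The coefficients may depend on the configuration, but only outside \<open>J\<close>.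
  With the sites outside \<open>J\<close> frozen they are constants, the exponential factorises over
  \<open>J\<close>, and \<open>two_point\<close> applies at each site.\<close>

lemma lin_exp:
  assumes "J \<subseteq> I"
    and c: "\<And>z S1 S2. z \<in> J \<Longrightarrow> S1 \<subseteq> J \<Longrightarrow> S2 \<subseteq> I - J \<Longrightarrow> c z (S1 \<union> S2) = c z S2"
  shows "EE I p (\<lambda>S. exp (\<Sum>z\<in>J. c z S * om z (z \<in> S))) \<le> EE I p (\<lambda>S. exp (M\<^sup>2 * (\<Sum>z\<in>J. (c z S)\<^sup>2)))"
  unfolding EE_split[OF finI assms(1)]
proof (rule EE_mono)
  show "z \<in> I - J \<Longrightarrow> 0 \<le> p z \<and> p z \<le> 1" for z using p01 by auto
  fix S2 assume S2: "S2 \<subseteq> I - J"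
  have fJ: "finite J" using assms(1) finI finite_subset by blast
  have "EE J p (\<lambda>S1. exp (\<Sum>z\<in>J. c z (S1 \<union> S2) * om z (z \<in> S1 \<union> S2)))
     = EE J p (\<lambda>S1. \<Prod>z\<in>J. exp (c z S2 * om z (z \<in> S1)))"
  proof (rule EE_cong)
    fix S1 assume S1: "S1 \<subseteq> J"
    have "(\<Sum>z\<in>J. c z (S1 \<union> S2) * om z (z \<in> S1 \<union> S2)) = (\<Sum>z\<in>J. c z S2 * om z (z \<in> S1))"
    proof (intro sum.cong refl)
      fix z assume z: "z \<in> J"
      then have "(z \<in> S1 \<union> S2) = (z \<in> S1)" using S2 by auto
      then show "c z (S1 \<union> S2) * om z (z \<in> S1 \<union> S2) = c z S2 * om z (z \<in> S1)"
        using c[OF z S1 S2] by simp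
    qed
    then show "exp (\<Sum>z\<in>J. c z (S1 \<union> S2) * om z (z \<in> S1 \<union> S2)) = (\<Prod>z\<in>J. exp (c z S2 * om z (z \<in> S1)))"
      by (simp add: exp_sum fJ)
  qed
  also have "\<dots> = (\<Prod>z\<in>J. p z * exp (c z S2 * om z True) + (1 - p z) * exp (c z S2 * om z False))"
    by (rule EE_prod[OF fJ, where g="\<lambda>z b. exp (c z S2 * om z b)"])
  also have "\<dots> \<le> (\<Prod>z\<in>J. exp (M\<^sup>2 * (c z S2)\<^sup>2))"
    using two_point assms(1) p01 by (intro prod_mono conjI add_nonneg_nonneg mult_nonneg_nonneg) auto
  also have "\<dots> = exp (M\<^sup>2 * (\<Sum>z\<in>J. (c z S2)\<^sup>2))" by (simp add: exp_sum fJ sum_distrib_left)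
  also have "\<dots> = EE J p (\<lambda>S1. exp (M\<^sup>2 * (\<Sum>z\<in>J. (c z S2)\<^sup>2)))" using EE_const[OF fJ] by simp
  also have "\<dots> = EE J p (\<lambda>S1. exp (M\<^sup>2 * (\<Sum>z\<in>J. (c z (S1 \<union> S2))\<^sup>2)))"
    using c[OF _ _ S2] by (intro EE_cong) simp
  finally show "EE J p (\<lambda>S1. exp (\<Sum>z\<in>J. c z (S1 \<union> S2) * om z (z \<in> S1 \<union> S2)))
    \<le> EE J p (\<lambda>S1. exp (M\<^sup>2 * (\<Sum>z\<in>J. (c z (S1 \<union> S2))\<^sup>2)))" .
qed

end

text \<open>Deleting \<open>t\<close> identifies the admissible \<open>R\<close> with the subsets of
  \<open>I - insert t B\<close>. Under a uniform colouring the event thus has probability exactly 2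
  to the power -(card B + 1), and exactness is what allows the factor to be undone in
  \<open>decouple\<close>.\<close>

lemma card_colourings:
  assumes "finite I" "B \<subseteq> I" "t \<in> I" "t \<notin> B"
  shows "real (card {R\<in>Pow I. t \<in> R \<and> B \<inter> R = {}}) * 2 ^ (card B + 1) = 2 ^ card I"
proof -
  have fB: "finite B" using assms finite_subset by blast
  have "bij_betw (insert t) (Pow (I - insert t B)) {R\<in>Pow I. t \<in> R \<and> B \<inter> R = {}}"
    unfolding bij_betw_def inj_on_def
  proof (intro conjI ballI impI set_eqI iffI)
    fix R assume "R \<in> {R\<in>Pow I. t \<in> R \<and> B \<inter> R = {}}"
    then have "R - {t} \<in> Pow (I - insert t B)" "R = insert t (R - {t})" by auto
    then show "R \<in> insert t ` Pow (I - insert t B)" by blast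
  qed (use assms in blast)+
  then have "card {R\<in>Pow I. t \<in> R \<and> B \<inter> R = {}} = 2 ^ card (I - insert t B)"
    using assms(1) by (simp add: bij_betw_same_card[symmetric] card_Pow)
  moreover have "card (I - insert t B) + (card B + 1) = card I"
  proof -
    have "card (insert t B) = card B + 1" using assms fB by simp
    moreover have "insert t B \<subseteq> I" using assms by auto
    ultimately show ?thesis
      by (metis assms(1) card_Diff_subset card_mono finite_subset le_add_diff_inverse2)
  qed
  ultimately show ?thesis by (metis of_nat_numeral of_nat_power power_add)
qed

lemma avg_le_ex:
  fixes a :: "'a \<Rightarrow> real"
  assumes "finite B" "B \<noteq> {}"
  shows "\<exists>R\<in>B. (\<Sum>R\<in>B. a R) / real (card B) \<le> a R"
proof (rule ccontr)
  assume "\<not> ?thesis"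
  then have "\<And>R. R \<in> B \<Longrightarrow> a R < (\<Sum>R\<in>B. a R) / real (card B)" by force
  then have "(\<Sum>R\<in>B. a R) < (\<Sum>R\<in>B. (\<Sum>R\<in>B. a R) / real (card B))"
    using assms by (intro sum_strict_mono) auto
  also have "\<dots> = (\<Sum>R\<in>B. a R)" using assms by simp
  finally show False by simp
qed

lemma exp_avg_le:
  assumes "finite B" "B \<noteq> {}"
  shows "exp ((\<Sum>R\<in>B. a R) / real (card B)) \<le> (\<Sum>R\<in>B. exp (a R)) / real (card B)"
proof -
  have "exp (\<Sum>R\<in>B. (1 / real (card B)) *\<^sub>R a R) \<le> (\<Sum>R\<in>B. (1 / real (card B)) * exp (a R))"
    using assms by (intro convex_on_sum[where C=UNIV] exp_convex) auto
  then show ?thesis by (simp add: sum_divide_distrib)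
qed

section \<open>Decoupling and exponential moments of quadratic and bilinear forms\<close>

context bern
begin

lemma prod_om_le:
  assumes "B \<subseteq> I"
  shows "\<bar>\<Prod>z\<in>B. om z (z \<in> S)\<bar> \<le> M ^ card B"
proof -
  have "\<bar>\<Prod>z\<in>B. om z (z \<in> S)\<bar> = (\<Prod>z\<in>B. \<bar>om z (z \<in> S)\<bar>)" by (rule abs_prod)
  also have "\<dots> \<le> (\<Prod>z\<in>B. M)" using omM assms by (intro prod_mono) auto
  finally show ?thesis by simp
qed

text \<open>Colour the sites at random. A pair (y, x) survives if t y is red and D y, cell x are blue, which has
  probability at least \<open>2\<^bsup>-(k+l+1)\<^esup>\<close> unless it overlaps; by Jensen some colouring loses only this factor, and given the
  blue sites the red factors are independent, centred and bounded.\<close>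
lemma decouple:
  fixes X :: "'x set" and Y :: "'y set" and K :: "'y \<Rightarrow> 'x \<Rightarrow> real"
  assumes fX: "finite X" and fY: "finite Y"
    and cellI: "\<And>x. x \<in> X \<Longrightarrow> cell x \<subseteq> I" and cellc: "\<And>x. x \<in> X \<Longrightarrow> card (cell x) = k"
    and DI: "\<And>y. y \<in> Y \<Longrightarrow> D y \<subseteq> I" and Dc: "\<And>y. y \<in> Y \<Longrightarrow> card (D y) = l"
    and tI: "\<And>y. y \<in> Y \<Longrightarrow> t y \<in> I" and tD: "\<And>y. y \<in> Y \<Longrightarrow> t y \<notin> D y"
    and inj: "inj_on t Y"
  shows "\<exists>U\<subseteq>X. EE I p (\<lambda>S. exp (\<Sum>y\<in>Y. \<Sum>x\<in>X. K y x *
            ((\<Prod>z\<in>insert (t y) (D y). om z (z \<in> S)) * (\<Prod>z\<in>cell x. om z (z \<in> S)))))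
     \<le> exp (M ^ (k + l + 1) * (1 + 2 ^ (k + l + 1)) *
           (\<Sum>y\<in>Y. \<Sum>x\<in>X. if insert (t y) (D y) \<inter> cell x \<noteq> {} then \<bar>K y x\<bar> else 0))
       * EE I p (\<lambda>S. exp (M ^ (2 * l + 2) * 4 ^ (k + l + 1) *
            (\<Sum>y\<in>Y. (\<Sum>x\<in>U. K y x * (\<Prod>z\<in>cell x. om z (z \<in> S)))\<^sup>2)))"
proof -
  define ze where "ze x S = (\<Prod>z\<in>cell x. om z (z \<in> S))" for x S
  define xi where "xi y S = (\<Prod>z\<in>insert (t y) (D y). om z (z \<in> S))" for y S
  define pd where "pd y S = (\<Prod>z\<in>D y. om z (z \<in> S))" for y S
  define chi where "chi R y x \<longleftrightarrow> t y \<in> R \<and> (D y \<union> cell x) \<inter> R = {}" for R y x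
  define ov where "ov y x \<longleftrightarrow> insert (t y) (D y) \<inter> cell x \<noteq> {}" for y x
  define c :: real where "c = 2 ^ (k + l + 1)"
  define m :: real where "m = M ^ (k + l + 1)"
  define Q where "Q R S = (\<Sum>y\<in>Y. \<Sum>x\<in>X. if chi R y x then K y x * (xi y S * ze x S) else 0)" for R S
  have c0: "c > 0" by (simp add: c_def)
  have fD: "finite (D y)" if "y \<in> Y" for y using DI[OF that] finI finite_subset by blast
  have fC: "finite (cell x)" if "x \<in> X" for x using cellI[OF that] finI finite_subset by blast
  have xi_eq: "xi y S = om (t y) (t y \<in> S) * pd y S" if "y \<in> Y" for y S
    unfolding xi_def pd_def using fD[OF that] tD[OF that] by simp
  have cardI: "real (card (Pow I)) = 2 ^ card I" using finI by (simp add: card_Pow)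
  have xize: "\<bar>xi y S * ze x S\<bar> \<le> m" if "y \<in> Y" "x \<in> X" for y x S
  proof -
    have "\<bar>xi y S\<bar> \<le> M ^ (l+1)"
      unfolding xi_def using prod_om_le[of "insert (t y) (D y)" S] DI tI tD Dc fD that by simp
    moreover have "\<bar>ze x S\<bar> \<le> M ^ k" unfolding ze_def using prod_om_le[OF cellI] cellc that by metis
    ultimately have "\<bar>xi y S\<bar> * \<bar>ze x S\<bar> \<le> M ^ (l+1) * M ^ k"
      using M1 by (intro mult_mono) auto
    then show ?thesis unfolding m_def abs_mult by (simp add: power_add mult_ac)
  qed
  \<comment> \<open>The uniform average over colourings, multiplied by \<open>c\<close>, returns a
    non-overlapping pair exactly, because its survival probability is \<open>1 / c\<close>. For an
    overlapping pair both sides are estimated by the sup bound \<open>m\<close>, at total cost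
    \<open>m * (1 + c)\<close> times the kernel.\<close>
  have pair: "K y x * (xi y S * ze x S) \<le> (if ov y x then m * (1 + c) * \<bar>K y x\<bar> else 0)
      + (\<Sum>R\<in>Pow I. c * (if chi R y x then K y x * (xi y S * ze x S) else 0)) / real (card (Pow I))"
    if y: "y \<in> Y" and x: "x \<in> X" for y x S
  proof -
    define v where "v = K y x * (xi y S * ze x S)"
    define pr where "pr = real (card {R\<in>Pow I. chi R y x}) / 2 ^ card I"
    have "(\<Sum>R\<in>Pow I. c * (if chi R y x then v else 0)) = c * v * real (card {R\<in>Pow I. chi R y x})"
    proof -
      have "(\<Sum>R\<in>Pow I. c * (if chi R y x then v else 0)) = (\<Sum>R\<in>{R\<in>Pow I. chi R y x}. c * v)"
        using finI by (intro sum.mono_neutral_cong_right) auto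
      then show ?thesis by simp
    qed
    then have e: "(\<Sum>R\<in>Pow I. c * (if chi R y x then v else 0)) / real (card (Pow I)) = c * v * pr"
      using cardI unfolding pr_def by simp
    have "card {R\<in>Pow I. chi R y x} \<le> card (Pow I)" using finI by (intro card_mono) auto
    then have pr01: "0 \<le> pr" "pr \<le> 1" unfolding pr_def using cardI
      by (auto simp: divide_le_eq_1 simp flip: of_nat_le_iff)
    have "v \<le> (if ov y x then m * (1 + c) * \<bar>K y x\<bar> else 0) + c * v * pr"
    proof (cases "ov y x")
      case False
      have tn: "t y \<notin> D y \<union> cell x" using False tD[OF y] unfolding ov_def by auto
      have "card (D y \<union> cell x) = l + k"
        using False card_Un_disjoint[OF fD[OF y] fC[OF x]] Dc[OF y] cellc[OF x] unfolding ov_def by auto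
      then have "real (card {R\<in>Pow I. chi R y x}) * c = 2 ^ card I"
        using card_colourings[OF finI _ tI[OF y] tn] DI[OF y] cellI[OF x] unfolding chi_def c_def
        by (simp add: add.commute)
      then have 1: "c * pr = 1" unfolding pr_def by (simp add: field_simps)
      have "c * v * pr = v * (c * pr)" by (simp only: mult_ac)
      also have "\<dots> = v" unfolding 1 by simp
      finally have "c * v * pr = v" .
      moreover have "(if ov y x then m * (1 + c) * \<bar>K y x\<bar> else 0) = 0" using False by simp
      ultimately show ?thesis by linarith
    next
      case True
      have av: "\<bar>v\<bar> \<le> m * \<bar>K y x\<bar>" unfolding v_def abs_mult[of "K y x"]
        using mult_left_mono[OF xize[OF y x, of S] abs_ge_zero[of "K y x"]] by (simp add: mult.commute)
      have "v - c * v * pr \<le> \<bar>v\<bar> + c * (\<bar>v\<bar> * pr)"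
        using pr01 c0 by (smt (verit) abs_mult abs_of_nonneg mult.assoc mult_minus_right mult_left_mono mult_right_mono minus_mult_left)
      also have "\<dots> \<le> \<bar>v\<bar> + c * (\<bar>v\<bar> * 1)" using pr01 c0 by (intro add_left_mono mult_left_mono) auto
      also have "\<dots> = (1 + c) * \<bar>v\<bar>" by (simp add: algebra_simps)
      also have "\<dots> \<le> (1 + c) * (m * \<bar>K y x\<bar>)" using av c0 by (intro mult_left_mono) auto
      finally show ?thesis using True by (simp add: algebra_simps)
    qed
    then show ?thesis using e unfolding v_def by simp
  qed
  define OV where "OV = (\<Sum>y\<in>Y. \<Sum>x\<in>X. if ov y x then \<bar>K y x\<bar> else 0)"
  have tot: "(\<Sum>y\<in>Y. \<Sum>x\<in>X. K y x * (xi y S * ze x S)) \<le> m * (1 + c) * OV + (\<Sum>R\<in>Pow I. c * Q R S) / real (card (Pow I))" for S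
  proof -
    have "(\<Sum>y\<in>Y. \<Sum>x\<in>X. K y x * (xi y S * ze x S)) \<le> (\<Sum>y\<in>Y. \<Sum>x\<in>X. (if ov y x then m * (1 + c) * \<bar>K y x\<bar> else 0)
      + (\<Sum>R\<in>Pow I. c * (if chi R y x then K y x * (xi y S * ze x S) else 0)) / real (card (Pow I)))"
      by (intro sum_mono pair)
    also have "\<dots> = m * (1 + c) * OV + (\<Sum>y\<in>Y. \<Sum>x\<in>X. \<Sum>R\<in>Pow I. c * (if chi R y x then K y x * (xi y S * ze x S) else 0)) / real (card (Pow I))"
      unfolding OV_def sum.distrib sum_distrib_left sum_divide_distrib
      by (intro arg_cong2[where f="(+)"] sum.cong refl) auto
    also have "(\<Sum>y\<in>Y. \<Sum>x\<in>X. \<Sum>R\<in>Pow I. c * (if chi R y x then K y x * (xi y S * ze x S) else 0)) = (\<Sum>R\<in>Pow I. c * Q R S)"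
    proof -
      have "(\<Sum>y\<in>Y. \<Sum>x\<in>X. \<Sum>R\<in>Pow I. c * (if chi R y x then K y x * (xi y S * ze x S) else 0))
        = (\<Sum>y\<in>Y. \<Sum>R\<in>Pow I. \<Sum>x\<in>X. c * (if chi R y x then K y x * (xi y S * ze x S) else 0))"
        by (intro sum.cong refl sum.swap)
      also have "\<dots> = (\<Sum>R\<in>Pow I. \<Sum>y\<in>Y. \<Sum>x\<in>X. c * (if chi R y x then K y x * (xi y S * ze x S) else 0))"
        by (rule sum.swap)
      finally show ?thesis unfolding Q_def sum_distrib_left .
    qed
    finally show ?thesis .
  qed
  have "EE I p (\<lambda>S. exp (\<Sum>y\<in>Y. \<Sum>x\<in>X. K y x * (xi y S * ze x S)))
     \<le> EE I p (\<lambda>S. exp (m * (1 + c) * OV) * ((\<Sum>R\<in>Pow I. exp (c * Q R S)) / real (card (Pow I))))"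
  proof (rule EE_mono[OF p01])
    fix S
    have "exp (\<Sum>y\<in>Y. \<Sum>x\<in>X. K y x * (xi y S * ze x S)) \<le> exp (m * (1 + c) * OV) * exp ((\<Sum>R\<in>Pow I. c * Q R S) / real (card (Pow I)))"
      using tot[of S] by (simp add: exp_add[symmetric])
    also have "\<dots> \<le> exp (m * (1 + c) * OV) * ((\<Sum>R\<in>Pow I. exp (c * Q R S)) / real (card (Pow I)))"
      using exp_avg_le[of "Pow I" "\<lambda>R. c * Q R S"] finI by (intro mult_left_mono) auto
    finally show "exp (\<Sum>y\<in>Y. \<Sum>x\<in>X. K y x * (xi y S * ze x S)) \<le> exp (m * (1 + c) * OV) * ((\<Sum>R\<in>Pow I. exp (c * Q R S)) / real (card (Pow I)))" .
  qed
  also have "\<dots> = exp (m * (1 + c) * OV) * ((\<Sum>R\<in>Pow I. EE I p (\<lambda>S. exp (c * Q R S))) / real (card (Pow I)))"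
    unfolding EE_cmult EE_sum[symmetric] using EE_cmult[of I p "1 / real (card (Pow I))"] by simp
  finally have step1: "EE I p (\<lambda>S. exp (\<Sum>y\<in>Y. \<Sum>x\<in>X. K y x * (xi y S * ze x S)))
     \<le> exp (m * (1 + c) * OV) * ((\<Sum>R\<in>Pow I. EE I p (\<lambda>S. exp (c * Q R S))) / real (card (Pow I)))" .
  obtain R where R: "R \<subseteq> I" and Rle: "(\<Sum>R\<in>Pow I. EE I p (\<lambda>S. exp (c * Q R S))) / real (card (Pow I)) \<le> EE I p (\<lambda>S. exp (c * Q R S))"
    using avg_le_ex[of "Pow I" "\<lambda>R. EE I p (\<lambda>S. exp (c * Q R S))"] finI by auto
  define Y' where "Y' = {y\<in>Y. t y \<in> R \<and> D y \<inter> R = {}}"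
  define U where "U = {x\<in>X. cell x \<inter> R = {}}"
  define b where "b y S = c * pd y S * (\<Sum>x\<in>U. K y x * ze x S)" for y S
  define cz where "cz z = b (the_inv_into Y' t z)" for z
  have injY': "inj_on t Y'" using inj unfolding Y'_def by (auto simp: inj_on_def)
  have czt: "cz (t y) = b y" if "y \<in> Y'" for y unfolding cz_def using the_inv_into_f_f[OF injY' that] by simp
  have JI: "t ` Y' \<subseteq> I" using tI unfolding Y'_def by auto
  \<comment> \<open>For a fixed colouring the form is linear in the red variables
    \<open>om (t y)\<close>: the coefficients \<open>b y\<close> use blue sites only, and
    injectivity of \<open>t\<close> makes the heads distinct sites. So \<open>lin_exp\<close>
    applies with \<open>J\<close> the set of surviving heads.\<close>
  have QR: "c * Q R S = (\<Sum>z\<in>t ` Y'. cz z S * om z (z \<in> S))" for S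
  proof -
    have "Q R S = (\<Sum>y\<in>Y'. \<Sum>x\<in>U. K y x * (xi y S * ze x S))"
      unfolding Q_def
    proof (rule sum.mono_neutral_cong_right[OF fY])
      show "Y' \<subseteq> Y" unfolding Y'_def by auto
      show "\<forall>y\<in>Y - Y'. (\<Sum>x\<in>X. if chi R y x then K y x * (xi y S * ze x S) else 0) = 0"
        unfolding Y'_def chi_def by (intro ballI sum.neutral) (auto split: if_splits)
      show "(\<Sum>x\<in>X. if chi R y x then K y x * (xi y S * ze x S) else 0) = (\<Sum>x\<in>U. K y x * (xi y S * ze x S))"
        if "y \<in> Y'" for y
        using that unfolding Y'_def chi_def U_def
        by (intro sum.mono_neutral_cong_right[OF fX]) auto
    qed
    also have "\<dots> = (\<Sum>y\<in>Y'. om (t y) (t y \<in> S) * pd y S * (\<Sum>x\<in>U. K y x * ze x S))"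
    proof (intro sum.cong refl)
      fix y assume "y \<in> Y'"
      then have y: "y \<in> Y" unfolding Y'_def by auto
      show "(\<Sum>x\<in>U. K y x * (xi y S * ze x S)) = om (t y) (t y \<in> S) * pd y S * (\<Sum>x\<in>U. K y x * ze x S)"
        unfolding xi_eq[OF y] sum_distrib_left by (intro sum.cong refl) (simp add: mult_ac)
    qed
    finally have Qe: "Q R S = (\<Sum>y\<in>Y'. om (t y) (t y \<in> S) * pd y S * (\<Sum>x\<in>U. K y x * ze x S))" .
    have "c * Q R S = (\<Sum>y\<in>Y'. cz (t y) S * om (t y) (t y \<in> S))"
      unfolding Qe sum_distrib_left[of c] by (intro sum.cong refl) (simp add: czt b_def mult_ac)
    then show ?thesis using injY' by (simp add: sum.reindex)
  qed
  have dep: "cz z (S1 \<union> S2) = cz z S2" if "z \<in> t ` Y'" "S1 \<subseteq> t ` Y'" for z S1 S2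
  proof -
    from that(1) obtain y where y: "y \<in> Y'" "z = t y" by auto
    have S1R: "S1 \<subseteq> R" using that(2) unfolding Y'_def by auto
    have "ze x (S1 \<union> S2) = ze x S2" if "x \<in> U" for x
      unfolding ze_def using that S1R unfolding U_def
      by (intro prod.cong refl arg_cong2[where f=om]) auto
    moreover have "pd y (S1 \<union> S2) = pd y S2"
      unfolding pd_def using y(1) S1R unfolding Y'_def
      by (intro prod.cong refl arg_cong2[where f=om]) auto
    ultimately have "b y (S1 \<union> S2) = b y S2" unfolding b_def by simp
    then show ?thesis using y czt by simp
  qed
  have "EE I p (\<lambda>S. exp (c * Q R S)) \<le> EE I p (\<lambda>S. exp (M\<^sup>2 * (\<Sum>z\<in>t ` Y'. (cz z S)\<^sup>2)))"
    unfolding QR by (rule lin_exp[OF JI dep])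
  also have "\<dots> \<le> EE I p (\<lambda>S. exp (M ^ (2 * l + 2) * 4 ^ (k + l + 1) * (\<Sum>y\<in>Y. (\<Sum>x\<in>U. K y x * ze x S)\<^sup>2)))"
  proof (rule EE_mono[OF p01])
    fix S
    have "(\<Sum>z\<in>t ` Y'. (cz z S)\<^sup>2) = (\<Sum>y\<in>Y'. (b y S)\<^sup>2)"
      using injY' czt by (simp add: sum.reindex)
    also have "\<dots> \<le> (\<Sum>y\<in>Y'. c\<^sup>2 * M ^ (2 * l) * (\<Sum>x\<in>U. K y x * ze x S)\<^sup>2)"
    proof (intro sum_mono)
      fix y assume "y \<in> Y'"
      then have y: "y \<in> Y" unfolding Y'_def by auto
      have "\<bar>pd y S\<bar> \<le> \<bar>M ^ l\<bar>" unfolding pd_def using prod_om_le[OF DI[OF y]] Dc[OF y] M1 by (metis abs_ge_self order_trans)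
      then have "(pd y S)\<^sup>2 \<le> M ^ (2 * l)" unfolding abs_le_square_iff by (simp add: power_mult mult.commute power_even_eq)
      then show "(b y S)\<^sup>2 \<le> c\<^sup>2 * M ^ (2 * l) * (\<Sum>x\<in>U. K y x * ze x S)\<^sup>2"
        unfolding b_def power_mult_distrib by (intro mult_right_mono mult_left_mono) auto
    qed
    also have "\<dots> \<le> (\<Sum>y\<in>Y. c\<^sup>2 * M ^ (2 * l) * (\<Sum>x\<in>U. K y x * ze x S)\<^sup>2)"
      using fY M1 unfolding Y'_def by (intro sum_mono2) auto
    finally have "M\<^sup>2 * (\<Sum>z\<in>t ` Y'. (cz z S)\<^sup>2) \<le> M\<^sup>2 * (\<Sum>y\<in>Y. c\<^sup>2 * M ^ (2 * l) * (\<Sum>x\<in>U. K y x * ze x S)\<^sup>2)"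
      by (intro mult_left_mono) auto
    also have "\<dots> = M ^ (2 * l + 2) * 4 ^ (k + l + 1) * (\<Sum>y\<in>Y. (\<Sum>x\<in>U. K y x * ze x S)\<^sup>2)"
    proof -
      have "c\<^sup>2 = 4 ^ (k+l+1)" unfolding c_def by (metis power2_eq_square power_mult power_mult_distrib mult.commute four_x_squared numeral_times_numeral semiring_norm(12) semiring_norm(13))
      then show ?thesis by (simp add: sum_distrib_left[symmetric] power_add power2_eq_square mult_ac)
    qed
    finally show "exp (M\<^sup>2 * (\<Sum>z\<in>t ` Y'. (cz z S)\<^sup>2)) \<le> exp (M ^ (2 * l + 2) * 4 ^ (k + l + 1) * (\<Sum>y\<in>Y. (\<Sum>x\<in>U. K y x * ze x S)\<^sup>2))" by simp
  qed
  finally have "EE I p (\<lambda>S. exp (\<Sum>y\<in>Y. \<Sum>x\<in>X. K y x * (xi y S * ze x S)))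
     \<le> exp (m * (1 + c) * OV) * EE I p (\<lambda>S. exp (M ^ (2 * l + 2) * 4 ^ (k + l + 1) * (\<Sum>y\<in>Y. (\<Sum>x\<in>U. K y x * ze x S)\<^sup>2)))"
    using step1 Rle by (meson exp_ge_zero mult_left_mono order_trans)
  moreover have "U \<subseteq> X" unfolding U_def by auto
  ultimately show ?thesis unfolding m_def c_def OV_def ov_def xi_def ze_def by blast
qed

text \<open>The bound is self-improving: for the subset \<open>U\<close> of X maximising the left-hand side \<open>m U\<close>, decoupling
  gives \<open>m U \<le> e\<^bsup>B\<^esup> sqrt (m U)\<close>.\<close>
lemma quad_exp:
  fixes X :: "'x set" and Z :: "'z set" and F :: "'z \<Rightarrow> 'x \<Rightarrow> real"
  assumes fX: "finite X" and fZ: "finite Z"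
    and DI: "\<And>x. x \<in> X \<Longrightarrow> D x \<subseteq> I" and Dc: "\<And>x. x \<in> X \<Longrightarrow> card (D x) = l"
    and tI: "\<And>x. x \<in> X \<Longrightarrow> t x \<in> I" and tD: "\<And>x. x \<in> X \<Longrightarrow> t x \<notin> D x"
    and inj: "inj_on t X"
    and ov: "\<And>x. x \<in> X \<Longrightarrow> card {x'\<in>X. insert (t x) (D x) \<inter> insert (t x') (D x') \<noteq> {}} \<le> N"
    and op: "\<And>w. (\<Sum>x\<in>X. (\<Sum>z\<in>Z. F z x * w z)\<^sup>2) \<le> \<nu> * (\<Sum>z\<in>Z. (w z)\<^sup>2)"
    and small: "M ^ (2 * l + 2) * 4 ^ (2 * l + 2) * \<nu> \<le> 1/2"
  shows "EE I p (\<lambda>S. exp (\<Sum>z\<in>Z. (\<Sum>x\<in>X. F z x * (\<Prod>s\<in>insert (t x) (D x). om s (s \<in> S)))\<^sup>2))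
     \<le> exp (2 * (M ^ (2 * l + 2) * (1 + 2 ^ (2 * l + 2))) * real N * (\<Sum>z\<in>Z. \<Sum>x\<in>X. (F z x)\<^sup>2))"
proof -
  define ze where "ze x S = (\<Prod>s\<in>insert (t x) (D x). om s (s \<in> S))" for x S
  define m where "m U = EE I p (\<lambda>S. exp (\<Sum>z\<in>Z. (\<Sum>x\<in>U. F z x * ze x S)\<^sup>2))" for U
  define K where "K x x' = (\<Sum>z\<in>Z. F z x * F z x')" for x x'
  define c1 where "c1 = M ^ (2 * l + 2) * (1 + 2 ^ (2 * l + 2))"
  define c2 where "c2 = M ^ (2 * l + 2) * 4 ^ (2 * l + 2)"
  define HS where "HS = (\<Sum>z\<in>Z. \<Sum>x\<in>X. (F z x)\<^sup>2)"
  have c10: "c1 \<ge> 0" unfolding c1_def using M1 by simp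
  have c20: "c2 \<ge> 0" unfolding c2_def using M1 by simp
  have mpos: "m U \<ge> 1" for U
  proof -
    have "EE I p (\<lambda>_. 1) \<le> m U" unfolding m_def by (rule EE_mono[OF p01]) (auto intro!: sum_nonneg)
    then show ?thesis using EE_const[OF finI] by simp
  qed
  have "\<exists>U0\<in>Pow X. \<forall>U\<in>Pow X. m U \<le> m U0"
  proof -
    have f: "finite (m ` Pow X)" "m ` Pow X \<noteq> {}" using fX by auto
    obtain U0 where "U0 \<in> Pow X" "m U0 = Max (m ` Pow X)" using Max_in[OF f] by force
    then show ?thesis using f by (metis Max_ge imageI)
  qed
  then obtain U0 where U0: "U0 \<subseteq> X" and U0max: "\<And>U. U \<subseteq> X \<Longrightarrow> m U \<le> m U0" by auto
  have fU0: "finite U0" using U0 fX finite_subset by blast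
  let ?ov = "\<lambda>x x'. insert (t x) (D x) \<inter> insert (t x') (D x') \<noteq> {}"
  have fD: "finite (D x)" if "x \<in> X" for x using DI[OF that] finI finite_subset by blast
  have e2: "(l+1) + l + 1 = 2 * l + 2" by simp
  have "\<exists>U\<subseteq>U0. EE I p (\<lambda>S. exp (\<Sum>y\<in>U0. \<Sum>x\<in>U0. K y x *
            ((\<Prod>z\<in>insert (t y) (D y). om z (z \<in> S)) * (\<Prod>z\<in>insert (t x) (D x). om z (z \<in> S)))))
     \<le> exp (M ^ ((l+1) + l + 1) * (1 + 2 ^ ((l+1) + l + 1)) *
           (\<Sum>y\<in>U0. \<Sum>x\<in>U0. if ?ov y x then \<bar>K y x\<bar> else 0))
       * EE I p (\<lambda>S. exp (M ^ (2 * l + 2) * 4 ^ ((l+1) + l + 1) *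
            (\<Sum>y\<in>U0. (\<Sum>x\<in>U. K y x * (\<Prod>z\<in>insert (t x) (D x). om z (z \<in> S)))\<^sup>2)))"
  proof (rule decouple[OF fU0 fU0])
    show "inj_on t U0" using inj U0 inj_on_subset by blast
  qed (use U0 DI Dc tI tD fD in auto)
  then obtain U where U: "U \<subseteq> U0" and dec: "EE I p (\<lambda>S. exp (\<Sum>y\<in>U0. \<Sum>x\<in>U0. K y x * (ze y S * ze x S)))
     \<le> exp (c1 * (\<Sum>y\<in>U0. \<Sum>x\<in>U0. if ?ov y x then \<bar>K y x\<bar> else 0))
       * EE I p (\<lambda>S. exp (c2 * (\<Sum>y\<in>U0. (\<Sum>x\<in>U. K y x * ze x S)\<^sup>2)))"
    unfolding e2 ze_def c1_def c2_def by blast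
  have fU: "finite U" using U fU0 finite_subset by blast
  have UX: "U \<subseteq> X" using U U0 by auto
  have quad: "(\<Sum>y\<in>U0. \<Sum>x\<in>U0. K y x * (ze y S * ze x S)) = (\<Sum>z\<in>Z. (\<Sum>x\<in>U0. F z x * ze x S)\<^sup>2)" for S
  proof -
    have "(\<Sum>y\<in>U0. \<Sum>x\<in>U0. K y x * (ze y S * ze x S)) = (\<Sum>y\<in>U0. \<Sum>x\<in>U0. \<Sum>z\<in>Z. (F z y * ze y S) * (F z x * ze x S))"
      unfolding K_def sum_distrib_right by (intro sum.cong refl) (simp add: mult_ac)
    also have "\<dots> = (\<Sum>z\<in>Z. \<Sum>y\<in>U0. \<Sum>x\<in>U0. (F z y * ze y S) * (F z x * ze x S))"
    proof -
      have "(\<Sum>y\<in>U0. \<Sum>x\<in>U0. \<Sum>z\<in>Z. (F z y * ze y S) * (F z x * ze x S))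
        = (\<Sum>y\<in>U0. \<Sum>z\<in>Z. \<Sum>x\<in>U0. (F z y * ze y S) * (F z x * ze x S))"
        by (intro sum.cong refl sum.swap)
      also have "\<dots> = (\<Sum>z\<in>Z. \<Sum>y\<in>U0. \<Sum>x\<in>U0. (F z y * ze y S) * (F z x * ze x S))"
        by (rule sum.swap)
      finally show ?thesis .
    qed
    also have "\<dots> = (\<Sum>z\<in>Z. (\<Sum>x\<in>U0. F z x * ze x S)\<^sup>2)"
      unfolding power2_eq_square sum_product by (rule refl)
    finally show ?thesis .
  qed
  \<comment> \<open>Each Gram entry is at most the mean of two diagonal entries, and each cell meets
    at most \<open>N\<close> cells, so the overlap term is controlled by the Hilbert-Schmidt
    norm.\<close>
  have ovb: "(\<Sum>y\<in>U0. \<Sum>x\<in>U0. if ?ov y x then \<bar>K y x\<bar> else 0) \<le> real N * HS"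
  proof -
    define a where "a x = (\<Sum>z\<in>Z. (F z x)\<^sup>2)" for x
    have a0: "a x \<ge> 0" for x unfolding a_def by (intro sum_nonneg) auto
    have Ka: "\<bar>K y x\<bar> \<le> a y / 2 + a x / 2" for x y
    proof -
      have "\<bar>K y x\<bar> \<le> (\<Sum>z\<in>Z. \<bar>F z y * F z x\<bar>)" unfolding K_def by (rule sum_abs)
      also have "\<dots> \<le> (\<Sum>z\<in>Z. (F z y)\<^sup>2 / 2 + (F z x)\<^sup>2 / 2)"
      proof (intro sum_mono)
        fix z
        have "2 * (\<bar>F z y\<bar> * \<bar>F z x\<bar>) \<le> \<bar>F z y\<bar>\<^sup>2 + \<bar>F z x\<bar>\<^sup>2"
          using sum_squares_bound[of "\<bar>F z y\<bar>" "\<bar>F z x\<bar>"] by simp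
        then show "\<bar>F z y * F z x\<bar> \<le> (F z y)\<^sup>2 / 2 + (F z x)\<^sup>2 / 2" by (simp add: abs_mult)
      qed
      finally show ?thesis unfolding a_def sum.distrib sum_divide_distrib .
    qed
    let ?ind = "\<lambda>y x. if ?ov y x then (1::real) else 0"
    have cnt: "(\<Sum>x\<in>U0. ?ind y x) \<le> real N" if "y \<in> U0" for y
    proof -
      have "(\<Sum>x\<in>U0. ?ind y x) = real (card {x\<in>U0. ?ov y x})"
        using fU0 by (simp add: sum.If_cases Int_def)
      also have "card {x\<in>U0. ?ov y x} \<le> card {x\<in>X. ?ov y x}"
        using fX U0 by (intro card_mono) auto
      finally show ?thesis using ov[of y] that U0 by (auto intro: order_trans)
    qed
    have sym: "?ind y x = ?ind x y" for x y by auto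
    have half: "(\<Sum>y\<in>U0. \<Sum>x\<in>U0. ?ind y x * (a y / 2)) \<le> real N * HS / 2"
    proof -
      have "(\<Sum>y\<in>U0. \<Sum>x\<in>U0. ?ind y x * (a y / 2)) = (\<Sum>y\<in>U0. (\<Sum>x\<in>U0. ?ind y x) * (a y / 2))"
        by (simp only: sum_distrib_right)
      also have "\<dots> \<le> (\<Sum>y\<in>U0. real N * (a y / 2))"
        using cnt a0 by (intro sum_mono mult_right_mono) auto
      also have "\<dots> \<le> (\<Sum>y\<in>X. real N * (a y / 2))" using a0 fX U0 by (intro sum_mono2) auto
      also have "\<dots> = real N * HS / 2" unfolding HS_def a_def
        by (subst sum.swap) (simp add: sum_distrib_left sum_divide_distrib)
      finally show ?thesis .
    qed
    have "(\<Sum>y\<in>U0. \<Sum>x\<in>U0. if ?ov y x then \<bar>K y x\<bar> else 0) \<le> (\<Sum>y\<in>U0. \<Sum>x\<in>U0. ?ind y x * (a y / 2) + ?ind y x * (a x / 2))"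
      using Ka by (intro sum_mono) auto
    also have "\<dots> = (\<Sum>y\<in>U0. \<Sum>x\<in>U0. ?ind y x * (a y / 2)) + (\<Sum>y\<in>U0. \<Sum>x\<in>U0. ?ind y x * (a x / 2))"
      by (simp only: sum.distrib)
    also have "(\<Sum>y\<in>U0. \<Sum>x\<in>U0. ?ind y x * (a x / 2)) = (\<Sum>y\<in>U0. \<Sum>x\<in>U0. ?ind y x * (a y / 2))"
      unfolding sum.swap[of "\<lambda>y x. ?ind y x * (a x / 2)"] by (intro sum.cong refl arg_cong2[where f="(*)"] sym)
    finally show ?thesis using half by linarith
  qed
  \<comment> \<open>With \<open>w\<close> the image under \<open>F\<close> of the products over
    \<open>U\<close>, the inner sum is the adjoint of \<open>F\<close> applied to \<open>w\<close>.
    The operator norm and \<open>small\<close> bring the square down to half of the original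
    quadratic form; Cauchy-Schwarz then turns the half in the exponent into the square root that
    closes the estimate.\<close>
  have sq: "c2 * (\<Sum>y\<in>U0. (\<Sum>x\<in>U. K y x * ze x S)\<^sup>2) \<le> (1/2) * (\<Sum>z\<in>Z. (\<Sum>x\<in>U. F z x * ze x S)\<^sup>2)" for S
  proof -
    define w where "w z = (\<Sum>x\<in>U. F z x * ze x S)" for z
    have e: "(\<Sum>x\<in>U. K y x * ze x S) = (\<Sum>z\<in>Z. F z y * w z)" for y
      unfolding K_def w_def sum_distrib_right sum_distrib_left by (subst sum.swap) (simp add: mult_ac)
    have "(\<Sum>y\<in>U0. (\<Sum>x\<in>U. K y x * ze x S)\<^sup>2) \<le> (\<Sum>y\<in>X. (\<Sum>z\<in>Z. F z y * w z)\<^sup>2)"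
      unfolding e using fX U0 by (intro sum_mono2) auto
    also have "\<dots> \<le> \<nu> * (\<Sum>z\<in>Z. (w z)\<^sup>2)" by (rule op)
    finally have "c2 * (\<Sum>y\<in>U0. (\<Sum>x\<in>U. K y x * ze x S)\<^sup>2) \<le> c2 * (\<nu> * (\<Sum>z\<in>Z. (w z)\<^sup>2))"
      using c20 by (rule mult_left_mono)
    also have "\<dots> = (c2 * \<nu>) * (\<Sum>z\<in>Z. (w z)\<^sup>2)" by simp
    also have "\<dots> \<le> (1/2) * (\<Sum>z\<in>Z. (w z)\<^sup>2)"
      using small unfolding c2_def[symmetric] by (intro mult_right_mono sum_nonneg) auto
    finally show ?thesis unfolding w_def .
  qed
  define B where "B = exp (c1 * (real N * HS))"
  have "m U0 \<le> B * EE I p (\<lambda>S. exp (c2 * (\<Sum>y\<in>U0. (\<Sum>x\<in>U. K y x * ze x S)\<^sup>2)))"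
  proof -
    have "m U0 \<le> exp (c1 * (\<Sum>y\<in>U0. \<Sum>x\<in>U0. if ?ov y x then \<bar>K y x\<bar> else 0))
       * EE I p (\<lambda>S. exp (c2 * (\<Sum>y\<in>U0. (\<Sum>x\<in>U. K y x * ze x S)\<^sup>2)))"
      using dec unfolding quad m_def .
    also have "\<dots> \<le> B * EE I p (\<lambda>S. exp (c2 * (\<Sum>y\<in>U0. (\<Sum>x\<in>U. K y x * ze x S)\<^sup>2)))"
    proof (rule mult_right_mono)
      show "exp (c1 * (\<Sum>y\<in>U0. \<Sum>x\<in>U0. if ?ov y x then \<bar>K y x\<bar> else 0)) \<le> B"
        unfolding B_def using ovb c10 by (simp add: mult_left_mono)
      show "0 \<le> EE I p (\<lambda>S. exp (c2 * (\<Sum>y\<in>U0. (\<Sum>x\<in>U. K y x * ze x S)\<^sup>2)))"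
        unfolding EE_def using wt_nonneg p01 by (intro sum_nonneg mult_nonneg_nonneg) auto
    qed
    finally show ?thesis .
  qed
  also have "\<dots> \<le> B * sqrt (m U)"
  proof (rule mult_left_mono)
    have "EE I p (\<lambda>S. exp (c2 * (\<Sum>y\<in>U0. (\<Sum>x\<in>U. K y x * ze x S)\<^sup>2)))
       \<le> EE I p (\<lambda>S. exp ((1/2) * (\<Sum>z\<in>Z. (\<Sum>x\<in>U. F z x * ze x S)\<^sup>2)))"
      using sq by (intro EE_mono[OF p01]) simp_all
    also have "\<dots> \<le> sqrt (m U)"
    proof (rule real_le_rsqrt)
      have "(EE I p (\<lambda>S. exp ((1/2) * (\<Sum>z\<in>Z. (\<Sum>x\<in>U. F z x * ze x S)\<^sup>2))))\<^sup>2
        \<le> EE I p (\<lambda>S. (exp ((1/2) * (\<Sum>z\<in>Z. (\<Sum>x\<in>U. F z x * ze x S)\<^sup>2)))\<^sup>2)"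
        by (rule EE_sqrt[OF finI p01])
      also have "\<dots> = m U" unfolding m_def by (intro EE_cong) (simp add: power2_eq_square exp_add[symmetric])
      finally show "(EE I p (\<lambda>S. exp ((1/2) * (\<Sum>z\<in>Z. (\<Sum>x\<in>U. F z x * ze x S)\<^sup>2))))\<^sup>2 \<le> m U" .
    qed
    finally show "EE I p (\<lambda>S. exp (c2 * (\<Sum>y\<in>U0. (\<Sum>x\<in>U. K y x * ze x S)\<^sup>2))) \<le> sqrt (m U)" .
  qed (simp add: B_def)
  also have "\<dots> \<le> B * sqrt (m U0)" using U0max[OF UX] by (intro mult_left_mono) (auto simp: B_def)
  finally have "m U0 \<le> B * sqrt (m U0)" .
  then have "sqrt (m U0) * sqrt (m U0) \<le> B * sqrt (m U0)" using mpos[of U0] by simp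
  moreover have "sqrt (m U0) > 0" using mpos[of U0] by (auto intro: less_le_trans)
  ultimately have "sqrt (m U0) \<le> B" by (rule mult_right_le_imp_le)
  then have "m U0 \<le> B\<^sup>2" using mpos[of U0] by (metis real_sqrt_ge_0_iff real_sqrt_pow2 order_trans power_mono zero_le_one)
  then have "m X \<le> B\<^sup>2" using U0max[of X] by auto
  also have "B\<^sup>2 = exp (2 * c1 * real N * HS)" unfolding B_def by (simp add: power2_eq_square exp_add[symmetric])
  finally show ?thesis unfolding m_def ze_def c1_def HS_def .
qed

text \<open>One decoupling step leaves squares of linear combinations of the products over
  \<open>X\<close>, which \<open>quad_exp\<close> handles with \<open>F = sqrt c * K\<close>.
  Disjointness of the cells on the support of \<open>K\<close> removes the overlap error of that
  step, so the bound sees \<open>K\<close> only through its Hilbert-Schmidt norm.\<close>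

lemma bilinear_exp:
  fixes X :: "'x set" and Y :: "'y set" and K :: "'y \<Rightarrow> 'x \<Rightarrow> real"
  assumes fX: "finite X" and fY: "finite Y"
    and DI: "\<And>x. x \<in> X \<Longrightarrow> D x \<subseteq> I" and Dc: "\<And>x. x \<in> X \<Longrightarrow> card (D x) = l"
    and tI: "\<And>x. x \<in> X \<Longrightarrow> t x \<in> I" and tD: "\<And>x. x \<in> X \<Longrightarrow> t x \<notin> D x"
    and inj: "inj_on t X"
    and ov: "\<And>x. x \<in> X \<Longrightarrow> card {x'\<in>X. insert (t x) (D x) \<inter> insert (t x') (D x') \<noteq> {}} \<le> N"
    and DI': "\<And>y. y \<in> Y \<Longrightarrow> D' y \<subseteq> I" and Dc': "\<And>y. y \<in> Y \<Longrightarrow> card (D' y) = l'"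
    and tI': "\<And>y. y \<in> Y \<Longrightarrow> t' y \<in> I" and tD': "\<And>y. y \<in> Y \<Longrightarrow> t' y \<notin> D' y"
    and inj': "inj_on t' Y"
    and disj: "\<And>x y. x \<in> X \<Longrightarrow> y \<in> Y \<Longrightarrow> K y x \<noteq> 0 \<Longrightarrow> insert (t' y) (D' y) \<inter> insert (t x) (D x) = {}"
    and op: "\<And>w. (\<Sum>x\<in>X. (\<Sum>y\<in>Y. K y x * w y)\<^sup>2) \<le> \<nu> * (\<Sum>y\<in>Y. (w y)\<^sup>2)"
    and small: "M ^ (2 * l + 2) * 4 ^ (2 * l + 2) * (M ^ (2 * l' + 2) * 4 ^ (l + l' + 2) * \<nu>) \<le> 1/2"
  shows "EE I p (\<lambda>S. exp (\<Sum>y\<in>Y. \<Sum>x\<in>X. K y x * ((\<Prod>s\<in>insert (t' y) (D' y). om s (s \<in> S)) * (\<Prod>s\<in>insert (t x) (D x). om s (s \<in> S)))))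
     \<le> exp (2 * (M ^ (2 * l + 2) * (1 + 2 ^ (2 * l + 2))) * real N * (M ^ (2 * l' + 2) * 4 ^ (l + l' + 2)) * (\<Sum>y\<in>Y. \<Sum>x\<in>X. (K y x)\<^sup>2))"
proof -
  define ze where "ze x S = (\<Prod>s\<in>insert (t x) (D x). om s (s \<in> S))" for x S
  define c where "c = M ^ (2 * l' + 2) * 4 ^ (l + l' + 2)"
  have c0: "c \<ge> 0" unfolding c_def using M1 by simp
  have fD: "finite (D x)" if "x \<in> X" for x using DI[OF that] finI finite_subset by blast
  have e2: "(l+1) + l' + 1 = l + l' + 2" by simp
  have "\<exists>U\<subseteq>X. EE I p (\<lambda>S. exp (\<Sum>y\<in>Y. \<Sum>x\<in>X. K y x *
            ((\<Prod>z\<in>insert (t' y) (D' y). om z (z \<in> S)) * (\<Prod>z\<in>insert (t x) (D x). om z (z \<in> S)))))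
     \<le> exp (M ^ ((l+1) + l' + 1) * (1 + 2 ^ ((l+1) + l' + 1)) *
           (\<Sum>y\<in>Y. \<Sum>x\<in>X. if insert (t' y) (D' y) \<inter> insert (t x) (D x) \<noteq> {} then \<bar>K y x\<bar> else 0))
       * EE I p (\<lambda>S. exp (M ^ (2 * l' + 2) * 4 ^ ((l+1) + l' + 1) *
            (\<Sum>y\<in>Y. (\<Sum>x\<in>U. K y x * (\<Prod>z\<in>insert (t x) (D x). om z (z \<in> S)))\<^sup>2)))"
    by (rule decouple[OF fX fY]) (use DI Dc tI tD fD DI' Dc' tI' tD' inj' in auto)
  then obtain U where U: "U \<subseteq> X" and dec: "EE I p (\<lambda>S. exp (\<Sum>y\<in>Y. \<Sum>x\<in>X. K y x *
            ((\<Prod>z\<in>insert (t' y) (D' y). om z (z \<in> S)) * (\<Prod>z\<in>insert (t x) (D x). om z (z \<in> S)))))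
     \<le> exp (M ^ (l + l' + 2) * (1 + 2 ^ (l + l' + 2)) *
           (\<Sum>y\<in>Y. \<Sum>x\<in>X. if insert (t' y) (D' y) \<inter> insert (t x) (D x) \<noteq> {} then \<bar>K y x\<bar> else 0))
       * EE I p (\<lambda>S. exp (c * (\<Sum>y\<in>Y. (\<Sum>x\<in>U. K y x * ze x S)\<^sup>2)))"
    unfolding e2 ze_def c_def by blast
  have fU: "finite U" using U fX finite_subset by blast
  have z: "(\<Sum>y\<in>Y. \<Sum>x\<in>X. if insert (t' y) (D' y) \<inter> insert (t x) (D x) \<noteq> {} then \<bar>K y x\<bar> else 0) = 0"
    using disj by (intro sum.neutral ballI) (metis abs_zero)
  define F where "F y x = sqrt c * K y x" for y x
  have "EE I p (\<lambda>S. exp (c * (\<Sum>y\<in>Y. (\<Sum>x\<in>U. K y x * ze x S)\<^sup>2)))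
     = EE I p (\<lambda>S. exp (\<Sum>y\<in>Y. (\<Sum>x\<in>U. F y x * ze x S)\<^sup>2))"
    unfolding F_def mult.assoc sum_distrib_left[symmetric] power_mult_distrib using c0 by simp
  also have "\<dots> \<le> exp (2 * (M ^ (2 * l + 2) * (1 + 2 ^ (2 * l + 2))) * real N * (\<Sum>z\<in>Y. \<Sum>x\<in>U. (F z x)\<^sup>2))"
    unfolding ze_def
  proof (rule quad_exp[OF fU fY])
    show "inj_on t U" using inj U inj_on_subset by blast
    show "card {x' \<in> U. insert (t x) (D x) \<inter> insert (t x') (D x') \<noteq> {}} \<le> N" if "x \<in> U" for x
      by (rule order_trans[OF card_mono ov[of x]]) (use fX U that in auto)
    show "(\<Sum>x\<in>U. (\<Sum>z\<in>Y. F z x * w z)\<^sup>2) \<le> (c * \<nu>) * (\<Sum>z\<in>Y. (w z)\<^sup>2)" for w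
    proof -
      have "(\<Sum>x\<in>U. (\<Sum>z\<in>Y. F z x * w z)\<^sup>2) = c * (\<Sum>x\<in>U. (\<Sum>z\<in>Y. K z x * w z)\<^sup>2)"
        unfolding F_def mult.assoc sum_distrib_left[symmetric] power_mult_distrib using c0 by simp
      also have "\<dots> \<le> c * (\<Sum>x\<in>X. (\<Sum>z\<in>Y. K z x * w z)\<^sup>2)"
        using c0 fX U by (intro mult_left_mono sum_mono2) auto
      also have "\<dots> \<le> c * (\<nu> * (\<Sum>z\<in>Y. (w z)\<^sup>2))" using op c0 by (intro mult_left_mono) auto
      finally show ?thesis by simp
    qed
    show "M ^ (2 * l + 2) * 4 ^ (2 * l + 2) * (c * \<nu>) \<le> 1/2" using small unfolding c_def .
  qed (use U DI Dc tI tD in auto)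
  also have "\<dots> \<le> exp (2 * (M ^ (2 * l + 2) * (1 + 2 ^ (2 * l + 2))) * real N * (c * (\<Sum>z\<in>Y. \<Sum>x\<in>X. (K z x)\<^sup>2)))"
  proof -
    have "(\<Sum>z\<in>Y. \<Sum>x\<in>U. (F z x)\<^sup>2) = c * (\<Sum>z\<in>Y. \<Sum>x\<in>U. (K z x)\<^sup>2)"
      unfolding F_def power_mult_distrib using c0 by (simp add: sum_distrib_left)
    also have "\<dots> \<le> c * (\<Sum>z\<in>Y. \<Sum>x\<in>X. (K z x)\<^sup>2)"
      using c0 fX U by (intro mult_left_mono sum_mono sum_mono2) auto
    finally show ?thesis using M1 by (intro iffD2[OF exp_le_cancel_iff] mult_left_mono) auto
  qed
  finally show ?thesis using dec unfolding z c_def by (simp add: mult_ac)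
qed

end

section \<open>The discrete torus\<close>

lemma box_image: "box n = vec_lambda ` (Pi\<^sub>E (UNIV::'d::finite set) (\<lambda>_. {0..<int n}))"
proof (rule set_eqI)
  fix x :: "int^'d"
  show "x \<in> box n \<longleftrightarrow> x \<in> vec_lambda ` (Pi\<^sub>E UNIV (\<lambda>_. {0..<int n}))"
  proof
    assume x: "x \<in> box n"
    then have "vec_nth x \<in> Pi\<^sub>E UNIV (\<lambda>_. {0..<int n})" unfolding box_def by auto
    then show "x \<in> vec_lambda ` (Pi\<^sub>E UNIV (\<lambda>_. {0..<int n}))" by (metis image_eqI vec_nth_inverse)
  qed (auto simp: box_def PiE_def Pi_def)
qed

lemma finite_box [simp]: "finite (box n :: (int^'d::finite) set)"
  unfolding box_image by (intro finite_imageI finite_PiE) auto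

lemma card_box: "card (box n :: (int^'d::finite) set) = n ^ CARD('d)"
proof -
  have "inj_on vec_lambda (Pi\<^sub>E (UNIV::'d set) (\<lambda>_. {0..<int n}))"
    by (auto simp: inj_on_def vec_lambda_inject)
  then show ?thesis unfolding box_image by (simp add: card_image card_PiE)
qed

lemma tmod_in_box: "n \<ge> 1 \<Longrightarrow> tmod n x \<in> box n" unfolding box_def tmod_def by simp
lemma tmod_id [simp]: "x \<in> box n \<Longrightarrow> tmod n x = x" unfolding box_def tmod_def by (simp add: vec_eq_iff)
lemma tmod_tmod [simp]: "tmod n (tmod n x) = tmod n x" unfolding tmod_def by (simp add: vec_eq_iff)
lemma tmod_add_left: "tmod n (tmod n x + y) = tmod n (x + y)"
  unfolding tmod_def by (simp add: vec_eq_iff mod_add_left_eq)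
lemma tmod_add_right: "tmod n (x + tmod n y) = tmod n (x + y)"
  unfolding tmod_def by (simp add: vec_eq_iff mod_add_right_eq)
lemma tmod_diff_left: "tmod n (tmod n x - y) = tmod n (x - y)"
  unfolding tmod_def by (simp add: vec_eq_iff mod_diff_left_eq)

lemma tmod_eq_iff: "tmod n x = tmod n y \<longleftrightarrow> (\<forall>i. int n dvd x $ i - y $ i)"
  unfolding tmod_def by (simp add: vec_eq_iff mod_eq_dvd_iff)

lemma tmod_cancel: "tmod n (x + a) = tmod n (x + b) \<longleftrightarrow> tmod n a = tmod n b"
  unfolding tmod_eq_iff by simp

lemma bij_shift:
  fixes v :: "int^'d::finite"
  assumes "n \<ge> 1"
  shows "bij_betw (\<lambda>x. tmod n (x + v)) (box n) (box n)"
proof (rule bij_betwI[where g="\<lambda>x. tmod n (x - v)"])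
  show "(\<lambda>x. tmod n (x + v)) \<in> box n \<rightarrow> box n" "(\<lambda>x. tmod n (x - v)) \<in> box n \<rightarrow> box n"
    using tmod_in_box[OF assms] by auto
  fix x :: "int^'d" assume x: "x \<in> box n"
  show "tmod n (tmod n (x + v) - v) = x" using x by (simp add: tmod_diff_left)
  show "tmod n (tmod n (x - v) + v) = x" using x by (simp add: tmod_add_left)
qed

lemma sum_shift:
  fixes g :: "int^'d::finite \<Rightarrow> 'b::comm_monoid_add"
  assumes "n \<ge> 1" "\<And>x. g (tmod n x) = g x"
  shows "(\<Sum>x\<in>box n. g (x + v)) = (\<Sum>x\<in>box n. g x)"
proof -
  have "(\<Sum>x\<in>box n. g (x + v)) = (\<Sum>x\<in>box n. g (tmod n (x + v)))" by (simp add: assms(2))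
  also have "\<dots> = (\<Sum>x\<in>box n. g x)" by (rule sum.reindex_bij_betw[OF bij_shift[OF assms(1)]])
  finally show ?thesis .
qed

section \<open>Periodic configurations and the product measure on the torus\<close>

definition cfg :: "nat \<Rightarrow> (int^'d::finite) set \<Rightarrow> int^'d \<Rightarrow> bool" where
  "cfg n S = (\<lambda>z. tmod n z \<in> S)"

lemma OmegaD: "\<xi> \<in> Omega n \<Longrightarrow> \<xi> (tmod n x) = \<xi> x" unfolding Omega_def by auto

lemma bij_cfg:
  assumes "n \<ge> 1"
  shows "bij_betw (cfg n) (Pow (box n)) (Omega n)"
proof (rule bij_betwI[where g="\<lambda>\<xi>. {x\<in>box n. \<xi> x}"])
  show "cfg n \<in> Pow (box n) \<rightarrow> Omega n" unfolding cfg_def Omega_def by auto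
  show "(\<lambda>\<xi>. {x \<in> box n. \<xi> x}) \<in> Omega n \<rightarrow> Pow (box n)" by auto
  fix S :: "(int^'d) set" assume "S \<in> Pow (box n)"
  then show "{x \<in> box n. cfg n S x} = S" unfolding cfg_def by auto
next
  fix \<xi> :: "int^'d \<Rightarrow> bool" assume "\<xi> \<in> Omega n"
  then show "cfg n {x \<in> box n. \<xi> x} = \<xi>" unfolding cfg_def
    using tmod_in_box[OF assms] OmegaD by fastforce
qed

lemma finite_Omega: "n \<ge> 1 \<Longrightarrow> finite (Omega n :: (int^'d::finite \<Rightarrow> bool) set)"
  using bij_betw_finite[OF bij_cfg[of n]] by simp

definition muU :: "nat \<Rightarrow> (int^'d::finite \<Rightarrow> real) \<Rightarrow> (int^'d \<Rightarrow> bool) \<Rightarrow> real" where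
  "muU n U \<xi> = (\<Prod>x\<in>box n. if \<xi> x then U x else 1 - U x)"

definition omU :: "(int^'d::finite \<Rightarrow> real) \<Rightarrow> (int^'d \<Rightarrow> bool) \<Rightarrow> int^'d \<Rightarrow> real" where
  "omU U \<xi> z = ((if \<xi> z then 1 else 0) - U z) / (U z * (1 - U z))"

lemma swap_tmod_left: "\<xi> \<in> Omega n \<Longrightarrow> swap n \<xi> (tmod n x) y = swap n \<xi> x y"
  unfolding swap_def by (auto simp: OmegaD fun_eq_iff)
lemma swap_Omega: "\<xi> \<in> Omega n \<Longrightarrow> swap n \<xi> x y \<in> Omega n"
  unfolding Omega_def swap_def by auto
lemma Omega_eq: "\<xi> \<in> Omega n \<Longrightarrow> tmod n x = tmod n y \<Longrightarrow> \<xi> x = \<xi> y"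
  by (metis OmegaD)
lemma swap_left: "\<xi> \<in> Omega n \<Longrightarrow> swap n \<xi> x y x = \<xi> y" unfolding swap_def by simp
lemma swap_right: "\<xi> \<in> Omega n \<Longrightarrow> swap n \<xi> x y y = \<xi> x" unfolding swap_def by (auto dest: Omega_eq)
lemma swap_swap: "\<xi> \<in> Omega n \<Longrightarrow> swap n (swap n \<xi> x y) x y = \<xi>"
  unfolding swap_def by (auto simp: fun_eq_iff dest: Omega_eq)
lemma swap_commute: "\<xi> \<in> Omega n \<Longrightarrow> swap n \<xi> x y = swap n \<xi> y x"
  unfolding swap_def by (auto simp: fun_eq_iff dest: Omega_eq)

text \<open>One instant of time: \<open>U\<close> is the density profile, read as an n-periodic
  function on the integer lattice and bounded away from 0 and 1. Time-dependent statements
  instantiate this locale anew at each time.\<close>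

locale tor =
  fixes n :: nat and U :: "int^'d::finite \<Rightarrow> real" and \<epsilon> :: real
  assumes n1: "n \<ge> 1" and Uper: "\<And>x. U (tmod n x) = U x"
    and eps: "0 < \<epsilon>" and Ulow: "\<And>x. \<epsilon> \<le> U x" and Uup: "\<And>x. U x \<le> 1 - \<epsilon>"
begin

definition Em :: "((int^'d \<Rightarrow> bool) \<Rightarrow> real) \<Rightarrow> real" where
  "Em g = (\<Sum>\<xi>\<in>Omega n. muU n U \<xi> * g \<xi>)"

definition om2 :: "int^'d \<Rightarrow> bool \<Rightarrow> real" where
  "om2 z b = ((if b then 1 else 0) - U z) / (U z * (1 - U z))"

lemma U01: "0 < U x" "U x < 1" using eps Ulow[of x] Uup[of x] by auto

lemma finO: "finite (Omega n :: (int^'d \<Rightarrow> bool) set)" using finite_Omega[OF n1] .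

lemma om2_T: "om2 z True = 1 / U z" and om2_F: "om2 z False = - 1 / (1 - U z)"
  using U01[of z] unfolding om2_def by (auto simp: field_simps)

lemma om2_le: "\<bar>om2 z b\<bar> \<le> 1 / \<epsilon>"
proof (cases b)
  case True
  then show ?thesis using U01[of z] Ulow[of z] eps by (auto simp: om2_T intro!: divide_left_mono)
next
  case False
  have "1 / (1 - U z) \<le> 1 / \<epsilon>" using U01[of z] Uup[of z] eps by (intro divide_left_mono) auto
  then show ?thesis using False U01[of z] by (auto simp: om2_F)
qed

sublocale b: bern "box n" U om2 "1/\<epsilon>"
proof
  show "1 \<le> 1/\<epsilon>" using eps Ulow[of 0] Uup[of 0] by auto
  fix z :: "int^'d"
  show "0 \<le> U z \<and> U z \<le> 1" using U01[of z] by auto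
  show "U z * om2 z True + (1 - U z) * om2 z False = 0" using U01[of z] by (simp add: om2_T om2_F)
  show "\<bar>om2 z b\<bar> \<le> 1 / \<epsilon>" for b by (rule om2_le)
qed simp

lemma muU_cfg: "S \<subseteq> box n \<Longrightarrow> muU n U (cfg n S) = wt (box n) U S"
  unfolding muU_def wt_def cfg_def by (intro prod.cong refl) auto

lemma omU_cfg: "omU U (cfg n S) z = om2 (tmod n z) (tmod n z \<in> S)"
  unfolding omU_def om2_def cfg_def Uper by simp

lemma omU_le: "\<bar>omU U \<xi> z\<bar> \<le> 1/\<epsilon>" using om2_le[of z "\<xi> z"] unfolding omU_def om2_def .

lemma omU_per: "\<xi> \<in> Omega n \<Longrightarrow> omU U \<xi> (tmod n z) = omU U \<xi> z"
  unfolding omU_def by (simp add: OmegaD Uper)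

lemma Em_EE: "Em g = EE (box n) U (\<lambda>S. g (cfg n S))"
proof -
  have "Em g = (\<Sum>S\<in>Pow (box n). muU n U (cfg n S) * g (cfg n S))"
    unfolding Em_def by (rule sum.reindex_bij_betw[OF bij_cfg[OF n1], symmetric])
  then show ?thesis unfolding EE_def using muU_cfg by (auto intro: sum.cong)
qed

lemma Em_const: "Em (\<lambda>_. c) = c" unfolding Em_EE by (rule EE_const) simp

lemma muU_pos: "muU n U \<xi> > 0" unfolding muU_def using U01 by (intro prod_pos) auto

definition za :: "(int^'d) set \<Rightarrow> (int^'d \<Rightarrow> bool) \<Rightarrow> int^'d \<Rightarrow> real" where
  "za A \<xi> x = (\<Prod>a\<in>A. omU U \<xi> (x + a))"

lemma za_cfg:
  assumes "inj_on (tmod n) A"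
  shows "za A (cfg n S) x = (\<Prod>s\<in>(\<lambda>a. tmod n (x + a)) ` A. om2 s (s \<in> S))"
proof -
  have "inj_on (\<lambda>a. tmod n (x + a)) A" using assms unfolding inj_on_def tmod_cancel .
  then show ?thesis unfolding za_def omU_cfg by (simp add: prod.reindex)
qed

text \<open>A translate that meets the cell of \<open>x\<close> is determined by the pair of
  elements of \<open>A\<close> whose translates coincide.\<close>

lemma card_overlap:
  assumes "finite A"
  shows "card {x'\<in>box n. (\<lambda>a. tmod n (x + a)) ` A \<inter> (\<lambda>a. tmod n (x' + a)) ` A \<noteq> {}} \<le> card A * card A"
proof -
  have "{x'\<in>box n. (\<lambda>a. tmod n (x + a)) ` A \<inter> (\<lambda>a. tmod n (x' + a)) ` A \<noteq> {}}
    \<subseteq> (\<lambda>(a,a'). tmod n (x + a - a')) ` (A \<times> A)"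
  proof
    fix x' assume x': "x' \<in> {x'\<in>box n. (\<lambda>a. tmod n (x + a)) ` A \<inter> (\<lambda>a. tmod n (x' + a)) ` A \<noteq> {}}"
    then obtain a a' where a: "a \<in> A" "a' \<in> A" "tmod n (x + a) = tmod n (x' + a')" by auto
    have "tmod n (x + a - a') = tmod n (x' + a' - a')" using a(3) by (metis tmod_diff_left)
    then have "x' = tmod n (x + a - a')" using x' by simp
    then show "x' \<in> (\<lambda>(a,a'). tmod n (x + a - a')) ` (A \<times> A)" using a by auto
  qed
  then have "card {x'\<in>box n. (\<lambda>a. tmod n (x + a)) ` A \<inter> (\<lambda>a. tmod n (x' + a)) ` A \<noteq> {}} \<le> card (A \<times> A)"
    using assms by (meson card_image_le card_mono finite_SigmaI finite_imageI order_trans)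
  then show ?thesis by (simp add: card_cartesian_product)
qed

text \<open>Splits each translate of \<open>A\<close> into a head, the image of a chosen
  \<open>a0\<close>, and the rest, in the form that decoupling requires. Different translates have
  different heads because translation is a bijection of the torus.\<close>

lemma cell_head:
  assumes A: "finite A" "inj_on (tmod n) A" and a0: "a0 \<in> A"
  defines "t \<equiv> \<lambda>x. tmod n (x + a0)" and "D \<equiv> \<lambda>x. (\<lambda>a. tmod n (x + a)) ` (A - {a0})"
  shows "insert (t x) (D x) = (\<lambda>a. tmod n (x + a)) ` A" "t x \<in> box n" "D x \<subseteq> box n"
    "t x \<notin> D x" "card (D x) = card A - 1" "inj_on t (box n)"
proof -
  have i: "inj_on (\<lambda>a. tmod n (x + a)) A" using A(2) unfolding inj_on_def tmod_cancel .
  show "insert (t x) (D x) = (\<lambda>a. tmod n (x + a)) ` A" unfolding t_def D_def using a0 by auto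
  show "t x \<in> box n" "D x \<subseteq> box n" unfolding t_def D_def using tmod_in_box[OF n1] by auto
  show "t x \<notin> D x" unfolding t_def D_def using i a0 by (auto simp: inj_on_def)
  show "card (D x) = card A - 1" unfolding D_def
    using card_image[OF inj_on_subset[OF i Diff_subset]] a0 A(1) by simp
  show "inj_on t (box n)" unfolding t_def using bij_shift[OF n1] bij_betw_imp_inj_on by blast
qed

lemma Em_exp_lin: "Em (\<lambda>\<xi>. exp (\<Sum>x\<in>box n. c x * omU U \<xi> x)) \<le> exp ((1/\<epsilon>)\<^sup>2 * (\<Sum>x\<in>box n. (c x)\<^sup>2))"
proof -
  have "Em (\<lambda>\<xi>. exp (\<Sum>x\<in>box n. c x * omU U \<xi> x)) = EE (box n) U (\<lambda>S. exp (\<Sum>x\<in>box n. c x * om2 x (x \<in> S)))"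
    unfolding Em_EE omU_cfg by (intro EE_cong arg_cong[where f=exp] sum.cong refl) auto
  also have "\<dots> \<le> EE (box n) U (\<lambda>S. exp ((1/\<epsilon>)\<^sup>2 * (\<Sum>x\<in>box n. (c x)\<^sup>2)))"
    by (rule b.lin_exp[where c="\<lambda>x S. c x"]) auto
  finally show ?thesis by (simp add: EE_const)
qed

lemma Em_exp_quad:
  assumes A: "finite A" "A \<noteq> {}" "inj_on (tmod n) A"
    and op: "\<And>w. (\<Sum>x\<in>box n. (\<Sum>z\<in>box n. F z x * w z)\<^sup>2) \<le> \<nu> * (\<Sum>z\<in>box n. (w z)\<^sup>2)"
    and small: "(1/\<epsilon>) ^ (2 * card A) * 4 ^ (2 * card A) * \<nu> \<le> 1/2"
  shows "Em (\<lambda>\<xi>. exp (\<Sum>z\<in>box n. (\<Sum>x\<in>box n. F z x * za A \<xi> x)\<^sup>2))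
     \<le> exp (2 * ((1/\<epsilon>) ^ (2 * card A) * (1 + 2 ^ (2 * card A))) * real (card A * card A) * (\<Sum>z\<in>box n. \<Sum>x\<in>box n. (F z x)\<^sup>2))"
proof -
  obtain a0 where a0: "a0 \<in> A" using A by auto
  note h = cell_head[OF A(1,3) a0]
  have "card A > 0" using A(1,2) by (simp add: card_gt_0_iff)
  then have l: "2 * (card A - 1) + 2 = 2 * card A" by simp
  have ov: "card {x'\<in>box n. insert (tmod n (x + a0)) ((\<lambda>a. tmod n (x + a)) ` (A - {a0})) \<inter>
      insert (tmod n (x' + a0)) ((\<lambda>a. tmod n (x' + a)) ` (A - {a0})) \<noteq> {}} \<le> card A * card A" for x
    unfolding h(1) by (rule card_overlap[OF A(1)])
  have "EE (box n) U (\<lambda>S. exp (\<Sum>z\<in>box n. (\<Sum>x\<in>box n. F z x * (\<Prod>s\<in>insert (tmod n (x + a0)) ((\<lambda>a. tmod n (x + a)) ` (A - {a0})). om2 s (s \<in> S)))\<^sup>2))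
     \<le> exp (2 * ((1/\<epsilon>) ^ (2 * (card A - 1) + 2) * (1 + 2 ^ (2 * (card A - 1) + 2))) * real (card A * card A) * (\<Sum>z\<in>box n. \<Sum>x\<in>box n. (F z x)\<^sup>2))"
  proof (rule b.quad_exp)
    show "(1/\<epsilon>) ^ (2 * (card A - 1) + 2) * 4 ^ (2 * (card A - 1) + 2) * \<nu> \<le> 1/2" unfolding l by (rule small)
  qed (rule finite_box h(2-6) ov op)+
  then show ?thesis unfolding Em_EE za_cfg[OF A(3)] h(1) l .
qed

lemma Em_exp_bil:
  assumes A: "finite A" "A \<noteq> {}" "inj_on (tmod n) A" and B: "finite B" "B \<noteq> {}" "inj_on (tmod n) B"
    and disj: "\<And>x y a b. x \<in> box n \<Longrightarrow> y \<in> box n \<Longrightarrow> K y x \<noteq> 0 \<Longrightarrow> a \<in> A \<Longrightarrow> b \<in> B \<Longrightarrow> tmod n (y + b) \<noteq> tmod n (x + a)"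
    and op: "\<And>w. (\<Sum>x\<in>box n. (\<Sum>z\<in>box n. K z x * w z)\<^sup>2) \<le> \<nu> * (\<Sum>z\<in>box n. (w z)\<^sup>2)"
    and small: "(1/\<epsilon>) ^ (2 * card A) * 4 ^ (2 * card A) * ((1/\<epsilon>) ^ (2 * card B) * 4 ^ (card A + card B) * \<nu>) \<le> 1/2"
  shows "Em (\<lambda>\<xi>. exp (\<Sum>y\<in>box n. \<Sum>x\<in>box n. K y x * (za B \<xi> y * za A \<xi> x)))
     \<le> exp (2 * ((1/\<epsilon>) ^ (2 * card A) * (1 + 2 ^ (2 * card A))) * real (card A * card A) * ((1/\<epsilon>) ^ (2 * card B) * 4 ^ (card A + card B))
          * (\<Sum>z\<in>box n. \<Sum>x\<in>box n. (K z x)\<^sup>2))"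
proof -
  obtain a0 where a0: "a0 \<in> A" using A by auto
  obtain b0 where b0: "b0 \<in> B" using B by auto
  note h = cell_head[OF A(1,3) a0]
  note h' = cell_head[OF B(1,3) b0]
  have "card A > 0" "card B > 0" using A(1,2) B(1,2) by (simp_all add: card_gt_0_iff)
  then have l: "2 * (card A - 1) + 2 = 2 * card A" "2 * (card B - 1) + 2 = 2 * card B"
    "card A - 1 + (card B - 1) + 2 = card A + card B" by simp_all
  have dis: "(\<lambda>b. tmod n (y + b)) ` B \<inter> (\<lambda>a. tmod n (x + a)) ` A = {}" if "x \<in> box n" "y \<in> box n" "K y x \<noteq> 0" for x y
    using disj[OF that] by auto
  have ov: "card {x'\<in>box n. insert (tmod n (x + a0)) ((\<lambda>a. tmod n (x + a)) ` (A - {a0})) \<inter>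
      insert (tmod n (x' + a0)) ((\<lambda>a. tmod n (x' + a)) ` (A - {a0})) \<noteq> {}} \<le> card A * card A" for x
    unfolding h(1) by (rule card_overlap[OF A(1)])
  have dis': "insert (tmod n (y + b0)) ((\<lambda>b. tmod n (y + b)) ` (B - {b0})) \<inter>
      insert (tmod n (x + a0)) ((\<lambda>a. tmod n (x + a)) ` (A - {a0})) = {}"
    if "x \<in> box n" "y \<in> box n" "K y x \<noteq> 0" for x y
    unfolding h(1) h'(1) by (rule dis[OF that])
  have "EE (box n) U (\<lambda>S. exp (\<Sum>y\<in>box n. \<Sum>x\<in>box n. K y x * (
          (\<Prod>s\<in>insert (tmod n (y + b0)) ((\<lambda>a. tmod n (y + a)) ` (B - {b0})). om2 s (s \<in> S)) *
          (\<Prod>s\<in>insert (tmod n (x + a0)) ((\<lambda>a. tmod n (x + a)) ` (A - {a0})). om2 s (s \<in> S)))))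
     \<le> exp (2 * ((1/\<epsilon>) ^ (2 * (card A - 1) + 2) * (1 + 2 ^ (2 * (card A - 1) + 2))) * real (card A * card A) *
          ((1/\<epsilon>) ^ (2 * (card B - 1) + 2) * 4 ^ (card A - 1 + (card B - 1) + 2)) * (\<Sum>z\<in>box n. \<Sum>x\<in>box n. (K z x)\<^sup>2))"
  proof (rule b.bilinear_exp)
    show "(1/\<epsilon>) ^ (2 * (card A - 1) + 2) * 4 ^ (2 * (card A - 1) + 2) * ((1/\<epsilon>) ^ (2 * (card B - 1) + 2) * 4 ^ (card A - 1 + (card B - 1) + 2) * \<nu>) \<le> 1/2"
      unfolding l by (rule small)
  qed (rule finite_box h(2-6) h'(2-6) ov op dis'; assumption)+
  then show ?thesis unfolding Em_EE za_cfg[OF A(3)] za_cfg[OF B(3)] h(1) h'(1) l .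
qed

text \<open>The Donsker-Varadhan (Gibbs) inequality. Pointwise it is \<open>ln y \<le> y - 1\<close>
  at \<open>y = exp (g \<xi>) / (Z * f \<xi>)\<close>; the two leftover terms integrate to 1 -
  1.\<close>

lemma entropy_ineq:
  assumes q0: "\<And>\<xi>. \<xi> \<in> Omega n \<Longrightarrow> f \<xi> \<ge> 0" and q1: "Em f = 1"
  shows "Em (\<lambda>\<xi>. f \<xi> * g \<xi>) \<le> Em (\<lambda>\<xi>. f \<xi> * ln (f \<xi>)) + ln (Em (\<lambda>\<xi>. exp (g \<xi>)))"
proof -
  define Z where "Z = Em (\<lambda>\<xi>. exp (g \<xi>))"
  have ne: "Omega n \<noteq> ({} :: (int^'d \<Rightarrow> bool) set)" unfolding Omega_def by auto
  have Z0: "Z > 0" unfolding Z_def Em_def using finO ne muU_pos by (intro sum_pos) auto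
  have pt: "f \<xi> * g \<xi> \<le> f \<xi> * ln (f \<xi>) + f \<xi> * ln Z + (exp (g \<xi>) / Z - f \<xi>)" if "\<xi> \<in> Omega n" for \<xi>
  proof (cases "f \<xi> = 0")
    case True then show ?thesis using Z0 by simp
  next
    case False
    then have f0: "f \<xi> > 0" using q0[OF that] by simp
    have "ln (exp (g \<xi>) / (Z * f \<xi>)) \<le> exp (g \<xi>) / (Z * f \<xi>) - 1"
      using Z0 f0 by (intro ln_le_minus_one) auto
    then have "g \<xi> - ln Z - ln (f \<xi>) \<le> exp (g \<xi>) / (Z * f \<xi>) - 1"
      using Z0 f0 by (simp add: ln_div ln_mult)
    then have "f \<xi> * (g \<xi> - ln Z - ln (f \<xi>)) \<le> f \<xi> * (exp (g \<xi>) / (Z * f \<xi>) - 1)"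
      using f0 by (intro mult_left_mono) auto
    also have "\<dots> = exp (g \<xi>) / Z - f \<xi>" using f0 Z0 by (simp add: field_simps)
    finally show ?thesis by (simp add: algebra_simps)
  qed
  have "Em (\<lambda>\<xi>. f \<xi> * g \<xi>) \<le> Em (\<lambda>\<xi>. f \<xi> * ln (f \<xi>) + f \<xi> * ln Z + (exp (g \<xi>) / Z - f \<xi>))"
    unfolding Em_def using pt muU_pos by (intro sum_mono mult_left_mono) (auto intro: less_imp_le)
  also have "\<dots> = Em (\<lambda>\<xi>. f \<xi> * ln (f \<xi>)) + Em f * ln Z + (Em (\<lambda>\<xi>. exp (g \<xi>)) / Z - Em f)"
    unfolding Em_def sum_distrib_right sum_divide_distrib sum_subtractf[symmetric] sum.distrib[symmetric]
    by (intro sum.cong refl) (simp add: algebra_simps)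
  also have "\<dots> = Em (\<lambda>\<xi>. f \<xi> * ln (f \<xi>)) + ln Z" using q1 Z0 unfolding Z_def by simp
  finally show ?thesis unfolding Z_def .
qed

end

section \<open>Integration by parts along a bond\<close>

context tor
begin

definition B10 :: "int^'d \<Rightarrow> int^'d \<Rightarrow> (int^'d \<Rightarrow> bool) set" where
  "B10 x y = {\<xi>\<in>Omega n. \<xi> x \<and> \<not> \<xi> y}"

text \<open>Up to normalisation the current through the bond: \<open>muU\<close> times
  \<open>bet\<close> is antisymmetric under exchange of the values at \<open>x\<close> and
  \<open>y\<close> and vanishes when they agree. The quadratic term compensates the different
  densities at the two ends.\<close>

definition bet :: "(int^'d \<Rightarrow> bool) \<Rightarrow> int^'d \<Rightarrow> int^'d \<Rightarrow> real" where
  "bet \<xi> x y = omU U \<xi> y - omU U \<xi> x + (U y - U x) * (omU U \<xi> x * omU U \<xi> y)"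

text \<open>The Dirichlet form of \<open>sqrt f\<close> for this bond, counting only the jumps from
  \<open>x\<close> to \<open>y\<close>.\<close>

definition bdir :: "((int^'d \<Rightarrow> bool) \<Rightarrow> real) \<Rightarrow> int^'d \<Rightarrow> int^'d \<Rightarrow> real" where
  "bdir f x y = (\<Sum>\<xi>\<in>B10 x y. muU n U \<xi> * (sqrt (f (swap n \<xi> x y)) - sqrt (f \<xi>))\<^sup>2)"

lemma finB: "finite (B10 x y)" unfolding B10_def using finO by simp

lemma omU_T: "\<xi> z \<Longrightarrow> omU U \<xi> z = 1 / U z" and omU_F: "\<not> \<xi> z \<Longrightarrow> omU U \<xi> z = - 1 / (1 - U z)"
  using om2_T[of z] om2_F[of z] unfolding omU_def om2_def by simp_all

lemma bet_algebra:
  fixes u v :: real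
  assumes "0 < u" "u < 1" "0 < v" "v < 1"
  shows "- 1 / (1 - v) - 1 / u + (v - u) * (1 / u * (- 1 / (1 - v))) = - 1 / (u * (1 - v))"
    and "- 1 / (1 - v) - - 1 / (1 - u) + (v - u) * (- 1 / (1 - u) * (- 1 / (1 - v))) = 0"
    and "1 / v - - 1 / (1 - u) + (v - u) * (- 1 / (1 - u) * (1 / v)) = 1 / ((1 - u) * v)"
proof -
  define w where "w = 1 - v"
  define z where "z = 1 - u"
  have e: "v = 1 - w" "u = 1 - z" "w \<noteq> 0" "u \<noteq> 0" "z \<noteq> 0" "v \<noteq> 0" using assms unfolding w_def z_def by auto
  show "- 1 / (1 - v) - 1 / u + (v - u) * (1 / u * (- 1 / (1 - v))) = - 1 / (u * (1 - v))"
    unfolding w_def[symmetric] using e(3,4) unfolding e(1) by (simp add: divide_simps)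
  show "- 1 / (1 - v) - - 1 / (1 - u) + (v - u) * (- 1 / (1 - u) * (- 1 / (1 - v))) = 0"
    unfolding w_def[symmetric] z_def[symmetric] using e(3,5) unfolding e(1,2) by (simp add: divide_simps)
  show "1 / v - - 1 / (1 - u) + (v - u) * (- 1 / (1 - u) * (1 / v)) = 1 / ((1 - u) * v)"
    unfolding z_def[symmetric] using e(5,6) unfolding e(2) by (simp add: divide_simps)
qed

lemma bet_10:
  assumes "\<xi> x" "\<not> \<xi> y"
  shows "bet \<xi> x y = - 1 / (U x * (1 - U y))"
  unfolding bet_def omU_T[of \<xi>, OF assms(1)] omU_F[of \<xi>, OF assms(2)]
  by (rule bet_algebra(1)[OF U01 U01])

lemma bet_01:
  assumes "\<not> \<xi> x" "\<xi> y"
  shows "bet \<xi> x y = 1 / ((1 - U x) * U y)"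
  unfolding bet_def omU_T[of \<xi>, OF assms(2)] omU_F[of \<xi>, OF assms(1)]
  by (rule bet_algebra(3)[OF U01 U01])

lemma bet_eq:
  assumes "\<xi> x = \<xi> y"
  shows "bet \<xi> x y = 0"
proof (cases "\<xi> x")
  case True
  then have y: "\<xi> y" using assms by simp
  show ?thesis unfolding bet_def omU_T[of \<xi>, OF True] omU_T[of \<xi>, OF y]
    using U01[of x] U01[of y] by (simp add: field_simps)
next
  case False
  then have y: "\<not> \<xi> y" using assms by simp
  show ?thesis unfolding bet_def omU_F[of \<xi>, OF False] omU_F[of \<xi>, OF y]
    by (rule bet_algebra(2)[OF U01 U01])
qed

lemma bij_swap: "bij_betw (\<lambda>\<xi>. swap n \<xi> x y) (B10 x y) (B10 y x)"
  by (rule bij_betwI[where g="\<lambda>\<xi>. swap n \<xi> x y"])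
    (auto simp: B10_def swap_Omega swap_left swap_right swap_swap)

text \<open>Only the factors at the two ends of the bond change; dividing by them gives a weight
  common to a configuration and its swap.\<close>

lemma muU_swap:
  assumes xi: "\<xi> \<in> B10 x y"
  shows "muU n U (swap n \<xi> x y) / ((1 - U x) * U y) = muU n U \<xi> / (U x * (1 - U y))"
proof -
  have O: "\<xi> \<in> Omega n" and v: "\<xi> x" "\<not> \<xi> y" using xi unfolding B10_def by auto
  let ?x = "tmod n x" and ?y = "tmod n y"
  have ne: "?x \<noteq> ?y" using v Omega_eq[OF O, of x y] by blast
  have inb: "?x \<in> box n" "?y \<in> box n" using tmod_in_box[OF n1] by auto
  have spl: "muU n U \<zeta> = (if \<zeta> ?x then U x else 1 - U x) * ((if \<zeta> ?y then U y else 1 - U y) *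
     (\<Prod>z\<in>box n - {?x} - {?y}. if \<zeta> z then U z else 1 - U z))" for \<zeta>
  proof -
    have 1: "muU n U \<zeta> = (if \<zeta> ?x then U ?x else 1 - U ?x) * (\<Prod>z\<in>box n - {?x}. if \<zeta> z then U z else 1 - U z)"
      unfolding muU_def by (rule prod.remove[OF finite_box inb(1)])
    have 2: "(\<Prod>z\<in>box n - {?x}. if \<zeta> z then U z else 1 - U z)
       = (if \<zeta> ?y then U ?y else 1 - U ?y) * (\<Prod>z\<in>box n - {?x} - {?y}. if \<zeta> z then U z else 1 - U z)"
      by (rule prod.remove) (use inb ne in auto)
    show ?thesis unfolding 1 2 Uper ..
  qed
  have "(\<Prod>z\<in>box n - {?x} - {?y}. if swap n \<xi> x y z then U z else 1 - U z)
     = (\<Prod>z\<in>box n - {?x} - {?y}. if \<xi> z then U z else 1 - U z)"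
    by (intro prod.cong refl) (auto simp: swap_def)
  then show ?thesis unfolding spl using v ne U01[of x] U01[of y]
    by (simp add: OmegaD[OF O] swap_def field_simps)
qed

lemma sum_B01:
  "(\<Sum>\<xi>\<in>B10 y x. h \<xi>) = (\<Sum>\<xi>\<in>B10 x y. h (swap n \<xi> x y))"
  by (rule sum.reindex_bij_betw[OF bij_swap, symmetric])

lemma sum_Omega_split:
  assumes "\<And>\<xi>. \<xi> \<in> Omega n \<Longrightarrow> \<xi> x = \<xi> y \<Longrightarrow> h \<xi> = 0"
  shows "(\<Sum>\<xi>\<in>Omega n. h \<xi>) = (\<Sum>\<xi>\<in>B10 x y. h \<xi>) + (\<Sum>\<xi>\<in>B10 y x. h \<xi>)"
proof -
  have "(\<Sum>\<xi>\<in>Omega n. h \<xi>) = (\<Sum>\<xi>\<in>B10 x y \<union> B10 y x. h \<xi>)"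
    by (rule sum.mono_neutral_right) (use assms finO in \<open>auto simp: B10_def\<close>)
  also have "\<dots> = (\<Sum>\<xi>\<in>B10 x y. h \<xi>) + (\<Sum>\<xi>\<in>B10 y x. h \<xi>)"
    by (rule sum.union_disjoint[OF finB finB]) (auto simp: B10_def)
  finally show ?thesis .
qed

text \<open>Antisymmetry of \<open>bet\<close>: each configuration with the particle at
  \<open>x\<close> is paired with its swap, and \<open>g\<close> comes out because it does not see
  the exchange.\<close>

lemma Em_bet:
  assumes g: "\<And>\<xi>. \<xi> \<in> Omega n \<Longrightarrow> g (swap n \<xi> x y) = g \<xi>"
  shows "Em (\<lambda>\<xi>. f \<xi> * g \<xi> * bet \<xi> x y)
    = (\<Sum>\<xi>\<in>B10 x y. muU n U \<xi> / (U x * (1 - U y)) * (g \<xi> * (f (swap n \<xi> x y) - f \<xi>)))"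
proof -
  have "Em (\<lambda>\<xi>. f \<xi> * g \<xi> * bet \<xi> x y) = (\<Sum>\<xi>\<in>B10 x y. muU n U \<xi> * (f \<xi> * g \<xi> * bet \<xi> x y))
      + (\<Sum>\<xi>\<in>B10 y x. muU n U \<xi> * (f \<xi> * g \<xi> * bet \<xi> x y))"
    unfolding Em_def by (rule sum_Omega_split) (simp add: bet_eq)
  also have "(\<Sum>\<xi>\<in>B10 y x. muU n U \<xi> * (f \<xi> * g \<xi> * bet \<xi> x y))
     = (\<Sum>\<xi>\<in>B10 x y. muU n U \<xi> / (U x * (1 - U y)) * (g \<xi> * f (swap n \<xi> x y)))"
    unfolding sum_B01[of _ y x]
  proof (rule sum.cong[OF refl])
    fix \<xi> assume xi: "\<xi> \<in> B10 x y"
    then have O: "\<xi> \<in> Omega n" and v: "\<xi> x" "\<not> \<xi> y" unfolding B10_def by auto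
    have "muU n U (swap n \<xi> x y) * bet (swap n \<xi> x y) x y = muU n U \<xi> / (U x * (1 - U y))"
      using bet_01[of "swap n \<xi> x y" x y] v muU_swap[OF xi] by (simp add: swap_left[OF O] swap_right[OF O])
    then show "muU n U (swap n \<xi> x y) * (f (swap n \<xi> x y) * g (swap n \<xi> x y) * bet (swap n \<xi> x y) x y)
       = muU n U \<xi> / (U x * (1 - U y)) * (g \<xi> * f (swap n \<xi> x y))"
      using g[OF O] by (simp add: mult_ac)
  qed
  also have "(\<Sum>\<xi>\<in>B10 x y. muU n U \<xi> * (f \<xi> * g \<xi> * bet \<xi> x y))
     = (\<Sum>\<xi>\<in>B10 x y. - (muU n U \<xi> / (U x * (1 - U y)) * (g \<xi> * f \<xi>)))"
    by (intro sum.cong refl) (auto simp: B10_def bet_10)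
  finally show ?thesis
    unfolding sum.distrib[symmetric] by (simp add: right_diff_distrib)
qed

lemma eps_prod: "\<epsilon>\<^sup>2 \<le> U x * (1 - U y)"
  unfolding power2_eq_square using Ulow[of x] Uup[of y] eps by (intro mult_mono) auto

text \<open>The difference of the two variables is \<open>- bet\<close> plus the product term with
  the density gradient. Against \<open>bet\<close> the density \<open>f\<close> enters only through
  its increment along the bond, which is a difference times a sum of square roots; Young's
  inequality sends the difference to the Dirichlet form and the sum to the square of
  \<open>g\<close>.\<close>

lemma ibp:
  assumes g: "\<And>\<xi>. \<xi> \<in> Omega n \<Longrightarrow> g (swap n \<xi> x y) = g \<xi>"
    and f0: "\<And>\<xi>. \<xi> \<in> Omega n \<Longrightarrow> f \<xi> \<ge> 0" and e1: "e1 > 0"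
  shows "Em (\<lambda>\<xi>. f \<xi> * (g \<xi> * (omU U \<xi> x - omU U \<xi> y)))
     \<le> e1 * bdir f x y + Em (\<lambda>\<xi>. f \<xi> * (g \<xi>)\<^sup>2) / (2 * e1 * \<epsilon>^4)
       + Em (\<lambda>\<xi>. f \<xi> * ((U y - U x) * (g \<xi> * (omU U \<xi> x * omU U \<xi> y))))"
proof -
  \<comment> \<open>The extra \<epsilon>^2 pays for replacing the weight \<open>W\<close> by
    \<open>muU\<close>; together with the second such replacement it becomes the \<epsilon>^4 of the
    statement.\<close>
  define e2 where "e2 = e1 * \<epsilon>\<^sup>2"
  have e2: "e2 > 0" unfolding e2_def using e1 eps by simp
  define W where "W \<xi> = muU n U \<xi> / (U x * (1 - U y))" for \<xi>
  have W0: "W \<xi> \<ge> 0" for \<xi> unfolding W_def using muU_pos[of \<xi>] U01[of x] U01[of y] by simp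
  have Wle: "W \<xi> \<le> muU n U \<xi> / \<epsilon>\<^sup>2" for \<xi>
    unfolding W_def using muU_pos[of \<xi>] eps_prod[of x y] eps U01[of x] U01[of y]
    by (intro divide_left_mono mult_pos_pos) auto
  let ?s = "\<lambda>\<xi>. swap n \<xi> x y"
  have hA: "Em (\<lambda>\<xi>. f \<xi> * (g \<xi> * (omU U \<xi> x - omU U \<xi> y)))
     = - Em (\<lambda>\<xi>. f \<xi> * g \<xi> * bet \<xi> x y) + Em (\<lambda>\<xi>. f \<xi> * ((U y - U x) * (g \<xi> * (omU U \<xi> x * omU U \<xi> y))))"
    unfolding Em_def sum_negf[symmetric] sum.distrib[symmetric] bet_def
    by (intro sum.cong refl) (simp add: algebra_simps)
  have hB: "- Em (\<lambda>\<xi>. f \<xi> * g \<xi> * bet \<xi> x y) = (\<Sum>\<xi>\<in>B10 x y. W \<xi> * (g \<xi> * (f \<xi> - f (?s \<xi>))))"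
  proof -
    have "Em (\<lambda>\<xi>. f \<xi> * g \<xi> * bet \<xi> x y)
      = (\<Sum>\<xi>\<in>B10 x y. muU n U \<xi> / (U x * (1 - U y)) * (g \<xi> * (f (?s \<xi>) - f \<xi>)))"
      by (rule Em_bet) (rule g)
    then show ?thesis unfolding W_def by (simp add: sum_negf[symmetric] algebra_simps)
  qed
  have "(\<Sum>\<xi>\<in>B10 x y. W \<xi> * (g \<xi> * (f \<xi> - f (?s \<xi>)))) \<le> (\<Sum>\<xi>\<in>B10 x y. e1 * (muU n U \<xi> * (sqrt (f (?s \<xi>)) - sqrt (f \<xi>))\<^sup>2)
      + (W \<xi> * ((g \<xi>)\<^sup>2 * f \<xi>) + W \<xi> * ((g \<xi>)\<^sup>2 * f (?s \<xi>))) / (2 * e2))"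
  proof (intro sum_mono)
    fix \<xi> assume xi: "\<xi> \<in> B10 x y"
    then have O: "\<xi> \<in> Omega n" unfolding B10_def by auto
    define r where "r = sqrt (f \<xi>)"
    define r' where "r' = sqrt (f (?s \<xi>))"
    have r: "f \<xi> = r\<^sup>2" "f (?s \<xi>) = r'\<^sup>2" "r \<ge> 0" "r' \<ge> 0"
      unfolding r_def r'_def using f0[OF O] f0[OF swap_Omega[OF O]] by auto
    define G where "G = g \<xi>"
    have "G * (r\<^sup>2 - r'\<^sup>2) \<le> e2 * (r' - r)\<^sup>2 + (G\<^sup>2 * r\<^sup>2 + G\<^sup>2 * r'\<^sup>2) / (2 * e2)"
    proof -
      \<comment> \<open>Completing the square in r - r' and r + r'; the added term turns (r + r')^2
        into 2 r^2 + 2 r'^2.\<close>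
      have "0 \<le> (2 * e2 * (r - r') - G * (r + r'))\<^sup>2 + G\<^sup>2 * (r - r')\<^sup>2" by simp
      also have "\<dots> = 4 * e2 * (e2 * (r' - r)\<^sup>2 + (G\<^sup>2 * r\<^sup>2 + G\<^sup>2 * r'\<^sup>2) / (2 * e2) - G * (r\<^sup>2 - r'\<^sup>2))"
        using e2 by (simp add: field_simps power2_eq_square)
      finally show ?thesis using e2 by (simp add: zero_le_mult_iff)
    qed
    then have "W \<xi> * (G * (r\<^sup>2 - r'\<^sup>2)) \<le> W \<xi> * (e2 * (r' - r)\<^sup>2 + (G\<^sup>2 * r\<^sup>2 + G\<^sup>2 * r'\<^sup>2) / (2 * e2))"
      using W0 by (intro mult_left_mono) auto
    also have "\<dots> = W \<xi> * (e2 * (r' - r)\<^sup>2) + (W \<xi> * (G\<^sup>2 * r\<^sup>2) + W \<xi> * (G\<^sup>2 * r'\<^sup>2)) / (2 * e2)"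
      by (simp add: distrib_left)
    also have "\<dots> \<le> e1 * (muU n U \<xi> * (r' - r)\<^sup>2) + (W \<xi> * (G\<^sup>2 * r\<^sup>2) + W \<xi> * (G\<^sup>2 * r'\<^sup>2)) / (2 * e2)"
    proof (rule add_right_mono)
      have "W \<xi> * (e2 * (r' - r)\<^sup>2) \<le> muU n U \<xi> / \<epsilon>\<^sup>2 * (e2 * (r' - r)\<^sup>2)"
        using Wle e2 by (intro mult_right_mono) auto
      also have "\<dots> = e1 * (muU n U \<xi> * (r' - r)\<^sup>2)"
        unfolding e2_def using eps by simp
      finally show "W \<xi> * (e2 * (r' - r)\<^sup>2) \<le> e1 * (muU n U \<xi> * (r' - r)\<^sup>2)" .
    qed
    finally show "W \<xi> * (g \<xi> * (f \<xi> - f (?s \<xi>))) \<le> e1 * (muU n U \<xi> * (sqrt (f (?s \<xi>)) - sqrt (f \<xi>))\<^sup>2)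
      + (W \<xi> * ((g \<xi>)\<^sup>2 * f \<xi>) + W \<xi> * ((g \<xi>)\<^sup>2 * f (?s \<xi>))) / (2 * e2)"
      unfolding G_def r_def[symmetric] r'_def[symmetric] unfolding r(1,2) .
  qed
  also have "\<dots> = e1 * bdir f x y + ((\<Sum>\<xi>\<in>B10 x y. W \<xi> * ((g \<xi>)\<^sup>2 * f \<xi>)) + (\<Sum>\<xi>\<in>B10 x y. W \<xi> * ((g \<xi>)\<^sup>2 * f (?s \<xi>)))) / (2 * e2)"
    unfolding bdir_def by (simp add: sum.distrib sum_distrib_left sum_divide_distrib add_divide_distrib)
  finally have hC: "(\<Sum>\<xi>\<in>B10 x y. W \<xi> * (g \<xi> * (f \<xi> - f (?s \<xi>)))) \<le> e1 * bdir f x y + ((\<Sum>\<xi>\<in>B10 x y. W \<xi> * ((g \<xi>)\<^sup>2 * f \<xi>)) + (\<Sum>\<xi>\<in>B10 x y. W \<xi> * ((g \<xi>)\<^sup>2 * f (?s \<xi>)))) / (2 * e2)" .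
  have hD: "((\<Sum>\<xi>\<in>B10 x y. W \<xi> * ((g \<xi>)\<^sup>2 * f \<xi>)) + (\<Sum>\<xi>\<in>B10 x y. W \<xi> * ((g \<xi>)\<^sup>2 * f (?s \<xi>)))) / (2 * e2)
     \<le> (Em (\<lambda>\<xi>. f \<xi> * (g \<xi>)\<^sup>2) / \<epsilon>\<^sup>2) / (2 * e2)"
  proof (rule divide_right_mono)
    have 1: "(\<Sum>\<xi>\<in>B10 x y. W \<xi> * ((g \<xi>)\<^sup>2 * f \<xi>)) \<le> (\<Sum>\<xi>\<in>B10 x y. muU n U \<xi> * (f \<xi> * (g \<xi>)\<^sup>2)) / \<epsilon>\<^sup>2"
      unfolding sum_divide_distrib
    proof (intro sum_mono)
      fix \<xi> assume "\<xi> \<in> B10 x y"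
      then have "0 \<le> f \<xi>" using f0 unfolding B10_def by auto
      then have "W \<xi> * ((g \<xi>)\<^sup>2 * f \<xi>) \<le> muU n U \<xi> / \<epsilon>\<^sup>2 * ((g \<xi>)\<^sup>2 * f \<xi>)"
        using Wle by (intro mult_right_mono) auto
      then show "W \<xi> * ((g \<xi>)\<^sup>2 * f \<xi>) \<le> muU n U \<xi> * (f \<xi> * (g \<xi>)\<^sup>2) / \<epsilon>\<^sup>2" by (simp add: mult_ac)
    qed
    \<comment> \<open>By \<open>muU_swap\<close> the weight also belongs to the swapped
      configuration, so this sum lives on the opposite orientation of the bond. The two orientations
      are disjoint and together stay below the full expectation.\<close>
    have "(\<Sum>\<xi>\<in>B10 x y. W \<xi> * ((g \<xi>)\<^sup>2 * f (?s \<xi>))) \<le> (\<Sum>\<xi>\<in>B10 x y. muU n U (?s \<xi>) * (f (?s \<xi>) * (g (?s \<xi>))\<^sup>2)) / \<epsilon>\<^sup>2"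
      unfolding sum_divide_distrib
    proof (intro sum_mono)
      fix \<xi> assume xi: "\<xi> \<in> B10 x y"
      then have O: "\<xi> \<in> Omega n" unfolding B10_def by auto
      have "0 \<le> f (?s \<xi>)" using f0 swap_Omega[OF O] by auto
      moreover have "W \<xi> \<le> muU n U (?s \<xi>) / \<epsilon>\<^sup>2"
        unfolding W_def muU_swap[OF xi, symmetric] using muU_pos[of "?s \<xi>"] eps_prod[of y x] eps U01[of x] U01[of y]
        by (intro divide_left_mono mult_pos_pos) (auto simp: mult.commute)
      ultimately have "W \<xi> * ((g \<xi>)\<^sup>2 * f (?s \<xi>)) \<le> muU n U (?s \<xi>) / \<epsilon>\<^sup>2 * ((g \<xi>)\<^sup>2 * f (?s \<xi>))"
        by (intro mult_right_mono) auto
      then show "W \<xi> * ((g \<xi>)\<^sup>2 * f (?s \<xi>)) \<le> muU n U (?s \<xi>) * (f (?s \<xi>) * (g (?s \<xi>))\<^sup>2) / \<epsilon>\<^sup>2"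
        unfolding g[OF O] by (simp add: mult_ac)
    qed
    then have 2: "(\<Sum>\<xi>\<in>B10 x y. W \<xi> * ((g \<xi>)\<^sup>2 * f (?s \<xi>))) \<le> (\<Sum>\<xi>\<in>B10 y x. muU n U \<xi> * (f \<xi> * (g \<xi>)\<^sup>2)) / \<epsilon>\<^sup>2"
      using sum_B01[of "\<lambda>\<xi>. muU n U \<xi> * (f \<xi> * (g \<xi>)\<^sup>2)" y x] by simp
    have "(\<Sum>\<xi>\<in>B10 x y. muU n U \<xi> * (f \<xi> * (g \<xi>)\<^sup>2)) + (\<Sum>\<xi>\<in>B10 y x. muU n U \<xi> * (f \<xi> * (g \<xi>)\<^sup>2))
       = (\<Sum>\<xi>\<in>B10 x y \<union> B10 y x. muU n U \<xi> * (f \<xi> * (g \<xi>)\<^sup>2))"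
      by (rule sum.union_disjoint[OF finB finB, symmetric]) (auto simp: B10_def)
    also have "\<dots> \<le> Em (\<lambda>\<xi>. f \<xi> * (g \<xi>)\<^sup>2)"
      unfolding Em_def using finO f0 less_imp_le[OF muU_pos]
      by (intro sum_mono2) (auto simp: B10_def intro!: mult_nonneg_nonneg)
    finally have "((\<Sum>\<xi>\<in>B10 x y. muU n U \<xi> * (f \<xi> * (g \<xi>)\<^sup>2)) + (\<Sum>\<xi>\<in>B10 y x. muU n U \<xi> * (f \<xi> * (g \<xi>)\<^sup>2))) / \<epsilon>\<^sup>2
       \<le> Em (\<lambda>\<xi>. f \<xi> * (g \<xi>)\<^sup>2) / \<epsilon>\<^sup>2" by (intro divide_right_mono) auto
    then show "(\<Sum>\<xi>\<in>B10 x y. W \<xi> * ((g \<xi>)\<^sup>2 * f \<xi>)) + (\<Sum>\<xi>\<in>B10 x y. W \<xi> * ((g \<xi>)\<^sup>2 * f (?s \<xi>)))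
      \<le> Em (\<lambda>\<xi>. f \<xi> * (g \<xi>)\<^sup>2) / \<epsilon>\<^sup>2"
      using 1 2 unfolding add_divide_distrib by linarith
  qed (use e2 in simp)
  have hE: "(Em (\<lambda>\<xi>. f \<xi> * (g \<xi>)\<^sup>2) / \<epsilon>\<^sup>2) / (2 * e2) = Em (\<lambda>\<xi>. f \<xi> * (g \<xi>)\<^sup>2) / (2 * e1 * \<epsilon>^4)"
    unfolding e2_def by (simp add: power2_eq_square power4_eq_xxxx mult_ac)
  show ?thesis using hA hB hC hD hE by linarith
qed

text \<open>The factor in front of the expectation is the mean current through the bond under the
  product measure; it vanishes exactly under detailed balance.\<close>

lemma bond_generator:
  "Em (\<lambda>\<xi>. (if \<xi> x \<and> \<not> \<xi> y then a else 0) * (f (swap n \<xi> x y) - f \<xi>)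
         + (if \<xi> y \<and> \<not> \<xi> x then a' else 0) * (f (swap n \<xi> x y) - f \<xi>))
   = (a * (U x * (1 - U y)) - a' * ((1 - U x) * U y)) * Em (\<lambda>\<xi>. f \<xi> * bet \<xi> x y)"
proof -
  let ?s = "\<lambda>\<xi>. swap n \<xi> x y"
  let ?h = "\<lambda>\<xi>. muU n U \<xi> * ((if \<xi> x \<and> \<not> \<xi> y then a else 0) * (f (swap n \<xi> x y) - f \<xi>)
         + (if \<xi> y \<and> \<not> \<xi> x then a' else 0) * (f (swap n \<xi> x y) - f \<xi>))"
  define W where "W \<xi> = muU n U \<xi> / (U x * (1 - U y))" for \<xi>
  have nz: "U x * (1 - U y) \<noteq> 0" "(1 - U x) * U y \<noteq> 0" using U01[of x] U01[of y] by auto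
  have "(\<Sum>\<xi>\<in>Omega n. ?h \<xi>) = (\<Sum>\<xi>\<in>B10 x y. ?h \<xi>) + (\<Sum>\<xi>\<in>B10 x y. ?h (?s \<xi>))"
    unfolding sum_B01[of ?h y x, symmetric] by (rule sum_Omega_split) auto
  also have "(\<Sum>\<xi>\<in>B10 x y. ?h \<xi>) = (\<Sum>\<xi>\<in>B10 x y. a * (U x * (1 - U y)) * (W \<xi> * (f (?s \<xi>) - f \<xi>)))"
    using nz by (intro sum.cong refl) (auto simp: B10_def W_def)
  also have "(\<Sum>\<xi>\<in>B10 x y. ?h (?s \<xi>)) = (\<Sum>\<xi>\<in>B10 x y. - a' * ((1 - U x) * U y) * (W \<xi> * (f (?s \<xi>) - f \<xi>)))"
  proof (intro sum.cong refl)
    fix \<xi> assume xi: "\<xi> \<in> B10 x y"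
    then have O: "\<xi> \<in> Omega n" and v: "\<xi> x" "\<not> \<xi> y" unfolding B10_def by auto
    have m: "muU n U (?s \<xi>) = (1 - U x) * U y * W \<xi>" using muU_swap[OF xi] nz unfolding W_def
      by (metis nonzero_eq_divide_eq mult.commute)
    have "?h (?s \<xi>) = muU n U (?s \<xi>) * (a' * (f \<xi> - f (?s \<xi>)))"
      using v by (simp add: swap_left[OF O] swap_right[OF O] swap_swap[OF O])
    then show "?h (?s \<xi>) = - a' * ((1 - U x) * U y) * (W \<xi> * (f (?s \<xi>) - f \<xi>))"
      unfolding m by (simp add: algebra_simps)
  qed
  also have "(\<Sum>\<xi>\<in>B10 x y. a * (U x * (1 - U y)) * (W \<xi> * (f (?s \<xi>) - f \<xi>))) + (\<Sum>\<xi>\<in>B10 x y. - a' * ((1 - U x) * U y) * (W \<xi> * (f (?s \<xi>) - f \<xi>)))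
     = (a * (U x * (1 - U y)) - a' * ((1 - U x) * U y)) * (\<Sum>\<xi>\<in>B10 x y. W \<xi> * (f (?s \<xi>) - f \<xi>))"
    unfolding sum_distrib_left[symmetric] by (simp add: algebra_simps)
  also have "(\<Sum>\<xi>\<in>B10 x y. W \<xi> * (f (?s \<xi>) - f \<xi>)) = Em (\<lambda>\<xi>. f \<xi> * bet \<xi> x y)"
    using Em_bet[of "\<lambda>_. 1" x y f] unfolding W_def by simp
  finally show ?thesis unfolding Em_def .
qed

end

section \<open>Schur test, convolution on the torus, and transport along lines\<close>

lemma schur_test:
  fixes F :: "'z \<Rightarrow> 'x \<Rightarrow> real"
  assumes "finite X" "finite Z"
    and col: "\<And>x. x \<in> X \<Longrightarrow> (\<Sum>z\<in>Z. \<bar>F z x\<bar>) \<le> r" and row: "\<And>z. z \<in> Z \<Longrightarrow> (\<Sum>x\<in>X. \<bar>F z x\<bar>) \<le> r"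
  shows "(\<Sum>x\<in>X. (\<Sum>z\<in>Z. F z x * w z)\<^sup>2) \<le> r\<^sup>2 * (\<Sum>z\<in>Z. (w z)\<^sup>2)"
proof (cases "X = {}")
  case True then show ?thesis by (simp add: sum_nonneg)
next
  case False
  then obtain x0 where "x0 \<in> X" by auto
  then have r0: "0 \<le> r" using col[of x0] by (meson abs_ge_zero order_trans sum_nonneg)
  have "(\<Sum>x\<in>X. (\<Sum>z\<in>Z. F z x * w z)\<^sup>2) \<le> (\<Sum>x\<in>X. r * (\<Sum>z\<in>Z. \<bar>F z x\<bar> * (w z)\<^sup>2))"
  proof (intro sum_mono)
    fix x assume x: "x \<in> X"
    \<comment> \<open>Writing the kernel as a product of two square roots lets Cauchy-Schwarz use
      the column sums once and, after the sums are exchanged, the row sums once.\<close>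
    have "(\<Sum>z\<in>Z. F z x * w z)\<^sup>2 \<le> (\<Sum>z\<in>Z. sqrt \<bar>F z x\<bar> * (sqrt \<bar>F z x\<bar> * \<bar>w z\<bar>))\<^sup>2"
    proof -
      have "\<bar>\<Sum>z\<in>Z. F z x * w z\<bar> \<le> (\<Sum>z\<in>Z. \<bar>F z x * w z\<bar>)" by (rule sum_abs)
      also have "\<dots> = (\<Sum>z\<in>Z. sqrt \<bar>F z x\<bar> * (sqrt \<bar>F z x\<bar> * \<bar>w z\<bar>))"
        by (intro sum.cong refl) (simp only: abs_mult mult.assoc[symmetric] real_sqrt_mult_self abs_abs)
      finally have "\<bar>\<Sum>z\<in>Z. F z x * w z\<bar> \<le> \<bar>\<Sum>z\<in>Z. sqrt \<bar>F z x\<bar> * (sqrt \<bar>F z x\<bar> * \<bar>w z\<bar>)\<bar>" by linarith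
      then show ?thesis unfolding abs_le_square_iff .
    qed
    also have "\<dots> \<le> (\<Sum>z\<in>Z. (sqrt \<bar>F z x\<bar>)\<^sup>2) * (\<Sum>z\<in>Z. (sqrt \<bar>F z x\<bar> * \<bar>w z\<bar>)\<^sup>2)"
      by (rule Cauchy_Schwarz_ineq_sum)
    also have "\<dots> = (\<Sum>z\<in>Z. \<bar>F z x\<bar>) * (\<Sum>z\<in>Z. \<bar>F z x\<bar> * (w z)\<^sup>2)"
      by (simp add: power_mult_distrib)
    also have "\<dots> \<le> r * (\<Sum>z\<in>Z. \<bar>F z x\<bar> * (w z)\<^sup>2)"
      using col[OF x] by (intro mult_right_mono sum_nonneg) auto
    finally show "(\<Sum>z\<in>Z. F z x * w z)\<^sup>2 \<le> r * (\<Sum>z\<in>Z. \<bar>F z x\<bar> * (w z)\<^sup>2)" .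
  qed
  also have "\<dots> = r * (\<Sum>z\<in>Z. (\<Sum>x\<in>X. \<bar>F z x\<bar>) * (w z)\<^sup>2)"
    unfolding sum_distrib_left[symmetric] sum_distrib_right by (subst sum.swap) (rule refl)
  also have "\<dots> \<le> r * (\<Sum>z\<in>Z. r * (w z)\<^sup>2)"
    using row r0 by (intro mult_left_mono sum_mono mult_right_mono) auto
  finally show ?thesis by (simp add: sum_distrib_left[symmetric] power2_eq_square mult.assoc)
qed

lemma bij_reflect:
  fixes y :: "int^'d::finite"
  assumes "n \<ge> 1"
  shows "bij_betw (\<lambda>x. tmod n (y - x)) (box n) (box n)"
proof (rule bij_betwI[where g="\<lambda>x. tmod n (y - x)"])
  have t: "tmod n (y - tmod n z) = tmod n (y - z)" for z :: "int^'d"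
    unfolding tmod_def by (simp add: vec_eq_iff mod_diff_right_eq)
  show "(\<lambda>x. tmod n (y - x)) \<in> box n \<rightarrow> box n" "(\<lambda>x. tmod n (y - x)) \<in> box n \<rightarrow> box n"
    using tmod_in_box[OF assms] by auto
  show "tmod n (y - tmod n (y - x)) = x" if "x \<in> box n" for x using that by (simp add: t)
  show "tmod n (y - tmod n (y - x)) = x" if "x \<in> box n" for x using that by (simp add: t)
qed

lemma sum_conv:
  fixes h :: "int^'d::finite \<Rightarrow> real"
  assumes "n \<ge> 1" and h: "\<And>y. h (tmod n y) = h y"
  shows "(\<Sum>y\<in>box n. k (tmod n (y - x)) * h y) = (\<Sum>z\<in>box n. k z * h (x + z))"
proof -
  have "(\<Sum>z\<in>box n. k z * h (x + z)) = (\<Sum>y\<in>box n. k (tmod n (y + - x)) * h (x + tmod n (y + - x)))"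
    by (rule sum.reindex_bij_betw[OF bij_shift[OF assms(1)], symmetric])
  also have "\<dots> = (\<Sum>y\<in>box n. k (tmod n (y - x)) * h y)"
  proof (intro sum.cong refl)
    fix y :: "int^'d"
    have "h (x + tmod n (y + - x)) = h (tmod n (x + (y + - x)))" by (metis h tmod_add_right)
    then show "k (tmod n (y + - x)) * h (x + tmod n (y + - x)) = k (tmod n (y - x)) * h y" by (simp add: h)
  qed
  finally show ?thesis ..
qed

lemma sum_abel:
  "(\<Sum>k<m. (real m - (real k + 1)) * (\<psi> k - \<psi> (Suc k))) = real m * \<psi> 0 - (\<Sum>k<m. \<psi> k)"
proof (induction m)
  case (Suc m)
  have "(\<Sum>k<Suc m. (real (Suc m) - (real k + 1)) * (\<psi> k - \<psi> (Suc k)))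
    = (\<Sum>k<m. (real m - (real k + 1)) * (\<psi> k - \<psi> (Suc k)) + (\<psi> k - \<psi> (Suc k)))"
    by (simp add: algebra_simps)
  also have "\<dots> = real m * \<psi> 0 - (\<Sum>k<m. \<psi> k) + (\<psi> 0 - \<psi> m)"
    unfolding sum.distrib Suc.IH sum_lessThan_telescope' ..
  finally show ?case by (simp add: algebra_simps)
qed simp

definition line :: "(int^'d::finite) set \<Rightarrow> 'd \<Rightarrow> nat \<Rightarrow> (int^'d) set" where
  "line P i m = (\<lambda>(v,k). v + of_nat k *s axis i 1) ` (P \<times> {..<m})"

lemma line_sum:
  fixes P :: "(int^'d::finite) set"
  assumes c: "\<forall>v\<in>P. v $ i = c"
  shows "(\<Sum>z\<in>line P i m. g z) = (\<Sum>v\<in>P. \<Sum>k<m. g (v + of_nat k *s axis i 1))"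
    and "inj_on (\<lambda>(v,k). v + of_nat k *s axis i (1::int)) (P \<times> {..<m})"
proof -
  show inj: "inj_on (\<lambda>(v,k). v + of_nat k *s axis i (1::int)) (P \<times> {..<m})"
  proof (rule inj_onI, clarsimp)
    fix v v' k k' assume v: "v \<in> P" "v' \<in> P" and e: "v + of_nat k *s axis i (1::int) = v' + of_nat k' *s axis i 1"
    have "(v + of_nat k *s axis i (1::int)) $ i = (v' + of_nat k' *s axis i 1) $ i" using e by simp
    then have "k = k'" using c v by (simp add: axis_def)
    then show "v = v' \<and> k = k'" using e by simp
  qed
  show "(\<Sum>z\<in>line P i m. g z) = (\<Sum>v\<in>P. \<Sum>k<m. g (v + of_nat k *s axis i 1))"
    unfolding line_def sum.reindex[OF inj] by (simp add: sum.cartesian_product case_prod_unfold)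
qed

lemma line_card:
  assumes "finite P" "\<forall>v\<in>P. v $ i = c"
  shows "card (line P i m) = card P * m"
  unfolding line_def using card_image[OF line_sum(2)[OF assms(2)]] by (simp add: card_cartesian_product)

text \<open>The weights are a flow in direction \<open>i\<close> that transports the uniform law on
  \<open>P\<close> to the uniform law on \<open>line P i m\<close>: a fraction 1/m of the mass is
  left behind at each layer. At the top layer the weight is 0, so nothing leaves the set.\<close>

lemma line_flow:
  fixes \<phi> :: "int^'d::finite \<Rightarrow> real"
  assumes P: "finite P" "P \<noteq> {}" "\<forall>v\<in>P. v $ i = c" and m: "m \<ge> 1"
  shows "(\<Sum>z\<in>P. \<phi> z) / real (card P) = (\<Sum>z\<in>line P i m. \<phi> z) / real (card (line P i m))
     + (\<Sum>z\<in>line P i m. (1 - (real_of_int (z $ i - c) + 1) / real m) / real (card P) * (\<phi> z - \<phi> (z + axis i 1)))"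
proof -
  have c0: "real (card P) > 0" using P by (simp add: card_gt_0_iff)
  have m0: "real m > 0" using m by simp
  have shift: "v + of_nat k *s axis i (1::int) + axis i 1 = v + of_nat (Suc k) *s axis i 1" for v :: "int^'d" and k
    by (simp add: vec_eq_iff algebra_simps)
  have "(\<Sum>z\<in>line P i m. (1 - (real_of_int (z $ i - c) + 1) / real m) / real (card P) * (\<phi> z - \<phi> (z + axis i 1)))
    = (\<Sum>v\<in>P. \<Sum>k<m. (1 - (real k + 1) / real m) / real (card P) * (\<phi> (v + of_nat k *s axis i 1) - \<phi> (v + of_nat (Suc k) *s axis i 1)))"
    unfolding line_sum(1)[OF P(3)] shift
    by (intro sum.cong refl) (simp add: P(3) axis_def)
  also have "\<dots> = (\<Sum>v\<in>P. (real m * \<phi> v - (\<Sum>k<m. \<phi> (v + of_nat k *s axis i 1))) / (real m * real (card P)))"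
  proof (intro sum.cong refl)
    fix v
    have "(\<Sum>k<m. (1 - (real k + 1) / real m) / real (card P) * (\<phi> (v + of_nat k *s axis i 1) - \<phi> (v + of_nat (Suc k) *s axis i 1)))
      = (\<Sum>k<m. (real m - (real k + 1)) * (\<phi> (v + of_nat k *s axis i 1) - \<phi> (v + of_nat (Suc k) *s axis i 1))) / (real m * real (card P))"
      unfolding sum_divide_distrib using m0 c0 by (intro sum.cong refl) (simp add: field_simps)
    also have "\<dots> = (real m * \<phi> v - (\<Sum>k<m. \<phi> (v + of_nat k *s axis i 1))) / (real m * real (card P))"
      unfolding sum_abel[of m "\<lambda>k. \<phi> (v + of_nat k *s axis i 1)"] by simp
    finally show "(\<Sum>k<m. (1 - (real k + 1) / real m) / real (card P) * (\<phi> (v + of_nat k *s axis i 1) - \<phi> (v + of_nat (Suc k) *s axis i 1)))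
      = (real m * \<phi> v - (\<Sum>k<m. \<phi> (v + of_nat k *s axis i 1))) / (real m * real (card P))" .
  qed
  also have "\<dots> = (real m * (\<Sum>v\<in>P. \<phi> v) - (\<Sum>z\<in>line P i m. \<phi> z)) / (real m * real (card P))"
    unfolding line_sum(1)[OF P(3)] sum_divide_distrib[symmetric] sum_subtractf sum_distrib_left ..
  also have "\<dots> = (\<Sum>v\<in>P. \<phi> v) / real (card P) - (\<Sum>z\<in>line P i m. \<phi> z) / real (card (line P i m))"
    unfolding line_card[OF P(1,3)] using m0 c0 by (simp add: diff_divide_distrib mult.commute)
  finally show ?thesis by linarith
qed

text \<open>With \<open>1 / \<epsilon>\<close> as bound of the one-site variables: \<open>cq\<close>
  multiplies the Hilbert-Schmidt norm in the quadratic moment bound, \<open>cs\<close> enters its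
  smallness condition, and \<open>cb\<close> is the cost of the decoupling step for bilinear forms.
  None of them depends on n.\<close>

definition cq :: "real \<Rightarrow> nat \<Rightarrow> real" where "cq \<epsilon> k = 2 * ((1/\<epsilon>) ^ (2 * k) * (1 + 2 ^ (2 * k))) * real (k * k)"
definition cs :: "real \<Rightarrow> nat \<Rightarrow> real" where "cs \<epsilon> k = (1/\<epsilon>) ^ (2 * k) * 4 ^ (2 * k)"
definition cb :: "real \<Rightarrow> nat \<Rightarrow> nat \<Rightarrow> real" where "cb \<epsilon> k k' = (1/\<epsilon>) ^ (2 * k') * 4 ^ (k + k')"

section \<open>Expectations under a density, bounded by its entropy\<close>

context tor
begin

lemma c_pos: "0 \<le> cq \<epsilon> k" "0 < cs \<epsilon> k" "0 < cb \<epsilon> k k'"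
  unfolding cq_def cs_def cb_def using eps by auto

definition Ent :: "((int^'d \<Rightarrow> bool) \<Rightarrow> real) \<Rightarrow> real" where "Ent f = Em (\<lambda>\<xi>. f \<xi> * ln (f \<xi>))"

definition dens :: "((int^'d \<Rightarrow> bool) \<Rightarrow> real) \<Rightarrow> bool" where
  "dens f \<longleftrightarrow> (\<forall>\<xi>\<in>Omega n. f \<xi> \<ge> 0) \<and> Em f = 1"

lemma Em_cmult: "Em (\<lambda>\<xi>. c * g \<xi>) = c * Em g"
  unfolding Em_def by (simp add: sum_distrib_left mult_ac)

lemma Em_sum: "Em (\<lambda>\<xi>. \<Sum>a\<in>S. g a \<xi>) = (\<Sum>a\<in>S. Em (g a))"
  unfolding Em_def sum_distrib_left by (rule sum.swap)

lemma Em_add: "Em (\<lambda>\<xi>. g \<xi> + h \<xi>) = Em g + Em h"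
  unfolding Em_def by (simp add: sum.distrib distrib_left)

lemma Em_mono: "(\<And>\<xi>. \<xi> \<in> Omega n \<Longrightarrow> g \<xi> \<le> h \<xi>) \<Longrightarrow> Em g \<le> Em h"
  unfolding Em_def using less_imp_le[OF muU_pos] by (intro sum_mono mult_left_mono) auto

lemma Em_cong: "(\<And>\<xi>. \<xi> \<in> Omega n \<Longrightarrow> g \<xi> = h \<xi>) \<Longrightarrow> Em g = Em h"
  unfolding Em_def by (intro sum.cong) auto

lemma Ent_ineq:
  assumes "dens f" "s > 0" "Em (\<lambda>\<xi>. exp (s * g \<xi>)) \<le> exp c"
  shows "Em (\<lambda>\<xi>. f \<xi> * g \<xi>) \<le> Ent f / s + c / s"
proof -
  have "Em (\<lambda>\<xi>. exp (s * g \<xi>)) > 0"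
  proof -
    have "Omega n \<noteq> ({} :: (int^'d \<Rightarrow> bool) set)" unfolding Omega_def by auto
    then show ?thesis unfolding Em_def using finO muU_pos by (intro sum_pos) auto
  qed
  then have "ln (Em (\<lambda>\<xi>. exp (s * g \<xi>))) \<le> c" using assms(3) by (metis ln_exp ln_le_cancel_iff exp_gt_zero)
  moreover have "s * Em (\<lambda>\<xi>. f \<xi> * g \<xi>) \<le> Ent f + ln (Em (\<lambda>\<xi>. exp (s * g \<xi>)))"
    using entropy_ineq[of f "\<lambda>\<xi>. s * g \<xi>"] assms(1) unfolding dens_def Ent_def Em_cmult[symmetric] by (simp add: mult_ac)
  ultimately have "s * Em (\<lambda>\<xi>. f \<xi> * g \<xi>) \<le> Ent f + c" by linarith
  then show ?thesis using assms(2) by (simp add: field_simps)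
qed

lemma Ent_nonneg: "dens f \<Longrightarrow> 0 \<le> Ent f"
  using Ent_ineq[of f 1 "\<lambda>_. 0" 0] by (simp add: Em_const)

lemma dens_lin:
  assumes "dens f"
  shows "Em (\<lambda>\<xi>. f \<xi> * (\<Sum>x\<in>box n. c x * omU U \<xi> x)) \<le> Ent f + (1/\<epsilon>)\<^sup>2 * (\<Sum>x\<in>box n. (c x)\<^sup>2)"
  using Ent_ineq[OF assms, of 1 "\<lambda>\<xi>. \<Sum>x\<in>box n. c x * omU U \<xi> x", simplified, OF Em_exp_lin] by simp

text \<open>\<open>s\<close> is the free parameter of the entropy inequality: it multiplies the
  operator norm in the smallness condition and divides the entropy, while the Hilbert-Schmidt term
  is linear in it and comes out unchanged.\<close>

lemma dens_quad:
  assumes f: "dens f" and A: "finite A" "A \<noteq> {}" "inj_on (tmod n) A"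
    and op: "\<And>w. (\<Sum>x\<in>box n. (\<Sum>z\<in>box n. F z x * w z)\<^sup>2) \<le> \<nu> * (\<Sum>z\<in>box n. (w z)\<^sup>2)"
    and s: "s > 0" and small: "cs \<epsilon> (card A) * (s * \<nu>) \<le> 1/2"
  shows "Em (\<lambda>\<xi>. f \<xi> * (\<Sum>z\<in>box n. (\<Sum>x\<in>box n. F z x * za A \<xi> x)\<^sup>2))
     \<le> Ent f / s + cq \<epsilon> (card A) * (\<Sum>z\<in>box n. \<Sum>x\<in>box n. (F z x)\<^sup>2)"
proof -
  define G where "G z x = sqrt s * F z x" for z x
  have G1: "(\<Sum>z\<in>Z. G z x * w z)\<^sup>2 = s * (\<Sum>z\<in>Z. F z x * w z)\<^sup>2" for Z x w
    unfolding G_def mult.assoc sum_distrib_left[symmetric] power_mult_distrib using s by simp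
  have G2: "(\<Sum>x\<in>Z. G z x * w x)\<^sup>2 = s * (\<Sum>x\<in>Z. F z x * w x)\<^sup>2" for Z z w
    unfolding G_def mult.assoc sum_distrib_left[symmetric] power_mult_distrib using s by simp
  have G3: "(\<Sum>z\<in>box n. \<Sum>x\<in>box n. (G z x)\<^sup>2) = s * (\<Sum>z\<in>box n. \<Sum>x\<in>box n. (F z x)\<^sup>2)"
    unfolding G_def power_mult_distrib sum_distrib_left using s by simp
  have "Em (\<lambda>\<xi>. exp (\<Sum>z\<in>box n. (\<Sum>x\<in>box n. G z x * za A \<xi> x)\<^sup>2))
     \<le> exp (cq \<epsilon> (card A) * (\<Sum>z\<in>box n. \<Sum>x\<in>box n. (G z x)\<^sup>2))" unfolding cq_def
  proof (rule Em_exp_quad[OF A])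
    fix w show "(\<Sum>x\<in>box n. (\<Sum>z\<in>box n. G z x * w z)\<^sup>2) \<le> (s * \<nu>) * (\<Sum>z\<in>box n. (w z)\<^sup>2)"
      unfolding G1 sum_distrib_left[symmetric] using op[of w] s by simp
    show "(1/\<epsilon>) ^ (2 * card A) * 4 ^ (2 * card A) * (s * \<nu>) \<le> 1/2" using small unfolding cs_def .
  qed
  then have "Em (\<lambda>\<xi>. exp (s * (\<Sum>z\<in>box n. (\<Sum>x\<in>box n. F z x * za A \<xi> x)\<^sup>2)))
     \<le> exp (cq \<epsilon> (card A) * (s * (\<Sum>z\<in>box n. \<Sum>x\<in>box n. (F z x)\<^sup>2)))"
    unfolding G2 G3 sum_distrib_left[symmetric] .
  from Ent_ineq[OF f s this] show ?thesis using s by simp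
qed

lemma dens_bil:
  assumes f: "dens f" and A: "finite A" "A \<noteq> {}" "inj_on (tmod n) A" and B: "finite B" "B \<noteq> {}" "inj_on (tmod n) B"
    and disj: "\<And>x y a b. x \<in> box n \<Longrightarrow> y \<in> box n \<Longrightarrow> K y x \<noteq> 0 \<Longrightarrow> a \<in> A \<Longrightarrow> b \<in> B \<Longrightarrow> tmod n (y + b) \<noteq> tmod n (x + a)"
    and op: "\<And>w. (\<Sum>x\<in>box n. (\<Sum>z\<in>box n. K z x * w z)\<^sup>2) \<le> \<nu> * (\<Sum>z\<in>box n. (w z)\<^sup>2)"
    and nu: "0 \<le> \<nu>" "\<nu> \<le> \<nu>'"
  defines "L \<equiv> 1 + 2 * (cs \<epsilon> (card A) * cb \<epsilon> (card A) (card B) * \<nu>')"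
  shows "Em (\<lambda>\<xi>. f \<xi> * (\<Sum>y\<in>box n. \<Sum>x\<in>box n. K y x * (za B \<xi> y * za A \<xi> x)))
     \<le> Ent f * L + cq \<epsilon> (card A) * cb \<epsilon> (card A) (card B) * (\<Sum>z\<in>box n. \<Sum>x\<in>box n. (K z x)\<^sup>2)"
proof -
  define c where "c = cs \<epsilon> (card A) * cb \<epsilon> (card A) (card B)"
  have c0: "c > 0" unfolding c_def using c_pos by simp
  have "0 \<le> c * \<nu>'" using c0 nu by simp
  then have L1: "L \<ge> 1" unfolding L_def c_def[symmetric] by simp
  \<comment> \<open>This value meets the smallness condition for every \<nu> below the a priori
    bound \<open>\<nu>'\<close>, and its inverse is the announced coefficient of the
    entropy.\<close>
  define s where "s = 1 / L"
  have s: "0 < s" "s \<le> 1" unfolding s_def using L1 by auto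
  define HS where "HS = (\<Sum>z\<in>box n. \<Sum>x\<in>box n. (K z x)\<^sup>2)"
  have HS0: "HS \<ge> 0" unfolding HS_def by (intro sum_nonneg) auto
  define G where "G z x = s * K z x" for z x
  have "c * (s\<^sup>2 * \<nu>) \<le> c * (s * \<nu>')"
    using c0 nu s by (intro mult_left_mono mult_mono) (auto simp: power2_eq_square mult_left_le)
  also have "\<dots> = c * \<nu>' / (1 + 2 * (c * \<nu>'))" unfolding s_def L_def c_def[symmetric] by simp
  also have "\<dots> \<le> 1/2" using \<open>0 \<le> c * \<nu>'\<close> by (simp add: field_simps)
  finally have sm: "c * (s\<^sup>2 * \<nu>) \<le> 1/2" .
  have "Em (\<lambda>\<xi>. exp (\<Sum>y\<in>box n. \<Sum>x\<in>box n. G y x * (za B \<xi> y * za A \<xi> x)))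
     \<le> exp (cq \<epsilon> (card A) * cb \<epsilon> (card A) (card B) * (\<Sum>z\<in>box n. \<Sum>x\<in>box n. (G z x)\<^sup>2))" unfolding cq_def cb_def
  proof (rule Em_exp_bil[OF A B])
    fix w
    have "(\<Sum>x\<in>box n. (\<Sum>z\<in>box n. G z x * w z)\<^sup>2) = s\<^sup>2 * (\<Sum>x\<in>box n. (\<Sum>z\<in>box n. K z x * w z)\<^sup>2)"
      unfolding G_def mult.assoc sum_distrib_left[symmetric] power_mult_distrib ..
    then show "(\<Sum>x\<in>box n. (\<Sum>z\<in>box n. G z x * w z)\<^sup>2) \<le> (s\<^sup>2 * \<nu>) * (\<Sum>z\<in>box n. (w z)\<^sup>2)"
      using op[of w] s by (simp add: mult.assoc mult_left_mono)
    show "(1/\<epsilon>) ^ (2 * card A) * 4 ^ (2 * card A) * ((1/\<epsilon>) ^ (2 * card B) * 4 ^ (card A + card B) * (s\<^sup>2 * \<nu>)) \<le> 1/2"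
      using sm unfolding c_def cs_def cb_def by (simp add: mult_ac)
  qed (use disj G_def in auto)
  also have "\<dots> \<le> exp (cq \<epsilon> (card A) * cb \<epsilon> (card A) (card B) * (s * HS))"
  proof -
    have "(\<Sum>z\<in>box n. \<Sum>x\<in>box n. (G z x)\<^sup>2) = s\<^sup>2 * HS" unfolding G_def power_mult_distrib HS_def sum_distrib_left ..
    also have "\<dots> \<le> s * HS" using s HS0 by (intro mult_right_mono) (auto simp: power2_eq_square mult_left_le)
    finally show ?thesis using c_pos(1) c_pos(3)
      by (intro iffD2[OF exp_le_cancel_iff] mult_left_mono mult_nonneg_nonneg less_imp_le[OF c_pos(3)])
  qed
  finally have "Em (\<lambda>\<xi>. exp (s * (\<Sum>y\<in>box n. \<Sum>x\<in>box n. K y x * (za B \<xi> y * za A \<xi> x))))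
     \<le> exp (cq \<epsilon> (card A) * cb \<epsilon> (card A) (card B) * (s * HS))"
    unfolding G_def sum_distrib_left mult.assoc .
  from Ent_ineq[OF f s(1) this] show ?thesis unfolding HS_def using s(1) by (simp add: s_def)
qed

text \<open>The kernel is a convolution modulated by bounded factors. Row and column sums are at
  most \<open>\<alpha> * K * m\<close>, so the Schur test gives the operator norm; in the
  Hilbert-Schmidt norm each row contributes at most the square sum of \<open>k\<close>, up to these
  factors.\<close>

lemma kernel_op:
  fixes k :: "int^'d \<Rightarrow> real"
  assumes G: "\<And>x. x \<in> box n \<Longrightarrow> \<bar>G x\<bar> \<le> K" and k: "(\<Sum>z\<in>box n. \<bar>k z\<bar>) \<le> m"
    and a: "\<And>y. y \<in> box n \<Longrightarrow> \<bar>a y\<bar> \<le> \<alpha>" and K: "0 \<le> K" "0 \<le> \<alpha>"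
  shows "(\<Sum>x\<in>box n. (\<Sum>y\<in>box n. a y * (k (tmod n (y - x)) * G x) * w y)\<^sup>2) \<le> (\<alpha> * K * m)\<^sup>2 * (\<Sum>y\<in>box n. (w y)\<^sup>2)"
    and "(\<Sum>y\<in>box n. \<Sum>x\<in>box n. (a y * (k (tmod n (y - x)) * G x))\<^sup>2) \<le> (\<alpha> * K)\<^sup>2 * (real n ^ CARD('d) * (\<Sum>z\<in>box n. (k z)\<^sup>2))"
proof -
  have ab: "\<bar>a y * (k (tmod n (y - x)) * G x)\<bar> \<le> \<alpha> * K * \<bar>k (tmod n (y - x))\<bar>" if "x \<in> box n" "y \<in> box n" for x y
  proof -
    have "\<bar>a y\<bar> * (\<bar>k (tmod n (y - x))\<bar> * \<bar>G x\<bar>) \<le> \<alpha> * (\<bar>k (tmod n (y - x))\<bar> * K)"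
      using G[OF that(1)] a[OF that(2)] K by (intro mult_mono mult_left_mono) auto
    then show ?thesis by (simp add: abs_mult mult_ac)
  qed
  have s1: "(\<Sum>y\<in>box n. h (tmod n (y - x))) = (\<Sum>z\<in>box n. h z)" for h :: "int^'d \<Rightarrow> real" and x
    using sum_conv[OF n1, of "\<lambda>_. 1" h x] by simp
  have s2: "(\<Sum>x\<in>box n. h (tmod n (y - x))) = (\<Sum>z\<in>box n. h z)" for h :: "int^'d \<Rightarrow> real" and y
    by (rule sum.reindex_bij_betw[OF bij_reflect[OF n1]])
  show "(\<Sum>x\<in>box n. (\<Sum>y\<in>box n. a y * (k (tmod n (y - x)) * G x) * w y)\<^sup>2) \<le> (\<alpha> * K * m)\<^sup>2 * (\<Sum>y\<in>box n. (w y)\<^sup>2)"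
  proof (rule schur_test)
    fix x :: "int^'d" assume x: "x \<in> box n"
    have "(\<Sum>y\<in>box n. \<bar>a y * (k (tmod n (y - x)) * G x)\<bar>) \<le> (\<Sum>y\<in>box n. \<alpha> * K * \<bar>k (tmod n (y - x))\<bar>)"
      using ab[OF x] by (intro sum_mono) auto
    also have "\<dots> = \<alpha> * K * (\<Sum>z\<in>box n. \<bar>k z\<bar>)" unfolding sum_distrib_left[symmetric] s1[of "\<lambda>z. \<bar>k z\<bar>"] ..
    also have "\<dots> \<le> \<alpha> * K * m" using k K by (intro mult_left_mono) auto
    finally show "(\<Sum>y\<in>box n. \<bar>a y * (k (tmod n (y - x)) * G x)\<bar>) \<le> \<alpha> * K * m" .
  next
    fix y :: "int^'d" assume y: "y \<in> box n"
    have "(\<Sum>x\<in>box n. \<bar>a y * (k (tmod n (y - x)) * G x)\<bar>) \<le> (\<Sum>x\<in>box n. \<alpha> * K * \<bar>k (tmod n (y - x))\<bar>)"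
      using ab[OF _ y] by (intro sum_mono) auto
    also have "\<dots> = \<alpha> * K * (\<Sum>z\<in>box n. \<bar>k z\<bar>)" unfolding sum_distrib_left[symmetric] s2[of "\<lambda>z. \<bar>k z\<bar>"] ..
    also have "\<dots> \<le> \<alpha> * K * m" using k K by (intro mult_left_mono) auto
    finally show "(\<Sum>x\<in>box n. \<bar>a y * (k (tmod n (y - x)) * G x)\<bar>) \<le> \<alpha> * K * m" .
  qed simp_all
  have "(\<Sum>y\<in>box n. \<Sum>x\<in>box n. (a y * (k (tmod n (y - x)) * G x))\<^sup>2) \<le> (\<Sum>y\<in>box n. \<Sum>x\<in>box n. (\<alpha> * K)\<^sup>2 * (k (tmod n (y - x)))\<^sup>2)"
  proof (intro sum_mono)
    fix x y :: "int^'d" assume "y \<in> box n" "x \<in> box n"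
    then have "\<bar>a y * (k (tmod n (y - x)) * G x)\<bar> \<le> \<bar>\<alpha> * K * \<bar>k (tmod n (y - x))\<bar>\<bar>" using ab by (meson abs_ge_self order_trans)
    then show "(a y * (k (tmod n (y - x)) * G x))\<^sup>2 \<le> (\<alpha> * K)\<^sup>2 * (k (tmod n (y - x)))\<^sup>2"
      unfolding abs_le_square_iff by (simp add: power_mult_distrib)
  qed
  also have "\<dots> = (\<Sum>y\<in>(box n :: (int^'d) set). (\<alpha> * K)\<^sup>2 * (\<Sum>z\<in>box n. (k z)\<^sup>2))"
    unfolding sum_distrib_left[symmetric] s2[of "\<lambda>z. (k z)\<^sup>2"] ..
  also have "\<dots> = (\<alpha> * K)\<^sup>2 * (real n ^ CARD('d) * (\<Sum>z\<in>box n. (k z)\<^sup>2))"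
    by (simp add: card_box mult_ac)
  finally show "(\<Sum>y\<in>box n. \<Sum>x\<in>box n. (a y * (k (tmod n (y - x)) * G x))\<^sup>2) \<le> (\<alpha> * K)\<^sup>2 * (real n ^ CARD('d) * (\<Sum>z\<in>box n. (k z)\<^sup>2))" .
qed

end

section \<open>Replacement by block averages\<close>

text \<open>\<open>J\<close> lists the directions already lengthened; in the others the side is 1.
  The corner sits at the unit vector of direction \<open>j\<close>, which keeps the
  \<open>j\<close>-th coordinate positive and the block away from the negative orthant.\<close>

definition PP :: "'d::finite \<Rightarrow> ('d \<Rightarrow> nat) \<Rightarrow> 'd set \<Rightarrow> (int^'d) set" where
  "PP j mm J = {z. \<forall>i. axis j 1 $ i \<le> z $ i \<and> z $ i < axis j 1 $ i + (if i \<in> J then int (mm i) else 1)}"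

lemma PP_empty: "PP j mm {} = {axis j 1}"
proof -
  have "z = axis j 1" if "z \<in> PP j mm {}" for z :: "int^'a"
  proof (subst vec_eq_iff, rule allI)
    fix i
    have "axis j 1 $ i \<le> z $ i \<and> z $ i < axis j 1 $ i + 1" using that unfolding PP_def by auto
    then show "z $ i = axis j 1 $ i" by linarith
  qed
  then show ?thesis unfolding PP_def by auto
qed

lemma PP_line:
  assumes "i \<notin> J"
  shows "line (PP j mm J) i (mm i) = PP j mm (insert i J)"
proof (rule set_eqI, rule iffI)
  fix z :: "int^'a" assume "z \<in> line (PP j mm J) i (mm i)"
  then obtain v k where v: "v \<in> PP j mm J" "k < mm i" "z = v + of_nat k *s axis i 1"
    unfolding line_def by auto
  show "z \<in> PP j mm (insert i J)" unfolding PP_def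
  proof (intro CollectI allI)
    fix l
    have vl: "axis j 1 $ l \<le> v $ l \<and> v $ l < axis j 1 $ l + (if l \<in> J then int (mm l) else 1)"
      using v(1) unfolding PP_def by auto
    show "axis j 1 $ l \<le> z $ l \<and> z $ l < axis j 1 $ l + (if l \<in> insert i J then int (mm l) else 1)"
    proof (cases "l = i")
      case True
      then have "z $ l = v $ l + int k" unfolding v(3) by (simp add: axis_def)
      then show ?thesis using vl v(2) True assms by auto
    next
      case False
      then have "z $ l = v $ l" unfolding v(3) by (simp add: axis_def)
      then show ?thesis using vl False by auto
    qed
  qed
next
  fix z :: "int^'a" assume z: "z \<in> PP j mm (insert i J)"
  define k where "k = nat (z $ i - axis j 1 $ i)"
  define v where "v = z - of_nat k *s axis i 1"
  have zi: "axis j 1 $ l \<le> z $ l \<and> z $ l < axis j 1 $ l + (if l \<in> insert i J then int (mm l) else 1)" for l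
    using z unfolding PP_def by auto
  have k: "int k = z $ i - axis j 1 $ i" "k < mm i" using zi[of i] unfolding k_def by auto
  have "v \<in> PP j mm J" unfolding PP_def
  proof (intro CollectI allI)
    fix l
    show "axis j 1 $ l \<le> v $ l \<and> v $ l < axis j 1 $ l + (if l \<in> J then int (mm l) else 1)"
    proof (cases "l = i")
      case True
      then have "v $ l = axis j 1 $ l" unfolding v_def using k(1) by (simp add: axis_def)
      then show ?thesis using True assms by simp
    next
      case False
      then have "v $ l = z $ l" unfolding v_def by (simp add: axis_def)
      then show ?thesis using zi[of l] False by auto
    qed
  qed
  then show "z \<in> line (PP j mm J) i (mm i)" unfolding line_def using k(2)
    by (intro image_eqI[of _ _ "(v,k)"]) (auto simp: v_def)
qed

lemma PP_box:
  assumes "\<And>i. int (mm i) + 2 \<le> int n"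
  shows "PP j mm J \<subseteq> box n"
  unfolding PP_def box_def
proof (intro Collect_mono impI allI)
  fix z :: "int^'a" and i
  assume "\<forall>i. axis j 1 $ i \<le> z $ i \<and> z $ i < axis j 1 $ i + (if i \<in> J then int (mm i) else 1)"
  then have "axis j 1 $ i \<le> z $ i \<and> z $ i < axis j 1 $ i + (if i \<in> J then int (mm i) else 1)" by blast
  moreover have "axis j (1::int) $ i = 0 \<or> axis j (1::int) $ i = 1" by (simp add: axis_def)
  ultimately show "0 \<le> z $ i \<and> z $ i < int n" using assms[of i] by (auto split: if_splits)
qed

lemma PP_finite:
  assumes "\<And>i. int (mm i) + 2 \<le> int n"
  shows "finite (PP j mm J)"
  using finite_subset[OF PP_box[OF assms] finite_box] .

lemma PP_card:
  assumes "\<And>i. int (mm i) + 2 \<le> int n"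
  shows "card (PP j mm J) = (\<Prod>i\<in>J. mm i)"
proof -
  have "finite J" by simp
  then show ?thesis
  proof (induction J)
    case empty show ?case by (simp add: PP_empty)
  next
    case (insert i J)
    have "\<forall>v\<in>PP j mm J. v $ i = axis j 1 $ i"
    proof
      fix v assume "v \<in> PP j mm J"
      then have "axis j 1 $ i \<le> v $ i \<and> v $ i < axis j 1 $ i + (if i \<in> J then int (mm i) else 1)"
        unfolding PP_def by blast
      then show "v $ i = axis j 1 $ i" using insert(2) by simp
    qed
    then have "card (line (PP j mm J) i (mm i)) = card (PP j mm J) * mm i"
      by (rule line_card[OF PP_finite[OF assms]])
    then show ?case using PP_line[OF insert(2), of j mm] insert by (simp add: mult.commute)
  qed
qed

context tor
begin

definition dirS :: "((int^'d \<Rightarrow> bool) \<Rightarrow> real) \<Rightarrow> 'd \<Rightarrow> real" where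
  "dirS f i = (\<Sum>y\<in>box n. bdir f y (y + axis i 1))"

text \<open>Up to normalisation, the field of the theorem with the variable at \<open>x + b\<close>
  replaced by its average over \<open>x + P\<close>.\<close>

definition VP :: "(int^'d) set \<Rightarrow> (int^'d \<Rightarrow> real) \<Rightarrow> (int^'d) set \<Rightarrow> (int^'d \<Rightarrow> bool) \<Rightarrow> real" where
  "VP A G P \<xi> = (\<Sum>x\<in>box n. G x * za A \<xi> x * ((\<Sum>z\<in>P. omU U \<xi> (x + z)) / real (card P)))"

lemma za_swap:
  assumes "\<And>a. a \<in> A \<Longrightarrow> tmod n (x + a) \<noteq> tmod n y \<and> tmod n (x + a) \<noteq> tmod n y'"
  shows "za A (swap n \<xi> y y') x = za A \<xi> x"
  unfolding za_def by (intro prod.cong refl) (use assms in \<open>simp add: omU_def swap_def\<close>)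

text \<open>\<open>line_flow\<close> writes the difference of the two averages as a sum over bonds
  of \<open>h y\<close> times an increment of the occupation variables, and \<open>ibp\<close> with
  \<open>e1 = \<delta> * (real n)\<^sup>2\<close> applies because \<open>A\<close> avoids the flow
  lines. What is left is a sum of squares of \<open>h\<close>, whose operator norm is of order m^2
  and is divided by n^2, and a bilinear term carrying a density gradient of order 1/n; both have
  bounded norm since m <= n.\<close>

lemma lengthen_block:
  fixes m :: nat
  assumes f: "dens f" and A: "finite A" "A \<noteq> {}" "inj_on (tmod n) A"
    and G: "\<And>x. x \<in> box n \<Longrightarrow> \<bar>G x\<bar> \<le> K" and K: "K > 0"
    and P: "finite P" "P \<noteq> {}" "\<forall>v\<in>P. v $ i = c" and L: "line P i m \<subseteq> box n" and m: "1 \<le> m" "m \<le> n" and n2: "2 \<le> n"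
    and disj: "\<And>z a. z \<in> line P i m \<Longrightarrow> a \<in> A \<Longrightarrow> tmod n z \<noteq> tmod n a \<and> tmod n (z + axis i 1) \<noteq> tmod n a"
    and lip: "\<And>y. \<bar>U (y + axis i 1) - U y\<bar> \<le> cU / real n" and cU: "0 \<le> cU" and \<delta>: "\<delta> > 0"
  shows "Em (\<lambda>\<xi>. f \<xi> * VP A G P \<xi>) \<le> Em (\<lambda>\<xi>. f \<xi> * VP A G (line P i m) \<xi>) + \<delta> * (real n)\<^sup>2 * dirS f i
     + (cs \<epsilon> (card A) * K\<^sup>2 / (\<delta> * \<epsilon>^4) + (1 + 2 * (cs \<epsilon> (card A) * cb \<epsilon> (card A) 2 * (cU * K)\<^sup>2))) * Ent f
     + (cq \<epsilon> (card A) * K\<^sup>2 / (2 * \<delta> * \<epsilon>^4) + cq \<epsilon> (card A) * cb \<epsilon> (card A) 2 * (cU * K)\<^sup>2)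
        * (real n ^ CARD('d) / (real n)\<^sup>2 * (real m / real (card P)))"
proof -
  define e where "e = (axis i 1 :: int^'d)"
  define k where "k z = (if z \<in> line P i m then (1 - (real_of_int (z $ i - c) + 1) / real m) / real (card P) else 0)" for z
  define h where "h y \<xi> = (\<Sum>x\<in>box n. (k (tmod n (y - x)) * G x) * za A \<xi> x)" for y \<xi>
  define D where "D y = U (y + e) - U y" for y
  have N0: "real n > 0" using n1 by simp
  have c0: "real (card P) > 0" using P by (simp add: card_gt_0_iff)
  have m0: "real m > 0" using m by simp
  have cL: "card (line P i m) = card P * m" by (rule line_card[OF P(1,3)])
  have k01: "0 \<le> k z" "k z \<le> 1 / real (card P)" for z
  proof -
    have "0 \<le> k z \<and> k z \<le> 1 / real (card P)"
    proof (cases "z \<in> line P i m")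
      case True
      then obtain v r where v: "v \<in> P" "r < m" "z = v + of_nat r *s axis i 1" unfolding line_def by auto
      have zi: "z $ i - c = int r" unfolding v(3) using P(3) v(1) by (simp add: axis_def)
      have "0 \<le> 1 - (real_of_int (int r) + 1) / real m" "1 - (real_of_int (int r) + 1) / real m \<le> 1"
        using v(2) m0 by (simp_all add: field_simps)
      then show ?thesis unfolding k_def zi using True c0 by (simp add: divide_right_mono)
    qed (auto simp: k_def)
    then show "0 \<le> k z" "k z \<le> 1 / real (card P)" by auto
  qed
  have ksum: "(\<Sum>z\<in>box n. k z * g z) = (\<Sum>z\<in>line P i m. (1 - (real_of_int (z $ i - c) + 1) / real m) / real (card P) * g z)" for g
    by (rule sum.mono_neutral_cong_right) (use L in \<open>auto simp: k_def\<close>)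
  have kabs: "(\<Sum>z\<in>box n. \<bar>k z\<bar>) \<le> real m"
  proof -
    have "(\<Sum>z\<in>box n. \<bar>k z\<bar>) = (\<Sum>z\<in>line P i m. \<bar>k z\<bar>)"
      by (rule sum.mono_neutral_right) (use L in \<open>auto simp: k_def\<close>)
    also have "\<dots> \<le> (\<Sum>z\<in>line P i m. 1 / real (card P))" using k01 by (intro sum_mono) auto
    also have "\<dots> = real m" unfolding sum_constant cL using c0 by simp
    finally show ?thesis .
  qed
  have ksq: "(\<Sum>z\<in>box n. (k z)\<^sup>2) \<le> real m / real (card P)"
  proof -
    have "(\<Sum>z\<in>box n. (k z)\<^sup>2) \<le> (\<Sum>z\<in>box n. \<bar>k z\<bar> * (1 / real (card P)))"
      unfolding power2_eq_square using k01 by (intro sum_mono mult_mono) auto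
    also have "\<dots> = (\<Sum>z\<in>box n. \<bar>k z\<bar>) / real (card P)" by (simp add: sum_divide_distrib)
    finally show ?thesis using kabs c0 by (meson divide_right_mono less_imp_le order_trans)
  qed
  have omper: "omU U \<xi> (tmod n y) = omU U \<xi> y" if "\<xi> \<in> Omega n" for \<xi> y using omU_per[OF that] .
  have eq: "VP A G P \<xi> = VP A G (line P i m) \<xi> + (\<Sum>y\<in>box n. h y \<xi> * (omU U \<xi> y - omU U \<xi> (y + e)))"
    if O: "\<xi> \<in> Omega n" for \<xi>
  proof -
    have "VP A G P \<xi> - VP A G (line P i m) \<xi> = (\<Sum>x\<in>box n. G x * za A \<xi> x * (\<Sum>z\<in>box n. k z * (omU U \<xi> (x + z) - omU U \<xi> (x + z + e))))"
      unfolding VP_def sum_subtractf[symmetric]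
    proof (intro sum.cong refl)
      fix x
      show "G x * za A \<xi> x * ((\<Sum>z\<in>P. omU U \<xi> (x + z)) / real (card P)) - G x * za A \<xi> x * ((\<Sum>z\<in>line P i m. omU U \<xi> (x + z)) / real (card (line P i m)))
        = G x * za A \<xi> x * (\<Sum>z\<in>box n. k z * (omU U \<xi> (x + z) - omU U \<xi> (x + z + e)))"
        unfolding ksum using line_flow[OF P m(1), of "\<lambda>z. omU U \<xi> (x + z)"]
        by (simp add: e_def add.assoc algebra_simps)
    qed
    also have "\<dots> = (\<Sum>x\<in>box n. G x * za A \<xi> x * (\<Sum>y\<in>box n. k (tmod n (y - x)) * (omU U \<xi> y - omU U \<xi> (y + e))))"
    proof (rule sum.cong[OF refl], rule arg_cong2[where f="(*)", OF refl])
      fix x :: "int^'d"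
      show "(\<Sum>z\<in>box n. k z * (omU U \<xi> (x + z) - omU U \<xi> (x + z + e))) = (\<Sum>y\<in>box n. k (tmod n (y - x)) * (omU U \<xi> y - omU U \<xi> (y + e)))"
      proof (rule sum_conv[OF n1, where h="\<lambda>y. omU U \<xi> y - omU U \<xi> (y + e)", symmetric])
        fix y
        have "omU U \<xi> (tmod n y + e) = omU U \<xi> (y + e)" by (metis omper[OF O] tmod_add_left)
        then show "omU U \<xi> (tmod n y) - omU U \<xi> (tmod n y + e) = omU U \<xi> y - omU U \<xi> (y + e)" using omper[OF O] by simp
      qed
    qed
    also have "\<dots> = (\<Sum>x\<in>box n. \<Sum>y\<in>box n. (k (tmod n (y - x)) * G x) * za A \<xi> x * (omU U \<xi> y - omU U \<xi> (y + e)))"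
      unfolding sum_distrib_left by (intro sum.cong refl) simp
    also have "\<dots> = (\<Sum>y\<in>box n. \<Sum>x\<in>box n. (k (tmod n (y - x)) * G x) * za A \<xi> x * (omU U \<xi> y - omU U \<xi> (y + e)))"
      by (rule sum.swap)
    also have "\<dots> = (\<Sum>y\<in>box n. h y \<xi> * (omU U \<xi> y - omU U \<xi> (y + e)))"
      unfolding h_def sum_distrib_right ..
    finally show ?thesis by simp
  qed
  \<comment> \<open>The coefficient of a bond does not see the exchange along it: where the flow
    weight is nonzero, \<open>disj\<close> keeps the translate of \<open>A\<close> off both
    ends.\<close>
  have hsw: "h y (swap n \<xi> y (y + e)) = h y \<xi>" for y \<xi>
    unfolding h_def
  proof (intro sum.cong refl)
    fix x :: "int^'d" assume "x \<in> box n"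
    show "(k (tmod n (y - x)) * G x) * za A (swap n \<xi> y (y + e)) x = (k (tmod n (y - x)) * G x) * za A \<xi> x"
    proof (cases "tmod n (y - x) \<in> line P i m")
      case True
      have "za A (swap n \<xi> y (y + e)) x = za A \<xi> x"
      proof (rule za_swap)
        fix a assume a: "a \<in> A"
        have "tmod n (y - x) \<noteq> tmod n a" "tmod n (y - x + e) \<noteq> tmod n a"
          using disj[OF True a] unfolding e_def by (simp_all add: tmod_add_left)
        then show "tmod n (x + a) \<noteq> tmod n y \<and> tmod n (x + a) \<noteq> tmod n (y + e)"
          by (auto simp: tmod_eq_iff algebra_simps dvd_diff_commute)
      qed
      then show ?thesis by simp
    qed (simp add: k_def)
  qed
  have f0: "f \<xi> \<ge> 0" if "\<xi> \<in> Omega n" for \<xi> using f that unfolding dens_def by auto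
  define e1 where "e1 = \<delta> * (real n)\<^sup>2"
  have e1: "e1 > 0" unfolding e1_def using \<delta> N0 by simp
  have h1: "Em (\<lambda>\<xi>. f \<xi> * VP A G P \<xi>) = Em (\<lambda>\<xi>. f \<xi> * VP A G (line P i m) \<xi>) + (\<Sum>y\<in>box n. Em (\<lambda>\<xi>. f \<xi> * (h y \<xi> * (omU U \<xi> y - omU U \<xi> (y + e)))))"
    unfolding Em_sum[symmetric] Em_add[symmetric] by (rule Em_cong) (simp add: eq distrib_left sum_distrib_left)
  have h2: "(\<Sum>y\<in>box n. Em (\<lambda>\<xi>. f \<xi> * (h y \<xi> * (omU U \<xi> y - omU U \<xi> (y + e)))))
     \<le> (\<Sum>y\<in>box n. e1 * bdir f y (y + e) + Em (\<lambda>\<xi>. f \<xi> * (h y \<xi>)\<^sup>2) / (2 * e1 * \<epsilon>^4)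
       + Em (\<lambda>\<xi>. f \<xi> * (D y * (h y \<xi> * (omU U \<xi> y * omU U \<xi> (y + e))))))"
    unfolding D_def by (intro sum_mono ibp f0 e1 hsw)
  also have "\<dots> = e1 * dirS f i + Em (\<lambda>\<xi>. f \<xi> * (\<Sum>y\<in>box n. (h y \<xi>)\<^sup>2)) / (2 * e1 * \<epsilon>^4)
     + Em (\<lambda>\<xi>. f \<xi> * (\<Sum>y\<in>box n. D y * (h y \<xi> * (omU U \<xi> y * omU U \<xi> (y + e)))))"
    unfolding dirS_def e_def sum.distrib sum_distrib_left sum_divide_distrib Em_sum ..
  finally have h2': "(\<Sum>y\<in>box n. Em (\<lambda>\<xi>. f \<xi> * (h y \<xi> * (omU U \<xi> y - omU U \<xi> (y + e)))))
    \<le> e1 * dirS f i + Em (\<lambda>\<xi>. f \<xi> * (\<Sum>y\<in>box n. (h y \<xi>)\<^sup>2)) / (2 * e1 * \<epsilon>^4)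
     + Em (\<lambda>\<xi>. f \<xi> * (\<Sum>y\<in>box n. D y * (h y \<xi> * (omU U \<xi> y * omU U \<xi> (y + e)))))" .
  let ?k = "card A"
  define R where "R = real n ^ CARD('d) * (real m / real (card P))"
  have R0: "R \<ge> 0" unfolding R_def by simp
  have ent: "0 \<le> Ent f" by (rule Ent_nonneg[OF f])
  have h3: "Em (\<lambda>\<xi>. f \<xi> * (\<Sum>y\<in>box n. (h y \<xi>)\<^sup>2)) \<le> Ent f * (2 * cs \<epsilon> ?k * (K * real m)\<^sup>2) + cq \<epsilon> ?k * (K\<^sup>2 * R)"
  proof -
    \<comment> \<open>The largest value allowed by the smallness condition. The resulting factor (K
      m)^2 in front of the entropy becomes harmless after division by \<open>e1\<close>, where m <=
      n is used.\<close>
    define s where "s = 1 / (2 * cs \<epsilon> ?k * (K * real m)\<^sup>2)"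
    have s0: "s > 0" unfolding s_def using c_pos(2)[of ?k] K m0 by simp
    have "Em (\<lambda>\<xi>. f \<xi> * (\<Sum>y\<in>box n. (h y \<xi>)\<^sup>2)) \<le> Ent f / s + cq \<epsilon> ?k * (\<Sum>y\<in>box n. \<Sum>x\<in>box n. (k (tmod n (y - x)) * G x)\<^sup>2)"
      unfolding h_def
    proof (rule dens_quad[OF f A _ s0])
      show "(\<Sum>x\<in>box n. (\<Sum>z\<in>box n. k (tmod n (z - x)) * G x * w z)\<^sup>2) \<le> (K * real m)\<^sup>2 * (\<Sum>z\<in>box n. (w z)\<^sup>2)" for w
        using kernel_op(1)[of G K k "real m" "\<lambda>_. 1" 1 w, OF G kabs] K by simp
      show "cs \<epsilon> ?k * (s * (K * real m)\<^sup>2) \<le> 1/2" unfolding s_def using c_pos(2)[of ?k] K m0 by simp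
    qed
    also have "(\<Sum>y\<in>box n. \<Sum>x\<in>box n. (k (tmod n (y - x)) * G x)\<^sup>2) \<le> K\<^sup>2 * R"
    proof -
      have "(\<Sum>y\<in>box n. \<Sum>x\<in>box n. (k (tmod n (y - x)) * G x)\<^sup>2) \<le> K\<^sup>2 * (real n ^ CARD('d) * (\<Sum>z\<in>box n. (k z)\<^sup>2))"
        using kernel_op(2)[of G K k "real m" "\<lambda>_. 1" 1, OF G kabs] K by simp
      also have "\<dots> \<le> K\<^sup>2 * R" unfolding R_def using ksq by (intro mult_left_mono) auto
      finally show ?thesis .
    qed
    finally show ?thesis using c_pos(1)[of ?k] unfolding s_def by (simp add: mult_left_mono)
  qed
  have h3': "Em (\<lambda>\<xi>. f \<xi> * (\<Sum>y\<in>box n. (h y \<xi>)\<^sup>2)) / (2 * e1 * \<epsilon>^4) \<le> cs \<epsilon> ?k * K\<^sup>2 / (\<delta> * \<epsilon>^4) * Ent f + cq \<epsilon> ?k * K\<^sup>2 / (2 * \<delta> * \<epsilon>^4) * (R / (real n)\<^sup>2)"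
  proof -
    have "Em (\<lambda>\<xi>. f \<xi> * (\<Sum>y\<in>box n. (h y \<xi>)\<^sup>2)) / (2 * e1 * \<epsilon>^4) \<le> (Ent f * (2 * cs \<epsilon> ?k * (K * real m)\<^sup>2) + cq \<epsilon> ?k * (K\<^sup>2 * R)) / (2 * e1 * \<epsilon>^4)"
      using h3 e1 eps by (intro divide_right_mono) auto
    also have "\<dots> = cs \<epsilon> ?k * K\<^sup>2 / (\<delta> * \<epsilon>^4) * Ent f * ((real m)\<^sup>2 / (real n)\<^sup>2) + cq \<epsilon> ?k * K\<^sup>2 / (2 * \<delta> * \<epsilon>^4) * (R / (real n)\<^sup>2)"
      unfolding e1_def power_mult_distrib using N0 \<delta> eps by (simp add: field_simps)
    also have "\<dots> \<le> cs \<epsilon> ?k * K\<^sup>2 / (\<delta> * \<epsilon>^4) * Ent f * 1 + cq \<epsilon> ?k * K\<^sup>2 / (2 * \<delta> * \<epsilon>^4) * (R / (real n)\<^sup>2)"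
      using m N0 c_pos(2)[of ?k] K \<delta> eps ent
      by (intro add_right_mono mult_left_mono) (auto simp: divide_le_eq_1 power_mono)
    finally show ?thesis by simp
  qed
  have h4: "Em (\<lambda>\<xi>. f \<xi> * (\<Sum>y\<in>box n. D y * (h y \<xi> * (omU U \<xi> y * omU U \<xi> (y + e)))))
    \<le> Ent f * (1 + 2 * (cs \<epsilon> ?k * cb \<epsilon> ?k 2 * (cU * K)\<^sup>2)) + cq \<epsilon> ?k * cb \<epsilon> ?k 2 * (cU * K)\<^sup>2 * (R / (real n)\<^sup>2)"
  proof -
    \<comment> \<open>The two-point cell of the bond; \<open>n2\<close> keeps its two ends distinct
      on the torus.\<close>
    define B where "B = {0, e}"
    have e0: "0 \<noteq> e" unfolding e_def by (simp add: axis_eq_0_iff)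
    have cB: "card B = 2" unfolding B_def using e0 by simp
    have te: "tmod n 0 \<noteq> tmod n e"
    proof -
      have "tmod n 0 $ i \<noteq> tmod n e $ i" unfolding tmod_def e_def using n2 by (simp add: axis_def)
      then show ?thesis by auto
    qed
    have B: "finite B" "B \<noteq> {}" "inj_on (tmod n) B" unfolding B_def using te by auto
    have zB: "za B \<xi> y = omU U \<xi> y * omU U \<xi> (y + e)" for \<xi> y unfolding za_def B_def using e0 by simp
    have lipD: "\<bar>D y\<bar> \<le> cU / real n" for y unfolding D_def e_def by (rule lip)
    have "Em (\<lambda>\<xi>. f \<xi> * (\<Sum>y\<in>box n. D y * (h y \<xi> * (omU U \<xi> y * omU U \<xi> (y + e)))))
       = Em (\<lambda>\<xi>. f \<xi> * (\<Sum>y\<in>box n. \<Sum>x\<in>box n. (D y * (k (tmod n (y - x)) * G x)) * (za B \<xi> y * za A \<xi> x)))"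
      unfolding zB h_def sum_distrib_left sum_distrib_right by (simp add: mult_ac)
    also have "\<dots> \<le> Ent f * (1 + 2 * (cs \<epsilon> ?k * cb \<epsilon> ?k (card B) * (cU * K)\<^sup>2)) + cq \<epsilon> ?k * cb \<epsilon> ?k (card B) *
       (\<Sum>y\<in>box n. \<Sum>x\<in>box n. (D y * (k (tmod n (y - x)) * G x))\<^sup>2)"
    proof (rule dens_bil[OF f A B])
      fix x y a b :: "int^'d"
      assume "D y * (k (tmod n (y - x)) * G x) \<noteq> 0" and ab: "a \<in> A" "b \<in> B"
      then have z: "tmod n (y - x) \<in> line P i m" unfolding k_def by (auto split: if_splits)
      have "tmod n (y - x) \<noteq> tmod n a" "tmod n (y - x + e) \<noteq> tmod n a"
        using disj[OF z ab(1)] unfolding e_def by (simp_all add: tmod_add_left)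
      then show "tmod n (y + b) \<noteq> tmod n (x + a)"
        using ab(2) unfolding B_def by (auto simp: tmod_eq_iff algebra_simps)
    next
      show "(\<Sum>x\<in>box n. (\<Sum>z\<in>box n. D z * (k (tmod n (z - x)) * G x) * w z)\<^sup>2) \<le> (cU / real n * K * real m)\<^sup>2 * (\<Sum>z\<in>box n. (w z)\<^sup>2)" for w
        using kernel_op(1)[of G K k "real m" D "cU / real n" w, OF G kabs lipD] K cU by simp
      have "cU / real n * K * real m \<le> cU * K"
        using m N0 cU K by (simp add: field_simps) (simp add: mult_left_mono mult.assoc)
      then show "(cU / real n * K * real m)\<^sup>2 \<le> (cU * K)\<^sup>2"
        using cU K by (intro power_mono) auto
    qed simp
    also have "(\<Sum>y\<in>box n. \<Sum>x\<in>box n. (D y * (k (tmod n (y - x)) * G x))\<^sup>2) \<le> (cU * K)\<^sup>2 * (R / (real n)\<^sup>2)"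
    proof -
      have "(\<Sum>y\<in>box n. \<Sum>x\<in>box n. (D y * (k (tmod n (y - x)) * G x))\<^sup>2) \<le> (cU / real n * K)\<^sup>2 * (real n ^ CARD('d) * (\<Sum>z\<in>box n. (k z)\<^sup>2))"
        using kernel_op(2)[of G K k "real m" D "cU / real n", OF G kabs lipD] K cU by simp
      also have "\<dots> \<le> (cU / real n * K)\<^sup>2 * R" unfolding R_def using ksq by (intro mult_left_mono) auto
      also have "\<dots> = (cU * K)\<^sup>2 * (R / (real n)\<^sup>2)" by (simp add: power_mult_distrib power_divide)
      finally show ?thesis .
    qed
    finally show ?thesis using c_pos(1)[of ?k] c_pos(3)[of ?k 2] unfolding cB by (simp add: mult_left_mono mult.assoc)
  qed
  have "Em (\<lambda>\<xi>. f \<xi> * VP A G P \<xi>) \<le> Em (\<lambda>\<xi>. f \<xi> * VP A G (line P i m) \<xi>) + e1 * dirS f i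
    + (cs \<epsilon> ?k * K\<^sup>2 / (\<delta> * \<epsilon>^4) * Ent f + cq \<epsilon> ?k * K\<^sup>2 / (2 * \<delta> * \<epsilon>^4) * (R / (real n)\<^sup>2))
    + (Ent f * (1 + 2 * (cs \<epsilon> ?k * cb \<epsilon> ?k 2 * (cU * K)\<^sup>2)) + cq \<epsilon> ?k * cb \<epsilon> ?k 2 * (cU * K)\<^sup>2 * (R / (real n)\<^sup>2))"
    using h1 h2' h3' h4 by linarith
  also have "R / (real n)\<^sup>2 = real n ^ CARD('d) / (real n)\<^sup>2 * (real m / real (card P))" unfolding R_def by simp
  finally show ?thesis unfolding e1_def distrib_right mult.commute[of "Ent f"] by linarith
qed

text \<open>The uniform kernel has total mass 1 and square sum \<open>1 / card P\<close>. The second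
  quantity alone governs the error term, so a large block is what makes the averaged field
  small.\<close>

lemma block_average_bound:
  assumes f: "dens f" and A: "finite A" "A \<noteq> {}" "inj_on (tmod n) A"
    and G: "\<And>x. x \<in> box n \<Longrightarrow> \<bar>G x\<bar> \<le> K" and K: "K > 0"
    and P: "P \<noteq> {}" "P \<subseteq> box n"
    and disj: "\<And>z a. z \<in> P \<Longrightarrow> a \<in> A \<Longrightarrow> tmod n z \<noteq> tmod n a"
  shows "Em (\<lambda>\<xi>. f \<xi> * VP A G P \<xi>) \<le> (1 + 2 * (cs \<epsilon> (card A) * cb \<epsilon> (card A) 1 * K\<^sup>2)) * Ent f
     + cq \<epsilon> (card A) * cb \<epsilon> (card A) 1 * K\<^sup>2 * (real n ^ CARD('d) / real (card P))"
proof -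
  define k where "k z = (if z \<in> P then 1 / real (card P) else 0)" for z
  have fP: "finite P" using P(2) finite_subset finite_box by blast
  have c0: "real (card P) > 0" using P(1) fP by (simp add: card_gt_0_iff)
  let ?k = "card A"
  have ksum: "(\<Sum>z\<in>box n. k z * g z) = (\<Sum>z\<in>P. 1 / real (card P) * g z)" for g
    by (rule sum.mono_neutral_cong_right) (use P in \<open>auto simp: k_def\<close>)
  have kabs: "(\<Sum>z\<in>box n. \<bar>k z\<bar>) \<le> 1"
  proof -
    have "(\<Sum>z\<in>box n. \<bar>k z\<bar>) = (\<Sum>z\<in>box n. k z * 1)" by (intro sum.cong) (auto simp: k_def)
    then show ?thesis unfolding ksum using c0 by simp
  qed
  have ksq: "(\<Sum>z\<in>box n. (k z)\<^sup>2) = 1 / real (card P)"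
    unfolding power2_eq_square ksum using c0 by (simp add: k_def)
  have eq: "VP A G P \<xi> = (\<Sum>y\<in>box n. \<Sum>x\<in>box n. (1 * (k (tmod n (y - x)) * G x)) * (za {0} \<xi> y * za A \<xi> x))"
    if O: "\<xi> \<in> Omega n" for \<xi>
  proof -
    have "VP A G P \<xi> = (\<Sum>x\<in>box n. G x * za A \<xi> x * (\<Sum>y\<in>box n. k (tmod n (y - x)) * omU U \<xi> y))"
      unfolding VP_def sum_conv[OF n1, where h="omU U \<xi>", OF omU_per[OF O]] ksum
      by (simp add: sum_divide_distrib)
    also have "\<dots> = (\<Sum>x\<in>box n. \<Sum>y\<in>box n. (1 * (k (tmod n (y - x)) * G x)) * (za {0} \<xi> y * za A \<xi> x))"
      unfolding sum_distrib_left za_def[of "{0}"] by (intro sum.cong refl) simp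
    also have "\<dots> = (\<Sum>y\<in>box n. \<Sum>x\<in>box n. (1 * (k (tmod n (y - x)) * G x)) * (za {0} \<xi> y * za A \<xi> x))"
      by (rule sum.swap)
    finally show ?thesis .
  qed
  have "Em (\<lambda>\<xi>. f \<xi> * VP A G P \<xi>) = Em (\<lambda>\<xi>. f \<xi> * (\<Sum>y\<in>box n. \<Sum>x\<in>box n. (1 * (k (tmod n (y - x)) * G x)) * (za {0} \<xi> y * za A \<xi> x)))"
    by (rule Em_cong) (simp only: eq)
  also have "\<dots> \<le> Ent f * (1 + 2 * (cs \<epsilon> ?k * cb \<epsilon> ?k (card {0::int^'d}) * K\<^sup>2)) + cq \<epsilon> ?k * cb \<epsilon> ?k (card {0::int^'d}) *
       (\<Sum>y\<in>box n. \<Sum>x\<in>box n. (1 * (k (tmod n (y - x)) * G x))\<^sup>2)"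
  proof (rule dens_bil[OF f A])
    fix x y a b :: "int^'d"
    assume "1 * (k (tmod n (y - x)) * G x) \<noteq> 0" and ab: "a \<in> A" "b \<in> {0}"
    then have z: "tmod n (y - x) \<in> P" unfolding k_def by (auto split: if_splits)
    have "tmod n (y - x) \<noteq> tmod n a" using disj[OF z ab(1)] by simp
    then show "tmod n (y + b) \<noteq> tmod n (x + a)"
      using ab(2) by (auto simp: tmod_eq_iff algebra_simps)
  next
    show "(\<Sum>x\<in>box n. (\<Sum>z\<in>box n. 1 * (k (tmod n (z - x)) * G x) * w z)\<^sup>2) \<le> K\<^sup>2 * (\<Sum>z\<in>box n. (w z)\<^sup>2)" for w
      using kernel_op(1)[of G K k 1 "\<lambda>_. 1" 1 w, OF G kabs] K by simp
  qed auto
  also have "(\<Sum>y\<in>box n. \<Sum>x\<in>box n. (1 * (k (tmod n (y - x)) * G x))\<^sup>2) \<le> K\<^sup>2 * (real n ^ CARD('d) / real (card P))"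
    using kernel_op(2)[of G K k 1 "\<lambda>_. 1" 1, OF G kabs] K ksq by simp
  finally show ?thesis using c_pos(1)[of ?k] c_pos(3)[of ?k 1] by (simp add: mult_left_mono mult.commute[of "Ent f"] mult.assoc)
qed

text \<open>Sums of the coefficients of the entropy (\<open>C1\<close>) and of the geometric error
  (\<open>C2\<close>) from the lengthening step and from the averaged block, so that one pair of
  constants serves for both.\<close>

definition C1 :: "real \<Rightarrow> real \<Rightarrow> real \<Rightarrow> nat \<Rightarrow> real" where
  "C1 \<delta> cU K k = cs \<epsilon> k * K\<^sup>2 / (\<delta> * \<epsilon>^4) + (1 + 2 * (cs \<epsilon> k * cb \<epsilon> k 2 * (cU * K)\<^sup>2))
     + (1 + 2 * (cs \<epsilon> k * cb \<epsilon> k 1 * K\<^sup>2))"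
definition C2 :: "real \<Rightarrow> real \<Rightarrow> real \<Rightarrow> nat \<Rightarrow> real" where
  "C2 \<delta> cU K k = cq \<epsilon> k * K\<^sup>2 / (2 * \<delta> * \<epsilon>^4) + cq \<epsilon> k * cb \<epsilon> k 2 * (cU * K)\<^sup>2
     + cq \<epsilon> k * cb \<epsilon> k 1 * K\<^sup>2"

text \<open>The block is lengthened one direction at a time, starting with j. Lengthening P by a factor m costs
  \<open>n\<^bsup>d-2\<^esup> m / card P\<close>, which is why the first side is chosen shorter than the others.\<close>
lemma main_estimate:
  fixes m M :: nat and j :: 'd
  assumes f: "dens f" and A: "finite A" "A \<noteq> {}" and \<alpha>: "\<And>a l. a \<in> A \<Longrightarrow> - int \<alpha> \<le> a $ l \<and> a $ l \<le> 0"
    and G: "\<And>x. x \<in> box n \<Longrightarrow> \<bar>G x\<bar> \<le> K" and K: "K > 0"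
    and m: "1 \<le> m" "m + \<alpha> + 3 \<le> n" "1 \<le> M" "M + \<alpha> + 3 \<le> n"
    and lip: "\<And>y i. \<bar>U (y + axis i 1) - U y\<bar> \<le> cU / real n" and cU: "0 \<le> cU" and \<delta>: "\<delta> > 0"
  shows "Em (\<lambda>\<xi>. f \<xi> * (\<Sum>x\<in>box n. G x * za A \<xi> x * omU U \<xi> (x + axis j 1)))
     \<le> \<delta> * (real n)\<^sup>2 * (\<Sum>i\<in>UNIV. dirS f i)
       + (real CARD('d) + 1) * (C1 \<delta> cU K (card A) * Ent f + C2 \<delta> cU K (card A) *
          (real n ^ CARD('d) / (real n)\<^sup>2 * (real m + real M / real m) + real n ^ CARD('d) / (real m * real M ^ (CARD('d) - 1))))"
proof -
  define mm where "mm i = (if i = j then m else M)" for i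
  define c1 where "c1 = C1 \<delta> cU K (card A)"
  define c2 where "c2 = C2 \<delta> cU K (card A)"
  let ?N = "real n ^ CARD('d) / (real n)\<^sup>2"
  let ?k = "card A"
  have Ent: "0 \<le> Ent f" by (rule Ent_nonneg[OF f])
  have p1: "0 \<le> cs \<epsilon> ?k * K\<^sup>2 / (\<delta> * \<epsilon>^4)" "0 \<le> cs \<epsilon> ?k * cb \<epsilon> ?k 2 * (cU * K)\<^sup>2" "0 \<le> cs \<epsilon> ?k * cb \<epsilon> ?k 1 * K\<^sup>2"
    "0 \<le> cq \<epsilon> ?k * K\<^sup>2 / (2 * \<delta> * \<epsilon>^4)" "0 \<le> cq \<epsilon> ?k * cb \<epsilon> ?k 2 * (cU * K)\<^sup>2" "0 \<le> cq \<epsilon> ?k * cb \<epsilon> ?k 1 * K\<^sup>2"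
    using c_pos(1)[of ?k] less_imp_le[OF c_pos(2)[of ?k]] less_imp_le[OF c_pos(3)[of ?k 2]] less_imp_le[OF c_pos(3)[of ?k 1]] \<delta> eps
    by (auto intro!: mult_nonneg_nonneg divide_nonneg_nonneg)
  have c10: "c1 \<ge> 0" unfolding c1_def C1_def using p1 by linarith
  have c20: "c2 \<ge> 0" unfolding c2_def C2_def using p1 by linarith
  have mmn: "int (mm i) + 2 \<le> int n" for i unfolding mm_def using m by auto
  have mm1: "1 \<le> mm i" "mm i \<le> n" "mm i + \<alpha> + 3 \<le> n" for i unfolding mm_def using m by auto
  have n2: "2 \<le> n" using m by simp
  have dv: "x = 0" if "int n dvd x" "\<bar>x\<bar> < int n" for x using dvd_imp_le_int[of x "int n"] that by fastforce
  have inj: "inj_on (tmod n) A"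
  proof (rule inj_onI)
    fix a a' assume a: "a \<in> A" "a' \<in> A" "tmod n a = tmod n a'"
    show "a = a'" unfolding vec_eq_iff
    proof
      fix l
      have "int n dvd a $ l - a' $ l" using a(3) unfolding tmod_eq_iff by blast
      moreover have "\<bar>a $ l - a' $ l\<bar> < int n" using \<alpha>[OF a(1), of l] \<alpha>[OF a(2), of l] m by auto
      ultimately have "a $ l - a' $ l = 0" by (rule dv)
      then show "a $ l = a' $ l" by simp
    qed
  qed
  \<comment> \<open>Direction \<open>j\<close> alone separates the block from \<open>A\<close>: its
    coordinate lies in [1, mm j] on the block, at most one more after a unit step, and in
    [-\<alpha>, 0] on \<open>A\<close>. The differences stay strictly between 0 and n, so wrapping
    around the torus produces no coincidence either.\<close>
  have disj: "tmod n z \<noteq> tmod n a \<and> tmod n (z + axis i 1) \<noteq> tmod n a" if z: "z \<in> PP j mm J" and a: "a \<in> A" for z a i J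
  proof -
    have "axis j 1 $ j \<le> z $ j \<and> z $ j < axis j 1 $ j + (if j \<in> J then int (mm j) else 1)" using z unfolding PP_def by blast
    then have zj: "1 \<le> z $ j" "z $ j \<le> int (mm j)" using mm1(1)[of j] by (auto split: if_splits)
    have aj: "- int \<alpha> \<le> a $ j" "a $ j \<le> 0" using \<alpha>[OF a] by auto
    have "\<not> int n dvd z $ j - a $ j" using dv[of "z $ j - a $ j"] zj aj mm1(3)[of j] by auto
    moreover have "\<not> int n dvd (z + axis i 1) $ j - a $ j"
    proof -
      have "axis i (1::int) $ j = 0 \<or> axis i (1::int) $ j = 1" by (simp add: axis_def)
      then show ?thesis using dv[of "(z + axis i 1) $ j - a $ j"] zj aj mm1(3)[of j] by auto
    qed
    ultimately show ?thesis unfolding tmod_eq_iff by blast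
  qed
  have cardP: "card (PP j mm J) = (\<Prod>i\<in>J. mm i)" for J by (rule PP_card[OF mmn])
  have finP: "finite (PP j mm J)" for J by (rule PP_finite[OF mmn])
  have neP: "PP j mm J \<noteq> {}" for J
  proof -
    have "(\<Prod>i\<in>J. mm i) > 0" using mm1(1) by (intro prod_pos) (auto simp: Suc_le_eq)
    then show ?thesis using cardP[of J] by (metis card.empty less_irrefl)
  qed
  let ?V = "\<lambda>J. Em (\<lambda>\<xi>. f \<xi> * VP A G (PP j mm J) \<xi>)"
  have one: "?V J \<le> ?V (insert i J) + \<delta> * (real n)\<^sup>2 * dirS f i + (c1 * Ent f + c2 * (?N * (real (mm i) / real (card (PP j mm J)))))"
    if i: "i \<notin> J" for i J
  proof -
    have lineq: "line (PP j mm J) i (mm i) = PP j mm (insert i J)" by (rule PP_line[OF i])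
    have Pc: "\<forall>v\<in>PP j mm J. v $ i = axis j 1 $ i"
    proof
      fix v assume "v \<in> PP j mm J"
      then have "axis j 1 $ i \<le> v $ i \<and> v $ i < axis j 1 $ i + (if i \<in> J then int (mm i) else 1)"
        unfolding PP_def by blast
      then show "v $ i = axis j 1 $ i" using i by simp
    qed
    have "?V J \<le> ?V (insert i J) + \<delta> * (real n)\<^sup>2 * dirS f i
      + (cs \<epsilon> ?k * K\<^sup>2 / (\<delta> * \<epsilon>^4) + (1 + 2 * (cs \<epsilon> ?k * cb \<epsilon> ?k 2 * (cU * K)\<^sup>2))) * Ent f
      + (cq \<epsilon> ?k * K\<^sup>2 / (2 * \<delta> * \<epsilon>^4) + cq \<epsilon> ?k * cb \<epsilon> ?k 2 * (cU * K)\<^sup>2) * (?N * (real (mm i) / real (card (PP j mm J))))"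
      unfolding lineq[symmetric]
    proof (rule lengthen_block[OF f A inj G K finP neP Pc _ mm1(1,2) n2 _ lip cU \<delta>])
      show "line (PP j mm J) i (mm i) \<subseteq> box n" unfolding lineq by (rule PP_box[OF mmn])
      show "tmod n z \<noteq> tmod n a \<and> tmod n (z + axis i 1) \<noteq> tmod n a" if "z \<in> line (PP j mm J) i (mm i)" "a \<in> A" for z a
        using disj[OF _ that(2)] that(1) unfolding lineq by blast
    qed
    also have "\<dots> \<le> ?V (insert i J) + \<delta> * (real n)\<^sup>2 * dirS f i + c1 * Ent f + c2 * (?N * (real (mm i) / real (card (PP j mm J))))"
    proof -
      have "cs \<epsilon> ?k * K\<^sup>2 / (\<delta> * \<epsilon>^4) + (1 + 2 * (cs \<epsilon> ?k * cb \<epsilon> ?k 2 * (cU * K)\<^sup>2)) \<le> c1"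
        unfolding c1_def C1_def using p1 by linarith
      then have a: "(cs \<epsilon> ?k * K\<^sup>2 / (\<delta> * \<epsilon>^4) + (1 + 2 * (cs \<epsilon> ?k * cb \<epsilon> ?k 2 * (cU * K)\<^sup>2))) * Ent f \<le> c1 * Ent f"
        using Ent by (rule mult_right_mono)
      have "cq \<epsilon> ?k * K\<^sup>2 / (2 * \<delta> * \<epsilon>^4) + cq \<epsilon> ?k * cb \<epsilon> ?k 2 * (cU * K)\<^sup>2 \<le> c2"
        unfolding c2_def C2_def using p1 by linarith
      then have "(cq \<epsilon> ?k * K\<^sup>2 / (2 * \<delta> * \<epsilon>^4) + cq \<epsilon> ?k * cb \<epsilon> ?k 2 * (cU * K)\<^sup>2) * (?N * (real (mm i) / real (card (PP j mm J))))
        \<le> c2 * (?N * (real (mm i) / real (card (PP j mm J))))" by (rule mult_right_mono) simp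
      then show ?thesis using a by linarith
    qed
    finally show ?thesis by simp
  qed
  have last: "?V J \<le> c1 * Ent f + c2 * (real n ^ CARD('d) / real (card (PP j mm J)))" for J
  proof -
    have "?V J \<le> (1 + 2 * (cs \<epsilon> ?k * cb \<epsilon> ?k 1 * K\<^sup>2)) * Ent f
     + cq \<epsilon> ?k * cb \<epsilon> ?k 1 * K\<^sup>2 * (real n ^ CARD('d) / real (card (PP j mm J)))"
    proof (rule block_average_bound[OF f A inj _ K neP PP_box[OF mmn]])
      show "\<bar>G x\<bar> \<le> K" if "x \<in> box n" for x by (rule G[OF that])
      show "tmod n z \<noteq> tmod n a" if "z \<in> PP j mm J" "a \<in> A" for z a using disj[OF that] by blast
    qed
    also have "\<dots> \<le> c1 * Ent f + c2 * (real n ^ CARD('d) / real (card (PP j mm J)))"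
    proof (intro add_mono mult_right_mono Ent)
      show "1 + 2 * (cs \<epsilon> ?k * cb \<epsilon> ?k 1 * K\<^sup>2) \<le> c1" unfolding c1_def C1_def using p1 by linarith
      show "cq \<epsilon> ?k * cb \<epsilon> ?k 1 * K\<^sup>2 \<le> c2" unfolding c2_def C2_def using p1 by linarith
    qed simp
    finally show ?thesis .
  qed
  have dir0: "dirS f i \<ge> 0" for i unfolding dirS_def bdir_def using less_imp_le[OF muU_pos] by (intro sum_nonneg mult_nonneg_nonneg) auto
  \<comment> \<open>Once direction \<open>j\<close> is done the block has at least \<open>m\<close>
    sites, so each further direction costs at most \<open>M / m\<close> instead of
    \<open>M\<close>.\<close>
  have chain: "?V {j} \<le> ?V (insert j J) + \<delta> * (real n)\<^sup>2 * (\<Sum>i\<in>J. dirS f i) + real (card J) * (c1 * Ent f + c2 * (?N * (real M / real m)))"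
    if "finite J" "j \<notin> J" for J
    using that
  proof (induction J)
    case empty then show ?case by simp
  next
    case (insert i J)
    have ne: "i \<notin> insert j J" using insert by auto
    have "?V (insert j J) \<le> ?V (insert i (insert j J)) + \<delta> * (real n)\<^sup>2 * dirS f i + (c1 * Ent f + c2 * (?N * (real (mm i) / real (card (PP j mm (insert j J))))))"
      by (rule one[OF ne])
    also have "\<dots> \<le> ?V (insert i (insert j J)) + \<delta> * (real n)\<^sup>2 * dirS f i + (c1 * Ent f + c2 * (?N * (real M / real m)))"
    proof -
      have "card (PP j mm (insert j J)) = m * (\<Prod>i\<in>J. mm i)" unfolding cardP using insert by (simp add: mm_def)
      moreover have "(\<Prod>i\<in>J. mm i) \<ge> 1" using mm1(1) by (intro prod_ge_1) auto
      ultimately have "m \<le> card (PP j mm (insert j J))" by simp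
      then have "real m \<le> real (card (PP j mm (insert j J)))" by (rule of_nat_mono)
      moreover have "mm i = M" unfolding mm_def using insert by auto
      ultimately have "real (mm i) / real (card (PP j mm (insert j J))) \<le> real M / real m"
        using m by (auto intro!: divide_left_mono mult_pos_pos)
      then show ?thesis using c20 by (intro add_left_mono mult_left_mono) auto
    qed
    finally have new: "?V (insert j J) \<le> ?V (insert i (insert j J)) + \<delta> * (real n)\<^sup>2 * dirS f i + (c1 * Ent f + c2 * (?N * (real M / real m)))" .
    have IH: "?V {j} \<le> ?V (insert j J) + \<delta> * (real n)\<^sup>2 * (\<Sum>i\<in>J. dirS f i) + real (card J) * (c1 * Ent f + c2 * (?N * (real M / real m)))"
      using insert by simp
    have "real (card (insert i J)) = real (card J) + 1" "(\<Sum>i\<in>insert i J. dirS f i) = dirS f i + (\<Sum>i\<in>J. dirS f i)"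
      using insert by auto
    then show ?case using IH new
      unfolding insert_commute[of j i J] distrib_left[of "\<delta> * (real n)\<^sup>2"] distrib_right[of "real (card J)"]
      by (simp only: distrib_left[of "\<delta> * (real n)\<^sup>2"] distrib_right[of "real (card J)"] mult_1_left)
  qed
  \<comment> \<open>The start is a single site, so the first direction pays for its full length
    \<open>m\<close>.\<close>
  have s1: "?V {} \<le> ?V {j} + \<delta> * (real n)\<^sup>2 * dirS f j + (c1 * Ent f + c2 * (?N * real m))"
    using one[of j "{}"] by (simp add: PP_empty mm_def)
  have s2: "?V {j} \<le> ?V UNIV + \<delta> * (real n)\<^sup>2 * (\<Sum>i\<in>UNIV - {j}. dirS f i) + real (CARD('d) - 1) * (c1 * Ent f + c2 * (?N * (real M / real m)))"
    using chain[of "UNIV - {j}"] by (simp add: insert_absorb card_Diff_singleton)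
  have s3: "?V UNIV \<le> c1 * Ent f + c2 * (real n ^ CARD('d) / (real m * real M ^ (CARD('d) - 1)))"
  proof -
    have "(\<Prod>i\<in>UNIV. mm i) = m * M ^ (CARD('d) - 1)"
    proof -
      have "(\<Prod>i\<in>UNIV. mm i) = mm j * (\<Prod>i\<in>UNIV - {j}. mm i)" by (rule prod.remove) auto
      also have "(\<Prod>i\<in>UNIV - {j}. mm i) = (\<Prod>i\<in>UNIV - {j}. M)" by (intro prod.cong) (auto simp: mm_def)
      finally show ?thesis by (simp add: mm_def card_Diff_singleton)
    qed
    then show ?thesis using last[of UNIV] unfolding cardP by simp
  qed
  have fin: "?V {} \<le> \<delta> * (real n)\<^sup>2 * (dirS f j + (\<Sum>i\<in>UNIV - {j}. dirS f i))
     + (c1 * Ent f + c2 * (real n ^ CARD('d) / (real m * real M ^ (CARD('d) - 1))))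
     + real (CARD('d) - 1) * (c1 * Ent f + c2 * (?N * (real M / real m)))
     + (c1 * Ent f + c2 * (?N * real m))" unfolding distrib_left[of "\<delta> * (real n)\<^sup>2"] using s1 s2 s3 by linarith
  have dsum: "dirS f j + (\<Sum>i\<in>UNIV - {j}. dirS f i) = (\<Sum>i\<in>UNIV. dirS f i)"
    by (rule sum.remove[symmetric]) auto
  let ?T = "c1 * Ent f + c2 * (?N * (real m + real M / real m) + real n ^ CARD('d) / (real m * real M ^ (CARD('d) - 1)))"
  have N0: "0 \<le> ?N * (real M / real m)" "0 \<le> ?N * real m" "0 \<le> real n ^ CARD('d) / (real m * real M ^ (CARD('d) - 1))" by auto
  have t1: "c1 * Ent f + c2 * (real n ^ CARD('d) / (real m * real M ^ (CARD('d) - 1))) \<le> ?T"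
    using N0 c20 by (intro add_left_mono mult_left_mono) (auto simp: distrib_left)
  have t2: "c1 * Ent f + c2 * (?N * (real M / real m)) \<le> ?T"
    using N0 c20 by (intro add_left_mono mult_left_mono) (auto simp: distrib_left)
  have t3: "c1 * Ent f + c2 * (?N * real m) \<le> ?T"
    using N0 c20 by (intro add_left_mono mult_left_mono) (auto simp: distrib_left)
  define TT where "TT = ?T"
  define X1 where "X1 = c1 * Ent f + c2 * (real n ^ CARD('d) / (real m * real M ^ (CARD('d) - 1)))"
  define X2 where "X2 = c1 * Ent f + c2 * (?N * (real M / real m))"
  define X3 where "X3 = c1 * Ent f + c2 * (?N * real m)"
  define r where "r = real (CARD('d) - 1)"
  have "r * X2 \<le> r * TT" using t2 unfolding X2_def TT_def r_def by (intro mult_left_mono) auto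
  moreover have "X1 \<le> TT" "X3 \<le> TT" using t1 t3 unfolding X1_def X3_def TT_def by auto
  moreover have "?V {} \<le> \<delta> * (real n)\<^sup>2 * (\<Sum>i\<in>UNIV. dirS f i) + X1 + r * X2 + X3"
    using fin unfolding dsum X1_def X2_def X3_def r_def .
  ultimately have "?V {} \<le> \<delta> * (real n)\<^sup>2 * (\<Sum>i\<in>UNIV. dirS f i) + (TT + r * TT + TT)" by linarith
  moreover have "r = real CARD('d) - 1" unfolding r_def by (simp add: of_nat_diff Suc_leI)
  ultimately have "?V {} \<le> \<delta> * (real n)\<^sup>2 * (\<Sum>i\<in>UNIV. dirS f i) + (real CARD('d) + 1) * TT" by (simp add: algebra_simps)
  then have "?V {} \<le> \<delta> * (real n)\<^sup>2 * (\<Sum>i\<in>UNIV. dirS f i) + (real CARD('d) + 1) * ?T" unfolding TT_def .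
  then show ?thesis unfolding c1_def c2_def PP_empty VP_def by simp
qed

end

section \<open>Maximum principle and consistency of the scheme\<close>

definition dd :: "'a::euclidean_space \<Rightarrow> ('a \<Rightarrow> real) \<Rightarrow> 'a \<Rightarrow> real" where
  "dd v g x = deriv (\<lambda>t. g (x + t *\<^sub>R v)) 0"

text \<open>\<open>smooth_fun\<close> offers derivatives at parameter 0 only; since they exist at
  every base point, moving the base point gives them at every parameter. The witness class
  \<open>S\<close> serves for the derivative as well.\<close>

lemma smooth_dd:
  assumes "smooth_fun g" "v \<in> Basis"
  shows "smooth_fun (dd v g)"
    and "((\<lambda>s. g (x + s *\<^sub>R v)) has_real_derivative dd v g (x + t *\<^sub>R v)) (at t)"
proof -
  obtain S where S: "g \<in> S" "\<And>h. h \<in> S \<Longrightarrow> continuous_on UNIV h \<and>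
     (\<forall>v\<in>Basis. \<exists>h'\<in>S. \<forall>x. ((\<lambda>t. h (x + t *\<^sub>R v)) has_real_derivative h' x) (at 0))"
    using assms(1) unfolding smooth_fun_def by blast
  obtain h' where h': "h' \<in> S" "\<And>x. ((\<lambda>t. g (x + t *\<^sub>R v)) has_real_derivative h' x) (at 0)"
    using S assms(2) by blast
  have "dd v g = h'" unfolding dd_def fun_eq_iff using DERIV_imp_deriv[OF h'(2)] by auto
  then show "smooth_fun (dd v g)" unfolding smooth_fun_def using S h'(1) by blast
  have "((\<lambda>s. g ((x + t *\<^sub>R v) + s *\<^sub>R v)) has_real_derivative h' (x + t *\<^sub>R v)) (at 0)" by (rule h'(2))
  then have "((\<lambda>s. g (x + (s + t) *\<^sub>R v)) has_real_derivative h' (x + t *\<^sub>R v)) (at 0)"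
    by (simp add: scaleR_add_left add_ac)
  then have "((\<lambda>s. g (x + s *\<^sub>R v)) has_real_derivative h' (x + t *\<^sub>R v)) (at (0 + t))"
    by (subst DERIV_shift)
  then show "((\<lambda>s. g (x + s *\<^sub>R v)) has_real_derivative dd v g (x + t *\<^sub>R v)) (at t)"
    using \<open>dd v g = h'\<close> by simp
qed

lemma smooth_cont: "smooth_fun g \<Longrightarrow> continuous_on UNIV g"
  unfolding smooth_fun_def by blast

lemma cont_bdd:
  fixes h :: "'a::topological_space \<Rightarrow> real"
  assumes "continuous_on UNIV h" "compact K"
  shows "\<exists>B>0. \<forall>x\<in>K. \<bar>h x\<bar> \<le> B"
proof -
  have "bounded (h ` K)" using compact_continuous_image[OF continuous_on_subset[OF assms(1)] assms(2)] compact_imp_bounded by blast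
  then obtain B where "B > 0" "\<forall>y\<in>h ` K. norm y \<le> B" unfolding bounded_pos by blast
  then show ?thesis by auto
qed

lemma per_int:
  fixes f :: "real^'d::finite \<Rightarrow> 'b"
  assumes per: "\<And>x i. f (x + axis i 1) = f x"
  shows "f (x + real_of_int k *\<^sub>R axis i 1) = f x"
proof -
  have up: "f (x + real k *\<^sub>R axis i 1) = f x" for x :: "real^'d" and k :: nat
  proof (induction k)
    case (Suc k)
    have "x + real (Suc k) *\<^sub>R axis i 1 = (x + real k *\<^sub>R axis i 1) + axis i 1" by (simp add: algebra_simps)
    then show ?case using Suc per by metis
  qed simp
  show ?thesis
  proof (cases "k \<ge> 0")
    case True
    then show ?thesis using up[of x "nat k"] by simp
  next
    case False
    define m where "m = nat (-k)"
    have "k = - int m" unfolding m_def using False by simp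
    then have k: "real_of_int k = - real m" by simp
    have e: "(x + real_of_int k *\<^sub>R axis i 1) + real m *\<^sub>R axis i 1 = x" unfolding k by (simp add: algebra_simps)
    show ?thesis using up[of "x + real_of_int k *\<^sub>R axis i 1" m] unfolding e by (rule sym)
  qed
qed

lemma per_ivec:
  fixes f :: "real^'d::finite \<Rightarrow> 'b"
  assumes per: "\<And>x i. f (x + axis i 1) = f x"
  shows "f (x + ivec z) = f x"
proof -
  have "f (x + (\<Sum>i\<in>J. real_of_int (z $ i) *\<^sub>R axis i 1)) = f x" if "finite J" for J
    using that
  proof (induction J)
    case (insert i J)
    have "f (x + (\<Sum>i\<in>insert i J. real_of_int (z $ i) *\<^sub>R axis i 1))
      = f ((x + (\<Sum>i\<in>J. real_of_int (z $ i) *\<^sub>R axis i 1)) + real_of_int (z $ i) *\<^sub>R axis i 1)"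
      using insert by (simp add: add_ac)
    then show ?case using insert per_int[of f, OF per] by metis
  qed simp
  moreover have "ivec z = (\<Sum>i\<in>UNIV. real_of_int (z $ i) *\<^sub>R axis i 1)"
    unfolding vec_eq_iff ivec_def by (simp add: sum_component axis_def if_distrib sum.delta cong: if_cong)
  ultimately show ?thesis by simp
qed

lemma per_unit_cube:
  fixes x :: "real^'d::finite"
  shows "\<exists>y z. x = y + ivec z \<and> (\<forall>i. 0 \<le> y $ i \<and> y $ i \<le> 1)"
proof (intro exI conjI allI)
  show "x = (\<chi> i. frac (x $ i)) + ivec (\<chi> i. \<lfloor>x $ i\<rfloor>)" unfolding vec_eq_iff ivec_def by (simp add: frac_def)
  show "0 \<le> (\<chi> i. frac (x $ i)) $ i" "(\<chi> i. frac (x $ i)) $ i \<le> 1" for i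
    using frac_ge_0 frac_lt_1[of "x $ i"] by (auto intro: less_imp_le)
qed

lemma compact_cube: "compact {y :: real^'d::finite. \<forall>i. a \<le> y $ i \<and> y $ i \<le> b}"
proof -
  have "{y :: real^'d. \<forall>i. a \<le> y $ i \<and> y $ i \<le> b} = cbox (\<chi> i. a) (\<chi> i. b)"
    by (auto simp: mem_box_cart)
  then show ?thesis by (metis compact_cbox)
qed

lemma second_deriv_min:
  fixes f f' :: "real \<Rightarrow> real"
  assumes f: "\<And>t. (f has_real_derivative f' t) (at t)" and f'': "(f' has_real_derivative D) (at 0)"
    and mn: "\<And>t. f 0 \<le> f t"
  shows "f' 0 = 0" "D \<ge> 0"
proof -
  show z: "f' 0 = 0" using DERIV_local_min[OF f[of 0], of 1] mn by auto
  show "D \<ge> 0"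
  proof (rule ccontr)
    assume "\<not> D \<ge> 0"
    then obtain d where d: "d > 0" "\<And>h. 0 < h \<Longrightarrow> h < d \<Longrightarrow> f' (0 + h) < f' 0"
      using DERIV_neg_dec_right[OF f''] by force
    have "f (d/2) < f 0"
    proof (rule DERIV_neg_imp_decreasing_open[where a=0 and b="d/2" and f=f])
      show "0 < d/2" using d by simp
      show "\<exists>y. (f has_real_derivative y) (at x) \<and> y < 0" if "0 < x" "x < d/2" for x
        using f[of x] d(2)[of x] that z d(1) by auto
      show "continuous_on {0..d/2} f" using f by (meson DERIV_continuous_on has_field_derivative_at_within)
    qed
    then show False using mn[of "d/2"] by simp
  qed
qed

text \<open>Comparison with a spatially constant barrier decaying at rate C + 1, strictly faster
  than \<open>crit\<close> permits. At the first contact time, which exists by compactness modulo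
  periods, the contact point is a spatial minimum, so \<open>crit\<close> applies and forces
  \<open>g\<close> below the barrier slightly earlier.\<close>

lemma min_principle:
  fixes g :: "real \<times> (real^'d::finite) \<Rightarrow> real"
  assumes sm: "smooth_fun g" and per: "\<And>t x i. t \<in> {0..T} \<Longrightarrow> g (t, x + axis i 1) = g (t, x)"
    and init: "\<And>x. \<epsilon>0 \<le> g (0, x)" and e0: "\<epsilon>0 > 0" and C: "C \<ge> 0"
    and crit: "\<And>t x. t \<in> {0..T} \<Longrightarrow> \<forall>i. 0 \<le> x $ i \<and> x $ i \<le> 1 \<Longrightarrow> \<forall>i. dd (0, axis i 1) g (t, x) = 0 \<Longrightarrow>
        \<forall>i. dd (0, axis i 1) (dd (0, axis i 1) g) (t, x) \<ge> 0 \<Longrightarrow> 0 < g (t, x) \<Longrightarrow> g (t, x) \<le> 1 \<Longrightarrow>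
        - C * g (t, x) \<le> dd (1, 0) g (t, x)"
    and t: "t \<in> {0..T}"
  shows "min \<epsilon>0 1 / 2 * exp (- (C + 1) * T) \<le> g (t, x)"
proof -
  \<comment> \<open>Half of \<open>min \<epsilon>0 1\<close> puts the barrier strictly below the
    initial values, and below 1 as \<open>crit\<close> requires.\<close>
  define w where "w t = min \<epsilon>0 1 / 2 * exp (- (C + 1) * t)" for t
  have w0: "w t > 0" for t unfolding w_def using e0 by simp
  define Q where "Q = {y :: real^'d. \<forall>i. 0 \<le> y $ i \<and> y $ i \<le> 1}"
  have cQ: "compact Q" unfolding Q_def by (rule compact_cube)
  have b1: "(1::real, 0::real^'d) \<in> Basis" "(0::real, axis i (1::real) :: real^'d) \<in> Basis" for i
    by (auto simp: Basis_prod_def axis_in_Basis_iff)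
  have cg: "continuous_on UNIV g" by (rule smooth_cont[OF sm])
  have cw: "continuous_on UNIV w" unfolding w_def by (intro continuous_intros)
  have red: "\<exists>y\<in>Q. g (s, x) = g (s, y)" if s: "s \<in> {0..T}" for s x
  proof -
    obtain y z where "x = y + ivec z" "y \<in> Q" using per_unit_cube[of x] unfolding Q_def by blast
    then show ?thesis using per_ivec[of "\<lambda>x. g (s, x)", OF per[OF s]] by metis
  qed
  have main: "w s < g (s, y)" if s: "s \<in> {0..T}" and y: "y \<in> Q" for s y
  proof (rule ccontr)
    assume neg: "\<not> ?thesis"
    define S where "S = {p \<in> {0..T} \<times> Q. g p \<le> w (fst p)}"
    have "closed {p. g p \<le> w (fst p)}"
      by (intro closed_Collect_le cg continuous_on_compose2[OF cw] continuous_intros) auto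
    then have "compact S" unfolding S_def Collect_conj_eq Collect_mem_eq
      by (intro compact_Int_closed compact_Times cQ) auto
    moreover have "S \<noteq> {}" using neg s y unfolding S_def by force
    ultimately obtain p where p: "p \<in> S" "\<And>q. q \<in> S \<Longrightarrow> fst p \<le> fst q"
      using continuous_attains_inf[of S fst] continuous_on_fst[OF continuous_on_id] by metis
    obtain t1 x1 where p1: "p = (t1, x1)" by (cases p)
    have t1: "t1 \<in> {0..T}" and x1: "x1 \<in> Q" and le1: "g (t1, x1) \<le> w t1" using p(1) unfolding S_def p1 by auto
    have "w 0 < \<epsilon>0" unfolding w_def using e0 by auto
    then have "t1 \<noteq> 0" using le1 init[of x1] by auto
    then have t1p: "t1 > 0" using t1 by auto
    have before: "w r < g (r, z)" if "0 \<le> r" "r < t1" "z \<in> Q" for r z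
      using p(2)[of "(r, z)"] that t1 unfolding S_def p1 by force
    have at1: "w t1 \<le> g (t1, z)" if z: "z \<in> Q" for z
    proof (rule tendsto_le[of "at_left t1"])
      have "continuous_on UNIV (\<lambda>r. g (r, z))" by (intro continuous_on_compose2[OF cg] continuous_intros) auto
      then have "((\<lambda>r. g (r, z)) \<longlongrightarrow> g (t1, z)) (at t1)" by (simp add: continuous_on_eq_continuous_at isCont_def)
      then show "((\<lambda>r. g (r, z)) \<longlongrightarrow> g (t1, z)) (at_left t1)" by (rule filterlim_mono) (auto simp: at_le)
      have "(w \<longlongrightarrow> w t1) (at t1)" using cw by (simp add: continuous_on_eq_continuous_at isCont_def)
      then show "(w \<longlongrightarrow> w t1) (at_left t1)" by (rule filterlim_mono) (auto simp: at_le)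
      show "\<forall>\<^sub>F r in at_left t1. w r \<le> g (r, z)"
        unfolding eventually_at_left[OF t1p] using before z t1p by (intro exI[of _ 0]) (auto intro: less_imp_le)
    qed simp
    have eq: "g (t1, x1) = w t1" using le1 at1[OF x1] by simp
    have gmin: "g (t1, x1) \<le> g (t1, z)" for z
      using red[OF t1, of z] at1 eq by metis
    have crit1: "dd (0, axis i 1) g (t1, x1) = 0" "dd (0, axis i 1) (dd (0, axis i 1) g) (t1, x1) \<ge> 0" for i
    proof -
      have d1: "((\<lambda>s. g ((t1, x1) + s *\<^sub>R (0, axis i 1))) has_real_derivative dd (0, axis i 1) g ((t1, x1) + r *\<^sub>R (0, axis i 1))) (at r)" for r
        by (rule smooth_dd(2)[OF sm b1(2)])
      have d2: "((\<lambda>s. dd (0, axis i 1) g ((t1, x1) + s *\<^sub>R (0, axis i 1))) has_real_derivative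
          dd (0, axis i 1) (dd (0, axis i 1) g) ((t1, x1) + 0 *\<^sub>R (0, axis i 1))) (at 0)"
        by (rule smooth_dd(2)[OF smooth_dd(1)[OF sm b1(2)] b1(2)])
      have mn: "g ((t1, x1) + 0 *\<^sub>R (0, axis i 1)) \<le> g ((t1, x1) + s *\<^sub>R (0, axis i 1))" for s :: real
        using gmin by simp
      show "dd (0, axis i 1) g (t1, x1) = 0" "dd (0, axis i 1) (dd (0, axis i 1) g) (t1, x1) \<ge> 0"
        using second_deriv_min[OF d1 d2 mn] by simp_all
    qed
    have "w t1 \<le> 1"
    proof -
      have "- (C + 1) * t1 \<le> 0" using C t1p by (intro mult_nonpos_nonneg) auto
      then have "exp (- (C + 1) * t1) \<le> 1" by (rule iffD2[OF exp_le_one_iff])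
      moreover have "min \<epsilon>0 1 / 2 \<le> 1" by auto
      ultimately show ?thesis unfolding w_def using e0 by (intro mult_le_one) auto
    qed
    then have lo: "- C * w t1 \<le> dd (1, 0) g (t1, x1)"
      using crit[OF t1, of x1] x1 crit1 eq w0[of t1] unfolding Q_def by auto
    have dt: "((\<lambda>s. g (s, x1)) has_real_derivative dd (1, 0) g (t1, x1)) (at t1)"
      using smooth_dd(2)[OF sm b1(1), of "(0, x1)" t1] by simp
    have dw: "(w has_real_derivative - (C + 1) * w t1) (at t1)"
      unfolding w_def by (auto intro!: derivative_eq_intros)
    have dif: "((\<lambda>s. g (s, x1) - w s) has_real_derivative (dd (1, 0) g (t1, x1) - (- (C + 1) * w t1))) (at t1)"
      by (rule DERIV_diff[OF dt dw])
    \<comment> \<open>Since \<open>g - w\<close> vanishes at the contact point, a strictly positive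
      time derivative makes it negative just before, against the choice of the first
      contact.\<close>
    have "0 < dd (1, 0) g (t1, x1) - (- (C + 1) * w t1)" using lo w0[of t1] by (simp add: algebra_simps)
    then obtain d where d: "d > 0" "\<And>h. 0 < h \<Longrightarrow> h < d \<Longrightarrow> g (t1 - h, x1) - w (t1 - h) < g (t1, x1) - w t1"
      using DERIV_pos_inc_left[OF dif] by auto
    define h where "h = min (d/2) (t1/2)"
    have h: "0 < h" "h < d" "0 \<le> t1 - h" "t1 - h < t1" unfolding h_def using d(1) t1p by auto
    show False using d(2)[OF h(1,2)] before[OF h(3,4) x1] eq by linarith
  qed
  obtain y where y: "y \<in> Q" "g (t, x) = g (t, y)" using red[OF t] by blast
  have "min \<epsilon>0 1 / 2 * exp (- (C + 1) * T) \<le> w t" unfolding w_def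
  proof (rule mult_left_mono, rule iffD2[OF exp_le_cancel_iff])
    have "(C + 1) * t \<le> (C + 1) * T" using t C by (intro mult_left_mono) auto
    then show "- (C + 1) * T \<le> - (C + 1) * t" by (simp add: algebra_simps)
  qed (use e0 in auto)
  also have "\<dots> < g (t, x)" using main[OF t y(1)] y(2) by simp
  finally show ?thesis by simp
qed

section \<open>Taylor bounds and consistency of the discrete current\<close>

lemma taylor3:
  fixes f f1 f2 f3 :: "real \<Rightarrow> real"
  assumes d: "\<And>s. (f has_real_derivative f1 s) (at s)" "\<And>s. (f1 has_real_derivative f2 s) (at s)" "\<And>s. (f2 has_real_derivative f3 s) (at s)"
    and B: "\<And>s. \<bar>s\<bar> \<le> 1 \<Longrightarrow> \<bar>f3 s\<bar> \<le> B" and h: "0 < h" "h \<le> 1"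
  shows "\<bar>(f (- h) - 2 * f 0 + f h) / h\<^sup>2 - f2 0\<bar> \<le> B * h"
proof -
  define df where "df m = (if m = 0 then f else if m = 1 then f1 else if m = 2 then f2 else f3)" for m :: nat
  have dfS: "\<forall>m t. m < 3 \<and> -1 \<le> t \<and> t \<le> 1 \<longrightarrow> DERIV (df m) t :> df (Suc m) t"
    using d by (auto simp: df_def numeral_3_eq_3 less_Suc_eq)
  have ex: "\<exists>t. \<bar>t\<bar> \<le> 1 \<and> f x = f 0 + f1 0 * x + f2 0 / 2 * x\<^sup>2 + f3 t / 6 * x^3" if x: "x \<noteq> 0" "\<bar>x\<bar> \<le> 1" for x
  proof -
    have "\<exists>t. (if x < 0 then x < t \<and> t < 0 else 0 < t \<and> t < x) \<and>
      f x = (\<Sum>m<3. (df m 0 / fact m) * (x - 0)^m) + (df 3 t / fact 3) * (x - 0)^3"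
      by (rule Taylor[OF _ _ dfS]) (use x in \<open>auto simp: df_def\<close>)
    then obtain t where "(if x < 0 then x < t \<and> t < 0 else 0 < t \<and> t < x)"
      "f x = (\<Sum>m<3. (df m 0 / fact m) * (x - 0)^m) + (df 3 t / fact 3) * (x - 0)^3" by blast
    then show ?thesis using x
      by (intro exI[of _ t]) (auto simp: df_def numeral_3_eq_3 fact_numeral power2_eq_square split: if_splits)
  qed
  obtain t1 where t1: "\<bar>t1\<bar> \<le> 1" "f h = f 0 + f1 0 * h + f2 0 / 2 * h\<^sup>2 + f3 t1 / 6 * h^3" using ex[of h] h by auto
  obtain t2 where t2: "\<bar>t2\<bar> \<le> 1" "f (-h) = f 0 + f1 0 * (-h) + f2 0 / 2 * (-h)\<^sup>2 + f3 t2 / 6 * (-h)^3" using ex[of "-h"] h by auto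
  have "(f (- h) - 2 * f 0 + f h) / h\<^sup>2 - f2 0 = (f3 t1 - f3 t2) / 6 * h"
    unfolding t1(2) t2(2) using h by (simp add: field_simps power2_eq_square power3_eq_cube)
  also have "\<bar>\<dots>\<bar> = \<bar>f3 t1 - f3 t2\<bar> / 6 * h" using h by (simp add: abs_mult)
  also have "\<dots> \<le> B * h" using B[OF t1(1)] B[OF t2(1)] h by (intro mult_right_mono) auto
  finally show ?thesis .
qed

lemma taylor2:
  fixes f f1 f2 :: "real \<Rightarrow> real"
  assumes d: "\<And>s. (f has_real_derivative f1 s) (at s)" "\<And>s. (f1 has_real_derivative f2 s) (at s)"
    and B: "\<And>s. \<bar>s\<bar> \<le> 1 \<Longrightarrow> \<bar>f2 s\<bar> \<le> B" and h: "0 < h" "h \<le> 1"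
  shows "\<bar>(f h - f (- h)) / h - 2 * f1 0\<bar> \<le> B * h"
proof -
  define df where "df m = (if m = 0 then f else if m = 1 then f1 else f2)" for m :: nat
  have dfS: "\<forall>m t. m < 2 \<and> -1 \<le> t \<and> t \<le> 1 \<longrightarrow> DERIV (df m) t :> df (Suc m) t"
    using d by (auto simp: df_def numeral_2_eq_2 less_Suc_eq)
  have ex: "\<exists>t. \<bar>t\<bar> \<le> 1 \<and> f x = f 0 + f1 0 * x + f2 t / 2 * x\<^sup>2" if x: "x \<noteq> 0" "\<bar>x\<bar> \<le> 1" for x
  proof -
    have "\<exists>t. (if x < 0 then x < t \<and> t < 0 else 0 < t \<and> t < x) \<and>
      f x = (\<Sum>m<2. (df m 0 / fact m) * (x - 0)^m) + (df 2 t / fact 2) * (x - 0)^2"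
      by (rule Taylor[OF _ _ dfS]) (use x in \<open>auto simp: df_def\<close>)
    then obtain t where "(if x < 0 then x < t \<and> t < 0 else 0 < t \<and> t < x)"
      "f x = (\<Sum>m<2. (df m 0 / fact m) * (x - 0)^m) + (df 2 t / fact 2) * (x - 0)^2" by blast
    then show ?thesis using x
      by (intro exI[of _ t]) (auto simp: df_def numeral_2_eq_2 split: if_splits)
  qed
  obtain t1 where t1: "\<bar>t1\<bar> \<le> 1" "f h = f 0 + f1 0 * h + f2 t1 / 2 * h\<^sup>2" using ex[of h] h by auto
  obtain t2 where t2: "\<bar>t2\<bar> \<le> 1" "f (-h) = f 0 + f1 0 * (-h) + f2 t2 / 2 * (-h)\<^sup>2" using ex[of "-h"] h by auto
  have "(f h - f (- h)) / h - 2 * f1 0 = (f2 t1 - f2 t2) / 2 * h"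
    unfolding t1(2) t2(2) using h by (simp add: field_simps power2_eq_square)
  also have "\<bar>\<dots>\<bar> = \<bar>f2 t1 - f2 t2\<bar> / 2 * h" using h by (simp add: abs_mult)
  also have "\<dots> \<le> B * h" using B[OF t1(1)] B[OF t2(1)] h by (intro mult_right_mono) auto
  finally show ?thesis .
qed

text \<open>The instantaneous current of the profile through the bond from x to x + e_i.\<close>
definition cur :: "(real \<Rightarrow> real^'d::finite \<Rightarrow> real) \<Rightarrow> (real^'d \<Rightarrow> real^'d) \<Rightarrow> nat \<Rightarrow> real \<Rightarrow> 'd \<Rightarrow> int^'d \<Rightarrow> real" where
  "cur u F n t i x = (real n)\<^sup>2 * (u t (xr n x) - u t (xr n (x + axis i 1)))
     + real n * Fbn F n (axis i 1) x * (u t (xr n x) + u t (xr n (x + axis i 1)) - 2 * u t (xr n x) * u t (xr n (x + axis i 1)))"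

locale pde =
  fixes F :: "real^'d::finite \<Rightarrow> real^'d" and u0 :: "real^'d \<Rightarrow> real" and u :: "real \<Rightarrow> real^'d \<Rightarrow> real" and T :: real
  assumes F_smooth: "\<forall>i. smooth_fun (\<lambda>x. F x $ i)"
    and u0_bounds: "\<exists>\<epsilon>0>0. \<forall>x. \<epsilon>0 \<le> u0 x \<and> u0 x \<le> 1 - \<epsilon>0"
    and F_per: "\<forall>x i. F (x + axis i 1) = F x"
    and T_pos: "T > 0"
    and u_smooth: "smooth_fun (\<lambda>p::real \<times> (real^'d). u (fst p) (snd p))"
    and u_init: "u 0 = u0"
    and u_per: "\<forall>t\<in>{0..T}. \<forall>x i. u t (x + axis i 1) = u t x"
    and u_pde: "\<forall>t\<in>{0..T}. \<forall>x. deriv (\<lambda>\<tau>. u \<tau> x) t =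
                  (\<Sum>i\<in>UNIV. pd i (pd i (u t)) x)
                  - 2 * (\<Sum>i\<in>UNIV. pd i (\<lambda>y. u t y * (1 - u t y) * F y $ i) x)"
begin

definition g :: "real \<times> (real^'d) \<Rightarrow> real" where "g p = u (fst p) (snd p)"
definition ev :: "'d \<Rightarrow> real \<times> (real^'d)" where "ev i = (0, axis i 1)"
definition Fi :: "'d \<Rightarrow> real^'d \<Rightarrow> real" where "Fi i x = F x $ i"

lemma g_smooth: "smooth_fun g" using u_smooth unfolding g_def .
lemma Fi_smooth: "smooth_fun (Fi i)" using F_smooth unfolding Fi_def by blast

lemma evB: "ev i \<in> Basis" unfolding ev_def by (auto simp: Basis_prod_def axis_in_Basis_iff)
lemma axB: "(axis i (1::real) :: real^'d) \<in> Basis" by (simp add: axis_in_Basis_iff)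
lemma tB: "(1::real, 0::real^'d) \<in> Basis" by (auto simp: Basis_prod_def)

lemma line_d:
  assumes "smooth_fun (G :: real \<times> (real^'d) \<Rightarrow> real)"
  shows "((\<lambda>s. G (t, x + s *\<^sub>R axis i 1)) has_real_derivative dd (ev i) G (t, x + r *\<^sub>R axis i 1)) (at r)"
  using smooth_dd(2)[OF assms evB, of "(t, x)" i r] by (simp add: ev_def)

lemma lineF:
  assumes "smooth_fun (G :: real^'d \<Rightarrow> real)"
  shows "((\<lambda>s. G (x + s *\<^sub>R axis i 1)) has_real_derivative dd (axis i 1) G (x + r *\<^sub>R axis i 1)) (at r)"
  by (rule smooth_dd(2)[OF assms axB])

lemma time_d: "((\<lambda>\<tau>. u \<tau> x) has_real_derivative dd (1, 0) g (t, x)) (at t)"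
  using smooth_dd(2)[OF g_smooth tB, of "(0, x)" t] by (simp add: g_def)

lemma pd_u: "pd i (u t) x = dd (ev i) g (t, x)"
  unfolding pd_def using DERIV_imp_deriv[OF line_d[OF g_smooth, where t=t and x=x and i=i and r=0]] by (simp add: g_def)

lemma pd_pd_u: "pd i (pd i (u t)) x = dd (ev i) (dd (ev i) g) (t, x)"
  unfolding pd_def[of i "pd i (u t)"] pd_u
  using DERIV_imp_deriv[OF line_d[OF smooth_dd(1)[OF g_smooth evB[of i]], where t=t and x=x and i=i and r=0]] by simp

lemma pd_flux: "pd i (\<lambda>y. u t y * (1 - u t y) * F y $ i) x
   = dd (ev i) g (t, x) * (1 - 2 * u t x) * Fi i x + u t x * (1 - u t x) * dd (axis i 1) (Fi i) x"
proof -
  have u': "((\<lambda>s. u t (x + s *\<^sub>R axis i 1)) has_real_derivative dd (ev i) g (t, x)) (at 0)"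
    using line_d[OF g_smooth, where t=t and x=x and i=i and r=0] by (simp add: g_def)
  have F': "((\<lambda>s. F (x + s *\<^sub>R axis i 1) $ i) has_real_derivative dd (axis i 1) (Fi i) x) (at 0)"
    using lineF[OF Fi_smooth[of i], where x=x and i=i and r=0] by (simp add: Fi_def)
  have "((\<lambda>s. u t (x + s *\<^sub>R axis i 1) * (1 - u t (x + s *\<^sub>R axis i 1)) * F (x + s *\<^sub>R axis i 1) $ i) has_real_derivative
     (dd (ev i) g (t, x) * (1 - 2 * u t x) * Fi i x + u t x * (1 - u t x) * dd (axis i 1) (Fi i) x)) (at 0)"
    by (rule derivative_eq_intros u' F' refl)+ (simp add: Fi_def algebra_simps)
  then show ?thesis unfolding pd_def by (rule DERIV_imp_deriv)
qed

lemma pde_eq: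
  assumes "t \<in> {0..T}"
  shows "dd (1, 0) g (t, x) = (\<Sum>i\<in>UNIV. dd (ev i) (dd (ev i) g) (t, x)
    - 2 * (dd (ev i) g (t, x) * (1 - 2 * u t x) * Fi i x + u t x * (1 - u t x) * dd (axis i 1) (Fi i) x))"
proof -
  have "dd (1, 0) g (t, x) = deriv (\<lambda>\<tau>. u \<tau> x) t" using DERIV_imp_deriv[OF time_d] by simp
  then show ?thesis using u_pde assms unfolding pd_pd_u pd_flux
    by (simp add: sum_subtractf sum_distrib_left)
qed

text \<open>At a spatial critical point the first order part of the equation reduces to
  \<open>- 2 * u * (1 - u)\<close> times the divergence of \<open>F\<close>, which is at most linear
  both in \<open>u\<close> and in \<open>1 - u\<close>. So the minimum principle applies to each of
  the two, with the same constant.\<close>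

lemma u_bounds: "\<exists>\<epsilon>>0. \<forall>t\<in>{0..T}. \<forall>x. \<epsilon> \<le> u t x \<and> u t x \<le> 1 - \<epsilon>"
proof -
  obtain e0 where e0: "e0 > 0" "\<And>x. e0 \<le> u0 x \<and> u0 x \<le> 1 - e0" using u0_bounds by blast
  define Q where "Q = {y :: real^'d. \<forall>i. 0 \<le> y $ i \<and> y $ i \<le> 1}"
  have "continuous_on UNIV (\<lambda>x. \<Sum>i\<in>UNIV. dd (axis i 1) (Fi i) x)"
    by (intro continuous_on_sum smooth_cont smooth_dd(1)[OF Fi_smooth axB])
  then obtain B where B: "B > 0" "\<And>x. x \<in> Q \<Longrightarrow> \<bar>\<Sum>i\<in>UNIV. dd (axis i 1) (Fi i) x\<bar> \<le> B"
    using cont_bdd[OF _ compact_cube[of 0 1]] unfolding Q_def by blast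
  have flux: "dd (1, 0) g (t, x) = (\<Sum>i\<in>UNIV. dd (ev i) (dd (ev i) g) (t, x)) - 2 * (u t x * (1 - u t x) * (\<Sum>i\<in>UNIV. dd (axis i 1) (Fi i) x))"
    if "t \<in> {0..T}" "\<forall>i. dd (ev i) g (t, x) = 0" for t x
    unfolding pde_eq[OF that(1)] using that(2) by (simp add: sum_subtractf sum_distrib_left)
  have bd: "\<bar>v * (1 - v) * D\<bar> \<le> v * B" if "0 < v" "v \<le> 1" "\<bar>D\<bar> \<le> B" for v D :: real
  proof -
    have "\<bar>v * (1 - v) * D\<bar> = v * (1 - v) * \<bar>D\<bar>" using that by (simp add: abs_mult)
    also have "\<dots> \<le> v * 1 * B" using that by (intro mult_mono mult_left_mono) auto
    finally show ?thesis by simp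
  qed
  define \<epsilon> where "\<epsilon> = min e0 1 / 2 * exp (- (2 * B + 1) * T)"
  have lower: "\<epsilon> \<le> u t x" if t: "t \<in> {0..T}" for t x
  proof -
    have "\<epsilon> \<le> g (t, x)" unfolding \<epsilon>_def
    proof (rule min_principle[OF g_smooth _ _ e0(1) _ _ t])
      show "g (s, x + axis i 1) = g (s, x)" if "s \<in> {0..T}" for s x i using u_per that unfolding g_def by simp
      show "e0 \<le> g (0, x)" for x using e0(2) u_init unfolding g_def by simp
      show "0 \<le> 2 * B" using B(1) by simp
      fix s x assume s: "s \<in> {0..T}" and Q: "\<forall>i. 0 \<le> x $ i \<and> x $ i \<le> 1"
        and z: "\<forall>i. dd (0, axis i 1) g (s, x) = 0" and p: "\<forall>i. 0 \<le> dd (0, axis i 1) (dd (0, axis i 1) g) (s, x)"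
        and v: "0 < g (s, x)" "g (s, x) \<le> 1"
      have gu: "g (s, x) = u s x" unfolding g_def by simp
      have "\<bar>u s x * (1 - u s x) * (\<Sum>i\<in>UNIV. dd (axis i 1) (Fi i) x)\<bar> \<le> u s x * B"
        using bd v B(2)[of x] Q unfolding Q_def gu by blast
      then have X: "u s x * (1 - u s x) * (\<Sum>i\<in>UNIV. dd (axis i 1) (Fi i) x) \<le> u s x * B" by (rule abs_le_D1)
      have S0: "0 \<le> (\<Sum>i\<in>UNIV. dd (ev i) (dd (ev i) g) (s, x))" using p unfolding ev_def by (intro sum_nonneg) auto
      have z': "\<forall>i. dd (ev i) g (s, x) = 0" using z unfolding ev_def by simp
      have "- (2 * B) * g (s, x) = - 2 * (u s x * B)" unfolding gu by simp
      then show "- (2 * B) * g (s, x) \<le> dd (1, 0) g (s, x)"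
        using flux[OF s z'] X S0 by linarith
    qed
    then show ?thesis unfolding g_def by simp
  qed
  define g' where "g' p = 1 - g p" for p
  have g'dd: "dd v g' p = - dd v g p" if "v \<in> Basis" for v p
  proof -
    have "((\<lambda>s. g (p + s *\<^sub>R v)) has_real_derivative dd v g p) (at 0)"
      using smooth_dd(2)[OF g_smooth that, of p 0] by simp
    then have "((\<lambda>s. 1 - g (p + s *\<^sub>R v)) has_real_derivative - dd v g p) (at 0)"
      by (auto intro!: derivative_eq_intros)
    then show ?thesis unfolding dd_def[of v g'] g'_def by (rule DERIV_imp_deriv)
  qed
  \<comment> \<open>\<open>smooth_fun\<close> is existential in the class \<open>S\<close>; the
    functions "constant minus a member of \<open>S\<close>" form a class that is again closed under
    derivatives.\<close>
  have neg_smooth: "smooth_fun (\<lambda>p. c - G p)" if "smooth_fun (G :: real \<times> (real^'d) \<Rightarrow> real)" for G and c :: real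
  proof -
    from that obtain S where S: "G \<in> S" "\<And>h. h \<in> S \<Longrightarrow> continuous_on UNIV h \<and>
       (\<forall>v\<in>Basis. \<exists>h'\<in>S. \<forall>x. ((\<lambda>t. h (x + t *\<^sub>R v)) has_real_derivative h' x) (at 0))"
      unfolding smooth_fun_def by blast
    show ?thesis unfolding smooth_fun_def
    proof (intro exI[of _ "{\<lambda>p. a - h p | a h. h \<in> S}"] conjI ballI)
      show "(\<lambda>p. c - G p) \<in> {\<lambda>p. a - h p | a h. h \<in> S}" using S(1) by blast
      fix k assume "k \<in> {\<lambda>p. a - h p | a h. h \<in> S}"
      then obtain a h where k: "k = (\<lambda>p. a - h p)" "h \<in> S" by blast
      show "continuous_on UNIV k" using S(2)[OF k(2)] unfolding k(1) by (intro continuous_intros) auto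
      fix v :: "real \<times> (real^'d)" assume "v \<in> Basis"
      then obtain h' where h': "h' \<in> S" "\<And>x. ((\<lambda>t. h (x + t *\<^sub>R v)) has_real_derivative h' x) (at 0)"
        using S(2)[OF k(2)] by blast
      show "\<exists>k'\<in>{\<lambda>p. a - h p | a h. h \<in> S}. \<forall>x. ((\<lambda>t. k (x + t *\<^sub>R v)) has_real_derivative k' x) (at 0)"
      proof (intro bexI[of _ "\<lambda>p. 0 - h' p"] allI)
        show "((\<lambda>t. k (x + t *\<^sub>R v)) has_real_derivative 0 - h' x) (at 0)" for x
          unfolding k(1) by (intro DERIV_diff DERIV_const h'(2))
        show "(\<lambda>p. 0 - h' p) \<in> {\<lambda>p. a - h p | a h. h \<in> S}" using h'(1) by blast
      qed
    qed
  qed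
  have g'_smooth: "smooth_fun g'" unfolding g'_def by (rule neg_smooth[OF g_smooth])
  have g'dd2: "dd (ev i) (dd (ev i) g') p = - dd (ev i) (dd (ev i) g) p" for i p
  proof -
    have e: "dd (ev i) g' = (\<lambda>p. - dd (ev i) g p)" using g'dd[OF evB] by (simp add: fun_eq_iff)
    have "((\<lambda>s. dd (ev i) g (p + s *\<^sub>R ev i)) has_real_derivative dd (ev i) (dd (ev i) g) p) (at 0)"
      using smooth_dd(2)[OF smooth_dd(1)[OF g_smooth evB[of i]] evB[of i], where x=p and t=0] by simp
    then have "((\<lambda>s. - dd (ev i) g (p + s *\<^sub>R ev i)) has_real_derivative - dd (ev i) (dd (ev i) g) p) (at 0)"
      by (rule DERIV_minus)
    then show ?thesis unfolding e dd_def[of "ev i" "\<lambda>p. - dd (ev i) g p"] by (rule DERIV_imp_deriv)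
  qed
  have upper: "\<epsilon> \<le> 1 - u t x" if t: "t \<in> {0..T}" for t x
  proof -
    have "\<epsilon> \<le> g' (t, x)" unfolding \<epsilon>_def
    proof (rule min_principle[OF g'_smooth _ _ e0(1) _ _ t])
      show "g' (s, x + axis i 1) = g' (s, x)" if "s \<in> {0..T}" for s x i using u_per that unfolding g_def g'_def by simp
      show "e0 \<le> g' (0, x)" for x using e0(2)[of x] u_init unfolding g_def g'_def by simp
      show "0 \<le> 2 * B" using B(1) by simp
      fix s x assume s: "s \<in> {0..T}" and Q: "\<forall>i. 0 \<le> x $ i \<and> x $ i \<le> 1"
        and z: "\<forall>i. dd (0, axis i 1) g' (s, x) = 0" and p: "\<forall>i. 0 \<le> dd (0, axis i 1) (dd (0, axis i 1) g') (s, x)"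
        and v: "0 < g' (s, x)" "g' (s, x) \<le> 1"
      have gu: "g' (s, x) = 1 - u s x" unfolding g_def g'_def by simp
      have "\<bar>(1 - u s x) * (1 - (1 - u s x)) * (\<Sum>i\<in>UNIV. dd (axis i 1) (Fi i) x)\<bar> \<le> (1 - u s x) * B"
        using bd[of "1 - u s x"] v B(2)[of x] Q unfolding Q_def gu by blast
      then have b: "- (1 - u s x) * B \<le> u s x * (1 - u s x) * (\<Sum>i\<in>UNIV. dd (axis i 1) (Fi i) x)"
        by (simp add: abs_le_iff algebra_simps)
      have z': "\<forall>i. dd (ev i) g (s, x) = 0" using z g'dd[OF evB] unfolding ev_def by simp
      have "0 \<le> (\<Sum>i\<in>UNIV. - dd (ev i) (dd (ev i) g) (s, x))"
        using p unfolding g'dd2[symmetric] unfolding ev_def by (intro sum_nonneg) auto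
      then have "(\<Sum>i\<in>UNIV. dd (ev i) (dd (ev i) g) (s, x)) \<le> 0" by (simp add: sum_negf)
      then show "- (2 * B) * g' (s, x) \<le> dd (1, 0) g' (s, x)"
        using flux[OF s z'] b g'dd[OF tB] unfolding gu by (simp add: algebra_simps)
    qed
    then show ?thesis unfolding g_def g'_def by simp
  qed
  have "\<epsilon> > 0" unfolding \<epsilon>_def using e0 by simp
  then show ?thesis using lower upper by (intro exI[of _ \<epsilon>]) (auto simp: algebra_simps)
qed

lemma xr_shift: "xr n (x + axis i 1) = xr n x + (1 / real n) *\<^sub>R axis i 1"
  "xr n (x - axis i 1) = xr n x + (- (1 / real n)) *\<^sub>R axis i 1"
  unfolding vec_eq_iff xr_def by (auto simp: axis_def add_divide_distrib diff_divide_distrib)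

lemma Fbn_axis: "Fbn F n (axis i 1) x = Fi i (xr n x + (1 / real n / 2) *\<^sub>R axis i 1)"
proof -
  have "ivec (axis i 1) = axis i (1::real)" unfolding vec_eq_iff ivec_def by (simp add: axis_def)
  then show ?thesis unfolding Fbn_def Fi_def by (simp add: inner_axis mult.commute)
qed

lemma xr_box: "x \<in> box n \<Longrightarrow> n \<ge> 1 \<Longrightarrow> 0 \<le> xr n x $ i \<and> xr n x $ i \<le> 1"
proof -
  assume x: "x \<in> box n" and n: "n \<ge> 1"
  then have "0 \<le> x $ i" "x $ i < int n" unfolding box_def by auto
  then have "0 \<le> real_of_int (x $ i)" "real_of_int (x $ i) \<le> real n" by linarith+
  then show ?thesis unfolding xr_def using n by (simp add: divide_le_eq_1)
qed

text \<open>On the line through a site in direction \<open>i\<close> the drift part of the current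
  is one smooth function \<psi>, because \<open>F\<close> is evaluated at bond midpoints. The
  discrete divergence is then a second difference of u minus a centred difference of \<psi>, and
  twice the derivative of \<psi> at 0 is the flux term of the equation.\<close>

lemma consistency:
  "\<exists>B>0. \<forall>t\<in>{0..T}. \<forall>n\<ge>1. \<forall>x\<in>box n.
     (\<forall>i. \<bar>u t (xr n (x + axis i 1)) - u t (xr n x)\<bar> \<le> B / real n) \<and>
     (\<forall>i. \<bar>Fbn F n (axis i 1) x\<bar> \<le> B) \<and>
     \<bar>(\<Sum>i\<in>UNIV. cur u F n t i (x - axis i 1) - cur u F n t i x) - dd (1, 0) g (t, xr n x)\<bar> \<le> B / real n"
proof -
  \<comment> \<open>Enlarged by one unit on each side, so that Taylor segments with parameter at
    most 1 starting in the unit cube stay inside.\<close>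
  define Q where "Q = {y :: real^'d. \<forall>i. -1 \<le> y $ i \<and> y $ i \<le> 2}"
  define G where "G p = \<bar>g p\<bar> + (\<Sum>i\<in>UNIV. \<bar>dd (ev i) g p\<bar> + \<bar>dd (ev i) (dd (ev i) g) p\<bar> + \<bar>dd (ev i) (dd (ev i) (dd (ev i) g)) p\<bar>)" for p
  define H where "H y = (\<Sum>i\<in>UNIV. \<bar>Fi i y\<bar> + \<bar>dd (axis i 1) (Fi i) y\<bar> + \<bar>dd (axis i 1) (dd (axis i 1) (Fi i)) y\<bar>)" for y
  have s1: "smooth_fun (dd (ev i) g)" for i by (rule smooth_dd(1)[OF g_smooth evB])
  have s2: "smooth_fun (dd (ev i) (dd (ev i) g))" for i by (rule smooth_dd(1)[OF s1 evB])
  have s3: "smooth_fun (dd (ev i) (dd (ev i) (dd (ev i) g)))" for i by (rule smooth_dd(1)[OF s2 evB])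
  have f1: "smooth_fun (dd (axis i 1) (Fi i))" for i by (rule smooth_dd(1)[OF Fi_smooth axB])
  have f2: "smooth_fun (dd (axis i 1) (dd (axis i 1) (Fi i)))" for i by (rule smooth_dd(1)[OF f1 axB])
  have "continuous_on UNIV G" unfolding G_def
    by (intro continuous_intros smooth_cont g_smooth s1 s2 s3)
  moreover have "compact ({0..T} \<times> Q)" unfolding Q_def by (intro compact_Times compact_cube) auto
  ultimately obtain B1 where B1: "B1 > 0" "\<And>p. p \<in> {0..T} \<times> Q \<Longrightarrow> \<bar>G p\<bar> \<le> B1" using cont_bdd by metis
  have "continuous_on UNIV H" unfolding H_def
    by (intro continuous_intros smooth_cont Fi_smooth f1 f2)
  moreover have "compact Q" unfolding Q_def by (rule compact_cube)
  ultimately obtain B2 where B2: "B2 > 0" "\<And>y. y \<in> Q \<Longrightarrow> \<bar>H y\<bar> \<le> B2" using cont_bdd by metis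
  define B where "B = max B1 B2"
  have B0: "B > 0" unfolding B_def using B1 by auto
  have gb: "\<bar>g p\<bar> \<le> B" "\<bar>dd (ev i) g p\<bar> \<le> B" "\<bar>dd (ev i) (dd (ev i) g) p\<bar> \<le> B" "\<bar>dd (ev i) (dd (ev i) (dd (ev i) g)) p\<bar> \<le> B"
    if p: "p \<in> {0..T} \<times> Q" for p i
  proof -
    have a: "\<bar>dd (ev i) g p\<bar> + \<bar>dd (ev i) (dd (ev i) g) p\<bar> + \<bar>dd (ev i) (dd (ev i) (dd (ev i) g)) p\<bar>
      \<le> (\<Sum>i\<in>UNIV. \<bar>dd (ev i) g p\<bar> + \<bar>dd (ev i) (dd (ev i) g) p\<bar> + \<bar>dd (ev i) (dd (ev i) (dd (ev i) g)) p\<bar>)"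
      by (rule member_le_sum) auto
    have "G p \<le> B" using B1(2)[OF p] unfolding B_def by auto
    then show "\<bar>g p\<bar> \<le> B" "\<bar>dd (ev i) g p\<bar> \<le> B" "\<bar>dd (ev i) (dd (ev i) g) p\<bar> \<le> B" "\<bar>dd (ev i) (dd (ev i) (dd (ev i) g)) p\<bar> \<le> B"
      using a unfolding G_def by linarith+
  qed
  have Fb: "\<bar>Fi i y\<bar> \<le> B" "\<bar>dd (axis i 1) (Fi i) y\<bar> \<le> B" "\<bar>dd (axis i 1) (dd (axis i 1) (Fi i)) y\<bar> \<le> B"
    if y: "y \<in> Q" for y i
  proof -
    have a: "\<bar>Fi i y\<bar> + \<bar>dd (axis i 1) (Fi i) y\<bar> + \<bar>dd (axis i 1) (dd (axis i 1) (Fi i)) y\<bar> \<le> H y"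
      unfolding H_def by (rule member_le_sum) auto
    have "H y \<le> B" using B2(2)[OF y] unfolding B_def by auto
    then show "\<bar>Fi i y\<bar> \<le> B" "\<bar>dd (axis i 1) (Fi i) y\<bar> \<le> B" "\<bar>dd (axis i 1) (dd (axis i 1) (Fi i)) y\<bar> \<le> B"
      using a by linarith+
  qed
  define P where "P = B / 4 * (2 * B + 2 * B * B) + B * (1 + 2 * B) * B + B * (1 + 2 * B) * B"
  have P0: "P > 0" unfolding P_def using B0 by (simp add: add_pos_pos)
  define C where "C = B + real CARD('d) * (B + P)"
  have C: "C > 0" "B \<le> C" unfolding C_def using B0 P0 by (auto simp: add_pos_nonneg)
  show ?thesis
  proof (intro exI[of _ C] conjI ballI allI impI C(1))
    fix t n and x :: "int^'d"
    assume t: "t \<in> {0..T}" and n: "1 \<le> n" and x: "x \<in> box n"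
    define h where "h = 1 / real n"
    define X where "X = xr n x"
    have h: "0 < h" "h \<le> 1" unfolding h_def using n by auto
    have inQ: "X + s *\<^sub>R axis i 1 \<in> Q" if "\<bar>s\<bar> \<le> 1" for s i
      unfolding Q_def
    proof (intro CollectI allI)
      fix l
      have "0 \<le> X $ l \<and> X $ l \<le> 1" unfolding X_def by (rule xr_box[OF x n])
      then show "-1 \<le> (X + s *\<^sub>R axis i 1) $ l \<and> (X + s *\<^sub>R axis i 1) $ l \<le> 2"
        using that by (auto simp: axis_def)
    qed
    have inP: "(t, X + s *\<^sub>R axis i 1) \<in> {0..T} \<times> Q" if "\<bar>s\<bar> \<le> 1" for s i using inQ[OF that] t by auto
    define \<phi> where "\<phi> i s = g (t, X + s *\<^sub>R axis i 1)" for i s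
    define \<phi>1 where "\<phi>1 i s = dd (ev i) g (t, X + s *\<^sub>R axis i 1)" for i s
    define \<phi>2 where "\<phi>2 i s = dd (ev i) (dd (ev i) g) (t, X + s *\<^sub>R axis i 1)" for i s
    define \<phi>3 where "\<phi>3 i s = dd (ev i) (dd (ev i) (dd (ev i) g)) (t, X + s *\<^sub>R axis i 1)" for i s
    define \<Phi> where "\<Phi> i s = Fi i (X + s *\<^sub>R axis i 1)" for i s
    define \<Phi>1 where "\<Phi>1 i s = dd (axis i 1) (Fi i) (X + s *\<^sub>R axis i 1)" for i s
    define \<Phi>2 where "\<Phi>2 i s = dd (axis i 1) (dd (axis i 1) (Fi i)) (X + s *\<^sub>R axis i 1)" for i s
    have d\<phi>: "(\<phi> i has_real_derivative \<phi>1 i s) (at s)" "(\<phi>1 i has_real_derivative \<phi>2 i s) (at s)" "(\<phi>2 i has_real_derivative \<phi>3 i s) (at s)" for i s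
      unfolding \<phi>_def \<phi>1_def \<phi>2_def \<phi>3_def by (rule line_d g_smooth s1 s2)+
    have d\<Phi>: "(\<Phi> i has_real_derivative \<Phi>1 i s) (at s)" "(\<Phi>1 i has_real_derivative \<Phi>2 i s) (at s)" for i s
      unfolding \<Phi>_def \<Phi>1_def \<Phi>2_def by (rule lineF Fi_smooth f1)+
    have d\<Phi>h: "((\<lambda>s. \<Phi> i (s / 2)) has_real_derivative \<Phi>1 i (s / 2) / 2) (at s)" "((\<lambda>s. \<Phi>1 i (s / 2)) has_real_derivative \<Phi>2 i (s / 2) / 2) (at s)" for i s
    proof -
      have "((\<lambda>s. s / 2) has_real_derivative 1 / 2) (at s)" by (auto intro!: derivative_eq_intros)
      from DERIV_chain2[where f="\<Phi> i" and g="\<lambda>s. s / 2" and x=s, OF d\<Phi>(1) this]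
        DERIV_chain2[where f="\<Phi>1 i" and g="\<lambda>s. s / 2" and x=s, OF d\<Phi>(2) this]
      show "((\<lambda>s. \<Phi> i (s / 2)) has_real_derivative \<Phi>1 i (s / 2) / 2) (at s)" "((\<lambda>s. \<Phi>1 i (s / 2)) has_real_derivative \<Phi>2 i (s / 2) / 2) (at s)"
        by simp_all
    qed
    \<comment> \<open>\<open>s = h\<close> describes the outgoing bond and \<open>s = - h\<close>
      the incoming one; the half in the argument of \<Phi> is the midpoint.\<close>
    define \<psi> where "\<psi> i s = \<Phi> i (s / 2) * (\<phi> i 0 + \<phi> i s - 2 * \<phi> i 0 * \<phi> i s)" for i s
    define \<psi>1 where "\<psi>1 i s = \<Phi>1 i (s / 2) / 2 * (\<phi> i 0 + \<phi> i s - 2 * \<phi> i 0 * \<phi> i s) + \<Phi> i (s / 2) * (1 - 2 * \<phi> i 0) * \<phi>1 i s" for i s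
    define \<psi>2 where "\<psi>2 i s = \<Phi>2 i (s / 2) / 4 * (\<phi> i 0 + \<phi> i s - 2 * \<phi> i 0 * \<phi> i s) + \<Phi>1 i (s / 2) * (1 - 2 * \<phi> i 0) * \<phi>1 i s
       + \<Phi> i (s / 2) * (1 - 2 * \<phi> i 0) * \<phi>2 i s" for i s
    have d\<psi>: "(\<psi> i has_real_derivative \<psi>1 i s) (at s)" for i s
      unfolding \<psi>_def \<psi>1_def
      by (rule derivative_eq_intros d\<Phi>h d\<phi> refl)+ (simp add: algebra_simps)
    have d\<psi>1: "(\<psi>1 i has_real_derivative \<psi>2 i s) (at s)" for i s
      unfolding \<psi>1_def \<psi>2_def
      by (rule derivative_eq_intros d\<Phi>h d\<phi> refl | simp)+ (simp add: algebra_simps)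
    have b\<phi>: "\<bar>\<phi> i s\<bar> \<le> B" "\<bar>\<phi>1 i s\<bar> \<le> B" "\<bar>\<phi>2 i s\<bar> \<le> B" "\<bar>\<phi>3 i s\<bar> \<le> B" if "\<bar>s\<bar> \<le> 1" for i s
      unfolding \<phi>_def \<phi>1_def \<phi>2_def \<phi>3_def using gb[OF inP[OF that]] by auto
    have b\<Phi>: "\<bar>\<Phi> i s\<bar> \<le> B" "\<bar>\<Phi>1 i s\<bar> \<le> B" "\<bar>\<Phi>2 i s\<bar> \<le> B" if "\<bar>s\<bar> \<le> 1" for i s
      unfolding \<Phi>_def \<Phi>1_def \<Phi>2_def using Fb[OF inQ[OF that]] by auto
    have b\<psi>2: "\<bar>\<psi>2 i s\<bar> \<le> P" if s: "\<bar>s\<bar> \<le> 1" for i s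
    proof -
      have s2: "\<bar>s / 2\<bar> \<le> 1" using s by simp
      have c0: "\<bar>1 - 2 * \<phi> i 0\<bar> \<le> 1 + 2 * B" using b\<phi>(1)[of 0 i] by simp
      have "\<bar>\<phi> i 0 * \<phi> i s\<bar> \<le> B * B" unfolding abs_mult using b\<phi>(1)[of 0 i] b\<phi>(1)[OF s, of i] by (intro mult_mono) auto
      then have c1: "\<bar>\<phi> i 0 + \<phi> i s - 2 * \<phi> i 0 * \<phi> i s\<bar> \<le> 2 * B + 2 * B * B"
        using b\<phi>(1)[of 0 i] b\<phi>(1)[OF s, of i] by (simp add: abs_le_iff)
      have t1: "\<bar>\<Phi>2 i (s / 2) / 4 * (\<phi> i 0 + \<phi> i s - 2 * \<phi> i 0 * \<phi> i s)\<bar> \<le> B / 4 * (2 * B + 2 * B * B)"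
        unfolding abs_mult using b\<Phi>(3)[OF s2, of i] c1 B0 by (intro mult_mono) auto
      have t2: "\<bar>\<Phi>1 i (s / 2) * (1 - 2 * \<phi> i 0) * \<phi>1 i s\<bar> \<le> B * (1 + 2 * B) * B"
        unfolding abs_mult using b\<Phi>(2)[OF s2, of i] c0 b\<phi>(2)[OF s, of i] B0 by (intro mult_mono) auto
      have t3: "\<bar>\<Phi> i (s / 2) * (1 - 2 * \<phi> i 0) * \<phi>2 i s\<bar> \<le> B * (1 + 2 * B) * B"
        unfolding abs_mult using b\<Phi>(1)[OF s2, of i] c0 b\<phi>(3)[OF s, of i] B0 by (intro mult_mono) auto
      show ?thesis unfolding \<psi>2_def P_def using t1 t2 t3 by linarith
    qed
    have ux: "u t (xr n (x + axis i 1)) = \<phi> i h" "u t (xr n x) = \<phi> i 0" "u t (xr n (x - axis i 1)) = \<phi> i (- h)"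
      "Fbn F n (axis i 1) x = \<Phi> i (h / 2)" "Fbn F n (axis i 1) (x - axis i 1) = \<Phi> i (- h / 2)" for i
    proof -
      show "u t (xr n (x + axis i 1)) = \<phi> i h" "u t (xr n x) = \<phi> i 0" "u t (xr n (x - axis i 1)) = \<phi> i (- h)"
        unfolding \<phi>_def g_def h_def X_def xr_shift by simp_all
      show "Fbn F n (axis i 1) x = \<Phi> i (h / 2)" unfolding Fbn_axis \<Phi>_def X_def h_def ..
      have e: "xr n x + (- (1 / real n)) *\<^sub>R axis i 1 + (1 / real n / 2) *\<^sub>R axis i 1 = xr n x + (- h / 2) *\<^sub>R axis i 1"
        unfolding h_def by (simp add: vec_eq_iff algebra_simps)
      show "Fbn F n (axis i 1) (x - axis i 1) = \<Phi> i (- h / 2)" unfolding Fbn_axis \<Phi>_def X_def xr_shift e ..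
    qed
    show "\<bar>u t (xr n (x + axis i 1)) - u t (xr n x)\<bar> \<le> C / real n" for i
    proof -
      obtain z where z: "0 < z" "z < h" "\<phi> i h - \<phi> i 0 = (h - 0) * \<phi>1 i z"
        using MVT2[OF h(1), of "\<phi> i" "\<phi>1 i"] d\<phi>(1) by blast
      have "\<bar>\<phi> i h - \<phi> i 0\<bar> = h * \<bar>\<phi>1 i z\<bar>" unfolding z(3) using h by (simp add: abs_mult)
      also have "\<dots> \<le> h * C" using b\<phi>(2)[of z i] z h C by (intro mult_left_mono) auto
      finally show ?thesis unfolding ux(1)[of i] ux(2)[of i] unfolding h_def by simp
    qed
    show "\<bar>Fbn F n (axis i 1) x\<bar> \<le> C" for i unfolding ux(4) using b\<Phi>(1)[of "h/2" i] h C by auto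
    have each: "\<bar>(cur u F n t i (x - axis i 1) - cur u F n t i x) - (\<phi>2 i 0 - 2 * \<psi>1 i 0)\<bar> \<le> (B + P) * h" for i
    proof -
      have N: "real n = 1 / h" unfolding h_def by simp
      have "cur u F n t i (x - axis i 1) - cur u F n t i x = (\<phi> i (- h) - 2 * \<phi> i 0 + \<phi> i h) / h\<^sup>2 - (\<psi> i h - \<psi> i (- h)) / h"
        unfolding cur_def diff_add_cancel ux[of i] \<psi>_def N using h(1) by (simp add: field_simps power2_eq_square)
      moreover have "\<bar>(\<phi> i (- h) - 2 * \<phi> i 0 + \<phi> i h) / h\<^sup>2 - \<phi>2 i 0\<bar> \<le> B * h"
        by (rule taylor3[OF d\<phi> b\<phi>(4) h])
      moreover have "\<bar>(\<psi> i h - \<psi> i (- h)) / h - 2 * \<psi>1 i 0\<bar> \<le> P * h"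
        by (rule taylor2[OF d\<psi> d\<psi>1 b\<psi>2 h])
      ultimately show ?thesis unfolding distrib_right by linarith
    qed
    have pdeX: "dd (1, 0) g (t, xr n x) = (\<Sum>i\<in>UNIV. \<phi>2 i 0 - 2 * \<psi>1 i 0)"
      unfolding pde_eq[OF t] \<phi>2_def \<psi>1_def \<phi>_def \<phi>1_def \<Phi>_def \<Phi>1_def X_def
      by (intro sum.cong refl) (simp add: g_def algebra_simps)
    have "\<bar>(\<Sum>i\<in>UNIV. cur u F n t i (x - axis i 1) - cur u F n t i x) - dd (1, 0) g (t, xr n x)\<bar>
       = \<bar>\<Sum>i\<in>UNIV. (cur u F n t i (x - axis i 1) - cur u F n t i x) - (\<phi>2 i 0 - 2 * \<psi>1 i 0)\<bar>"
      unfolding pdeX sum_subtractf[symmetric] ..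
    also have "\<dots> \<le> (\<Sum>i\<in>(UNIV::'d set). (B + P) * h)"
      by (rule order_trans[OF sum_abs]) (intro sum_mono each)
    also have "\<dots> \<le> C * h" unfolding C_def using B0 h by (simp add: algebra_simps)
    finally show "\<bar>(\<Sum>i\<in>UNIV. cur u F n t i (x - axis i 1) - cur u F n t i x) - dd (1, 0) g (t, xr n x)\<bar> \<le> C / real n"
      unfolding h_def by simp
  qed
qed

end

section \<open>A Lyapunov functional for tilted flows\<close>

definition jump :: "'k set \<Rightarrow> ('k \<Rightarrow> 'e \<Rightarrow> real) \<Rightarrow> ('k \<Rightarrow> 'e \<Rightarrow> 'e) \<Rightarrow> ('e \<Rightarrow> real) \<Rightarrow> 'e \<Rightarrow> real" where
  "jump K c \<sigma> f \<xi> = (\<Sum>k\<in>K. c k \<xi> * (f (\<sigma> k \<xi>) - f \<xi>))"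

lemma exp_convex_le: "0 \<le> \<theta> \<Longrightarrow> \<theta> \<le> 1 \<Longrightarrow> exp (\<theta> * x) \<le> 1 - \<theta> + \<theta> * exp (x::real)"
  using convex_onD[OF exp_convex, of \<theta> 0 x] by simp

text \<open>The geometric mean with weight \<open>s \<le> 1/2\<close> is a geometric mean, with
  weight 2s, of \<open>a\<close> and \<open>sqrt a * sqrt a'\<close>, hence below the corresponding
  arithmetic mean; and twice that product of roots is \<open>a + a'\<close> minus the squared
  difference of the roots. This is where the dissipation of the tilted flow comes from.\<close>

lemma geo_le:
  fixes a a' :: real
  assumes "a > 0" "a' > 0" "0 \<le> s" "s \<le> 1/2"
  shows "exp ((1 - s) * ln a + s * ln a') - a \<le> s * (- (sqrt a' - sqrt a)\<^sup>2 + (a' - a))"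
proof -
  have "(1 - s) * ln a + s * ln a' = ln a + (2 * s) * ((ln a' - ln a) / 2)" by (simp add: field_simps)
  then have "exp ((1 - s) * ln a + s * ln a') = a * exp ((2 * s) * ((ln a' - ln a) / 2))"
    using assms(1) by (simp only: exp_add exp_ln)
  also have "\<dots> \<le> a * (1 - 2 * s + 2 * s * exp ((ln a' - ln a) / 2))"
    using assms by (intro mult_left_mono exp_convex_le) auto
  also have "exp ((ln a' - ln a) / 2) = sqrt a' / sqrt a"
  proof -
    have "sqrt a' / sqrt a = exp (ln (sqrt a' / sqrt a))" using assms by simp
    also have "ln (sqrt a' / sqrt a) = (ln a' - ln a) / 2" using assms by (simp add: ln_div ln_sqrt diff_divide_distrib)
    finally show ?thesis by simp
  qed
  also have "a * (1 - 2 * s + 2 * s * (sqrt a' / sqrt a)) = a - 2 * s * a + 2 * s * (sqrt a * sqrt a')"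
  proof -
    have e: "a * (sqrt a' / sqrt a) = sqrt a * sqrt a'" using assms by (simp add: real_div_sqrt field_simps)
    have "a * (1 - 2 * s + 2 * s * (sqrt a' / sqrt a)) = a - 2 * s * a + 2 * s * (a * (sqrt a' / sqrt a))"
      by (simp only: distrib_left right_diff_distrib mult_1_right) (simp add: mult_ac)
    then show ?thesis unfolding e .
  qed
  also have "\<dots> = a + s * (- (sqrt a' - sqrt a)\<^sup>2 + (a' - a))"
    using assms by (simp add: power2_diff algebra_simps)
  finally show ?thesis by simp
qed

lemma geo_le_sum:
  fixes a a' :: real
  assumes "a > 0" "a' > 0" "0 \<le> s" "s \<le> 1"
  shows "exp ((1 - s) * ln a + s * ln a') \<le> a + a'"
proof -
  have "exp ((1 - s) * ln a + s * ln a') \<le> (1 - s) * exp (ln a) + s * exp (ln a')"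
    using convex_onD[OF exp_convex, of s "ln a" "ln a'"] assms by simp
  also have "\<dots> \<le> 1 * a + 1 * a'" using assms by (intro add_mono mult_right_mono) auto
  finally show ?thesis by simp
qed

text \<open>\<open>W\<close> is the potential accumulated since the last mesh point. It does not
  commute with the jumps; the commutation error is the last term, with a crude factor that vanishes
  with \<open>w\<close>. The rest is \<open>geo_le\<close> on each jump.\<close>

lemma jump_tilted_le:
  fixes \<mu> f :: "'e \<Rightarrow> real"
  assumes E: "finite E" and K: "finite K" and \<sigma>: "\<And>k \<xi>. \<xi> \<in> E \<Longrightarrow> k \<in> K \<Longrightarrow> c k \<xi> \<noteq> 0 \<Longrightarrow> \<sigma> k \<xi> \<in> E"
    and c: "\<And>k \<xi>. \<xi> \<in> E \<Longrightarrow> k \<in> K \<Longrightarrow> 0 \<le> c k \<xi>"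
    and \<mu>: "\<And>\<xi>. \<xi> \<in> E \<Longrightarrow> 0 < \<mu> \<xi>" and f: "\<And>\<xi>. \<xi> \<in> E \<Longrightarrow> 0 < f \<xi>" and s: "0 \<le> s" "s \<le> 1/2"
    and W: "\<And>\<xi>. \<xi> \<in> E \<Longrightarrow> \<bar>W \<xi>\<bar> \<le> w"
  shows "(\<Sum>\<xi>\<in>E. \<mu> \<xi> * (\<Sum>k\<in>K. c k \<xi> * (exp (W (\<sigma> k \<xi>) - W \<xi>) * exp ((1 - s) * ln (f \<xi>) + s * ln (f (\<sigma> k \<xi>))) - f \<xi>)))
    \<le> s * (- (\<Sum>\<xi>\<in>E. \<mu> \<xi> * (\<Sum>k\<in>K. c k \<xi> * (sqrt (f (\<sigma> k \<xi>)) - sqrt (f \<xi>))\<^sup>2)) + (\<Sum>\<xi>\<in>E. \<mu> \<xi> * jump K c \<sigma> f \<xi>))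
      + (exp (2 * w) - 1) * (\<Sum>\<xi>\<in>E. \<mu> \<xi> * (\<Sum>k\<in>K. c k \<xi> * (f \<xi> + f (\<sigma> k \<xi>))))"
proof -
  have "(\<Sum>\<xi>\<in>E. \<mu> \<xi> * (\<Sum>k\<in>K. c k \<xi> * (exp (W (\<sigma> k \<xi>) - W \<xi>) * exp ((1 - s) * ln (f \<xi>) + s * ln (f (\<sigma> k \<xi>))) - f \<xi>)))
    \<le> (\<Sum>\<xi>\<in>E. \<mu> \<xi> * (\<Sum>k\<in>K. c k \<xi> * (s * (- (sqrt (f (\<sigma> k \<xi>)) - sqrt (f \<xi>))\<^sup>2 + (f (\<sigma> k \<xi>) - f \<xi>)) + (exp (2 * w) - 1) * (f \<xi> + f (\<sigma> k \<xi>)))))"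
  proof (rule sum_mono, rule mult_left_mono, rule sum_mono)
    fix \<xi> k assume xi: "\<xi> \<in> E" and k: "k \<in> K"
    show "c k \<xi> * (exp (W (\<sigma> k \<xi>) - W \<xi>) * exp ((1 - s) * ln (f \<xi>) + s * ln (f (\<sigma> k \<xi>))) - f \<xi>)
      \<le> c k \<xi> * (s * (- (sqrt (f (\<sigma> k \<xi>)) - sqrt (f \<xi>))\<^sup>2 + (f (\<sigma> k \<xi>) - f \<xi>)) + (exp (2 * w) - 1) * (f \<xi> + f (\<sigma> k \<xi>)))"
    proof (cases "c k \<xi> = 0")
      case False
      then have S: "\<sigma> k \<xi> \<in> E" using \<sigma>[OF xi k] by simp
      define Y where "Y = exp ((1 - s) * ln (f \<xi>) + s * ln (f (\<sigma> k \<xi>)))"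
      have Y1: "Y - f \<xi> \<le> s * (- (sqrt (f (\<sigma> k \<xi>)) - sqrt (f \<xi>))\<^sup>2 + (f (\<sigma> k \<xi>) - f \<xi>))"
        unfolding Y_def by (rule geo_le[OF f[OF xi] f[OF S] s])
      have Y2: "Y \<le> f \<xi> + f (\<sigma> k \<xi>)" unfolding Y_def using s by (intro geo_le_sum f xi S) auto
      have Y0: "0 < Y" unfolding Y_def by simp
      have w0: "0 \<le> w" using W[OF xi] by (meson abs_ge_zero order_trans)
      have "W (\<sigma> k \<xi>) - W \<xi> \<le> 2 * w" using W[OF xi] W[OF S] by (simp add: abs_le_iff)
      then have "exp (W (\<sigma> k \<xi>) - W \<xi>) * Y \<le> exp (2 * w) * Y" using Y0 by (intro mult_right_mono) auto
      also have "\<dots> = Y + (exp (2 * w) - 1) * Y" by (simp add: algebra_simps)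
      also have "\<dots> \<le> Y + (exp (2 * w) - 1) * (f \<xi> + f (\<sigma> k \<xi>))" using Y2 w0 by (intro add_left_mono mult_left_mono) auto
      finally have "exp (W (\<sigma> k \<xi>) - W \<xi>) * Y - f \<xi> \<le> s * (- (sqrt (f (\<sigma> k \<xi>)) - sqrt (f \<xi>))\<^sup>2 + (f (\<sigma> k \<xi>) - f \<xi>)) + (exp (2 * w) - 1) * (f \<xi> + f (\<sigma> k \<xi>))"
        using Y1 by linarith
      then show ?thesis unfolding Y_def using c[OF xi k] by (rule mult_left_mono)
    qed simp
  next
    fix \<xi> assume "\<xi> \<in> E" then show "0 \<le> \<mu> \<xi>" using \<mu> less_imp_le by blast
  qed
  also have "\<dots> = s * (- (\<Sum>\<xi>\<in>E. \<mu> \<xi> * (\<Sum>k\<in>K. c k \<xi> * (sqrt (f (\<sigma> k \<xi>)) - sqrt (f \<xi>))\<^sup>2)) + (\<Sum>\<xi>\<in>E. \<mu> \<xi> * jump K c \<sigma> f \<xi>))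
      + (exp (2 * w) - 1) * (\<Sum>\<xi>\<in>E. \<mu> \<xi> * (\<Sum>k\<in>K. c k \<xi> * (f \<xi> + f (\<sigma> k \<xi>))))"
    unfolding jump_def sum_distrib_left sum_negf[symmetric] sum.distrib[symmetric]
    by (intro sum.cong refl) (simp add: algebra_simps)
  finally show ?thesis .
qed

text \<open>The logarithm of the L^p norm of the density of \<phi> with respect to \<mu>, where p = 1 / (1 - s).\<close>
definition Lyap :: "'e set \<Rightarrow> ('e \<Rightarrow> real) \<Rightarrow> ('e \<Rightarrow> real) \<Rightarrow> real \<Rightarrow> real" where
  "Lyap E \<mu> \<phi> s = (1 - s) * ln (\<Sum>\<zeta>\<in>E. exp ((ln (\<phi> \<zeta>) - s * ln (\<mu> \<zeta>)) / (1 - s)))"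

text \<open>The probability weights proportional to \<phi>^p \<mu>^(1-p) with p = 1/(1-s), under
  which the derivative of \<open>Lyap\<close> is an expectation.\<close>

definition tilt :: "'e set \<Rightarrow> ('e \<Rightarrow> real) \<Rightarrow> ('e \<Rightarrow> real) \<Rightarrow> real \<Rightarrow> 'e \<Rightarrow> real" where
  "tilt E \<mu> \<phi> s \<zeta> = exp ((ln (\<phi> \<zeta>) - s * ln (\<mu> \<zeta>)) / (1 - s)) / (\<Sum>\<zeta>\<in>E. exp ((ln (\<phi> \<zeta>) - s * ln (\<mu> \<zeta>)) / (1 - s)))"

text \<open>The moving exponent contributes \<open>s'\<close> times the relative entropy of the
  tilted law with respect to \<mu>; for decreasing \<open>s\<close> this is the negative term that
  absorbs the entropy in the production bound.\<close>

lemma Lyap_deriv: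
  fixes \<mu> \<phi> \<mu>' \<phi>' :: "real \<Rightarrow> 'e \<Rightarrow> real" and s :: "real \<Rightarrow> real"
  assumes E: "finite E" "E \<noteq> {}"
    and \<mu>: "\<And>\<zeta>. \<zeta> \<in> E \<Longrightarrow> ((\<lambda>r. \<mu> r \<zeta>) has_real_derivative \<mu>' r \<zeta>) (at r)" "\<And>\<zeta>. \<zeta> \<in> E \<Longrightarrow> 0 < \<mu> r \<zeta>"
    and \<phi>: "\<And>\<zeta>. \<zeta> \<in> E \<Longrightarrow> ((\<lambda>r. \<phi> r \<zeta>) has_real_derivative \<phi>' r \<zeta>) (at r)" "\<And>\<zeta>. \<zeta> \<in> E \<Longrightarrow> 0 < \<phi> r \<zeta>"
    and s: "(s has_real_derivative s') (at r)" "s r < 1"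
  defines "q \<equiv> tilt E (\<mu> r) (\<phi> r) (s r)"
  shows "((\<lambda>r. Lyap E (\<mu> r) (\<phi> r) (s r)) has_real_derivative
     (\<Sum>\<zeta>\<in>E. q \<zeta> * (\<phi>' r \<zeta> / \<phi> r \<zeta>)) - s r * (\<Sum>\<zeta>\<in>E. q \<zeta> * (\<mu>' r \<zeta> / \<mu> r \<zeta>))
       + s' * (\<Sum>\<zeta>\<in>E. q \<zeta> * ln (q \<zeta> / \<mu> r \<zeta>))) (at r)"
proof -
  define A where "A r \<zeta> = (ln (\<phi> r \<zeta>) - s r * ln (\<mu> r \<zeta>)) / (1 - s r)" for r \<zeta>
  define A' where "A' \<zeta> = (\<phi>' r \<zeta> / \<phi> r \<zeta> - s' * ln (\<mu> r \<zeta>) - s r * (\<mu>' r \<zeta> / \<mu> r \<zeta>) + s' * A r \<zeta>) / (1 - s r)" for \<zeta>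
  define Z where "Z r = (\<Sum>\<zeta>\<in>E. exp (A r \<zeta>))" for r
  have Z0: "Z r > 0" unfolding Z_def using E by (intro sum_pos) auto
  have s1: "1 - s r > 0" using s(2) by simp
  have dA: "((\<lambda>r. A r \<zeta>) has_real_derivative A' \<zeta>) (at r)" if z: "\<zeta> \<in> E" for \<zeta>
    unfolding A_def A'_def
    using \<mu>(2)[OF z] \<phi>(2)[OF z] s1
    by (auto intro!: derivative_eq_intros \<mu>(1)[OF z] \<phi>(1)[OF z] s(1) simp: field_simps)
  have dZ: "(Z has_real_derivative (\<Sum>\<zeta>\<in>E. exp (A r \<zeta>) * A' \<zeta>)) (at r)"
    unfolding Z_def by (auto intro!: derivative_eq_intros dA simp: mult.commute)
  have "((\<lambda>r. (1 - s r) * ln (Z r)) has_real_derivative (- s' * ln (Z r) + (1 - s r) * ((\<Sum>\<zeta>\<in>E. exp (A r \<zeta>) * A' \<zeta>) / Z r))) (at r)"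
    using Z0 by (auto intro!: derivative_eq_intros s(1) dZ simp: field_simps)
  moreover have "(\<lambda>r. Lyap E (\<mu> r) (\<phi> r) (s r)) = (\<lambda>r. (1 - s r) * ln (Z r))"
    unfolding Lyap_def Z_def A_def ..
  moreover have "- s' * ln (Z r) + (1 - s r) * ((\<Sum>\<zeta>\<in>E. exp (A r \<zeta>) * A' \<zeta>) / Z r)
     = (\<Sum>\<zeta>\<in>E. q \<zeta> * (\<phi>' r \<zeta> / \<phi> r \<zeta>)) - s r * (\<Sum>\<zeta>\<in>E. q \<zeta> * (\<mu>' r \<zeta> / \<mu> r \<zeta>))
       + s' * (\<Sum>\<zeta>\<in>E. q \<zeta> * ln (q \<zeta> / \<mu> r \<zeta>))"
  proof -
    have q: "q \<zeta> = exp (A r \<zeta>) / Z r" for \<zeta> unfolding q_def tilt_def A_def Z_def ..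
    have q1: "(\<Sum>\<zeta>\<in>E. q \<zeta>) = 1" unfolding q sum_divide_distrib[symmetric] using Z0 by (simp add: Z_def)
    have lnq: "ln (q \<zeta> / \<mu> r \<zeta>) = A r \<zeta> - ln (Z r) - ln (\<mu> r \<zeta>)" if "\<zeta> \<in> E" for \<zeta>
      unfolding q using Z0 \<mu>(2)[OF that] by (simp add: ln_div ln_mult)
    have "(1 - s r) * ((\<Sum>\<zeta>\<in>E. exp (A r \<zeta>) * A' \<zeta>) / Z r) = (\<Sum>\<zeta>\<in>E. q \<zeta> * ((1 - s r) * A' \<zeta>))"
      unfolding q sum_divide_distrib sum_distrib_left by (intro sum.cong refl) simp
    also have "\<dots> = (\<Sum>\<zeta>\<in>E. q \<zeta> * (\<phi>' r \<zeta> / \<phi> r \<zeta>) - s r * (q \<zeta> * (\<mu>' r \<zeta> / \<mu> r \<zeta>)) + s' * (q \<zeta> * ln (q \<zeta> / \<mu> r \<zeta>)) + s' * ln (Z r) * q \<zeta>)"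
    proof (intro sum.cong refl)
      fix \<zeta> assume z: "\<zeta> \<in> E"
      have e: "(1 - s r) * A' \<zeta> = \<phi>' r \<zeta> / \<phi> r \<zeta> - s' * ln (\<mu> r \<zeta>) - s r * (\<mu>' r \<zeta> / \<mu> r \<zeta>) + s' * A r \<zeta>"
        unfolding A'_def using s1 by simp
      show "q \<zeta> * ((1 - s r) * A' \<zeta>) = q \<zeta> * (\<phi>' r \<zeta> / \<phi> r \<zeta>) - s r * (q \<zeta> * (\<mu>' r \<zeta> / \<mu> r \<zeta>)) + s' * (q \<zeta> * ln (q \<zeta> / \<mu> r \<zeta>)) + s' * ln (Z r) * q \<zeta>"
        unfolding lnq[OF z] e by (simp add: algebra_simps)
    qed
    also have "\<dots> = (\<Sum>\<zeta>\<in>E. q \<zeta> * (\<phi>' r \<zeta> / \<phi> r \<zeta>)) - s r * (\<Sum>\<zeta>\<in>E. q \<zeta> * (\<mu>' r \<zeta> / \<mu> r \<zeta>))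
       + s' * (\<Sum>\<zeta>\<in>E. q \<zeta> * ln (q \<zeta> / \<mu> r \<zeta>)) + s' * ln (Z r)"
      unfolding sum.distrib sum_subtractf sum_distrib_left[symmetric] q1 by simp
    finally show ?thesis by simp
  qed
  ultimately show ?thesis by simp
qed

lemma Lyap_self:
  assumes "finite E" "(\<Sum>\<zeta>\<in>E. \<mu> \<zeta>) = 1" "\<And>\<zeta>. \<zeta> \<in> E \<Longrightarrow> 0 < \<mu> \<zeta>" "s < 1"
  shows "Lyap E \<mu> \<mu> s = 0"
proof -
  have "(\<Sum>\<zeta>\<in>E. exp ((ln (\<mu> \<zeta>) - s * ln (\<mu> \<zeta>)) / (1 - s))) = (\<Sum>\<zeta>\<in>E. \<mu> \<zeta>)"
  proof (intro sum.cong refl)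
    fix \<zeta> assume "\<zeta> \<in> E"
    have "(ln (\<mu> \<zeta>) - s * ln (\<mu> \<zeta>)) / (1 - s) = ln (\<mu> \<zeta>)" using assms(4) by (simp add: field_simps)
    then show "exp ((ln (\<mu> \<zeta>) - s * ln (\<mu> \<zeta>)) / (1 - s)) = \<mu> \<zeta>" using assms(3)[OF \<open>\<zeta> \<in> E\<close>] by simp
  qed
  then show ?thesis unfolding Lyap_def using assms(2) by simp
qed

text \<open>Monotonicity of L^p norms under a probability measure, in logarithmic form; pointwise
  convexity of the exponential takes the place of Hoelder's inequality.\<close>

lemma Lyap_ge:
  assumes E: "finite E" "E \<noteq> {}" and mu1: "(\<Sum>\<zeta>\<in>E. \<mu> \<zeta>) = 1" and \<mu>: "\<And>\<zeta>. \<zeta> \<in> E \<Longrightarrow> 0 < \<mu> \<zeta>"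
    and \<phi>: "\<And>\<zeta>. \<zeta> \<in> E \<Longrightarrow> 0 < \<phi> \<zeta>" and s: "0 \<le> s" "s < 1"
  shows "ln (\<Sum>\<zeta>\<in>E. \<phi> \<zeta>) \<le> Lyap E \<mu> \<phi> s"
proof -
  define A where "A \<zeta> = (ln (\<phi> \<zeta>) - s * ln (\<mu> \<zeta>)) / (1 - s)" for \<zeta>
  define Z where "Z = (\<Sum>\<zeta>\<in>E. exp (A \<zeta>))"
  have Z0: "Z > 0" unfolding Z_def using E by (intro sum_pos) auto
  have pt: "\<phi> \<zeta> \<le> exp ((1 - s) * ln Z) * ((1 - s) * (exp (A \<zeta>) / Z) + s * \<mu> \<zeta>)" if z: "\<zeta> \<in> E" for \<zeta>
  proof -
    have "ln (\<phi> \<zeta>) = (1 - s) * A \<zeta> + s * ln (\<mu> \<zeta>)" unfolding A_def using s by simp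
    then have e: "\<phi> \<zeta> = exp ((1 - s) * ln Z) * exp ((1 - s) * (A \<zeta> - ln Z) + s * ln (\<mu> \<zeta>))"
      using \<phi>[OF z] unfolding exp_add[symmetric] by (metis exp_ln add.assoc distrib_left diff_add_cancel add.commute)
    have "exp ((1 - s) * (A \<zeta> - ln Z) + s * ln (\<mu> \<zeta>)) \<le> (1 - s) * exp (A \<zeta> - ln Z) + s * exp (ln (\<mu> \<zeta>))"
      using convex_onD[OF exp_convex, of s "A \<zeta> - ln Z" "ln (\<mu> \<zeta>)"] s by simp
    also have "\<dots> = (1 - s) * (exp (A \<zeta>) / Z) + s * \<mu> \<zeta>" using Z0 \<mu>[OF z] by (simp add: exp_diff)
    finally show ?thesis using e by (simp add: mult_left_mono)
  qed
  have "(\<Sum>\<zeta>\<in>E. \<phi> \<zeta>) \<le> (\<Sum>\<zeta>\<in>E. exp ((1 - s) * ln Z) * ((1 - s) * (exp (A \<zeta>) / Z) + s * \<mu> \<zeta>))"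
    by (intro sum_mono pt)
  also have "\<dots> = exp ((1 - s) * ln Z) * ((1 - s) * (Z / Z) + s * 1)"
    unfolding sum_distrib_left[symmetric] sum.distrib sum_divide_distrib[symmetric] mu1 Z_def ..
  also have "\<dots> = exp ((1 - s) * ln Z)" using Z0 by simp
  finally have le: "(\<Sum>\<zeta>\<in>E. \<phi> \<zeta>) \<le> exp ((1 - s) * ln Z)" .
  have "(\<Sum>\<zeta>\<in>E. \<phi> \<zeta>) > 0" using E \<phi> by (intro sum_pos) auto
  then have "ln (\<Sum>\<zeta>\<in>E. \<phi> \<zeta>) \<le> (1 - s) * ln Z" using le by (metis ln_exp ln_le_cancel_iff exp_gt_zero)
  then show ?thesis unfolding Lyap_def Z_def A_def .
qed

text \<open>Until the first time some component is no longer positive, all inflows are nonnegative.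
  Hence that component multiplied by \<open>exp (c * r)\<close>, with \<open>c\<close> compensating
  the diagonal entry, cannot fall below its initial value.\<close>

lemma ode_positive:
  fixes X :: "real \<Rightarrow> 'e \<Rightarrow> real" and Q :: "'e \<Rightarrow> 'e \<Rightarrow> real"
  assumes E: "finite E" and off: "\<And>\<xi> \<zeta>. \<xi> \<in> E \<Longrightarrow> \<zeta> \<in> E \<Longrightarrow> \<xi> \<noteq> \<zeta> \<Longrightarrow> 0 \<le> Q \<xi> \<zeta>"
    and d: "\<And>r \<zeta>. \<zeta> \<in> E \<Longrightarrow> ((\<lambda>r. X r \<zeta>) has_real_derivative (\<Sum>\<xi>\<in>E. X r \<xi> * Q \<xi> \<zeta>)) (at r)"
    and init: "\<And>\<zeta>. \<zeta> \<in> E \<Longrightarrow> 0 < X 0 \<zeta>" and r: "0 \<le> r" and z: "\<zeta> \<in> E"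
  shows "0 < X r \<zeta>"
proof (rule ccontr)
  assume neg: "\<not> 0 < X r \<zeta>"
  define S where "S = {t\<in>{0..r}. \<exists>\<zeta>\<in>E. X t \<zeta> \<le> 0}"
  have "S = {0..r} \<inter> (\<Union>\<zeta>\<in>E. {t. X t \<zeta> \<le> 0})" unfolding S_def by auto
  moreover have "closed (\<Union>\<zeta>\<in>E. {t. X t \<zeta> \<le> 0})"
  proof (intro closed_UN E ballI)
    fix \<zeta> assume "\<zeta> \<in> E"
    then have "continuous_on UNIV (\<lambda>t. X t \<zeta>)" using d by (meson DERIV_isCont continuous_at_imp_continuous_on)
    then show "closed {t. X t \<zeta> \<le> 0}" by (intro closed_Collect_le continuous_on_const)
  qed
  ultimately have "compact S" by (simp add: compact_Int_closed)
  moreover have "S \<noteq> {}" using neg r z unfolding S_def by force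
  ultimately obtain t where t: "t \<in> S" "\<And>t'. t' \<in> S \<Longrightarrow> t \<le> t'" using compact_attains_inf by metis
  obtain \<zeta>0 where z0: "\<zeta>0 \<in> E" "X t \<zeta>0 \<le> 0" using t(1) unfolding S_def by auto
  have "t \<noteq> 0" using init[OF z0(1)] z0(2) by auto
  then have tp: "0 < t" "t \<le> r" using t(1) unfolding S_def by auto
  have pos: "0 < X t' \<xi>" if "0 \<le> t'" "t' < t" "\<xi> \<in> E" for t' \<xi>
    using t(2)[of t'] that tp unfolding S_def by force
  define c where "c = \<bar>Q \<zeta>0 \<zeta>0\<bar>"
  have dy: "((\<lambda>r. exp (c * r) * X r \<zeta>0) has_real_derivative exp (c * x) * (c * X x \<zeta>0 + (\<Sum>\<xi>\<in>E. X x \<xi> * Q \<xi> \<zeta>0))) (at x)" for x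
    by (rule derivative_eq_intros d z0 refl)+ (simp add: algebra_simps)
  obtain x where x: "0 < x" "x < t" "exp (c * t) * X t \<zeta>0 - exp (c * 0) * X 0 \<zeta>0 = (t - 0) * (exp (c * x) * (c * X x \<zeta>0 + (\<Sum>\<xi>\<in>E. X x \<xi> * Q \<xi> \<zeta>0)))"
    using MVT2[OF tp(1), of "\<lambda>r. exp (c * r) * X r \<zeta>0" "\<lambda>x. exp (c * x) * (c * X x \<zeta>0 + (\<Sum>\<xi>\<in>E. X x \<xi> * Q \<xi> \<zeta>0))"] dy by blast
  have "(\<Sum>\<xi>\<in>E. X x \<xi> * Q \<xi> \<zeta>0) = X x \<zeta>0 * Q \<zeta>0 \<zeta>0 + (\<Sum>\<xi>\<in>E - {\<zeta>0}. X x \<xi> * Q \<xi> \<zeta>0)"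
    by (rule sum.remove[OF E z0(1)])
  moreover have "0 \<le> (\<Sum>\<xi>\<in>E - {\<zeta>0}. X x \<xi> * Q \<xi> \<zeta>0)"
    using pos x off z0(1) by (intro sum_nonneg mult_nonneg_nonneg) (auto intro: less_imp_le)
  moreover have "0 \<le> X x \<zeta>0 * (c + Q \<zeta>0 \<zeta>0)"
    using pos[of x \<zeta>0] x z0(1) unfolding c_def by (intro mult_nonneg_nonneg) auto
  ultimately have "0 \<le> c * X x \<zeta>0 + (\<Sum>\<xi>\<in>E. X x \<xi> * Q \<xi> \<zeta>0)" by (simp add: algebra_simps)
  then have "0 \<le> exp (c * t) * X t \<zeta>0 - exp (c * 0) * X 0 \<zeta>0" unfolding x(3) using tp by simp
  then have "0 < exp (c * t) * X t \<zeta>0" using init[OF z0(1)] by simp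
  then show False using z0(2) by (simp add: zero_less_mult_iff)
qed

section \<open>Entropy production\<close>

lemma sum_basisZ: "(\<Sum>b\<in>basisZ. h b) = (\<Sum>i\<in>(UNIV::'d::finite set). h (axis i 1 :: int^'d))"
proof -
  have "inj_on (\<lambda>i. axis i 1 :: int^'d) UNIV" by (auto simp: inj_on_def axis_eq_axis)
  then show ?thesis unfolding basisZ_def by (simp add: sum.reindex)
qed

definition rp :: "(real^'d::finite \<Rightarrow> real^'d) \<Rightarrow> nat \<Rightarrow> 'd \<Rightarrow> int^'d \<Rightarrow> real" where
  "rp F n i x = (real n)\<^sup>2 * max (1/2) (1 + Fbn F n (axis i 1) x / real n)"
definition rm :: "(real^'d::finite \<Rightarrow> real^'d) \<Rightarrow> nat \<Rightarrow> 'd \<Rightarrow> int^'d \<Rightarrow> real" where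
  "rm F n i x = (real n)\<^sup>2 * max (1/2) (1 - Fbn F n (axis i 1) x / real n)"

lemma rate_nonneg: "0 \<le> rate F n x y"
  unfolding rate_def by (intro sum_nonneg add_nonneg_nonneg) auto

text \<open>\<open>rate\<close> adds the contributions of all bonds joining two sites, so the double
  sum over sites regroups into a sum over bonds, also on small tori where one pair is joined by
  several bonds.\<close>

lemma rate_sum:
  fixes \<Psi> :: "int^'d::finite \<Rightarrow> int^'d \<Rightarrow> real"
  assumes n: "n \<ge> 1" and \<Psi>: "\<And>x y. \<Psi> x (tmod n y) = \<Psi> x y" "\<And>x y. \<Psi> (tmod n x) y = \<Psi> x y"
  shows "(\<Sum>x\<in>box n. \<Sum>y\<in>box n. rate F n x y * \<Psi> x y)
    = (\<Sum>i\<in>UNIV. \<Sum>x\<in>box n. rp F n i x * \<Psi> x (x + axis i 1) + rm F n i x * \<Psi> (x + axis i 1) x)"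
proof -
  have r: "rate F n x y = (\<Sum>i\<in>UNIV. (if tmod n y = tmod n (x + axis i 1) then rp F n i x else 0)
      + (if tmod n x = tmod n (y + axis i 1) then rm F n i y else 0))" for x y
    unfolding rate_def sum_basisZ rp_def rm_def ..
  have a: "(\<Sum>y\<in>box n. (if tmod n y = tmod n (x + axis i 1) then rp F n i x else 0) * \<Psi> x y) = rp F n i x * \<Psi> x (x + axis i 1)" for x i
  proof -
    have "(\<Sum>y\<in>box n. (if tmod n y = tmod n (x + axis i 1) then rp F n i x else 0) * \<Psi> x y)
      = (\<Sum>y\<in>box n. if y = tmod n (x + axis i 1) then rp F n i x * \<Psi> x y else 0)"
      by (intro sum.cong refl) auto
    then show ?thesis using tmod_in_box[OF n, of "x + axis i 1"] by (simp add: \<Psi>)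
  qed
  have b: "(\<Sum>x\<in>box n. (if tmod n x = tmod n (y + axis i 1) then rm F n i y else 0) * \<Psi> x y) = rm F n i y * \<Psi> (y + axis i 1) y" for y i
  proof -
    have "(\<Sum>x\<in>box n. (if tmod n x = tmod n (y + axis i 1) then rm F n i y else 0) * \<Psi> x y)
      = (\<Sum>x\<in>box n. if x = tmod n (y + axis i 1) then rm F n i y * \<Psi> x y else 0)"
      by (intro sum.cong refl) auto
    then show ?thesis using tmod_in_box[OF n, of "y + axis i 1"] by (simp add: \<Psi>)
  qed
  let ?a = "\<lambda>i x y. (if tmod n y = tmod n (x + axis i 1) then rp F n i x else 0) * \<Psi> x y"
  let ?b = "\<lambda>i x y. (if tmod n x = tmod n (y + axis i 1) then rm F n i y else 0) * \<Psi> x y"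
  have "(\<Sum>x\<in>box n. \<Sum>y\<in>box n. rate F n x y * \<Psi> x y) = (\<Sum>x\<in>box n. \<Sum>y\<in>box n. \<Sum>i\<in>UNIV. ?a i x y + ?b i x y)"
    unfolding r sum_distrib_right distrib_right ..
  also have "\<dots> = (\<Sum>x\<in>box n. \<Sum>i\<in>UNIV. \<Sum>y\<in>box n. ?a i x y + ?b i x y)"
    by (rule sum.cong[OF refl], rule sum.swap)
  also have "\<dots> = (\<Sum>i\<in>UNIV. \<Sum>x\<in>box n. \<Sum>y\<in>box n. ?a i x y + ?b i x y)"
    by (rule sum.swap)
  also have "\<dots> = (\<Sum>i\<in>UNIV. (\<Sum>x\<in>box n. \<Sum>y\<in>box n. ?a i x y) + (\<Sum>y\<in>box n. \<Sum>x\<in>box n. ?b i x y))"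
    unfolding sum.distrib by (intro arg_cong2[where f="(+)"] refl sum.cong[OF refl] sum.swap)
  also have "\<dots> = (\<Sum>i\<in>UNIV. \<Sum>x\<in>box n. rp F n i x * \<Psi> x (x + axis i 1) + rm F n i x * \<Psi> (x + axis i 1) x)"
    unfolding a b sum.distrib ..
  finally show ?thesis .
qed

text \<open>Indexing the jumps by ordered pairs of sites brings the generator into the abstract form
  \<open>jump\<close>.\<close>

definition jc :: "(real^'d::finite \<Rightarrow> real^'d) \<Rightarrow> nat \<Rightarrow> (int^'d) \<times> (int^'d) \<Rightarrow> (int^'d \<Rightarrow> bool) \<Rightarrow> real" where
  "jc F n k \<xi> = rate F n (fst k) (snd k) * (if \<xi> (fst k) \<and> \<not> \<xi> (snd k) then 1 else 0)"
definition js :: "nat \<Rightarrow> (int^'d::finite) \<times> (int^'d) \<Rightarrow> (int^'d \<Rightarrow> bool) \<Rightarrow> int^'d \<Rightarrow> bool" where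
  "js n k \<xi> = swap n \<xi> (fst k) (snd k)"

lemma Lgen_jump: "Lgen F n f \<xi> = jump (box n \<times> box n) (jc F n) (js n) f \<xi>"
  unfolding Lgen_def jump_def jc_def js_def by (simp add: sum.cartesian_product case_prod_unfold)

lemma jump_bonds:
  assumes n: "n \<ge> 1" and O: "\<xi> \<in> Omega n"
  shows "(\<Sum>k\<in>box n \<times> box n. jc F n k \<xi> * h (js n k \<xi>))
    = (\<Sum>i\<in>UNIV. \<Sum>x\<in>box n. (if \<xi> x \<and> \<not> \<xi> (x + axis i 1) then rp F n i x else 0) * h (swap n \<xi> x (x + axis i 1))
       + (if \<xi> (x + axis i 1) \<and> \<not> \<xi> x then rm F n i x else 0) * h (swap n \<xi> x (x + axis i 1)))"
proof -
  have "(\<Sum>k\<in>box n \<times> box n. jc F n k \<xi> * h (js n k \<xi>))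
    = (\<Sum>x\<in>box n. \<Sum>y\<in>box n. rate F n x y * ((if \<xi> x \<and> \<not> \<xi> y then 1 else 0) * h (swap n \<xi> x y)))"
    unfolding jc_def js_def by (simp add: sum.cartesian_product case_prod_unfold mult.assoc)
  also have "\<dots> = (\<Sum>i\<in>UNIV. \<Sum>x\<in>box n. rp F n i x * ((if \<xi> x \<and> \<not> \<xi> (x + axis i 1) then 1 else 0) * h (swap n \<xi> x (x + axis i 1)))
      + rm F n i x * ((if \<xi> (x + axis i 1) \<and> \<not> \<xi> x then 1 else 0) * h (swap n \<xi> (x + axis i 1) x)))"
  proof (rule rate_sum[OF n])
    have t: "swap n \<xi> x (tmod n y) = swap n \<xi> x y" for x y
      unfolding swap_def by (simp add: OmegaD[OF O])
    show "(if \<xi> x \<and> \<not> \<xi> (tmod n y) then 1 else 0) * h (swap n \<xi> x (tmod n y)) = (if \<xi> x \<and> \<not> \<xi> y then 1 else 0) * h (swap n \<xi> x y)" for x y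
      by (simp add: OmegaD[OF O] t)
    show "(if \<xi> (tmod n x) \<and> \<not> \<xi> y then 1 else 0) * h (swap n \<xi> (tmod n x) y) = (if \<xi> x \<and> \<not> \<xi> y then 1 else 0) * h (swap n \<xi> x y)" for x y
      by (simp add: OmegaD[OF O] swap_tmod_left[OF O])
  qed
  finally show ?thesis unfolding swap_commute[OF O, of "_ + axis _ 1"]
    by (simp add: if_distrib[of "\<lambda>a. _ * a"] mult.assoc[symmetric] cong: if_cong)
qed

context tor
begin

text \<open>The bound on \<open>Fbn\<close> makes the truncation at 1/2 in the rates inactive; the
  coefficient from \<open>bond_generator\<close> is then the current \<open>cur\<close> of the
  profile.\<close>

lemma Em_Lgen:
  assumes "\<And>x i. x \<in> box n \<Longrightarrow> \<bar>Fbn F n (axis i 1) x\<bar> \<le> real n / 2"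
  shows "Em (Lgen F n f) = (\<Sum>i\<in>UNIV. \<Sum>x\<in>box n.
    ((real n)\<^sup>2 * (U x - U (x + axis i 1)) + real n * Fbn F n (axis i 1) x * (U x + U (x + axis i 1) - 2 * U x * U (x + axis i 1)))
      * Em (\<lambda>\<xi>. f \<xi> * bet \<xi> x (x + axis i 1)))"
proof -
  have N0: "real n > 0" using n1 by simp
  have "Em (Lgen F n f) = Em (\<lambda>\<xi>. \<Sum>i\<in>UNIV. \<Sum>x\<in>box n. (if \<xi> x \<and> \<not> \<xi> (x + axis i 1) then rp F n i x else 0) * (f (swap n \<xi> x (x + axis i 1)) - f \<xi>)
       + (if \<xi> (x + axis i 1) \<and> \<not> \<xi> x then rm F n i x else 0) * (f (swap n \<xi> x (x + axis i 1)) - f \<xi>))"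
    by (rule Em_cong) (simp add: Lgen_jump jump_def jump_bonds[OF n1, where h="\<lambda>\<zeta>. f \<zeta> - f _"])
  also have "\<dots> = (\<Sum>i\<in>UNIV. \<Sum>x\<in>box n. (rp F n i x * (U x * (1 - U (x + axis i 1))) - rm F n i x * ((1 - U x) * U (x + axis i 1)))
      * Em (\<lambda>\<xi>. f \<xi> * bet \<xi> x (x + axis i 1)))"
    unfolding Em_sum bond_generator ..
  also have "\<dots> = (\<Sum>i\<in>UNIV. \<Sum>x\<in>box n.
    ((real n)\<^sup>2 * (U x - U (x + axis i 1)) + real n * Fbn F n (axis i 1) x * (U x + U (x + axis i 1) - 2 * U x * U (x + axis i 1)))
      * Em (\<lambda>\<xi>. f \<xi> * bet \<xi> x (x + axis i 1)))"
  proof (intro sum.cong refl arg_cong2[where f="(*)"])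
    fix i :: 'd and x :: "int^'d" assume x: "x \<in> box n"
    have b: "\<bar>Fbn F n (axis i 1) x / real n\<bar> \<le> 1/2" using assms[OF x, of i] N0 by (simp add: abs_divide divide_le_eq)
    have b': "- (1/2) \<le> Fbn F n (axis i 1) x / real n" "Fbn F n (axis i 1) x / real n \<le> 1/2"
      using b unfolding abs_le_iff by linarith+
    have m: "max (1/2) (1 + Fbn F n (axis i 1) x / real n) = 1 + Fbn F n (axis i 1) x / real n"
      "max (1/2) (1 - Fbn F n (axis i 1) x / real n) = 1 - Fbn F n (axis i 1) x / real n"
      using b' by (intro max_absorb2; linarith)+
    show "rp F n i x * (U x * (1 - U (x + axis i 1))) - rm F n i x * ((1 - U x) * U (x + axis i 1))
      = (real n)\<^sup>2 * (U x - U (x + axis i 1)) + real n * Fbn F n (axis i 1) x * (U x + U (x + axis i 1) - 2 * U x * U (x + axis i 1))"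
      unfolding rp_def rm_def m using N0 by (simp add: field_simps power2_eq_square)
  qed
  finally show ?thesis .
qed

text \<open>The truncation bounds every rate below by half of n^2. Only the jumps along one
  orientation of each bond are kept, in line with \<open>bdir\<close>.\<close>

lemma Em_dissip:
  assumes f: "\<And>\<xi>. \<xi> \<in> Omega n \<Longrightarrow> 0 \<le> f \<xi>"
  shows "(real n)\<^sup>2 / 2 * (\<Sum>i\<in>UNIV. dirS f i) \<le> Em (\<lambda>\<xi>. \<Sum>k\<in>box n \<times> box n. jc F n k \<xi> * (sqrt (f (js n k \<xi>)) - sqrt (f \<xi>))\<^sup>2)"
proof -
  have "(real n)\<^sup>2 / 2 * (\<Sum>i\<in>UNIV. dirS f i) = (\<Sum>i\<in>UNIV. \<Sum>x\<in>box n. Em (\<lambda>\<xi>. (if \<xi> x \<and> \<not> \<xi> (x + axis i 1) then (real n)\<^sup>2 / 2 else 0) * (sqrt (f (swap n \<xi> x (x + axis i 1))) - sqrt (f \<xi>))\<^sup>2))"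
    unfolding dirS_def sum_distrib_left
  proof (intro sum.cong refl)
    fix i :: 'd and x :: "int^'d"
    have "Em (\<lambda>\<xi>. (if \<xi> x \<and> \<not> \<xi> (x + axis i 1) then (real n)\<^sup>2 / 2 else 0) * (sqrt (f (swap n \<xi> x (x + axis i 1))) - sqrt (f \<xi>))\<^sup>2)
      = (\<Sum>\<xi>\<in>B10 x (x + axis i 1). muU n U \<xi> * ((real n)\<^sup>2 / 2 * (sqrt (f (swap n \<xi> x (x + axis i 1))) - sqrt (f \<xi>))\<^sup>2))"
      unfolding Em_def B10_def using finO by (intro sum.mono_neutral_cong_right) auto
    then show "(real n)\<^sup>2 / 2 * bdir f x (x + axis i 1) = Em (\<lambda>\<xi>. (if \<xi> x \<and> \<not> \<xi> (x + axis i 1) then (real n)\<^sup>2 / 2 else 0) * (sqrt (f (swap n \<xi> x (x + axis i 1))) - sqrt (f \<xi>))\<^sup>2)"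
      unfolding bdir_def sum_distrib_left by (simp add: mult_ac)
  qed
  also have "\<dots> \<le> (\<Sum>i\<in>UNIV. \<Sum>x\<in>box n. Em (\<lambda>\<xi>. (if \<xi> x \<and> \<not> \<xi> (x + axis i 1) then rp F n i x else 0) * (sqrt (f (swap n \<xi> x (x + axis i 1))) - sqrt (f \<xi>))\<^sup>2
      + (if \<xi> (x + axis i 1) \<and> \<not> \<xi> x then rm F n i x else 0) * (sqrt (f (swap n \<xi> x (x + axis i 1))) - sqrt (f \<xi>))\<^sup>2))"
  proof (intro sum_mono Em_mono)
    fix i :: 'd and x :: "int^'d" and \<xi>
    have r: "(real n)\<^sup>2 / 2 \<le> rp F n i x" "0 \<le> rm F n i x" unfolding rp_def rm_def
      using mult_left_mono[of "1/2" "max (1/2) (1 + Fbn F n (axis i 1) x / real n)" "(real n)\<^sup>2"] by auto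
    define Y where "Y = (sqrt (f (swap n \<xi> x (x + axis i 1))) - sqrt (f \<xi>))\<^sup>2"
    have Y: "(real n)\<^sup>2 / 2 * Y \<le> rp F n i x * Y" "0 \<le> rm F n i x * Y"
      using r unfolding Y_def by (intro mult_right_mono mult_nonneg_nonneg; simp)+
    show "(if \<xi> x \<and> \<not> \<xi> (x + axis i 1) then (real n)\<^sup>2 / 2 else 0) * (sqrt (f (swap n \<xi> x (x + axis i 1))) - sqrt (f \<xi>))\<^sup>2
      \<le> (if \<xi> x \<and> \<not> \<xi> (x + axis i 1) then rp F n i x else 0) * (sqrt (f (swap n \<xi> x (x + axis i 1))) - sqrt (f \<xi>))\<^sup>2
      + (if \<xi> (x + axis i 1) \<and> \<not> \<xi> x then rm F n i x else 0) * (sqrt (f (swap n \<xi> x (x + axis i 1))) - sqrt (f \<xi>))\<^sup>2"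
      unfolding Y_def[symmetric] using Y by auto
  qed
  also have "\<dots> = Em (\<lambda>\<xi>. \<Sum>i\<in>UNIV. \<Sum>x\<in>box n. (if \<xi> x \<and> \<not> \<xi> (x + axis i 1) then rp F n i x else 0) * (sqrt (f (swap n \<xi> x (x + axis i 1))) - sqrt (f \<xi>))\<^sup>2
      + (if \<xi> (x + axis i 1) \<and> \<not> \<xi> x then rm F n i x else 0) * (sqrt (f (swap n \<xi> x (x + axis i 1))) - sqrt (f \<xi>))\<^sup>2)"
    unfolding Em_sum ..
  also have "\<dots> = Em (\<lambda>\<xi>. \<Sum>k\<in>box n \<times> box n. jc F n k \<xi> * (sqrt (f (js n k \<xi>)) - sqrt (f \<xi>))\<^sup>2)"
    by (rule Em_cong) (simp add: jump_bonds[OF n1, where h="\<lambda>\<zeta>. (sqrt (f \<zeta>) - sqrt (f _))\<^sup>2"])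
  finally show ?thesis .
qed

end

section \<open>Sizes of the blocks\<close>

lemma block_scales:
  fixes d :: nat and \<alpha> :: nat
  assumes d: "1 \<le> d" "d \<le> 3" and n: "2 * (\<alpha> + 5) + 32 \<le> n"
  shows "\<exists>m M :: nat. 1 \<le> m \<and> m + \<alpha> + 3 \<le> n \<and> 1 \<le> M \<and> M + \<alpha> + 3 \<le> n \<and>
    real n ^ d / (real n)\<^sup>2 * (real m + real M / real m) + real n ^ d / (real m * real M ^ (d - 1)) \<le> 5 * real n powr (real d / 2 - 1/10)"
proof -
  define v where "v = real n"
  have v: "v \<ge> 32" unfolding v_def using n by simp
  \<comment> \<open>With 3/5 for the other sides, this makes the volume term n^d / (m M^(d-1)) of
    order exactly n^(d/2 - 1/10). The first lengthening has exponent (9 d - 13)/10, which is at most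
    d/2 - 1/10 = (5 d - 1)/10 precisely for d <= 3.\<close>
  define a where "a = (7 - real d) / 10"
  have a: "0 < a" "a \<le> 3/5" unfolding a_def using d by auto
  define m where "m = nat \<lceil>v powr a\<rceil>"
  define M where "M = nat \<lceil>v powr (3/5)\<rceil>"
  have ge1: "1 \<le> v powr a" "1 \<le> v powr (3/5)" using v a by (auto intro!: ge_one_powr_ge_zero)
  have m: "v powr a \<le> real m" "real m \<le> 2 * v powr a" unfolding m_def using ge1 by linarith+
  have M: "v powr (3/5) \<le> real M" "real M \<le> v powr (3/5) + 1" "real M \<le> 2 * v powr (3/5)" unfolding M_def using ge1 by linarith+
  have mM: "m \<le> M" unfolding m_def M_def using v a by (intro nat_mono ceiling_mono powr_mono) auto
  have m1: "1 \<le> m" "1 \<le> M" using m(1) M(1) ge1 by linarith+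
  \<comment> \<open>The threshold 32 is 2^5, so its power is computable; it yields 2 v^(3/5) <= v,
    which leaves room for the margin \<alpha> + 3.\<close>
  have "v powr (2/5) \<ge> 32 powr (2/5)" using v by (intro powr_mono2) auto
  moreover have "(32::real) powr (2/5) = 4"
  proof -
    have "(32::real) = 2 powr 5" by (simp add: powr_numeral)
    then have "(32::real) powr (2/5) = 2 powr 2" by (simp add: powr_powr)
    then show ?thesis by (simp add: powr_numeral)
  qed
  moreover have "v = v powr (3/5) * v powr (2/5)" using v by (simp add: powr_add[symmetric])
  moreover have "v powr (3/5) * 2 \<le> v powr (3/5) * v powr (2/5)" using calculation by (intro mult_left_mono) auto
  ultimately have "2 * v powr (3/5) \<le> v" by linarith
  moreover have "2 * (real \<alpha> + 5) + 32 \<le> v" using of_nat_mono[OF n, where 'a=real] unfolding v_def by simp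
  moreover define p where "p = v powr (3/5)"
  ultimately have "real M + real \<alpha> + 3 \<le> v" using M(2) unfolding p_def[symmetric] by argo
  then have "real M + real \<alpha> + 3 \<le> real n" unfolding v_def .
  then have Mn: "M + \<alpha> + 3 \<le> n" by linarith
  have vd: "v ^ d = v powr real d" using v by (simp add: powr_realpow)
  have v2: "v\<^sup>2 = v powr 2" using v by (simp add: powr_numeral)
  let ?R = "v powr (real d / 2 - 1/10)"
  have pm: "v powr x \<le> ?R" if "x \<le> real d / 2 - 1/10" for x using v that by (intro powr_mono) auto
  have base: "v ^ d / v\<^sup>2 = v powr (real d - 2)" unfolding vd v2 by (simp add: powr_diff)
  have dr: "1 \<le> real d" "real d \<le> 3" using d by auto
  have ex: "real d - 2 + a \<le> real d / 2 - 1/10" "real d - 2 + (3/5 - a) \<le> real d / 2 - 1/10"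
    unfolding a_def using dr by (simp_all add: field_simps)
  have t1: "v ^ d / v\<^sup>2 * real m \<le> 2 * ?R"
  proof -
    have "v ^ d / v\<^sup>2 * real m \<le> v powr (real d - 2) * (2 * v powr a)" unfolding base using m by (intro mult_left_mono) auto
    also have "\<dots> = 2 * v powr (real d - 2 + a)" by (simp add: powr_add)
    also have "\<dots> \<le> 2 * ?R" using pm[OF ex(1)] by simp
    finally show ?thesis .
  qed
  have t2: "v ^ d / v\<^sup>2 * (real M / real m) \<le> 2 * ?R"
  proof -
    have "real M / real m \<le> 2 * v powr (3/5) / v powr a" using m(1) M(3) ge1 m1 by (intro frac_le) auto
    also have "\<dots> = 2 * v powr (3/5 - a)" by (simp add: powr_diff)
    finally have "v ^ d / v\<^sup>2 * (real M / real m) \<le> v powr (real d - 2) * (2 * v powr (3/5 - a))" unfolding base by (intro mult_left_mono) auto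
    also have "\<dots> = 2 * v powr (real d - 2 + (3/5 - a))" by (simp only: powr_add mult.left_commute)
    also have "\<dots> \<le> 2 * ?R" using pm[OF ex(2)] by simp
    finally show ?thesis .
  qed
  have t3: "v ^ d / (real m * real M ^ (d - 1)) \<le> ?R"
  proof -
    have "v powr a * (v powr (3/5)) ^ (d - 1) \<le> real m * real M ^ (d - 1)"
      using m(1) M(1) by (intro mult_mono power_mono) auto
    moreover have "v powr a * (v powr (3/5)) ^ (d - 1) = v powr (a + 3/5 * (real d - 1))"
    proof -
      have "(v powr (3/5)) ^ (d - 1) = (v powr (3/5)) powr real (d - 1)" using v by (simp add: powr_realpow)
      also have "\<dots> = v powr (3/5 * real (d - 1))" by (rule powr_powr)
      also have "real (d - 1) = real d - 1" using d by (simp add: of_nat_diff)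
      finally show ?thesis by (simp only: powr_add)
    qed
    ultimately have "v ^ d / (real m * real M ^ (d - 1)) \<le> v powr real d / v powr (a + 3/5 * (real d - 1))"
      unfolding vd using v m1 by (intro divide_left_mono) auto
    also have "\<dots> = v powr (real d - (a + 3/5 * (real d - 1)))" by (simp add: powr_diff)
    also have "\<dots> \<le> ?R" by (rule pm) (simp add: a_def field_simps)
    finally show ?thesis .
  qed
  have "v ^ d / v\<^sup>2 * (real m + real M / real m) + v ^ d / (real m * real M ^ (d - 1)) \<le> 5 * ?R"
    using t1 t2 t3 by (simp add: distrib_left)
  then show ?thesis using m1 Mn mM unfolding v_def by (intro exI[of _ m] exI[of _ M]) auto
qed

lemma xr_tmod:
  assumes "n \<ge> 1"
  shows "xr n x = xr n (tmod n x) + ivec (\<chi> i. x $ i div int n)"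
proof -
  have "real_of_int (x $ i) / real n = real_of_int (x $ i mod int n) / real n + real_of_int (x $ i div int n)" for i
  proof -
    have "real_of_int (x $ i) = real_of_int (x $ i div int n * int n + x $ i mod int n)" by simp
    also have "\<dots> = real_of_int (x $ i div int n) * real n + real_of_int (x $ i mod int n)"
      unfolding of_int_add of_int_mult by simp
    finally show ?thesis using assms by (simp add: field_simps)
  qed
  then show ?thesis unfolding vec_eq_iff xr_def tmod_def ivec_def by simp
qed

lemma (in tor) power_div_square: "real n ^ CARD('d) / (real n)\<^sup>2 = real n powr (real CARD('d) - 2)"
  using n1 by (simp add: powr_diff powr_realpow powr_numeral)

section \<open>The entropy production estimate\<close>

context pde
begin

lemma u_tmod: "n \<ge> 1 \<Longrightarrow> t \<in> {0..T} \<Longrightarrow> u t (xr n (tmod n x)) = u t (xr n x)"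
  unfolding xr_tmod[of n x] using per_ivec[of "u t"] u_per by simp

lemma Fbn_tmod: "n \<ge> 1 \<Longrightarrow> Fbn F n b (tmod n x) = Fbn F n b x"
proof -
  assume n: "n \<ge> 1"
  have "F (xr n x + y) = F (xr n (tmod n x) + y)" for y
  proof -
    have "F ((xr n (tmod n x) + y) + ivec (\<chi> i. x $ i div int n)) = F (xr n (tmod n x) + y)"
      by (rule per_ivec) (use F_per in auto)
    then show ?thesis unfolding xr_tmod[OF n, of x] by (simp add: add_ac)
  qed
  then show ?thesis unfolding Fbn_def by simp
qed

lemma tor_u:
  assumes "n \<ge> 1" "t \<in> {0..T}" "\<epsilon> > 0" "\<And>x. \<epsilon> \<le> u t x \<and> u t x \<le> 1 - \<epsilon>"
  shows "tor n (\<lambda>x. u t (xr n x)) \<epsilon>"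
  by unfold_locales (use assms u_tmod in auto)

text \<open>The first two terms are the entropy production of f relative to the moving product measure;
  the jump rates are at least \<open>n\<^sup>2 / 2\<close>, so the dissipation absorbs the Dirichlet term.\<close>
definition production_le :: "(int^'d) set \<Rightarrow> 'd \<Rightarrow> real \<Rightarrow> nat \<Rightarrow> real \<Rightarrow> real \<Rightarrow> bool" where
  "production_le A j K n C R \<longleftrightarrow> (\<forall>t\<in>{0..T}. \<forall>f H. tor.dens n (\<lambda>x. u t (xr n x)) f \<longrightarrow> (\<forall>x\<in>box n. \<bar>H x\<bar> \<le> K) \<longrightarrow>
     tor.Em n (\<lambda>x. u t (xr n x)) (Lgen F n f)
      - tor.Em n (\<lambda>x. u t (xr n x)) (\<lambda>\<xi>. f \<xi> * (\<Sum>x\<in>box n. dd (1, 0) g (t, xr n x) * omU (\<lambda>x. u t (xr n x)) \<xi> x))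
      + tor.Em n (\<lambda>x. u t (xr n x)) (\<lambda>\<xi>. f \<xi> * (\<Sum>x\<in>box n. H x * tor.za (\<lambda>x. u t (xr n x)) A \<xi> x * omU (\<lambda>x. u t (xr n x)) \<xi> (x + axis j 1)))
     \<le> (real n)\<^sup>2 / 2 * (\<Sum>i\<in>UNIV. tor.dirS n (\<lambda>x. u t (xr n x)) f i) + C * (tor.Ent n (\<lambda>x. u t (xr n x)) f + R))"

lemma production_leD:
  assumes "production_le A j K n C R"
  shows "t \<in> {0..T} \<Longrightarrow> tor.dens n (\<lambda>x. u t (xr n x)) f \<Longrightarrow> (\<forall>x\<in>box n. \<bar>H x\<bar> \<le> K) \<Longrightarrow>
     tor.Em n (\<lambda>x. u t (xr n x)) (Lgen F n f)
      - tor.Em n (\<lambda>x. u t (xr n x)) (\<lambda>\<xi>. f \<xi> * (\<Sum>x\<in>box n. dd (1, 0) g (t, xr n x) * omU (\<lambda>x. u t (xr n x)) \<xi> x))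
      + tor.Em n (\<lambda>x. u t (xr n x)) (\<lambda>\<xi>. f \<xi> * (\<Sum>x\<in>box n. H x * tor.za (\<lambda>x. u t (xr n x)) A \<xi> x * omU (\<lambda>x. u t (xr n x)) \<xi> (x + axis j 1)))
     \<le> (real n)\<^sup>2 / 2 * (\<Sum>i\<in>UNIV. tor.dirS n (\<lambda>x. u t (xr n x)) f i) + C * (tor.Ent n (\<lambda>x. u t (xr n x)) f + R)"
  using assms unfolding production_le_def by blast

text \<open>Shifting one index in the mean of the generator collects the linear terms into the
  discrete divergence of the current, whose distance from the time derivative of u costs only
  n^(d-2) by \<open>dens_lin\<close>. The quadratic remainder, current times density increment, is
  again a field of the kind treated by \<open>main_estimate\<close>, with \<open>A\<close> the
  origin, one for each direction.\<close>

lemma production_bound: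
  fixes A :: "(int^'d) set" and j :: 'd
  assumes dim: "CARD('d) \<le> 3" and A: "finite A" "A \<noteq> {}" "\<And>a i. a \<in> A \<Longrightarrow> a $ i \<le> 0" and K: "K > 0"
    and eps: "\<epsilon> > 0" "\<And>t x. t \<in> {0..T} \<Longrightarrow> \<epsilon> \<le> u t x \<and> u t x \<le> 1 - \<epsilon>"
  shows "\<exists>C>0. \<exists>n0\<ge>1. \<forall>n\<ge>n0. production_le A j K n C (real n powr (real CARD('d) / 2 - 1/10))"
proof -
  obtain B where B: "B > 0" "\<And>t n x. t \<in> {0..T} \<Longrightarrow> n \<ge> 1 \<Longrightarrow> x \<in> box n \<Longrightarrow>
     (\<forall>i. \<bar>u t (xr n (x + axis i 1)) - u t (xr n x)\<bar> \<le> B / real n) \<and>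
     (\<forall>i. \<bar>Fbn F n (axis i 1) x\<bar> \<le> B) \<and>
     \<bar>(\<Sum>i\<in>UNIV. cur u F n t i (x - axis i 1) - cur u F n t i x) - dd (1, 0) g (t, xr n x)\<bar> \<le> B / real n"
    using consistency by blast
  have "\<exists>\<alpha>::nat. \<forall>a\<in>A. \<forall>l. - int \<alpha> \<le> a $ l"
  proof -
    have fin: "finite ((\<lambda>(a,l). nat (- (a $ l))) ` (A \<times> UNIV))" using A(1) by simp
    define \<alpha> where "\<alpha> = Max (insert 0 ((\<lambda>(a,l). nat (- (a $ l))) ` (A \<times> UNIV)))"
    have "nat (- (a $ l)) \<le> \<alpha>" if "a \<in> A" for a l
      unfolding \<alpha>_def using fin that by (intro Max_ge) (auto intro!: image_eqI[of _ _ "(a,l)"])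
    then have "- int \<alpha> \<le> a $ l" if "a \<in> A" for a l using that by (metis minus_le_iff nat_le_iff)
    then show ?thesis by blast
  qed
  then obtain \<alpha> :: nat where \<alpha>: "\<And>a l. a \<in> A \<Longrightarrow> - int \<alpha> \<le> a $ l \<and> a $ l \<le> 0" using A(3) by blast
  define d where "d = CARD('d)"
  have d1: "1 \<le> d" unfolding d_def by (simp add: Suc_leI)
  \<comment> \<open>\<open>main_estimate\<close> is used d + 1 times, once for each direction and
    once for the field of \<open>H\<close>; the shares of the Dirichlet form add up to 1/2.\<close>
  define \<delta> where "\<delta> = 1 / (2 * (real d + 1))"
  have \<delta>: "\<delta> > 0" "(real d + 1) * \<delta> = 1/2" unfolding \<delta>_def by (auto simp: field_simps)
  \<comment> \<open>The current is at most 2 n B and the density increment at most B / n, so their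
    product stays bounded.\<close>
  define K1 where "K1 = 2 * B * B"
  have K1: "K1 > 0" unfolding K1_def using B(1) by simp
  define a1 where "a1 = tor.C1 \<epsilon> \<delta> B K1 1"
  define a2 where "a2 = tor.C2 \<epsilon> \<delta> B K1 1"
  define b1 where "b1 = tor.C1 \<epsilon> \<delta> B K (card A)"
  define b2 where "b2 = tor.C2 \<epsilon> \<delta> B K (card A)"
  define CE where "CE = 1 + real d * (real d + 1) * a1 + (real d + 1) * b1"
  define CR where "CR = (1/\<epsilon>)\<^sup>2 * B\<^sup>2 + real d * (real d + 1) * (5 * a2) + (real d + 1) * (5 * b2)"
  define C where "C = \<bar>CE\<bar> + \<bar>CR\<bar> + 1"
  \<comment> \<open>Room for the blocks of \<open>block_scales\<close>, and 2 B <= n so that the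
    rates are not truncated.\<close>
  define n0 where "n0 = 2 * (\<alpha> + 5) + 32 + nat \<lceil>2 * B\<rceil>"
  show ?thesis
    unfolding production_le_def
  proof (intro exI[of _ C] exI[of _ n0] conjI allI impI ballI)
    show "C > 0" unfolding C_def by linarith
    show "1 \<le> n0" unfolding n0_def by simp
    fix n t and f :: "(int^'d \<Rightarrow> bool) \<Rightarrow> real" and H :: "int^'d \<Rightarrow> real"
    assume n: "n0 \<le> n" and t: "t \<in> {0..T}" and f: "tor.dens n (\<lambda>x. u t (xr n x)) f" and H: "\<forall>x\<in>box n. \<bar>H x\<bar> \<le> K"
    have n1: "1 \<le> n" and nA: "2 * (\<alpha> + 5) + 32 \<le> n" using n unfolding n0_def by auto
    have nB: "2 * B \<le> real n" using n unfolding n0_def by linarith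
    have N0: "real n > 0" using n1 by simp
    define U where "U x = u t (xr n x)" for x :: "int^'d"
    have U: "U = (\<lambda>x. u t (xr n x))" unfolding U_def ..
    interpret t: tor n U \<epsilon> unfolding U by (rule tor_u[OF n1 t eps(1) eps(2)[OF t]])
    have f: "t.dens f" using f unfolding U .
    define R where "R = real n powr (real d / 2 - 1/10)"
    have R0: "R \<ge> 0" unfolding R_def by simp
    have Ent0: "t.Ent f \<ge> 0" by (rule t.Ent_nonneg[OF f])
    obtain m M :: nat where mM: "1 \<le> m" "m + \<alpha> + 3 \<le> n" "1 \<le> M" "M + \<alpha> + 3 \<le> n"
      and sc: "real n ^ d / (real n)\<^sup>2 * (real m + real M / real m) + real n ^ d / (real m * real M ^ (d - 1)) \<le> 5 * R"
      using block_scales[OF d1 _ nA] dim unfolding d_def R_def by blast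
    have lip: "\<bar>U (y + axis i 1) - U y\<bar> \<le> B / real n" for y i
    proof -
      have "\<bar>U (tmod n y + axis i 1) - U (tmod n y)\<bar> \<le> B / real n"
        using B(2)[OF t n1 tmod_in_box[OF n1, of y]] unfolding U_def by blast
      moreover have "U (tmod n y + axis i 1) = U (y + axis i 1)" by (metis t.Uper tmod_add_left)
      ultimately show ?thesis using t.Uper by simp
    qed
    define cu where "cu i x = cur u F n t i x" for i x
    have cu_eq: "cu i x = (real n)\<^sup>2 * (U x - U (x + axis i 1)) + real n * Fbn F n (axis i 1) x * (U x + U (x + axis i 1) - 2 * U x * U (x + axis i 1))" for i x
      unfolding cu_def cur_def U_def ..
    have cu_tmod: "cu i (tmod n x) = cu i x" for i x
    proof -
      have "U (tmod n x + axis i 1) = U (x + axis i 1)" by (metis t.Uper tmod_add_left)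
      then show ?thesis unfolding cu_eq Fbn_tmod[OF n1] t.Uper by simp
    qed
    define D where "D i x = U (x + axis i 1) - U x" for i x
    let ?om = "omU U"
    have gen: "t.Em (Lgen F n f) = (\<Sum>i\<in>UNIV. \<Sum>x\<in>box n. cu i x * t.Em (\<lambda>\<xi>. f \<xi> * t.bet \<xi> x (x + axis i 1)))"
      unfolding cu_eq
    proof (rule t.Em_Lgen)
      fix x :: "int^'d" and i assume x: "x \<in> box n"
      have "\<bar>Fbn F n (axis i 1) x\<bar> \<le> B" using B(2)[OF t n1 x] by blast
      then show "\<bar>Fbn F n (axis i 1) x\<bar> \<le> real n / 2" using nB by linarith
    qed
    also have "\<dots> = t.Em (\<lambda>\<xi>. f \<xi> * (\<Sum>x\<in>box n. (\<Sum>i\<in>UNIV. cu i (x - axis i 1) - cu i x) * ?om \<xi> x))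
       + (\<Sum>i\<in>UNIV. t.Em (\<lambda>\<xi>. f \<xi> * (\<Sum>x\<in>box n. (cu i x * D i x) * t.za {0} \<xi> x * ?om \<xi> (x + axis i 1))))"
      unfolding t.Em_sum[symmetric] t.Em_cmult[symmetric] t.Em_add[symmetric]
    proof (rule t.Em_cong)
      fix \<xi> :: "int^'d \<Rightarrow> bool" assume O: "\<xi> \<in> Omega n"
      have sh: "(\<Sum>x\<in>box n. cu i x * ?om \<xi> (x + axis i 1)) = (\<Sum>x\<in>box n. cu i (x - axis i 1) * ?om \<xi> x)" for i
      proof -
        have "(\<Sum>x\<in>box n. cu i ((x + axis i 1) - axis i 1) * ?om \<xi> (x + axis i 1)) = (\<Sum>x\<in>box n. cu i (x - axis i 1) * ?om \<xi> x)"
        proof (rule sum_shift[OF n1, of "\<lambda>x. cu i (x - axis i 1) * ?om \<xi> x"])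
          fix x :: "int^'d"
          have "cu i (tmod n x - axis i 1) = cu i (x - axis i 1)" by (metis cu_tmod tmod_diff_left)
          then show "cu i (tmod n x - axis i 1) * ?om \<xi> (tmod n x) = cu i (x - axis i 1) * ?om \<xi> x"
            using t.omU_per[OF O] by simp
        qed
        then show ?thesis by simp
      qed
      have "(\<Sum>i\<in>UNIV. \<Sum>x\<in>box n. cu i x * (f \<xi> * t.bet \<xi> x (x + axis i 1)))
        = (\<Sum>i\<in>UNIV. f \<xi> * ((\<Sum>x\<in>box n. cu i x * ?om \<xi> (x + axis i 1)) - (\<Sum>x\<in>box n. cu i x * ?om \<xi> x))
           + f \<xi> * (\<Sum>x\<in>box n. (cu i x * D i x) * t.za {0} \<xi> x * ?om \<xi> (x + axis i 1)))"
        unfolding sum_subtractf[symmetric] sum_distrib_left sum.distrib[symmetric]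
        by (intro sum.cong refl) (simp add: t.bet_def D_def t.za_def algebra_simps)
      also have "\<dots> = f \<xi> * (\<Sum>i\<in>UNIV. \<Sum>x\<in>box n. (cu i (x - axis i 1) - cu i x) * ?om \<xi> x)
           + (\<Sum>i\<in>UNIV. f \<xi> * (\<Sum>x\<in>box n. (cu i x * D i x) * t.za {0} \<xi> x * ?om \<xi> (x + axis i 1)))"
        unfolding sh sum.distrib sum_distrib_left[symmetric] left_diff_distrib sum_subtractf ..
      also have "(\<Sum>i\<in>UNIV. \<Sum>x\<in>box n. (cu i (x - axis i 1) - cu i x) * ?om \<xi> x)
          = (\<Sum>x\<in>box n. (\<Sum>i\<in>UNIV. cu i (x - axis i 1) - cu i x) * ?om \<xi> x)"
        unfolding sum_distrib_right by (rule sum.swap)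
      finally show "(\<Sum>i\<in>UNIV. \<Sum>x\<in>box n. cu i x * (f \<xi> * t.bet \<xi> x (x + axis i 1)))
        = f \<xi> * (\<Sum>x\<in>box n. (\<Sum>i\<in>UNIV. cu i (x - axis i 1) - cu i x) * ?om \<xi> x)
           + (\<Sum>i\<in>UNIV. f \<xi> * (\<Sum>x\<in>box n. (cu i x * D i x) * t.za {0} \<xi> x * ?om \<xi> (x + axis i 1)))" .
    qed
    finally have gen2: "t.Em (Lgen F n f) = t.Em (\<lambda>\<xi>. f \<xi> * (\<Sum>x\<in>box n. (\<Sum>i\<in>UNIV. cu i (x - axis i 1) - cu i x) * ?om \<xi> x))
       + (\<Sum>i\<in>UNIV. t.Em (\<lambda>\<xi>. f \<xi> * (\<Sum>x\<in>box n. (cu i x * D i x) * t.za {0} \<xi> x * ?om \<xi> (x + axis i 1))))" .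
    define c where "c x = (\<Sum>i\<in>UNIV. cu i (x - axis i 1) - cu i x) - dd (1, 0) g (t, xr n x)" for x
    have lin: "t.Em (\<lambda>\<xi>. f \<xi> * (\<Sum>x\<in>box n. (\<Sum>i\<in>UNIV. cu i (x - axis i 1) - cu i x) * ?om \<xi> x))
      = t.Em (\<lambda>\<xi>. f \<xi> * (\<Sum>x\<in>box n. c x * ?om \<xi> x)) + t.Em (\<lambda>\<xi>. f \<xi> * (\<Sum>x\<in>box n. dd (1, 0) g (t, xr n x) * ?om \<xi> x))"
      unfolding t.Em_add[symmetric] distrib_left[symmetric] sum.distrib[symmetric] c_def by (simp add: left_diff_distrib)
    have lin2: "t.Em (\<lambda>\<xi>. f \<xi> * (\<Sum>x\<in>box n. c x * ?om \<xi> x)) \<le> t.Ent f + (1/\<epsilon>)\<^sup>2 * B\<^sup>2 * R"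
    proof -
      have "(\<Sum>x\<in>box n. (c x)\<^sup>2) \<le> (\<Sum>x\<in>(box n :: (int^'d) set). (B / real n)\<^sup>2)"
      proof (rule sum_mono)
        fix x :: "int^'d" assume "x \<in> box n"
        then have "\<bar>c x\<bar> \<le> B / real n" using B(2)[OF t n1] unfolding c_def cu_def by blast
        then show "(c x)\<^sup>2 \<le> (B / real n)\<^sup>2" by (metis abs_ge_zero power2_abs power_mono)
      qed
      also have "\<dots> = B\<^sup>2 * (real n ^ d / (real n)\<^sup>2)" unfolding d_def by (simp add: card_box power_divide)
      also have "\<dots> \<le> B\<^sup>2 * R"
      proof (rule mult_left_mono)
        have "real n ^ d / (real n)\<^sup>2 = real n powr (real d - 2)" unfolding d_def by (rule t.power_div_square)
        also have "\<dots> \<le> R" unfolding R_def using n1 dim d1 unfolding d_def by (intro powr_mono) auto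
        finally show "real n ^ d / (real n)\<^sup>2 \<le> R" .
      qed simp
      finally have "(1/\<epsilon>)\<^sup>2 * (\<Sum>x\<in>box n. (c x)\<^sup>2) \<le> (1/\<epsilon>)\<^sup>2 * (B\<^sup>2 * R)" by (rule mult_left_mono) simp
      then show ?thesis using t.dens_lin[OF f, of c] by simp
    qed
    define Dir where "Dir = (\<Sum>i\<in>UNIV. t.dirS f i)"
    have quad: "t.Em (\<lambda>\<xi>. f \<xi> * (\<Sum>x\<in>box n. (cu i x * D i x) * t.za {0} \<xi> x * ?om \<xi> (x + axis i 1)))
      \<le> \<delta> * (real n)\<^sup>2 * Dir + (real d + 1) * (a1 * t.Ent f + a2 * (5 * R))" for i
    proof -
      have "t.Em (\<lambda>\<xi>. f \<xi> * (\<Sum>x\<in>box n. (cu i x * D i x) * t.za {0} \<xi> x * ?om \<xi> (x + axis i 1)))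
        \<le> \<delta> * (real n)\<^sup>2 * Dir + (real CARD('d) + 1) * (t.C1 \<delta> B K1 (card {0::int^'d}) * t.Ent f + t.C2 \<delta> B K1 (card {0::int^'d}) *
          (real n ^ CARD('d) / (real n)\<^sup>2 * (real m + real M / real m) + real n ^ CARD('d) / (real m * real M ^ (CARD('d) - 1))))"
        unfolding Dir_def
      proof (rule t.main_estimate[OF f _ _ _ _ K1 mM lip _ \<delta>(1)])
        show "- int \<alpha> \<le> a $ l \<and> a $ l \<le> 0" if "a \<in> {0}" for a :: "int^'d" and l using that by simp
        show "\<bar>cu i x * D i x\<bar> \<le> K1" if x: "x \<in> box n" for x
        proof -
          have u: "0 \<le> U x * (1 - U (x + axis i 1))" "0 \<le> U (x + axis i 1) * (1 - U x)"
            "0 \<le> U x * U (x + axis i 1)" "0 \<le> (1 - U x) * (1 - U (x + axis i 1))"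
            using t.U01[of x] t.U01[of "x + axis i 1"] by auto
          have "\<bar>U x + U (x + axis i 1) - 2 * U x * U (x + axis i 1)\<bar> \<le> 1"
            using u unfolding abs_le_iff by (simp add: algebra_simps)
          then have "\<bar>Fbn F n (axis i 1) x\<bar> * \<bar>U x + U (x + axis i 1) - 2 * U x * U (x + axis i 1)\<bar> \<le> B * 1"
            using B(2)[OF t n1 x] B(1) by (intro mult_mono) auto
          then have "\<bar>real n * Fbn F n (axis i 1) x * (U x + U (x + axis i 1) - 2 * U x * U (x + axis i 1))\<bar> \<le> real n * B"
            using N0 by (simp add: abs_mult mult.assoc)
          moreover have "\<bar>(real n)\<^sup>2 * (U x - U (x + axis i 1))\<bar> \<le> (real n)\<^sup>2 * (B / real n)"
            using lip[of x i] unfolding abs_mult by (intro mult_mono) (auto simp: abs_minus_commute)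
          moreover have "(real n)\<^sup>2 * (B / real n) = real n * B" using N0 by (simp add: power2_eq_square)
          ultimately have "\<bar>cu i x\<bar> \<le> 2 * (real n * B)" unfolding cu_eq by linarith
          then have "\<bar>cu i x\<bar> * \<bar>D i x\<bar> \<le> 2 * (real n * B) * (B / real n)"
            using lip[of x i] B(1) unfolding D_def by (intro mult_mono) auto
          also have "\<dots> = K1" unfolding K1_def using N0 by simp
          finally show ?thesis by (simp add: abs_mult)
        qed
      qed (use B(1) in auto)
      also have "\<dots> \<le> \<delta> * (real n)\<^sup>2 * Dir + (real d + 1) * (a1 * t.Ent f + a2 * (5 * R))"
      proof -
        have "0 \<le> a2" unfolding a2_def t.C2_def using t.c_pos(1)[of 1] less_imp_le[OF t.c_pos(3)] \<delta>(1) eps(1)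
          by (intro add_nonneg_nonneg mult_nonneg_nonneg divide_nonneg_nonneg) auto
        then have "a2 * (real n ^ d / (real n)\<^sup>2 * (real m + real M / real m) + real n ^ d / (real m * real M ^ (d - 1))) \<le> a2 * (5 * R)"
          by (rule mult_left_mono[OF sc])
        moreover have "card {0::int^'d} = 1" by simp
        ultimately show ?thesis unfolding d_def[symmetric] a1_def[symmetric] a2_def[symmetric]
          by (simp only: a1_def[symmetric] a2_def[symmetric]) (rule add_left_mono, rule mult_left_mono, rule add_left_mono, assumption, simp)
      qed
      finally show ?thesis .
    qed
    have V: "t.Em (\<lambda>\<xi>. f \<xi> * (\<Sum>x\<in>box n. H x * t.za A \<xi> x * ?om \<xi> (x + axis j 1)))
      \<le> \<delta> * (real n)\<^sup>2 * Dir + (real d + 1) * (b1 * t.Ent f + b2 * (5 * R))"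
    proof -
      have "t.Em (\<lambda>\<xi>. f \<xi> * (\<Sum>x\<in>box n. H x * t.za A \<xi> x * ?om \<xi> (x + axis j 1)))
        \<le> \<delta> * (real n)\<^sup>2 * Dir + (real CARD('d) + 1) * (t.C1 \<delta> B K (card A) * t.Ent f + t.C2 \<delta> B K (card A) *
          (real n ^ CARD('d) / (real n)\<^sup>2 * (real m + real M / real m) + real n ^ CARD('d) / (real m * real M ^ (CARD('d) - 1))))"
        unfolding Dir_def
        by (rule t.main_estimate[OF f A(1,2) \<alpha> _ K mM lip _ \<delta>(1)]) (use B(1) H in auto)
      also have "\<dots> \<le> \<delta> * (real n)\<^sup>2 * Dir + (real d + 1) * (b1 * t.Ent f + b2 * (5 * R))"
      proof -
        have "0 \<le> b2" unfolding b2_def t.C2_def using t.c_pos(1) less_imp_le[OF t.c_pos(3)] \<delta>(1) eps(1)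
          by (intro add_nonneg_nonneg mult_nonneg_nonneg divide_nonneg_nonneg) auto
        then have "b2 * (real n ^ d / (real n)\<^sup>2 * (real m + real M / real m) + real n ^ d / (real m * real M ^ (d - 1))) \<le> b2 * (5 * R)"
          by (rule mult_left_mono[OF sc])
        then show ?thesis unfolding d_def[symmetric] b1_def[symmetric] b2_def[symmetric]
          by - (rule add_left_mono, rule mult_left_mono, rule add_left_mono, assumption, simp)
      qed
      finally show ?thesis .
    qed
    have "(\<Sum>i\<in>UNIV. t.Em (\<lambda>\<xi>. f \<xi> * (\<Sum>x\<in>box n. (cu i x * D i x) * t.za {0} \<xi> x * ?om \<xi> (x + axis i 1))))
      \<le> (\<Sum>i\<in>(UNIV::'d set). \<delta> * (real n)\<^sup>2 * Dir + (real d + 1) * (a1 * t.Ent f + a2 * (5 * R)))"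
      by (intro sum_mono quad)
    also have "\<dots> = real d * (\<delta> * (real n)\<^sup>2 * Dir) + real d * ((real d + 1) * (a1 * t.Ent f + a2 * (5 * R)))"
      unfolding d_def by (simp add: distrib_left)
    finally have quads: "(\<Sum>i\<in>UNIV. t.Em (\<lambda>\<xi>. f \<xi> * (\<Sum>x\<in>box n. (cu i x * D i x) * t.za {0} \<xi> x * ?om \<xi> (x + axis i 1))))
      \<le> real d * (\<delta> * (real n)\<^sup>2 * Dir) + real d * ((real d + 1) * (a1 * t.Ent f + a2 * (5 * R)))" .
    define LHS where "LHS = t.Em (Lgen F n f) - t.Em (\<lambda>\<xi>. f \<xi> * (\<Sum>x\<in>box n. dd (1, 0) g (t, xr n x) * ?om \<xi> x))
       + t.Em (\<lambda>\<xi>. f \<xi> * (\<Sum>x\<in>box n. H x * t.za A \<xi> x * ?om \<xi> (x + axis j 1)))"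
    have "LHS \<le> (t.Ent f + (1/\<epsilon>)\<^sup>2 * B\<^sup>2 * R) + (real d * (\<delta> * (real n)\<^sup>2 * Dir) + real d * ((real d + 1) * (a1 * t.Ent f + a2 * (5 * R))))
       + (\<delta> * (real n)\<^sup>2 * Dir + (real d + 1) * (b1 * t.Ent f + b2 * (5 * R)))"
      unfolding LHS_def using gen2 lin lin2 quads V by linarith
    also have "\<dots> = ((real d + 1) * \<delta>) * ((real n)\<^sup>2 * Dir) + (CE * t.Ent f + CR * R)"
      unfolding CE_def CR_def by (simp add: algebra_simps)
    also have "\<dots> \<le> (real n)\<^sup>2 / 2 * Dir + C * (t.Ent f + R)"
    proof -
      have "CE * t.Ent f \<le> C * t.Ent f" "CR * R \<le> C * R"
        unfolding C_def using Ent0 R0 by (intro mult_right_mono; linarith)+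
      then show ?thesis unfolding \<delta>(2) by (simp add: distrib_left)
    qed
    finally show "tor.Em n (\<lambda>x. u t (xr n x)) (Lgen F n f)
      - tor.Em n (\<lambda>x. u t (xr n x)) (\<lambda>\<xi>. f \<xi> * (\<Sum>x\<in>box n. dd (1, 0) g (t, xr n x) * omU (\<lambda>x. u t (xr n x)) \<xi> x))
      + tor.Em n (\<lambda>x. u t (xr n x)) (\<lambda>\<xi>. f \<xi> * (\<Sum>x\<in>box n. H x * tor.za (\<lambda>x. u t (xr n x)) A \<xi> x * omU (\<lambda>x. u t (xr n x)) \<xi> (x + axis j 1)))
     \<le> (real n)\<^sup>2 / 2 * (\<Sum>i\<in>UNIV. tor.dirS n (\<lambda>x. u t (xr n x)) f i)
       + C * (tor.Ent n (\<lambda>x. u t (xr n x)) f + real n powr (real CARD('d) / 2 - 1/10))"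
      unfolding LHS_def Dir_def R_def d_def U .
  qed
qed

end

section \<open>The transition semigroup\<close>

context
  fixes F :: "real^'d::finite \<Rightarrow> real^'d" and n :: nat
  assumes n1: "n \<ge> 1"
begin

lemma qpow_bound:
  fixes \<xi> \<zeta> :: "int^'d \<Rightarrow> bool"
  defines "B \<equiv> (\<Sum>\<xi>\<in>Omega n. \<Sum>\<zeta>\<in>Omega n. \<bar>Qmat F n \<xi> \<zeta>\<bar>)"
  assumes "\<zeta> \<in> Omega n"
  shows "\<bar>qpow F n k \<xi> \<zeta>\<bar> \<le> B ^ k"
  using assms(2)
proof (induction k arbitrary: \<zeta>)
  case 0 then show ?case by simp
next
  case (Suc k)
  have B0: "B \<ge> 0" unfolding B_def by (intro sum_nonneg) auto
  have "\<bar>qpow F n (Suc k) \<xi> \<zeta>\<bar> \<le> (\<Sum>\<zeta>'\<in>Omega n. \<bar>qpow F n k \<xi> \<zeta>' * Qmat F n \<zeta>' \<zeta>\<bar>)" by simp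
  also have "\<dots> \<le> (\<Sum>\<zeta>'\<in>Omega n. B ^ k * \<bar>Qmat F n \<zeta>' \<zeta>\<bar>)"
    unfolding abs_mult by (intro sum_mono mult_right_mono Suc.IH) auto
  also have "\<dots> = B ^ k * (\<Sum>\<zeta>'\<in>Omega n. \<bar>Qmat F n \<zeta>' \<zeta>\<bar>)" by (simp add: sum_distrib_left)
  also have "\<dots> \<le> B ^ k * B"
  proof (rule mult_left_mono)
    show "(\<Sum>\<zeta>'\<in>Omega n. \<bar>Qmat F n \<zeta>' \<zeta>\<bar>) \<le> B"
      unfolding B_def using Suc.prems finite_Omega[OF n1]
      by (intro sum_mono member_le_sum[of \<zeta> "Omega n" "\<lambda>\<zeta>. \<bar>Qmat F n _ \<zeta>\<bar>"]) auto
  qed (use B0 in simp)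
  finally show ?case by (simp only: power_Suc2)
qed

lemma qpow_summable:
  fixes \<xi> \<zeta> :: "int^'d \<Rightarrow> bool"
  assumes "\<zeta> \<in> Omega n"
  shows "summable (\<lambda>k. qpow F n k \<xi> \<zeta> / fact k * t ^ k)"
proof -
  define B where "B = (\<Sum>\<xi>\<in>(Omega n :: (int^'d \<Rightarrow> bool) set). \<Sum>\<zeta>\<in>Omega n. \<bar>Qmat F n \<xi> \<zeta>\<bar>)"
  show ?thesis
  proof (rule summable_comparison_test[OF _ summable_exp[of "B * \<bar>t\<bar>"]], intro exI[of _ 0] allI impI)
    fix k :: nat
    have "\<bar>qpow F n k \<xi> \<zeta>\<bar> \<le> B ^ k" unfolding B_def by (rule qpow_bound[OF assms])
    then have "\<bar>qpow F n k \<xi> \<zeta>\<bar> / fact k * \<bar>t\<bar> ^ k \<le> B ^ k / fact k * \<bar>t\<bar> ^ k"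
      by (intro mult_right_mono divide_right_mono) auto
    then show "norm (qpow F n k \<xi> \<zeta> / fact k * t ^ k) \<le> inverse (fact k) * (B * \<bar>t\<bar>) ^ k"
      by (simp add: abs_mult power_abs power_mult_distrib field_simps)
  qed
qed

text \<open>Termwise differentiation of the exponential series gives the forward Kolmogorov
  equation.\<close>

lemma ptrans_deriv:
  fixes \<xi> \<zeta> :: "int^'d \<Rightarrow> bool"
  assumes z: "\<zeta> \<in> Omega n"
  shows "((\<lambda>t. ptrans F n t \<xi> \<zeta>) has_real_derivative (\<Sum>\<zeta>'\<in>Omega n. ptrans F n t \<xi> \<zeta>' * Qmat F n \<zeta>' \<zeta>)) (at t)"
proof -
  define c where "c \<zeta> k = qpow F n k \<xi> \<zeta> / fact k" for \<zeta> k
  have pt: "ptrans F n t \<xi> \<zeta> = (\<Sum>k. c \<zeta> k * t ^ k)" for t \<zeta> unfolding ptrans_def c_def by (simp add: mult.commute)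
  have sm: "summable (\<lambda>k. c \<zeta> k * t ^ k)" if "\<zeta> \<in> Omega n" for \<zeta> t unfolding c_def by (rule qpow_summable[OF that])
  have "((\<lambda>t. \<Sum>k. c \<zeta> k * t ^ k) has_real_derivative (\<Sum>k. diffs (c \<zeta>) k * t ^ k)) (at t)"
    by (rule termdiffs_strong_converges_everywhere[OF sm[OF z]])
  moreover have "(\<Sum>k. diffs (c \<zeta>) k * t ^ k) = (\<Sum>k. \<Sum>\<zeta>'\<in>Omega n. (c \<zeta>' k * t ^ k) * Qmat F n \<zeta>' \<zeta>)"
  proof (rule suminf_cong)
    fix k
    have "diffs (c \<zeta>) k = qpow F n (Suc k) \<xi> \<zeta> / fact k" unfolding diffs_def c_def by (simp add: fact_Suc del: qpow.simps of_nat_Suc)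
    also have "\<dots> = (\<Sum>\<zeta>'\<in>Omega n. c \<zeta>' k * Qmat F n \<zeta>' \<zeta>)" unfolding c_def by (simp add: sum_divide_distrib)
    finally have e: "diffs (c \<zeta>) k = (\<Sum>\<zeta>'\<in>Omega n. c \<zeta>' k * Qmat F n \<zeta>' \<zeta>)" .
    show "diffs (c \<zeta>) k * t ^ k = (\<Sum>\<zeta>'\<in>Omega n. (c \<zeta>' k * t ^ k) * Qmat F n \<zeta>' \<zeta>)"
      unfolding e sum_distrib_right by (intro sum.cong refl) (simp add: mult_ac)
  qed
  moreover have "\<dots> = (\<Sum>\<zeta>'\<in>Omega n. \<Sum>k. (c \<zeta>' k * t ^ k) * Qmat F n \<zeta>' \<zeta>)"
    by (rule suminf_sum) (intro summable_mult2 sm)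
  moreover have "\<dots> = (\<Sum>\<zeta>'\<in>Omega n. ptrans F n t \<xi> \<zeta>' * Qmat F n \<zeta>' \<zeta>)"
    unfolding pt by (intro sum.cong refl suminf_mult2[symmetric] sm)
  ultimately show ?thesis unfolding pt by simp
qed

lemma ptrans_zero: "ptrans F n 0 \<xi> \<zeta> = (if \<xi> = \<zeta> then 1 else 0)"
  unfolding ptrans_def using powser_zero[of "\<lambda>k. qpow F n k \<xi> \<zeta> / fact k"] by (simp add: mult.commute)

lemma Qmat_Lgen:
  assumes "\<xi> \<in> Omega n"
  shows "(\<Sum>\<zeta>\<in>Omega n. Qmat F n \<xi> \<zeta> * h \<zeta>) = Lgen F n h (\<xi> :: int^'d \<Rightarrow> bool)"
proof -
  have fO: "finite (Omega n :: (int^'d \<Rightarrow> bool) set)" by (rule finite_Omega[OF n1])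
  have d: "(\<Sum>\<zeta>\<in>Omega n. (if \<xi>' = \<zeta> then 1 else 0) * h \<zeta>) = h \<xi>'" if "\<xi>' \<in> Omega n" for \<xi>'
    using that fO by (simp add: if_distrib[of "\<lambda>a. a * _"] cong: if_cong)
  have "(\<Sum>\<zeta>\<in>Omega n. Qmat F n \<xi> \<zeta> * h \<zeta>) = (\<Sum>\<zeta>\<in>Omega n. \<Sum>k\<in>box n \<times> box n. jc F n k \<xi> * ((if js n k \<xi> = \<zeta> then 1 else 0) * h \<zeta> - (if \<xi> = \<zeta> then 1 else 0) * h \<zeta>))"
    unfolding Qmat_def Lgen_jump jump_def sum_distrib_right by (intro sum.cong refl) (simp add: algebra_simps)
  also have "\<dots> = (\<Sum>k\<in>box n \<times> box n. \<Sum>\<zeta>\<in>Omega n. jc F n k \<xi> * ((if js n k \<xi> = \<zeta> then 1 else 0) * h \<zeta> - (if \<xi> = \<zeta> then 1 else 0) * h \<zeta>))"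
    by (rule sum.swap)
  also have "\<dots> = (\<Sum>k\<in>box n \<times> box n. jc F n k \<xi> * (h (js n k \<xi>) - h \<xi>))"
    unfolding sum_distrib_left[symmetric] sum_subtractf
    by (intro sum.cong refl arg_cong2[where f="(*)"] arg_cong2[where f="(-)"] d assms)
       (simp add: js_def swap_Omega[OF assms])
  finally show ?thesis unfolding Lgen_jump jump_def .
qed

lemma Qmat_off: "\<xi> \<noteq> \<zeta> \<Longrightarrow> 0 \<le> Qmat F n \<xi> \<zeta>"
  unfolding Qmat_def Lgen_def using rate_nonneg by (intro sum_nonneg mult_nonneg_nonneg) auto

text \<open>\<phi> is an unnormalised law carried forward in time, not an observable.\<close>

definition evol :: "((int^'d \<Rightarrow> bool) \<Rightarrow> real) \<Rightarrow> real \<Rightarrow> (int^'d \<Rightarrow> bool) \<Rightarrow> real" where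
  "evol \<phi> t \<zeta> = (\<Sum>\<xi>\<in>Omega n. \<phi> \<xi> * ptrans F n t \<xi> \<zeta>)"

lemma evol_deriv:
  assumes "\<zeta> \<in> Omega n"
  shows "((\<lambda>t. evol \<phi> t \<zeta>) has_real_derivative (\<Sum>\<xi>\<in>Omega n. evol \<phi> t \<xi> * Qmat F n \<xi> \<zeta>)) (at t)"
proof -
  have "((\<lambda>t. evol \<phi> t \<zeta>) has_real_derivative (\<Sum>\<xi>\<in>Omega n. \<phi> \<xi> * (\<Sum>\<zeta>'\<in>Omega n. ptrans F n t \<xi> \<zeta>' * Qmat F n \<zeta>' \<zeta>))) (at t)"
    unfolding evol_def by (intro DERIV_sum DERIV_cmult ptrans_deriv assms)
  moreover have "(\<Sum>\<xi>\<in>Omega n. \<phi> \<xi> * (\<Sum>\<zeta>'\<in>Omega n. ptrans F n t \<xi> \<zeta>' * Qmat F n \<zeta>' \<zeta>)) = (\<Sum>\<xi>\<in>Omega n. evol \<phi> t \<xi> * Qmat F n \<xi> \<zeta>)"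
    unfolding evol_def sum_distrib_left sum_distrib_right by (subst sum.swap) (simp add: mult.assoc)
  ultimately show ?thesis by simp
qed

lemma evol_zero: "\<zeta> \<in> Omega n \<Longrightarrow> evol \<phi> 0 \<zeta> = \<phi> \<zeta>"
  unfolding evol_def ptrans_zero using finite_Omega[OF n1, where 'd='d] by (simp add: if_distrib[of "\<lambda>a. _ * a"] cong: if_cong)

lemma evol_pos:
  assumes "\<And>\<zeta>. \<zeta> \<in> Omega n \<Longrightarrow> 0 < \<phi> \<zeta>" "0 \<le> t" "\<zeta> \<in> Omega n"
  shows "0 < evol \<phi> t \<zeta>"
  by (rule ode_positive[OF finite_Omega[OF n1] Qmat_off evol_deriv _ assms(2,3)]) (use assms(1) evol_zero in auto)

end

section \<open>The Lyapunov functional over one mesh interval\<close>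

context pde
begin

text \<open>Logarithmic derivative of a product: the factor at \<open>x\<close> contributes the time
  derivative of u times 1/u or -1/(1-u), and this factor is the normalised occupation
  variable.\<close>

lemma muU_deriv:
  assumes t: "tor n (\<lambda>x. u r (xr n x)) \<epsilon>"
  shows "((\<lambda>t. muU n (\<lambda>x. u t (xr n x)) \<zeta>) has_real_derivative
     muU n (\<lambda>x. u r (xr n x)) \<zeta> * (\<Sum>x\<in>box n. dd (1, 0) g (r, xr n x) * omU (\<lambda>x. u r (xr n x)) \<zeta> x)) (at r)"
proof -
  interpret t: tor n "\<lambda>x. u r (xr n x)" \<epsilon> by (rule t)
  let ?f = "\<lambda>x t. if \<zeta> x then u t (xr n x) else 1 - u t (xr n x)"
  let ?f' = "\<lambda>x. if \<zeta> x then dd (1, 0) g (r, xr n x) else - dd (1, 0) g (r, xr n x)"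
  have d: "(?f x has_real_derivative ?f' x) (at r)" for x
    using time_d[of "xr n x" r] by (auto intro!: derivative_eq_intros)
  have "((\<lambda>t. \<Prod>x\<in>box n. ?f x t) has_real_derivative (\<Sum>x\<in>box n. ?f' x * (\<Prod>y\<in>box n - {x}. ?f y r))) (at r)"
    by (rule has_field_derivative_prod) (rule d)
  moreover have "(\<Sum>x\<in>box n. ?f' x * (\<Prod>y\<in>box n - {x}. ?f y r))
     = (\<Prod>x\<in>box n. ?f x r) * (\<Sum>x\<in>box n. dd (1, 0) g (r, xr n x) * omU (\<lambda>x. u r (xr n x)) \<zeta> x)"
    unfolding sum_distrib_left
  proof (intro sum.cong refl)
    fix x :: "int^'d" assume x: "x \<in> box n"
    have p: "(\<Prod>x\<in>box n. ?f x r) = ?f x r * (\<Prod>y\<in>box n - {x}. ?f y r)" by (rule prod.remove[OF finite_box x])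
    have "?f x r * (dd (1, 0) g (r, xr n x) * omU (\<lambda>x. u r (xr n x)) \<zeta> x) = ?f' x"
      using t.U01[of x] t.omU_T[of \<zeta> x] t.omU_F[of \<zeta> x] by (cases "\<zeta> x") auto
    then show "?f' x * (\<Prod>y\<in>box n - {x}. ?f y r) = (\<Prod>x\<in>box n. ?f x r) * (dd (1, 0) g (r, xr n x) * omU (\<lambda>x. u r (xr n x)) \<zeta> x)"
      unfolding p by (simp add: mult_ac)
  qed
  ultimately show ?thesis unfolding muU_def by simp
qed

lemma muU_lower:
  assumes t: "tor n U \<epsilon>"
  shows "\<epsilon> ^ card (box n :: (int^'d) set) \<le> muU n (U :: int^'d \<Rightarrow> real) \<zeta>"
proof -
  interpret t: tor n U \<epsilon> by (rule t)
  have "(\<Prod>x\<in>(box n :: (int^'d) set). \<epsilon>) \<le> muU n U \<zeta>"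
    unfolding muU_def using t.Ulow t.Uup t.eps by (intro prod_mono) (auto simp: algebra_simps)
  then show ?thesis by simp
qed

text \<open>The derivative of the functional is at most \<open>s\<close> times the production bound
  plus \<open>s'\<close> times the entropy, up to errors; \<open>s' = - C * s\<close> cancels the
  entropy and leaves \<open>C * R\<close>. The bound \<open>vle\<close> is required at every time of
  the interval since the reference measure moves while \<open>v\<close> is frozen. \<open>X\<close>
  may be huge but does not depend on \<open>h\<close>, and its factor becomes small with the
  mesh.\<close>

lemma Lyap_step:
  fixes A :: "(int^'d) set" and j :: 'd and \<phi> v :: "(int^'d \<Rightarrow> bool) \<Rightarrow> real"
  assumes n1: "n \<ge> 1" and eps: "\<epsilon> > 0" "\<And>t x. t \<in> {0..T} \<Longrightarrow> \<epsilon> \<le> u t x \<and> u t x \<le> 1 - \<epsilon>"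
    and a: "0 \<le> a" "0 < h" "a + h \<le> T" and C: "C > 0" and \<delta>: "\<delta> = exp (- C * T) / 2" and R: "R \<ge> 0"
    and pb: "production_le A j K n C R"
    and \<phi>: "\<And>\<zeta>. \<zeta> \<in> Omega n \<Longrightarrow> 0 < \<phi> \<zeta>"
    and v: "\<And>\<zeta>. \<zeta> \<in> Omega n \<Longrightarrow> h * \<bar>v \<zeta>\<bar> \<le> w"
    and vle: "\<And>r \<zeta>. a \<le> r \<Longrightarrow> r \<le> a + h \<Longrightarrow> \<zeta> \<in> Omega n \<Longrightarrow>
      v \<zeta> \<le> \<delta> * (\<Sum>x\<in>box n. Hb x * tor.za (\<lambda>x. u r (xr n x)) A \<zeta> x * omU (\<lambda>x. u r (xr n x)) \<zeta> (x + axis j 1)) + e"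
    and Hb: "\<forall>x\<in>box n. \<bar>Hb x\<bar> \<le> K"
  defines "X \<equiv> (\<Sum>k\<in>(box n :: (int^'d) set) \<times> box n. rate F n (fst k) (snd k)) * (2 / \<epsilon> ^ card (box n :: (int^'d) set))"
  shows "Lyap (Omega n) (muU n (\<lambda>x. u (a + h) (xr n x))) (\<lambda>\<zeta>. exp (h * v \<zeta>) * evol F n \<phi> h \<zeta>) (exp (- C * (a + h)) / 2)
    \<le> Lyap (Omega n) (muU n (\<lambda>x. u a (xr n x))) \<phi> (exp (- C * a) / 2) + h * (C * R + e + (exp (2 * w) - 1) * X)"
    and "\<And>\<zeta>. \<zeta> \<in> Omega n \<Longrightarrow> 0 < exp (h * v \<zeta>) * evol F n \<phi> h \<zeta>"
proof -
  define E where "E = (Omega n :: (int^'d \<Rightarrow> bool) set)"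
  have fE: "finite E" unfolding E_def by (rule finite_Omega[OF n1])
  have neE: "E \<noteq> {}" unfolding E_def Omega_def by auto
  have w0: "w \<ge> 0"
  proof -
    obtain \<zeta> where "\<zeta> \<in> E" using neE by auto
    then have "h * \<bar>v \<zeta>\<bar> \<le> w" using v unfolding E_def by auto
    moreover have "0 \<le> h * \<bar>v \<zeta>\<bar>" using a by simp
    ultimately show ?thesis by linarith
  qed
  \<comment> \<open>Interpolates between \<phi> and the next step of the flow: the semigroup runs
    while the exponential weight, applied after it, grows with the elapsed time.\<close>
  define ph where "ph r \<zeta> = exp ((r - a) * v \<zeta>) * evol F n \<phi> (r - a) \<zeta>" for r \<zeta>
  define ph' where "ph' r \<zeta> = v \<zeta> * ph r \<zeta> + exp ((r - a) * v \<zeta>) * (\<Sum>\<xi>\<in>E. evol F n \<phi> (r - a) \<xi> * Qmat F n \<xi> \<zeta>)" for r \<zeta>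
  define s where "s r = exp (- C * r) / 2" for r
  define mu where "mu r = muU n (\<lambda>x. u r (xr n x))" for r
  define mu' where "mu' r \<zeta> = mu r \<zeta> * (\<Sum>x\<in>box n. dd (1, 0) g (r, xr n x) * omU (\<lambda>x. u r (xr n x)) \<zeta> x)" for r \<zeta>
  have ph_pos: "0 < ph r \<zeta>" if "a \<le> r" "\<zeta> \<in> E" for r \<zeta>
    unfolding ph_def using that \<phi> by (intro mult_pos_pos evol_pos[OF n1]) (auto simp: E_def)
  then show "0 < exp (h * v \<zeta>) * evol F n \<phi> h \<zeta>" if "\<zeta> \<in> Omega n" for \<zeta>
    using ph_pos[of "a + h" \<zeta>] that a unfolding ph_def E_def by simp
  have dph: "((\<lambda>r. ph r \<zeta>) has_real_derivative ph' r \<zeta>) (at r)" if z: "\<zeta> \<in> E" for r \<zeta>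
  proof -
    have "((\<lambda>r. evol F n \<phi> (r - a) \<zeta>) has_real_derivative (\<Sum>\<xi>\<in>E. evol F n \<phi> (r - a) \<xi> * Qmat F n \<xi> \<zeta>) * 1) (at r)"
      unfolding E_def by (rule DERIV_chain2[where f="\<lambda>t. evol F n \<phi> t \<zeta>" and g="\<lambda>r. r - a", OF evol_deriv[OF n1]])
        (use z in \<open>auto simp: E_def intro!: derivative_eq_intros\<close>)
    then show ?thesis unfolding ph_def ph'_def by (auto intro!: derivative_eq_intros simp: algebra_simps)
  qed
  define D where "D r = (\<Sum>\<zeta>\<in>E. tilt E (mu r) (ph r) (s r) \<zeta> * (ph' r \<zeta> / ph r \<zeta>))
     - s r * (\<Sum>\<zeta>\<in>E. tilt E (mu r) (ph r) (s r) \<zeta> * (mu' r \<zeta> / mu r \<zeta>))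
     + (- C * s r) * (\<Sum>\<zeta>\<in>E. tilt E (mu r) (ph r) (s r) \<zeta> * ln (tilt E (mu r) (ph r) (s r) \<zeta> / mu r \<zeta>))" for r
  have s_pos: "0 < s r" for r unfolding s_def by simp
  have s_half: "s r \<le> 1/2" "\<delta> \<le> s r" if "0 \<le> r" "r \<le> T" for r
    using that C mult_left_mono[OF that(2), of C] unfolding s_def \<delta> by auto
  have ds: "(s has_real_derivative (- C * s r)) (at r)" for r unfolding s_def by (auto intro!: derivative_eq_intros)
  have dL: "((\<lambda>r. Lyap E (mu r) (ph r) (s r)) has_real_derivative D r) (at r)" and Dle: "D r \<le> C * R + e + (exp (2 * w) - 1) * X"
    if r: "a \<le> r" "r \<le> a + h" for r
  proof -
    have rT: "r \<in> {0..T}" using r a by auto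
    have tor: "tor n (\<lambda>x. u r (xr n x)) \<epsilon>" by (rule tor_u[OF n1 rT eps(1) eps(2)[OF rT]])
    interpret t: tor n "\<lambda>x. u r (xr n x)" \<epsilon> by (rule tor)
    have sr: "s r \<le> 1/2" "\<delta> \<le> s r" using s_half rT by auto
    have mu_pos: "0 < mu r \<zeta>" for \<zeta> unfolding mu_def by (rule t.muU_pos)
    have dmu: "((\<lambda>r. mu r \<zeta>) has_real_derivative mu' r \<zeta>) (at r)" for \<zeta>
      unfolding mu_def mu'_def by (rule muU_deriv[OF tor])
    show "((\<lambda>r. Lyap E (mu r) (ph r) (s r)) has_real_derivative D r) (at r)"
      unfolding D_def using sr by (intro Lyap_deriv fE neE dmu mu_pos dph ph_pos r(1) ds) auto
    define q where "q = tilt E (mu r) (ph r) (s r)"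
    define f where "f \<zeta> = q \<zeta> / mu r \<zeta>" for \<zeta>
    define Z where "Z = (\<Sum>\<zeta>\<in>E. exp ((ln (ph r \<zeta>) - s r * ln (mu r \<zeta>)) / (1 - s r)))"
    have Z0: "Z > 0" unfolding Z_def using fE neE by (intro sum_pos) auto
    have q_eq: "q \<zeta> = exp ((ln (ph r \<zeta>) - s r * ln (mu r \<zeta>)) / (1 - s r)) / Z" for \<zeta> unfolding q_def tilt_def Z_def ..
    have q0: "0 < q \<zeta>" for \<zeta> unfolding q_eq using Z0 by simp
    have q1: "(\<Sum>\<zeta>\<in>E. q \<zeta>) = 1" unfolding q_eq sum_divide_distrib[symmetric] using Z0 unfolding Z_def by simp
    have f0: "0 < f \<zeta>" for \<zeta> unfolding f_def using q0 mu_pos by simp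
    have muf: "mu r \<zeta> * f \<zeta> = q \<zeta>" for \<zeta> unfolding f_def using mu_pos[of \<zeta>] by simp
    have Em: "t.Em G = (\<Sum>\<zeta>\<in>E. mu r \<zeta> * G \<zeta>)" for G unfolding t.Em_def mu_def E_def ..
    have dens: "t.dens f" unfolding t.dens_def Em muf q1 using f0 less_imp_le by auto
    have Ent: "(\<Sum>\<zeta>\<in>E. q \<zeta> * ln (q \<zeta> / mu r \<zeta>)) = t.Ent f"
      unfolding t.Ent_def Em f_def[symmetric] by (simp add: muf[symmetric] mult.assoc)
    have Ent0: "0 \<le> t.Ent f" by (rule t.Ent_nonneg[OF dens])
    have muE: "(\<Sum>\<zeta>\<in>E. q \<zeta> * (mu' r \<zeta> / mu r \<zeta>)) = t.Em (\<lambda>\<xi>. f \<xi> * (\<Sum>x\<in>box n. dd (1, 0) g (r, xr n x) * omU (\<lambda>x. u r (xr n x)) \<xi> x))"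
      unfolding Em mu'_def using mu_pos by (intro sum.cong refl) (simp add: f_def less_imp_neq[THEN not_sym])
    have lnf: "ln (f \<zeta>) = (ln (ph r \<zeta>) - ln (mu r \<zeta>)) / (1 - s r) - ln Z" for \<zeta>
    proof -
      have "ln (f \<zeta>) = (ln (ph r \<zeta>) - s r * ln (mu r \<zeta>)) / (1 - s r) - ln Z - ln (mu r \<zeta>)"
        unfolding f_def q_eq using Z0 mu_pos[of \<zeta>] by (simp add: ln_div ln_mult)
      also have "\<dots> = (ln (ph r \<zeta>) - ln (mu r \<zeta>)) / (1 - s r) - ln Z" using sr by (simp add: field_simps)
      finally show ?thesis .
    qed
    \<comment> \<open>The identity behind the tilted generator: testing the forward flow against the
      tilted weights produces weighted geometric means of the density \<open>f\<close>, the form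
      treated by \<open>geo_le\<close>.\<close>
    have tilt_eq: "ph r \<xi> * (q \<zeta> / ph r \<zeta>) = mu r \<xi> * exp ((1 - s r) * ln (f \<xi>) + s r * ln (f \<zeta>))" if "\<xi> \<in> E" "\<zeta> \<in> E" for \<xi> \<zeta>
    proof -
      have p: "0 < ph r \<xi>" "0 < ph r \<zeta>" using ph_pos[OF r(1)] that by auto
      have "ph r \<xi> * (q \<zeta> / ph r \<zeta>) = exp (ln (ph r \<xi> * (mu r \<zeta> * f \<zeta> / ph r \<zeta>)))" unfolding muf using p q0 by simp
      also have "ln (ph r \<xi> * (mu r \<zeta> * f \<zeta> / ph r \<zeta>)) = ln (ph r \<xi>) + ln (mu r \<zeta>) + ln (f \<zeta>) - ln (ph r \<zeta>)"
        using p mu_pos[of \<zeta>] f0[of \<zeta>] by (simp add: ln_mult ln_div)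
      also have "\<dots> = ln (mu r \<xi>) + ((1 - s r) * ln (f \<xi>) + s r * ln (f \<zeta>))"
      proof -
        have e: "(1 - s r) * ln (f x) = ln (ph r x) - ln (mu r x) - (1 - s r) * ln Z" for x
          unfolding lnf using sr by (simp add: field_simps)
        show ?thesis using e[of \<xi>] e[of \<zeta>] by (simp add: algebra_simps)
      qed
      finally show ?thesis using mu_pos[of \<xi>] by (simp add: exp_add)
    qed
    define W where "W \<zeta> = (r - a) * v \<zeta>" for \<zeta>
    have Wb: "\<bar>W \<zeta>\<bar> \<le> w" if "\<zeta> \<in> E" for \<zeta>
    proof -
      have "\<bar>W \<zeta>\<bar> \<le> h * \<bar>v \<zeta>\<bar>" unfolding W_def abs_mult using r by (intro mult_right_mono) auto
      then show ?thesis using v[of \<zeta>] that unfolding E_def by linarith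
    qed
    have W1: "exp (W \<zeta>) * evol F n \<phi> (r - a) \<zeta> = ph r \<zeta>" for \<zeta> unfolding W_def ph_def ..
    let ?K = "(box n :: (int^'d) set) \<times> box n"
    have jsE: "js n k \<xi> \<in> E" if "\<xi> \<in> E" for k \<xi> using that swap_Omega unfolding E_def js_def by auto
    have jc0: "0 \<le> jc F n k \<xi>" for k \<xi> unfolding jc_def using rate_nonneg by auto
    have "(\<Sum>\<zeta>\<in>E. q \<zeta> * (ph' r \<zeta> / ph r \<zeta>)) = (\<Sum>\<zeta>\<in>E. q \<zeta> * v \<zeta>) + (\<Sum>\<zeta>\<in>E. \<Sum>\<xi>\<in>E. evol F n \<phi> (r - a) \<xi> * (Qmat F n \<xi> \<zeta> * (exp (W \<zeta>) * (q \<zeta> / ph r \<zeta>))))"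
      unfolding sum.distrib[symmetric]
    proof (intro sum.cong refl)
      fix \<zeta> assume "\<zeta> \<in> E"
      then have p: "ph r \<zeta> > 0" using ph_pos[OF r(1)] by auto
      define S where "S = (\<Sum>\<xi>\<in>E. evol F n \<phi> (r - a) \<xi> * Qmat F n \<xi> \<zeta>)"
      have S: "(\<Sum>\<xi>\<in>E. evol F n \<phi> (r - a) \<xi> * (Qmat F n \<xi> \<zeta> * (exp (W \<zeta>) * (q \<zeta> / ph r \<zeta>)))) = S * (exp (W \<zeta>) * (q \<zeta> / ph r \<zeta>))"
        unfolding S_def by (simp only: sum_distrib_right mult.assoc)
      show "q \<zeta> * (ph' r \<zeta> / ph r \<zeta>) = q \<zeta> * v \<zeta> + (\<Sum>\<xi>\<in>E. evol F n \<phi> (r - a) \<xi> * (Qmat F n \<xi> \<zeta> * (exp (W \<zeta>) * (q \<zeta> / ph r \<zeta>))))"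
        unfolding S ph'_def W_def[symmetric] S_def[symmetric] using p by (simp add: field_simps)
    qed
    also have "(\<Sum>\<zeta>\<in>E. \<Sum>\<xi>\<in>E. evol F n \<phi> (r - a) \<xi> * (Qmat F n \<xi> \<zeta> * (exp (W \<zeta>) * (q \<zeta> / ph r \<zeta>))))
      = (\<Sum>\<xi>\<in>E. evol F n \<phi> (r - a) \<xi> * Lgen F n (\<lambda>\<zeta>. exp (W \<zeta>) * (q \<zeta> / ph r \<zeta>)) \<xi>)"
    proof (subst sum.swap, rule sum.cong[OF refl])
      fix \<xi> assume "\<xi> \<in> E"
      then have L: "Lgen F n (\<lambda>\<zeta>. exp (W \<zeta>) * (q \<zeta> / ph r \<zeta>)) \<xi> = (\<Sum>\<zeta>\<in>E. Qmat F n \<xi> \<zeta> * (exp (W \<zeta>) * (q \<zeta> / ph r \<zeta>)))"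
        unfolding E_def by (rule Qmat_Lgen[OF n1, symmetric])
      show "(\<Sum>\<zeta>\<in>E. evol F n \<phi> (r - a) \<xi> * (Qmat F n \<xi> \<zeta> * (exp (W \<zeta>) * (q \<zeta> / ph r \<zeta>))))
        = evol F n \<phi> (r - a) \<xi> * Lgen F n (\<lambda>\<zeta>. exp (W \<zeta>) * (q \<zeta> / ph r \<zeta>)) \<xi>"
        unfolding L sum_distrib_left ..
    qed
    also have "\<dots> = (\<Sum>\<xi>\<in>E. mu r \<xi> * (\<Sum>k\<in>?K. jc F n k \<xi> * (exp (W (js n k \<xi>) - W \<xi>) * exp ((1 - s r) * ln (f \<xi>) + s r * ln (f (js n k \<xi>))) - f \<xi>)))"
      unfolding Lgen_jump jump_def sum_distrib_left
    proof (intro sum.cong refl)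
      fix \<xi> k assume xi: "\<xi> \<in> E"
      have p: "ph r \<xi> > 0" using ph_pos[OF r(1) xi] .
      have ev: "evol F n \<phi> (r - a) \<xi> = exp (- W \<xi>) * ph r \<xi>" unfolding W1[symmetric] by (simp add: exp_minus)
      have "evol F n \<phi> (r - a) \<xi> * (exp (W (js n k \<xi>)) * (q (js n k \<xi>) / ph r (js n k \<xi>)) - exp (W \<xi>) * (q \<xi> / ph r \<xi>))
        = exp (W (js n k \<xi>) - W \<xi>) * (ph r \<xi> * (q (js n k \<xi>) / ph r (js n k \<xi>))) - q \<xi>"
        unfolding ev using p by (simp add: exp_diff exp_minus field_simps)
      also have "\<dots> = mu r \<xi> * (exp (W (js n k \<xi>) - W \<xi>) * exp ((1 - s r) * ln (f \<xi>) + s r * ln (f (js n k \<xi>))) - f \<xi>)"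
        unfolding tilt_eq[OF xi jsE[OF xi]] unfolding muf[of \<xi>, symmetric] by (simp add: right_diff_distrib mult_ac)
      finally show "evol F n \<phi> (r - a) \<xi> * (jc F n k \<xi> * (exp (W (js n k \<xi>)) * (q (js n k \<xi>) / ph r (js n k \<xi>)) - exp (W \<xi>) * (q \<xi> / ph r \<xi>)))
        = mu r \<xi> * (jc F n k \<xi> * (exp (W (js n k \<xi>) - W \<xi>) * exp ((1 - s r) * ln (f \<xi>) + s r * ln (f (js n k \<xi>))) - f \<xi>))"
        by (metis mult.left_commute)
    qed
    finally have e1: "(\<Sum>\<zeta>\<in>E. q \<zeta> * (ph' r \<zeta> / ph r \<zeta>)) = (\<Sum>\<zeta>\<in>E. q \<zeta> * v \<zeta>)
      + (\<Sum>\<xi>\<in>E. mu r \<xi> * (\<Sum>k\<in>?K. jc F n k \<xi> * (exp (W (js n k \<xi>) - W \<xi>) * exp ((1 - s r) * ln (f \<xi>) + s r * ln (f (js n k \<xi>))) - f \<xi>)))" .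
    define Dis where "Dis = (\<Sum>\<xi>\<in>E. mu r \<xi> * (\<Sum>k\<in>?K. jc F n k \<xi> * (sqrt (f (js n k \<xi>)) - sqrt (f \<xi>))\<^sup>2))"
    define X0 where "X0 = (\<Sum>\<xi>\<in>E. mu r \<xi> * (\<Sum>k\<in>?K. jc F n k \<xi> * (f \<xi> + f (js n k \<xi>))))"
    have e2: "(\<Sum>\<xi>\<in>E. mu r \<xi> * (\<Sum>k\<in>?K. jc F n k \<xi> * (exp (W (js n k \<xi>) - W \<xi>) * exp ((1 - s r) * ln (f \<xi>) + s r * ln (f (js n k \<xi>))) - f \<xi>)))
      \<le> s r * (- Dis + t.Em (Lgen F n f)) + (exp (2 * w) - 1) * X0"
      unfolding Dis_def X0_def Em Lgen_jump
      by (rule jump_tilted_le[OF fE _ jsE jc0 mu_pos f0 less_imp_le[OF s_pos] sr(1) Wb]) simp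
    have e3: "(real n)\<^sup>2 / 2 * (\<Sum>i\<in>UNIV. t.dirS f i) \<le> Dis"
      unfolding Dis_def using t.Em_dissip[of f F] f0 unfolding Em by (simp add: less_imp_le)
    \<comment> \<open>The prefactor \<delta> is rewritten as \<open>s r\<close> times a ratio that
      is at most 1, so the production bound can be used with the same \<open>K\<close>.\<close>
    have e4: "(\<Sum>\<zeta>\<in>E. q \<zeta> * v \<zeta>) \<le> s r * t.Em (\<lambda>\<xi>. f \<xi> * (\<Sum>x\<in>box n. (\<delta> * Hb x / s r) * t.za A \<xi> x * omU (\<lambda>x. u r (xr n x)) \<xi> (x + axis j 1))) + e"
    proof -
      have "(\<Sum>\<zeta>\<in>E. q \<zeta> * v \<zeta>) \<le> (\<Sum>\<zeta>\<in>E. q \<zeta> * (\<delta> * (\<Sum>x\<in>box n. Hb x * t.za A \<zeta> x * omU (\<lambda>x. u r (xr n x)) \<zeta> (x + axis j 1)) + e))"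
        using vle[OF r] less_imp_le[OF q0] unfolding E_def by (intro sum_mono mult_left_mono) auto
      also have "\<dots> = (\<Sum>\<zeta>\<in>E. q \<zeta> * (\<delta> * (\<Sum>x\<in>box n. Hb x * t.za A \<zeta> x * omU (\<lambda>x. u r (xr n x)) \<zeta> (x + axis j 1)))) + e"
        unfolding distrib_left sum.distrib sum_distrib_right[symmetric] q1 by simp
      also have "(\<Sum>\<zeta>\<in>E. q \<zeta> * (\<delta> * (\<Sum>x\<in>box n. Hb x * t.za A \<zeta> x * omU (\<lambda>x. u r (xr n x)) \<zeta> (x + axis j 1))))
        = s r * t.Em (\<lambda>\<xi>. f \<xi> * (\<Sum>x\<in>box n. (\<delta> * Hb x / s r) * t.za A \<xi> x * omU (\<lambda>x. u r (xr n x)) \<xi> (x + axis j 1)))"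
        unfolding Em sum_distrib_left muf[symmetric] using s_pos[of r] by (intro sum.cong refl) simp
      finally show ?thesis .
    qed
    have Hs: "\<forall>x\<in>box n. \<bar>\<delta> * Hb x / s r\<bar> \<le> K"
    proof
      fix x :: "int^'d" assume x: "x \<in> box n"
      have d0: "0 < \<delta>" unfolding \<delta> by simp
      have "\<bar>\<delta> * Hb x / s r\<bar> = \<delta> / s r * \<bar>Hb x\<bar>" using d0 s_pos[of r] by (simp add: abs_mult)
      also have "\<dots> \<le> 1 * \<bar>Hb x\<bar>" using sr(2) s_pos[of r] by (intro mult_right_mono) auto
      finally show "\<bar>\<delta> * Hb x / s r\<bar> \<le> K" using Hb x by force
    qed
    have e5: "s r * (t.Em (Lgen F n f)
      - t.Em (\<lambda>\<xi>. f \<xi> * (\<Sum>x\<in>box n. dd (1, 0) g (r, xr n x) * omU (\<lambda>x. u r (xr n x)) \<xi> x))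
      + t.Em (\<lambda>\<xi>. f \<xi> * (\<Sum>x\<in>box n. (\<delta> * Hb x / s r) * t.za A \<xi> x * omU (\<lambda>x. u r (xr n x)) \<xi> (x + axis j 1))))
      \<le> s r * (Dis + C * (t.Ent f + R))"
      using production_leD[OF pb rT dens Hs] e3 s_pos[of r] by (intro mult_left_mono) auto
    \<comment> \<open>A crude bound is enough: a density is at most the inverse of a lower bound for
      the atoms of the product measure.\<close>
    have e6: "X0 \<le> X"
    proof -
      define m where "m = \<epsilon> ^ card (box n :: (int^'d) set)"
      have m0: "m > 0" unfolding m_def using eps by simp
      have fm: "f \<zeta> \<le> 1 / m" if z: "\<zeta> \<in> E" for \<zeta>
      proof -
        have "q \<zeta> \<le> (\<Sum>\<zeta>\<in>E. q \<zeta>)" using z fE q0 less_imp_le by (intro member_le_sum) auto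
        moreover have "m \<le> mu r \<zeta>" unfolding m_def mu_def by (rule muU_lower[OF tor])
        ultimately show ?thesis unfolding f_def q1 using m0 mu_pos[of \<zeta>] less_imp_le[OF q0] by (intro frac_le) auto
      qed
      have "X0 \<le> (\<Sum>\<xi>\<in>E. mu r \<xi> * X)"
        unfolding X0_def
      proof (intro sum_mono mult_left_mono less_imp_le[OF mu_pos])
        fix \<xi> assume xi: "\<xi> \<in> E"
        have "(\<Sum>k\<in>?K. jc F n k \<xi> * (f \<xi> + f (js n k \<xi>))) \<le> (\<Sum>k\<in>?K. rate F n (fst k) (snd k) * (2 / m))"
        proof (intro sum_mono mult_mono)
          fix k
          show "jc F n k \<xi> \<le> rate F n (fst k) (snd k)" unfolding jc_def using rate_nonneg[of F n] by auto
          show "f \<xi> + f (js n k \<xi>) \<le> 2 / m" using fm[OF xi] fm[OF jsE[OF xi]] by (smt (verit) add_divide_distrib)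
          show "0 \<le> rate F n (fst k) (snd k)" by (rule rate_nonneg)
          show "0 \<le> f \<xi> + f (js n k \<xi>)" using f0[of \<xi>] f0[of "js n k \<xi>"] by linarith
        qed
        then show "(\<Sum>k\<in>?K. jc F n k \<xi> * (f \<xi> + f (js n k \<xi>))) \<le> X" unfolding X_def m_def sum_distrib_right .
      qed
      also have "\<dots> = X" using t.Em_const[of X] unfolding Em .
      finally show ?thesis .
    qed
    have e7: "(exp (2 * w) - 1) * X0 \<le> (exp (2 * w) - 1) * X" using e6 w0 by (intro mult_left_mono) auto
    have "s r * (C * R) \<le> 1 * (C * R)" using sr(1) C R by (intro mult_right_mono) auto
    then have e8: "s r * (C * R) \<le> C * R" by simp
    have "D r \<le> (s r * t.Em (\<lambda>\<xi>. f \<xi> * (\<Sum>x\<in>box n. (\<delta> * Hb x / s r) * t.za A \<xi> x * omU (\<lambda>x. u r (xr n x)) \<xi> (x + axis j 1))) + e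
       + (s r * (- Dis + t.Em (Lgen F n f)) + (exp (2 * w) - 1) * X))
       - s r * t.Em (\<lambda>\<xi>. f \<xi> * (\<Sum>x\<in>box n. dd (1, 0) g (r, xr n x) * omU (\<lambda>x. u r (xr n x)) \<xi> x))
       + (- C * s r) * t.Ent f"
      unfolding D_def q_def[symmetric] muE Ent using e1 e2 e4 e7 by linarith
    also have "\<dots> \<le> s r * (C * R) + e + (exp (2 * w) - 1) * X"
      using e5 by (simp add: algebra_simps)
    finally show "D r \<le> C * R + e + (exp (2 * w) - 1) * X" using e8 by linarith
  qed
  obtain z where z: "a < z" "z < a + h" "Lyap E (mu (a + h)) (ph (a + h)) (s (a + h)) - Lyap E (mu a) (ph a) (s a) = (a + h - a) * D z"
    using MVT2[of a "a + h" "\<lambda>r. Lyap E (mu r) (ph r) (s r)" D] dL a by auto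
  have "h * D z \<le> h * (C * R + e + (exp (2 * w) - 1) * X)" using Dle[of z] z a by (intro mult_left_mono) auto
  then have fin: "Lyap E (mu (a + h)) (ph (a + h)) (s (a + h)) \<le> Lyap E (mu a) (ph a) (s a) + h * (C * R + e + (exp (2 * w) - 1) * X)"
    using z(3) by simp
  have "Lyap E (mu a) (ph a) (s a) = Lyap E (mu a) \<phi> (s a)"
    unfolding Lyap_def by (intro arg_cong2[where f="(*)"] arg_cong[where f=ln] sum.cong refl) (simp add: ph_def E_def evol_zero[OF n1])
  then show "Lyap (Omega n) (muU n (\<lambda>x. u (a + h) (xr n x))) (\<lambda>\<zeta>. exp (h * v \<zeta>) * evol F n \<phi> h \<zeta>) (exp (- C * (a + h)) / 2)
    \<le> Lyap (Omega n) (muU n (\<lambda>x. u a (xr n x))) \<phi> (exp (- C * a) / 2) + h * (C * R + e + (exp (2 * w) - 1) * X)"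
    using fin unfolding E_def mu_def s_def ph_def by simp
qed

end

section \<open>Path functionals of the chain\<close>

text \<open>Restricted to the sampled indices, so that its values lie in a finite product set and
  every functional of it is a finite sum of indicators.\<close>

definition hist :: "(real \<Rightarrow> 'w \<Rightarrow> 'e) \<Rightarrow> real \<Rightarrow> nat \<Rightarrow> 'w \<Rightarrow> nat \<Rightarrow> 'e" where
  "hist \<eta> h k \<omega> = restrict (\<lambda>j. \<eta> (real j * h) \<omega>) {..k}"

lemma is_ctmcD:
  fixes F :: "real^'d::finite \<Rightarrow> real^'d"
  assumes "is_ctmc F n M \<eta>"
  shows "prob_space M"
    and "t \<ge> 0 \<Longrightarrow> \<eta> t \<in> M \<rightarrow>\<^sub>M count_space UNIV"
    and "t \<ge> 0 \<Longrightarrow> \<omega> \<in> space M \<Longrightarrow> \<eta> t \<omega> \<in> Omega n"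
    and "t \<ge> 0 \<Longrightarrow> \<omega> \<in> space M \<Longrightarrow> \<exists>\<delta>>0. \<forall>s. t \<le> s \<and> s < t + \<delta> \<longrightarrow> \<eta> s \<omega> = \<eta> t \<omega>"
  using assms unfolding is_ctmc_def by blast+

lemma is_ctmc_fdd:
  fixes F :: "real^'d::finite \<Rightarrow> real^'d"
  assumes c: "is_ctmc F n M \<eta>" and h: "h > 0" and xs: "\<forall>j\<le>k. xs j \<in> Omega n"
  shows "measure M {\<omega>\<in>space M. \<forall>j\<le>k. \<eta> (real j * h) \<omega> = xs j}
         = measure M {\<omega>\<in>space M. \<eta> 0 \<omega> = xs 0} * (\<Prod>j<k. ptrans F n h (xs j) (xs (Suc j)))"
proof -
  have gen: "\<forall>k (ts::nat \<Rightarrow> real) xs. 0 \<le> ts 0 \<and> (\<forall>j<k. ts j < ts (Suc j)) \<and> (\<forall>j\<le>k. xs j \<in> Omega n) \<longrightarrow>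
         measure M {\<omega>\<in>space M. \<forall>j\<le>k. \<eta> (ts j) \<omega> = xs j}
         = measure M {\<omega>\<in>space M. \<eta> (ts 0) \<omega> = xs 0}
           * (\<Prod>j<k. ptrans F n (ts (Suc j) - ts j) (xs j) (xs (Suc j)))"
    using c unfolding is_ctmc_def by (elim conjE)
  have pr: "0 \<le> real 0 * h \<and> (\<forall>j<k. real j * h < real (Suc j) * h) \<and> (\<forall>j\<le>k. xs j \<in> Omega n)"
    using xs h by simp
  have d: "real (Suc j) * h - real j * h = h" for j by (simp add: algebra_simps)
  show ?thesis using gen[THEN spec, of k, THEN spec, of "\<lambda>j. real j * h", THEN spec, of xs, THEN mp, OF pr] unfolding d by simp
qed

lemma hist_integrable:
  fixes F :: "real^'d::finite \<Rightarrow> real^'d" and g :: "(nat \<Rightarrow> int^'d \<Rightarrow> bool) \<Rightarrow> real"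
  assumes c: "is_ctmc F n M \<eta>" and n1: "n \<ge> 1" and h: "h > 0"
  shows "integrable M (\<lambda>\<omega>. g (hist \<eta> h k \<omega>))"
    and "{\<omega>\<in>space M. \<forall>j\<le>k. \<eta> (real j * h) \<omega> = f j} \<in> sets M"
    and "\<omega> \<in> space M \<Longrightarrow> g (hist \<eta> h k \<omega>) = (\<Sum>f\<in>PiE {..k} (\<lambda>_. Omega n). g f * indicator {\<omega>\<in>space M. \<forall>j\<le>k. \<eta> (real j * h) \<omega> = f j} \<omega>)"
proof -
  interpret prob_space M by (rule is_ctmcD(1)[OF c])
  define H where "H = PiE {..k} (\<lambda>_. Omega n :: (int^'d \<Rightarrow> bool) set)"
  have fH: "finite H" unfolding H_def using finite_Omega[OF n1] by (intro finite_PiE) auto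
  have histH: "hist \<eta> h k \<omega> \<in> H" if "\<omega> \<in> space M" for \<omega>
    unfolding hist_def H_def using is_ctmcD(3)[OF c _ that] h by (auto intro!: restrict_PiE_iff[THEN iffD2])
  have hist_iff: "hist \<eta> h k \<omega> = f \<longleftrightarrow> (\<forall>j\<le>k. \<eta> (real j * h) \<omega> = f j)" if "f \<in> H" for f \<omega>
  proof
    assume "hist \<eta> h k \<omega> = f"
    then show "\<forall>j\<le>k. \<eta> (real j * h) \<omega> = f j" unfolding hist_def by auto
  next
    assume "\<forall>j\<le>k. \<eta> (real j * h) \<omega> = f j"
    then have "hist \<eta> h k \<omega> = restrict f {..k}" unfolding hist_def by (intro restrict_ext) simp
    then show "hist \<eta> h k \<omega> = f" using PiE_restrict[OF that[unfolded H_def]] by simp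
  qed
  have mset: "{\<omega>\<in>space M. \<eta> (real j * h) \<omega> = x} \<in> sets M" for j x
    using measurable_sets[OF is_ctmcD(2)[OF c, of "real j * h"], of "{x}"] h by (simp add: vimage_def Int_def conj_commute)
  show m: "{\<omega>\<in>space M. \<forall>j\<le>k. \<eta> (real j * h) \<omega> = f j} \<in> sets M" for f
    using sets.sets_Collect_finite_All[of "{..k}" M "\<lambda>j \<omega>. \<eta> (real j * h) \<omega> = f j"] mset by simp
  show eq: "g (hist \<eta> h k \<omega>) = (\<Sum>f\<in>PiE {..k} (\<lambda>_. Omega n). g f * indicator {\<omega>\<in>space M. \<forall>j\<le>k. \<eta> (real j * h) \<omega> = f j} \<omega>)"
    if w: "\<omega> \<in> space M" for \<omega>
  proof -
    have "(\<Sum>f\<in>H. g f * indicator {\<omega>\<in>space M. \<forall>j\<le>k. \<eta> (real j * h) \<omega> = f j} \<omega>)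
        = (\<Sum>f\<in>H. if hist \<eta> h k \<omega> = f then g f else 0)"
      by (intro sum.cong refl) (use w hist_iff in \<open>auto simp: indicator_def\<close>)
    then show ?thesis using histH[OF w] fH unfolding H_def by simp
  qed
  have "integrable M (\<lambda>\<omega>. \<Sum>f\<in>H. g f * indicator {\<omega>\<in>space M. \<forall>j\<le>k. \<eta> (real j * h) \<omega> = f j} \<omega>)"
    by (intro Bochner_Integration.integrable_sum integrable_mult_right integrable_real_indicator m)
       (simp add: emeasure_eq_measure)
  then show "integrable M (\<lambda>\<omega>. g (hist \<eta> h k \<omega>))"
    by (rule Bochner_Integration.integrable_cong[OF refl, THEN iffD1, rotated]) (simp add: eq H_def)
qed

text \<open>The Markov property at a grid time, obtained by summing the product formula of the
  finite-dimensional laws over all histories.\<close>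

lemma ctmc_step:
  fixes F :: "real^'d::finite \<Rightarrow> real^'d" and k :: nat
  assumes c: "is_ctmc F n M \<eta>" and n1: "n \<ge> 1" and h: "h > 0" and z: "\<zeta> \<in> Omega n"
  shows "(\<integral>\<omega>. g (hist \<eta> h k \<omega>) * (if \<eta> (real (Suc k) * h) \<omega> = \<zeta> then 1 else 0) \<partial>M)
    = (\<integral>\<omega>. g (hist \<eta> h k \<omega>) * ptrans F n h (\<eta> (real k * h) \<omega>) \<zeta> \<partial>M)"
proof -
  interpret prob_space M by (rule is_ctmcD(1)[OF c])
  define H where "H = PiE {..k} (\<lambda>_. Omega n :: (int^'d \<Rightarrow> bool) set)"
  define A where "A f = {\<omega>\<in>space M. \<forall>j\<le>k. \<eta> (real j * h) \<omega> = f j}" for f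
  have g: "g (hist \<eta> h k \<omega>) = (\<Sum>f\<in>H. g f * indicator (A f) \<omega>)" if "\<omega> \<in> space M" for \<omega>
    unfolding H_def A_def by (rule hist_integrable(3)[OF c n1 h that])
  have mA: "A f \<in> sets M" for f unfolding A_def by (rule hist_integrable(2)[OF c n1 h])
  have fin: "emeasure M S < \<infinity>" for S by (simp add: emeasure_eq_measure)
  define B where "B f = {\<omega>\<in>A f. \<eta> (real (Suc k) * h) \<omega> = \<zeta>}" for f
  define f' where "f' f = (\<lambda>j. if j = Suc k then \<zeta> else f j)" for f
  have B': "B f = {\<omega>\<in>space M. \<forall>j\<le>Suc k. \<eta> (real j * h) \<omega> = f' f j}" for f
    unfolding A_def B_def f'_def by (auto simp: le_Suc_eq)
  have mB: "B f \<in> sets M" for f unfolding B' by (rule hist_integrable(2)[OF c n1 h])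
  have AB: "measure M (B f) = measure M (A f) * ptrans F n h (f k) \<zeta>" if "f \<in> H" for f
  proof -
    have fO: "\<forall>j\<le>k. f j \<in> Omega n" using that unfolding H_def by auto
    then have f'O: "\<forall>j\<le>Suc k. f' f j \<in> Omega n" unfolding f'_def using z by auto
    show ?thesis unfolding B' is_ctmc_fdd[OF c h f'O] A_def is_ctmc_fdd[OF c h fO] by (simp add: f'_def)
  qed
  have "(\<integral>\<omega>. g (hist \<eta> h k \<omega>) * (if \<eta> (real (Suc k) * h) \<omega> = \<zeta> then 1 else 0) \<partial>M) = (\<integral>\<omega>. (\<Sum>f\<in>H. g f * indicator (B f) \<omega>) \<partial>M)"
    by (rule Bochner_Integration.integral_cong[OF refl])
       (auto simp: g B_def indicator_def sum_distrib_right intro!: sum.cong)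
  also have "\<dots> = (\<Sum>f\<in>H. g f * measure M (B f))"
    using mB fin by (subst Bochner_Integration.integral_sum) (auto simp: Int_absorb2 sets.sets_into_space)
  also have "\<dots> = (\<Sum>f\<in>H. g f * ptrans F n h (f k) \<zeta> * measure M (A f))"
    by (intro sum.cong refl) (simp add: AB)
  also have "\<dots> = (\<integral>\<omega>. (\<Sum>f\<in>H. (g f * ptrans F n h (f k) \<zeta>) * indicator (A f) \<omega>) \<partial>M)"
    using mA fin by (subst Bochner_Integration.integral_sum) (auto simp: Int_absorb2 sets.sets_into_space)
  also have "\<dots> = (\<integral>\<omega>. g (hist \<eta> h k \<omega>) * ptrans F n h (\<eta> (real k * h) \<omega>) \<zeta> \<partial>M)"
    by (rule Bochner_Integration.integral_cong[OF refl], subst g, assumption)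
       (unfold sum_distrib_right, intro sum.cong refl, auto simp: A_def indicator_def)
  finally show ?thesis .
qed

text \<open>The weight \<open>v k\<close> acts after the semigroup step, hence at the right end of
  the mesh interval. This sampling converges for right-continuous paths.\<close>

primrec fkw :: "(real^'d::finite \<Rightarrow> real^'d) \<Rightarrow> nat \<Rightarrow> real \<Rightarrow> (nat \<Rightarrow> (int^'d \<Rightarrow> bool) \<Rightarrow> real) \<Rightarrow> ((int^'d \<Rightarrow> bool) \<Rightarrow> real)
    \<Rightarrow> nat \<Rightarrow> (int^'d \<Rightarrow> bool) \<Rightarrow> real" where
  "fkw F n h v \<nu> 0 = \<nu>"
| "fkw F n h v \<nu> (Suc k) = (\<lambda>\<zeta>. exp (v k \<zeta>) * evol F n (fkw F n h v \<nu> k) h \<zeta>)"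

lemma fkw_linear:
  fixes \<nu> :: "(int^'d::finite \<Rightarrow> bool) \<Rightarrow> real"
  assumes "n \<ge> 1"
  shows "\<zeta> \<in> Omega n \<Longrightarrow> fkw F n h v \<nu> k \<zeta> = (\<Sum>\<xi>\<in>Omega n. \<nu> \<xi> * fkw F n h v (\<lambda>\<zeta>. if \<zeta> = \<xi> then 1 else 0) k \<zeta>)"
proof (induction k arbitrary: \<zeta>)
  case 0
  then show ?case using finite_Omega[OF assms, where 'd='d] by (simp add: if_distrib[of "\<lambda>a. _ * a"] cong: if_cong)
next
  case (Suc k)
  have "evol F n (fkw F n h v \<nu> k) h \<zeta> = (\<Sum>\<zeta>'\<in>Omega n. (\<Sum>\<xi>\<in>Omega n. \<nu> \<xi> * fkw F n h v (\<lambda>\<zeta>. if \<zeta> = \<xi> then 1 else 0) k \<zeta>') * ptrans F n h \<zeta>' \<zeta>)"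
    unfolding evol_def[OF assms] using Suc.IH by (intro sum.cong refl) simp
  also have "\<dots> = (\<Sum>\<xi>\<in>Omega n. \<nu> \<xi> * evol F n (fkw F n h v (\<lambda>\<zeta>. if \<zeta> = \<xi> then 1 else 0) k) h \<zeta>)"
    unfolding evol_def[OF assms] sum_distrib_left sum_distrib_right by (subst sum.swap) (simp add: mult.assoc)
  finally show ?case by (simp add: sum_distrib_left mult.left_commute)
qed

text \<open>The path weight of \<open>fkw\<close>: the shift \<open>Suc j\<close> evaluates each
  potential at the right end of its mesh interval.\<close>

definition fkg :: "(nat \<Rightarrow> 'e \<Rightarrow> real) \<Rightarrow> ('e \<Rightarrow> real) \<Rightarrow> nat \<Rightarrow> (nat \<Rightarrow> 'e) \<Rightarrow> real" where
  "fkg v G k f = G (f 0) * exp (\<Sum>j<k. v j (f (Suc j)))"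

text \<open>Discrete Feynman-Kac formula, by the Markov property and a decomposition over the last
  state. The factor \<open>G\<close> of the initial state later isolates a single starting
  configuration.\<close>

lemma fkw_process:
  fixes F :: "real^'d::finite \<Rightarrow> real^'d" and G :: "(int^'d \<Rightarrow> bool) \<Rightarrow> real"
  assumes c: "is_ctmc F n M \<eta>" and n1: "n \<ge> 1" and h: "h > 0"
  defines "p0 \<equiv> \<lambda>\<xi>. measure M {\<omega>\<in>space M. \<eta> 0 \<omega> = \<xi>}"
  shows "\<zeta> \<in> Omega n \<Longrightarrow> (\<integral>\<omega>. fkg v G k (hist \<eta> h k \<omega>) * (if \<eta> (real k * h) \<omega> = \<zeta> then 1 else 0) \<partial>M)
     = fkw F n h v (\<lambda>\<xi>. p0 \<xi> * G \<xi>) k \<zeta>"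
proof (induction k arbitrary: \<zeta>)
  interpret prob_space M by (rule is_ctmcD(1)[OF c])
  case 0
  have "{\<omega>\<in>space M. \<eta> 0 \<omega> = \<zeta>} \<in> sets M"
    using hist_integrable(2)[OF c n1 h, of 0 "\<lambda>_. \<zeta>"] by simp
  moreover have "(\<integral>\<omega>. fkg v G 0 (hist \<eta> h 0 \<omega>) * (if \<eta> (real 0 * h) \<omega> = \<zeta> then 1 else 0) \<partial>M) = (\<integral>\<omega>. G \<zeta> * indicator {\<omega>\<in>space M. \<eta> 0 \<omega> = \<zeta>} \<omega> \<partial>M)"
    by (rule Bochner_Integration.integral_cong[OF refl]) (auto simp: indicator_def fkg_def hist_def)
  moreover have "space M \<inter> {\<omega>\<in>space M. \<eta> 0 \<omega> = \<zeta>} = {\<omega>\<in>space M. \<eta> 0 \<omega> = \<zeta>}" by blast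
  ultimately show ?case unfolding p0_def by (simp add: Int_commute mult.commute)
next
  interpret prob_space M by (rule is_ctmcD(1)[OF c])
  have fO: "finite (Omega n :: (int^'d \<Rightarrow> bool) set)" by (rule finite_Omega[OF n1])
  case (Suc k)
  have hk: "hist \<eta> h k \<omega> j = \<eta> (real j * h) \<omega>" if "j \<le> k" for k j \<omega> unfolding hist_def using that by simp
  have gh: "fkg v G (Suc k) (hist \<eta> h (Suc k) \<omega>) = fkg v G k (hist \<eta> h k \<omega>) * exp (v k (\<eta> (real (Suc k) * h) \<omega>))" for \<omega>
    unfolding fkg_def by (simp add: hk exp_add del: of_nat_Suc)
  have "(\<integral>\<omega>. fkg v G (Suc k) (hist \<eta> h (Suc k) \<omega>) * (if \<eta> (real (Suc k) * h) \<omega> = \<zeta> then 1 else 0) \<partial>M)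
    = (\<integral>\<omega>. exp (v k \<zeta>) * (fkg v G k (hist \<eta> h k \<omega>) * (if \<eta> (real (Suc k) * h) \<omega> = \<zeta> then 1 else 0)) \<partial>M)"
    by (rule Bochner_Integration.integral_cong[OF refl]) (simp add: gh del: of_nat_Suc)
  also have "\<dots> = exp (v k \<zeta>) * (\<integral>\<omega>. fkg v G k (hist \<eta> h k \<omega>) * ptrans F n h (\<eta> (real k * h) \<omega>) \<zeta> \<partial>M)"
    using ctmc_step[OF c n1 h Suc.prems, of "fkg v G k" k] by simp
  also have "(\<integral>\<omega>. fkg v G k (hist \<eta> h k \<omega>) * ptrans F n h (\<eta> (real k * h) \<omega>) \<zeta> \<partial>M)
     = (\<integral>\<omega>. (\<Sum>\<xi>\<in>Omega n. (fkg v G k (hist \<eta> h k \<omega>) * (if \<eta> (real k * h) \<omega> = \<xi> then 1 else 0)) * ptrans F n h \<xi> \<zeta>) \<partial>M)"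
  proof (rule Bochner_Integration.integral_cong[OF refl])
    fix \<omega> assume "\<omega> \<in> space M"
    then have "\<eta> (real k * h) \<omega> \<in> Omega n" using is_ctmcD(3)[OF c] h by simp
    moreover have "(\<Sum>\<xi>\<in>Omega n. (fkg v G k (hist \<eta> h k \<omega>) * (if \<eta> (real k * h) \<omega> = \<xi> then 1 else 0)) * ptrans F n h \<xi> \<zeta>)
      = (\<Sum>\<xi>\<in>Omega n. if \<eta> (real k * h) \<omega> = \<xi> then fkg v G k (hist \<eta> h k \<omega>) * ptrans F n h \<xi> \<zeta> else 0)"
      by (intro sum.cong refl) auto
    ultimately show "fkg v G k (hist \<eta> h k \<omega>) * ptrans F n h (\<eta> (real k * h) \<omega>) \<zeta> = (\<Sum>\<xi>\<in>Omega n. (fkg v G k (hist \<eta> h k \<omega>) * (if \<eta> (real k * h) \<omega> = \<xi> then 1 else 0)) * ptrans F n h \<xi> \<zeta>)"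
      using fO by simp
  qed
  also have "\<dots> = (\<Sum>\<xi>\<in>Omega n. (\<integral>\<omega>. fkg v G k (hist \<eta> h k \<omega>) * (if \<eta> (real k * h) \<omega> = \<xi> then 1 else 0) \<partial>M) * ptrans F n h \<xi> \<zeta>)"
  proof (subst Bochner_Integration.integral_sum)
    fix \<xi> :: "int^'d \<Rightarrow> bool" assume "\<xi> \<in> Omega n"
    show "integrable M (\<lambda>\<omega>. (fkg v G k (hist \<eta> h k \<omega>) * (if \<eta> (real k * h) \<omega> = \<xi> then 1 else 0)) * ptrans F n h \<xi> \<zeta>)"
      using hist_integrable(1)[OF c n1 h, of "\<lambda>f. (fkg v G k f * (if f k = \<xi> then 1 else 0)) * ptrans F n h \<xi> \<zeta>" k] by (simp add: hk)
  qed simp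
  also have "\<dots> = (\<Sum>\<xi>\<in>Omega n. fkw F n h v (\<lambda>\<xi>. p0 \<xi> * G \<xi>) k \<xi> * ptrans F n h \<xi> \<zeta>)"
    by (intro sum.cong refl) (simp only: Suc.IH)
  finally show ?case by (simp add: evol_def[OF n1])
qed

text \<open>Positivity of the flow is available from strictly positive data only, so the point mass
  is perturbed by an arbitrarily small positive constant.\<close>

lemma ptrans_nonneg:
  fixes F :: "real^'d::finite \<Rightarrow> real^'d"
  assumes n1: "n \<ge> 1" and "0 \<le> t" and xi: "\<xi> \<in> Omega n" and z: "\<zeta> \<in> Omega n"
  shows "0 \<le> ptrans F n t \<xi> \<zeta>"
proof (rule ccontr)
  have fO: "finite (Omega n :: (int^'d \<Rightarrow> bool) set)" by (rule finite_Omega[OF n1])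
  define S where "S = (\<Sum>\<xi>\<in>Omega n. ptrans F n t \<xi> \<zeta>)"
  have pos: "0 < ptrans F n t \<xi> \<zeta> + e * S" if "e > 0" for e
  proof -
    have "0 < evol F n (\<lambda>\<xi>'. (if \<xi>' = \<xi> then 1 else 0) + e) t \<zeta>"
      using assms(2) z that by (intro evol_pos[OF n1]) auto
    also have "\<dots> = ptrans F n t \<xi> \<zeta> + e * S"
      unfolding evol_def[OF n1] S_def using xi fO by (simp add: distrib_right sum.distrib sum_distrib_left if_distrib[of "\<lambda>a. a * _"] cong: if_cong)
    finally show ?thesis .
  qed
  assume n: "\<not> 0 \<le> ptrans F n t \<xi> \<zeta>"
  define e where "e = - ptrans F n t \<xi> \<zeta> / (\<bar>S\<bar> + 1)"
  have e0: "e > 0" unfolding e_def using n by (intro divide_pos_pos) auto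
  have "e * S \<le> e * (\<bar>S\<bar> + 1)" using e0 by (intro mult_left_mono) auto
  also have "\<dots> = - ptrans F n t \<xi> \<zeta>" unfolding e_def by simp
  finally show False using pos[OF e0] by simp
qed

lemma fkw_nonneg:
  fixes F :: "real^'d::finite \<Rightarrow> real^'d"
  assumes "n \<ge> 1" "0 \<le> h" "\<And>\<xi>. \<xi> \<in> Omega n \<Longrightarrow> 0 \<le> \<nu> \<xi>"
  shows "\<zeta> \<in> Omega n \<Longrightarrow> 0 \<le> fkw F n h v \<nu> k \<zeta>"
proof (induction k arbitrary: \<zeta>)
  case (Suc k)
  then show ?case unfolding fkw.simps evol_def[OF assms(1)]
    by (intro mult_nonneg_nonneg sum_nonneg ptrans_nonneg assms) auto
qed (use assms in simp)

text \<open>The entropy inequality is applied to the initial configuration only, with test function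
  the conditional probability \<open>a\<close> of the event given the start. As
  \<open>\<delta> * lam = 2 * \<beta>\<close>, one \<beta> offsets the factor
  \<open>exp \<beta>\<close> coming from \<open>exp (\<beta> * a \<xi>)\<close> and the other the
  bound on the flow. The exponential moment is thus at most 2, hence the
  \<open>ln 2\<close>.\<close>

lemma discrete_tail:
  fixes F :: "real^'d::finite \<Rightarrow> real^'d" and V :: "nat \<Rightarrow> (int^'d \<Rightarrow> bool) \<Rightarrow> real"
  assumes c: "is_ctmc F n M \<eta>" and n1: "n \<ge> 1" and h: "h > 0"
    and U: "tor n U \<epsilon>" and \<beta>: "\<beta> > 0" and \<delta>: "\<delta> > 0" "\<delta> * lam = 2 * \<beta>"
    and Z: "(\<Sum>\<zeta>\<in>Omega n. fkw F n h (\<lambda>k \<zeta>. \<delta> * V k \<zeta>) (muU n U) N \<zeta>) \<le> exp \<beta>"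
  shows "measure M {\<omega>\<in>space M. (\<Sum>k<N. V k (\<eta> (real (Suc k) * h) \<omega>)) > lam}
     \<le> (rel_entropy n (\<lambda>\<xi>. measure M {\<omega>\<in>space M. \<eta> 0 \<omega> = \<xi>}) (muU n U) + ln 2) / \<beta>"
proof -
  interpret prob_space M by (rule is_ctmcD(1)[OF c])
  interpret tor n U \<epsilon> by (rule U)
  define p where "p \<xi> = measure M {\<omega>\<in>space M. \<eta> 0 \<omega> = \<xi>}" for \<xi>
  define X where "X f = (\<Sum>k<N. V k (f (Suc k)))" for f
  define v where "v = (\<lambda>k \<zeta>. \<delta> * V k \<zeta>)"
  define hs where "hs = hist \<eta> h N"
  have hk: "hs \<omega> j = \<eta> (real j * h) \<omega>" if "j \<le> N" for j \<omega> unfolding hs_def hist_def using that by simp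
  have Xh: "(\<Sum>k<N. V k (\<eta> (real (Suc k) * h) \<omega>)) = X (hs \<omega>)" for \<omega>
    unfolding X_def by (intro sum.cong refl) (simp add: hk del: of_nat_Suc)
  have int: "integrable M (\<lambda>\<omega>. q (hs \<omega>))" for q :: "_ \<Rightarrow> real" unfolding hs_def by (rule hist_integrable(1)[OF c n1 h])
  have meas: "{\<omega>\<in>space M. P (hs \<omega>)} \<in> sets M" for P
  proof -
    have "(\<lambda>\<omega>. if P (hs \<omega>) then 1 else 0 :: real) \<in> borel_measurable M"
      using int[of "\<lambda>f. if P f then 1 else 0"] by (rule borel_measurable_integrable)
    from measurable_sets[OF this, of "{1}"] show ?thesis
      by (rule back_subst[of "\<lambda>S. S \<in> sets M"]) (auto split: if_splits)
  qed
  define \<psi> where "\<psi> \<xi> = (\<Sum>\<zeta>\<in>Omega n. fkw F n h v (\<lambda>\<zeta>. if \<zeta> = \<xi> then 1 else 0) N \<zeta>)" for \<xi>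
  have \<psi>0: "0 \<le> \<psi> \<xi>" for \<xi> unfolding \<psi>_def using h by (intro sum_nonneg fkw_nonneg[OF n1]) auto
  have lin: "(\<Sum>\<zeta>\<in>Omega n. fkw F n h v \<nu> N \<zeta>) = (\<Sum>\<xi>\<in>Omega n. \<nu> \<xi> * \<psi> \<xi>)" for \<nu>
  proof -
    have "(\<Sum>\<zeta>\<in>Omega n. fkw F n h v \<nu> N \<zeta>) = (\<Sum>\<zeta>\<in>Omega n. \<Sum>\<xi>\<in>Omega n. \<nu> \<xi> * fkw F n h v (\<lambda>\<zeta>. if \<zeta> = \<xi> then 1 else 0) N \<zeta>)"
      by (intro sum.cong refl) (rule fkw_linear[OF n1])
    then show ?thesis unfolding \<psi>_def sum_distrib_left by (subst (asm) sum.swap)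
  qed
  define m where "m \<xi> = measure M {\<omega>\<in>space M. hs \<omega> 0 = \<xi> \<and> X (hs \<omega>) > lam}" for \<xi>
  have mp: "m \<xi> \<le> p \<xi>" for \<xi> unfolding m_def p_def
    using meas[of "\<lambda>f. f 0 = \<xi>"] by (intro finite_measure_mono) (auto simp: hk)
  have m0: "0 \<le> m \<xi>" for \<xi> unfolding m_def by simp
  \<comment> \<open>Chernoff bound for one starting configuration; \<open>\<psi> \<xi>\<close> is
    the exponential moment of the chain started there and does not involve the initial law.\<close>
  have m\<psi>: "m \<xi> \<le> exp (- (\<delta> * lam)) * (p \<xi> * \<psi> \<xi>)" if xi: "\<xi> \<in> Omega n" for \<xi>
  proof -
    define G where "G = (\<lambda>\<zeta>. if \<zeta> = \<xi> then 1 else 0 :: real)"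
    have "m \<xi> = (\<integral>\<omega>. indicator {\<omega>\<in>space M. hs \<omega> 0 = \<xi> \<and> X (hs \<omega>) > lam} \<omega> \<partial>M)"
      unfolding m_def using meas[of "\<lambda>f. f 0 = \<xi> \<and> X f > lam"] by (simp add: Int_absorb2 sets.sets_into_space)
    also have "\<dots> \<le> (\<integral>\<omega>. exp (- (\<delta> * lam)) * fkg v G N (hs \<omega>) \<partial>M)"
    proof (rule integral_mono)
      show "integrable M (indicator {\<omega>\<in>space M. hs \<omega> 0 = \<xi> \<and> X (hs \<omega>) > lam} :: _ \<Rightarrow> real)"
        using meas[of "\<lambda>f. f 0 = \<xi> \<and> X f > lam"] by (intro integrable_real_indicator) (auto simp: emeasure_eq_measure)
      show "integrable M (\<lambda>\<omega>. exp (- (\<delta> * lam)) * fkg v G N (hs \<omega>))" by (rule int)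
      fix \<omega> assume "\<omega> \<in> space M"
      have e: "exp (- (\<delta> * lam)) * fkg v G N (hs \<omega>) = G (hs \<omega> 0) * exp (\<delta> * (X (hs \<omega>) - lam))"
        unfolding fkg_def v_def X_def sum_distrib_left[symmetric] right_diff_distrib by (simp add: exp_diff exp_minus field_simps)
      have "1 \<le> exp (\<delta> * (X (hs \<omega>) - lam))" if "X (hs \<omega>) > lam"
        using that \<delta>(1) by simp
      then show "indicator {\<omega>\<in>space M. hs \<omega> 0 = \<xi> \<and> X (hs \<omega>) > lam} \<omega> \<le> exp (- (\<delta> * lam)) * fkg v G N (hs \<omega>)"
        unfolding e unfolding G_def by (auto simp: indicator_def)
    qed
    also have "\<dots> = exp (- (\<delta> * lam)) * (\<integral>\<omega>. fkg v G N (hs \<omega>) \<partial>M)" by simp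
    also have "(\<integral>\<omega>. fkg v G N (hs \<omega>) \<partial>M) = (\<integral>\<omega>. (\<Sum>\<zeta>\<in>Omega n. fkg v G N (hs \<omega>) * (if \<eta> (real N * h) \<omega> = \<zeta> then 1 else 0)) \<partial>M)"
      using is_ctmcD(3)[OF c, of "real N * h"] h finO
      by (intro Bochner_Integration.integral_cong[OF refl]) (simp add: sum_distrib_left[symmetric])
    also have "\<dots> = (\<Sum>\<zeta>\<in>Omega n. fkw F n h v (\<lambda>\<xi>. p \<xi> * G \<xi>) N \<zeta>)"
    proof (subst Bochner_Integration.integral_sum)
      show "integrable M (\<lambda>\<omega>. fkg v G N (hs \<omega>) * (if \<eta> (real N * h) \<omega> = \<zeta> then 1 else 0))" for \<zeta>
        using int[of "\<lambda>f. fkg v G N f * (if f N = \<zeta> then 1 else 0)"] by (simp add: hk)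
      show "(\<Sum>\<zeta>\<in>Omega n. \<integral>\<omega>. fkg v G N (hs \<omega>) * (if \<eta> (real N * h) \<omega> = \<zeta> then 1 else 0) \<partial>M)
         = (\<Sum>\<zeta>\<in>Omega n. fkw F n h v (\<lambda>\<xi>. p \<xi> * G \<xi>) N \<zeta>)"
        unfolding hs_def p_def by (intro sum.cong refl) (rule fkw_process[OF c n1 h])
    qed
    also have "\<dots> = (\<Sum>\<xi>'\<in>Omega n. p \<xi>' * G \<xi>' * \<psi> \<xi>')" by (rule lin)
    also have "\<dots> = p \<xi> * \<psi> \<xi>" unfolding G_def using xi finO
      by (simp add: if_distrib[of "\<lambda>a. _ * a"] if_distrib[of "\<lambda>a. a * _"] cong: if_cong)
    finally show ?thesis .
  qed
  define f where "f \<xi> = p \<xi> / muU n U \<xi>" for \<xi>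
  \<comment> \<open>Starting points of probability 0 get the value 0; there \<open>m\<close>
    vanishes as well, so \<open>p \<xi> * a \<xi> = m \<xi>\<close> holds everywhere.\<close>
  define a where "a \<xi> = (if p \<xi> = 0 then 0 else m \<xi> / p \<xi>)" for \<xi>
  have p0: "p \<xi> \<ge> 0" for \<xi> unfolding p_def by simp
  have split: "measure M {\<omega>\<in>space M. P (hs \<omega>)} = (\<Sum>\<xi>\<in>Omega n. measure M {\<omega>\<in>space M. hs \<omega> 0 = \<xi> \<and> P (hs \<omega>)})" for P
  proof -
    have "{\<omega>\<in>space M. P (hs \<omega>)} = (\<Union>\<xi>\<in>Omega n. {\<omega>\<in>space M. hs \<omega> 0 = \<xi> \<and> P (hs \<omega>)})"
      using is_ctmcD(3)[OF c, of 0] hk[of 0] by auto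
    then show ?thesis
      using meas[of "\<lambda>f. f 0 = _ \<and> P f"] finO
      by (simp, subst finite_measure_finite_Union) (auto simp: disjoint_family_on_def)
  qed
  have muf: "muU n U \<xi> * f \<xi> = p \<xi>" for \<xi> unfolding f_def using muU_pos[of \<xi>] by simp
  have "Em f = 1"
  proof -
    have "Em f = (\<Sum>\<xi>\<in>Omega n. p \<xi>)" unfolding Em_def muf ..
    also have "\<dots> = measure M {\<omega>\<in>space M. True}" unfolding split[of "\<lambda>_. True"] p_def by (simp add: hk)
    finally show ?thesis by (simp add: prob_space)
  qed
  then have dens: "dens f" unfolding dens_def f_def using p0 less_imp_le[OF muU_pos] by simp
  have a1: "a \<xi> \<le> 1" "0 \<le> a \<xi>" for \<xi> unfolding a_def using mp[of \<xi>] p0[of \<xi>] m0[of \<xi>] by (auto simp: divide_le_eq_1)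
  have pa: "p \<xi> * a \<xi> = m \<xi>" for \<xi> unfolding a_def using mp[of \<xi>] m0[of \<xi>] by auto
  \<comment> \<open>Convexity of the exponential on [0, 1] makes the estimate linear in
    \<open>a\<close>, to which the Chernoff bound applies.\<close>
  have apt: "exp (\<beta> * a \<xi>) \<le> 1 + exp (- \<beta>) * \<psi> \<xi>" if "\<xi> \<in> Omega n" for \<xi>
  proof -
    have "exp (\<beta> * a \<xi>) \<le> 1 + exp \<beta> * a \<xi>"
    proof -
      have "exp (a \<xi> * \<beta>) \<le> 1 - a \<xi> + a \<xi> * exp \<beta>" using exp_convex_le a1[of \<xi>] by blast
      then show ?thesis using a1[of \<xi>] by (simp add: mult.commute)
    qed
    also have "exp \<beta> * a \<xi> \<le> exp \<beta> * (exp (- (\<delta> * lam)) * \<psi> \<xi>)"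
    proof (intro mult_left_mono)
      show "a \<xi> \<le> exp (- (\<delta> * lam)) * \<psi> \<xi>"
        using m\<psi>[OF that] \<psi>0[of \<xi>] p0[of \<xi>] unfolding a_def by (auto simp: field_simps)
    qed simp
    also have "\<dots> = exp (- \<beta>) * \<psi> \<xi>" unfolding \<delta>(2) mult.assoc[symmetric] exp_add[symmetric] by simp
    finally show ?thesis by simp
  qed
  have "Em (\<lambda>\<xi>. exp (\<beta> * a \<xi>)) \<le> Em (\<lambda>\<xi>. 1 + exp (- \<beta>) * \<psi> \<xi>)"
    unfolding Em_def using apt less_imp_le[OF muU_pos] by (intro sum_mono mult_left_mono) auto
  also have "\<dots> = Em (\<lambda>_. 1) + exp (- \<beta>) * (\<Sum>\<xi>\<in>Omega n. muU n U \<xi> * \<psi> \<xi>)"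
    unfolding Em_def sum_distrib_left sum.distrib[symmetric] by (intro sum.cong refl) (simp add: algebra_simps)
  also have "\<dots> = 1 + exp (- \<beta>) * (\<Sum>\<zeta>\<in>Omega n. fkw F n h v (muU n U) N \<zeta>)" unfolding lin by (simp add: Em_const)
  also have "\<dots> \<le> 1 + exp (- \<beta>) * exp \<beta>" using Z unfolding v_def by (intro add_left_mono mult_left_mono) auto
  also have "\<dots> = exp (ln 2)" by (simp add: exp_add[symmetric])
  finally have "Em (\<lambda>\<xi>. f \<xi> * a \<xi>) \<le> Ent f / \<beta> + ln 2 / \<beta>" by (rule Ent_ineq[OF dens \<beta>])
  moreover have "Em (\<lambda>\<xi>. f \<xi> * a \<xi>) = measure M {\<omega>\<in>space M. X (hs \<omega>) > lam}"
    unfolding Em_def mult.assoc[symmetric] muf pa split[of "\<lambda>f. X f > lam"] m_def ..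
  moreover have "Ent f = rel_entropy n p (muU n U)"
    unfolding Ent_def Em_def mult.assoc[symmetric] muf rel_entropy_def unfolding f_def ..
  ultimately show ?thesis unfolding Xh by (simp add: p_def[abs_def] add_divide_distrib)
qed

text \<open>For r in (0, T] the sampled time is the first grid point not before r. It tends to r
  from the right, where the path eventually equals \<open>z r\<close>; dominated convergence does
  the rest. The pointwise limit also supplies the measurability of the integrand.\<close>

lemma uniform_grid_limit:
  fixes z :: "real \<Rightarrow> 'e" and Y :: "real \<Rightarrow> 'e \<Rightarrow> real"
  assumes T: "T > 0" and zE: "\<And>t. t \<ge> 0 \<Longrightarrow> z t \<in> E"
    and rc: "\<And>t. t \<ge> 0 \<Longrightarrow> \<exists>\<delta>>0. \<forall>s. t \<le> s \<and> s < t + \<delta> \<longrightarrow> z s = z t"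
    and Ym: "\<And>\<xi>. (\<lambda>r. Y r \<xi>) \<in> borel_measurable borel"
    and Yb: "\<And>r \<xi>. \<xi> \<in> E \<Longrightarrow> \<bar>Y r \<xi>\<bar> \<le> B" and Y0: "\<And>r \<xi>. r \<notin> {0<..T} \<Longrightarrow> Y r \<xi> = 0"
  defines "h \<equiv> \<lambda>N. T / real (Suc N)"
  shows "(\<lambda>N. \<Sum>k<Suc N. \<integral>r. indicator {real k * h N<..real (Suc k) * h N} r * Y r (z (real (Suc k) * h N)) \<partial>lborel)
     \<longlonglongrightarrow> (\<integral>r. Y r (z r) \<partial>lborel)"
proof -
  have h0: "h N > 0" for N unfolding h_def using T by simp
  have hT: "real (Suc N) * h N = T" for N unfolding h_def by simp
  have h_lim: "h \<longlonglongrightarrow> 0"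
    unfolding h_def using tendsto_mult_right_zero[OF LIMSEQ_inverse_real_of_nat, of T] by (simp add: divide_inverse)
  define s where "s N r = (\<Sum>k<Suc N. indicator {real k * h N<..real (Suc k) * h N} r * Y r (z (real (Suc k) * h N)))" for N r
  have val: "s N r = Y r (z (h N * \<lceil>r / h N\<rceil>)) \<and> r \<le> h N * \<lceil>r / h N\<rceil> \<and> h N * \<lceil>r / h N\<rceil> < r + h N" if r: "0 < r" "r \<le> T" for N r
  proof -
    define q where "q = \<lceil>r / h N\<rceil>"
    have q: "real_of_int q - 1 < r / h N" "r / h N \<le> real_of_int q" unfolding q_def by linarith+
    have qq: "(real_of_int q - 1) * h N < r" "r \<le> real_of_int q * h N"
      using q h0[of N] by (simp_all add: pos_less_divide_eq pos_divide_le_eq)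
    have q0: "q \<ge> 1" unfolding q_def using r h0[of N] by (simp add: one_le_ceiling)
    define k where "k = nat (q - 1)"
    have kq: "real (Suc k) = real_of_int q" "real k = real_of_int q - 1" unfolding k_def using q0 by auto
    have "r / h N \<le> real (Suc N)" using r hT[of N] h0[of N] by (simp add: pos_divide_le_eq del: of_nat_Suc)
    then have "q \<le> int (Suc N)" unfolding q_def by (simp add: ceiling_le_iff)
    then have kN: "k < Suc N" unfolding k_def using q0 by auto
    have "indicator {real j * h N<..real (Suc j) * h N} r = (if j = k then 1 else 0 :: real)" for j
    proof (cases "j = k")
      case True then show ?thesis using qq(1)[folded kq(2)] qq(2)[folded kq(1)] by simp
    next
      case False
      then consider "Suc j \<le> k" | "Suc k \<le> j" by linarith
      then show ?thesis
      proof cases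
        case 1
        have "real (Suc j) * h N \<le> real k * h N" using 1 h0[of N] by (intro mult_right_mono) auto
        then show ?thesis using qq(1) False unfolding kq(2)[symmetric] by simp
      next
        case 2
        have "real (Suc k) * h N \<le> real j * h N" using 2 h0[of N] by (intro mult_right_mono) auto
        then show ?thesis using qq(2) False unfolding kq(1)[symmetric] by simp
      qed
    qed
    then have "s N r = (\<Sum>j<Suc N. if j = k then Y r (z (real (Suc j) * h N)) else 0)"
      unfolding s_def by (intro sum.cong refl) simp
    also have "\<dots> = Y r (z (real (Suc k) * h N))" using kN by simp
    finally show ?thesis using qq unfolding kq(1) q_def[symmetric] by (simp add: algebra_simps)
  qed
  have lim: "(\<lambda>N. s N r) \<longlonglongrightarrow> Y r (z r)" for r
  proof (cases "r \<in> {0<..T}")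
    case True
    then have r: "0 < r" "r \<le> T" by auto
    obtain d where d: "d > 0" "\<And>t. r \<le> t \<Longrightarrow> t < r + d \<Longrightarrow> z t = z r" using rc[of r] r by auto
    have "\<forall>\<^sub>F N in sequentially. h N < d" using order_tendstoD(2)[OF h_lim d(1)] .
    then have "\<forall>\<^sub>F N in sequentially. s N r = Y r (z r)"
    proof eventually_elim
      case (elim N)
      have "z (h N * \<lceil>r / h N\<rceil>) = z r" using val[OF r, of N] elim by (intro d(2)) auto
      then show ?case using val[OF r, of N] by simp
    qed
    then show ?thesis by (rule tendsto_eventually)
  next
    case False
    then show ?thesis unfolding s_def Y0[OF False] by simp
  qed
  have sm: "s N \<in> borel_measurable lborel" for N
    unfolding s_def[abs_def] using Ym by (intro borel_measurable_sum borel_measurable_times borel_measurable_indicator) auto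
  have B0: "B \<ge> 0" using Yb[OF zE[of 0], of 0] by simp
  have sb: "\<bar>s N r\<bar> \<le> B * indicator {0..T} r" for N r
  proof (cases "r \<in> {0<..T}")
    case True
    then have "s N r = Y r (z (h N * \<lceil>r / h N\<rceil>))" "0 \<le> h N * \<lceil>r / h N\<rceil>" using val[of r N] by auto
    then show ?thesis using Yb[OF zE] True by simp
  next
    case False
    then show ?thesis unfolding s_def Y0[OF False] using B0 by simp
  qed
  have "(\<lambda>N. \<integral>r. s N r \<partial>lborel) \<longlonglongrightarrow> (\<integral>r. Y r (z r) \<partial>lborel)"
  proof (rule integral_dominated_convergence)
    show "integrable lborel (\<lambda>r. B * indicator {0..T} r)" by (intro integrable_mult_right integrable_real_indicator) (use T in auto)
    show "(\<lambda>r. Y r (z r)) \<in> borel_measurable lborel" by (rule borel_measurable_LIMSEQ_real[OF lim sm])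
  qed (use sm sb lim in auto)
  moreover have "(\<integral>r. s N r \<partial>lborel) = (\<Sum>k<Suc N. \<integral>r. indicator {real k * h N<..real (Suc k) * h N} r * Y r (z (real (Suc k) * h N)) \<partial>lborel)" for N
    unfolding s_def
  proof (rule Bochner_Integration.integral_sum)
    fix k
    show "integrable lborel (\<lambda>r. indicator {real k * h N<..real (Suc k) * h N} r * Y r (z (real (Suc k) * h N)))"
    proof (rule Bochner_Integration.integrable_bound)
      show "integrable lborel (\<lambda>r. B * indicator {0..T} r)" by (intro integrable_mult_right integrable_real_indicator) (use T in auto)
      show "(\<lambda>r. indicator {real k * h N<..real (Suc k) * h N} r * Y r (z (real (Suc k) * h N))) \<in> borel_measurable lborel"
        using Ym by (intro borel_measurable_times borel_measurable_indicator) auto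
      have "real (Suc k) * h N \<ge> 0" using h0[of N] by (intro mult_nonneg_nonneg) auto
      then have le: "\<bar>Y r (z (real (Suc k) * h N))\<bar> \<le> B * indicator {0..T} r" for r
        using Yb[OF zE] Y0[of r] B0 by (cases "r \<in> {0<..T}") auto
      show "AE r in lborel. norm (indicator {real k * h N<..real (Suc k) * h N} r * Y r (z (real (Suc k) * h N))) \<le> norm (B * indicator {0..T} r)"
      proof (intro AE_I2)
        fix r
        have "norm (indicator {real k * h N<..real (Suc k) * h N} r * Y r (z (real (Suc k) * h N))) \<le> \<bar>Y r (z (real (Suc k) * h N))\<bar>"
          unfolding indicator_def by simp
        also have "\<dots> \<le> norm (B * indicator {0..T} r)" using le[of r] by simp
        finally show "norm (indicator {real k * h N<..real (Suc k) * h N} r * Y r (z (real (Suc k) * h N))) \<le> norm (B * indicator {0..T} r)" .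
      qed
    qed
  qed
  ultimately show ?thesis by simp
qed

section \<open>The discretised flow over the whole time interval\<close>

context pde
begin

text \<open>Started from the product measure the functional is 0 at time 0; it grows by one
  \<open>Lyap_step\<close> per mesh interval, and at time T it dominates the logarithm of the total
  mass.\<close>

lemma fkw_bound:
  fixes A :: "(int^'d) set" and j :: 'd and V :: "nat \<Rightarrow> (int^'d \<Rightarrow> bool) \<Rightarrow> real"
  assumes n1: "n \<ge> 1" and eps: "\<epsilon> > 0" "\<And>t x. t \<in> {0..T} \<Longrightarrow> \<epsilon> \<le> u t x \<and> u t x \<le> 1 - \<epsilon>"
    and h: "0 < h" "real N * h = T" and C: "C > 0" and \<delta>: "\<delta> = exp (- C * T) / 2" and R: "R \<ge> 0"
    and pb: "production_le A j K n C R"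
    and V: "\<And>k \<zeta>. k < N \<Longrightarrow> \<zeta> \<in> Omega n \<Longrightarrow> \<bar>\<delta> * V k \<zeta>\<bar> \<le> w"
    and Vle: "\<And>k r \<zeta>. k < N \<Longrightarrow> real k * h \<le> r \<Longrightarrow> r \<le> real (Suc k) * h \<Longrightarrow> \<zeta> \<in> Omega n \<Longrightarrow>
      \<delta> * V k \<zeta> \<le> h * (\<delta> * (\<Sum>x\<in>box n. Hb k x * tor.za (\<lambda>x. u r (xr n x)) A \<zeta> x * omU (\<lambda>x. u r (xr n x)) \<zeta> (x + axis j 1)) + e)"
    and Hb: "\<And>k. k < N \<Longrightarrow> \<forall>x\<in>box n. \<bar>Hb k x\<bar> \<le> K"
  defines "X \<equiv> (\<Sum>k\<in>(box n :: (int^'d) set) \<times> box n. rate F n (fst k) (snd k)) * (2 / \<epsilon> ^ card (box n :: (int^'d) set))"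
  shows "(\<Sum>\<zeta>\<in>Omega n. fkw F n h (\<lambda>k \<zeta>. \<delta> * V k \<zeta>) (muU n (\<lambda>x. u 0 (xr n x))) N \<zeta>) \<le> exp (T * (C * R + e + (exp (2 * w) - 1) * X))"
proof -
  define \<phi> where "\<phi> = fkw F n h (\<lambda>k \<zeta>. \<delta> * V k \<zeta>) (muU n (\<lambda>x. u 0 (xr n x)))"
  define mu where "mu r = muU n (\<lambda>x. u r (xr n x))" for r
  define B where "B = C * R + e + (exp (2 * w) - 1) * X"
  have tor: "tor n (\<lambda>x. u t (xr n x)) \<epsilon>" if "t \<in> {0..T}" for t
    by (rule tor_u[OF n1 that eps(1) eps(2)[OF that]])
  have T0: "0 \<in> {0..T}" "T \<in> {0..T}" using T_pos by auto
  have mu_pos: "0 < mu t \<zeta>" if "t \<in> {0..T}" for t \<zeta> unfolding mu_def by (rule tor.muU_pos[OF tor[OF that]])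
  have mu_sum: "(\<Sum>\<zeta>\<in>Omega n. mu t \<zeta>) = 1" if "t \<in> {0..T}" for t
    using tor.Em_const[OF tor[OF that], of 1] unfolding tor.Em_def[OF tor[OF that]] mu_def by simp
  have fO: "finite (Omega n :: (int^'d \<Rightarrow> bool) set)" "Omega n \<noteq> ({} :: (int^'d \<Rightarrow> bool) set)"
    using finite_Omega[OF n1] unfolding Omega_def by auto
  have s1: "exp (- C * t) / 2 < 1" if "0 \<le> t" for t :: real
  proof -
    have "exp (- C * t) \<le> 1" using C that by simp
    then show ?thesis by linarith
  qed
  have ind: "(\<forall>\<zeta>\<in>Omega n. 0 < \<phi> k \<zeta>) \<and> Lyap (Omega n) (mu (real k * h)) (\<phi> k) (exp (- C * (real k * h)) / 2) \<le> real k * h * B" if "k \<le> N" for k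
    using that
  proof (induction k)
    case 0
    have "Lyap (Omega n) (mu 0) (mu 0) (exp (- C * 0) / 2) = 0"
      by (rule Lyap_self[OF fO(1) mu_sum[OF T0(1)] mu_pos[OF T0(1)]]) simp
    then show ?case using mu_pos[OF T0(1)] unfolding \<phi>_def mu_def by simp
  next
    case (Suc k)
    then have kN: "k < N" and IH: "\<And>\<zeta>. \<zeta> \<in> Omega n \<Longrightarrow> 0 < \<phi> k \<zeta>"
      "Lyap (Omega n) (mu (real k * h)) (\<phi> k) (exp (- C * (real k * h)) / 2) \<le> real k * h * B" by auto
    have a: "0 \<le> real k * h" "real k * h + h = real (Suc k) * h" using h by (auto simp: algebra_simps)
    have "real (Suc k) * h \<le> real N * h" using kN h by (intro mult_right_mono) auto
    then have aT: "real k * h + h \<le> T" using h a by simp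
    have v: "h * \<bar>\<delta> * V k \<zeta> / h\<bar> \<le> w" if "\<zeta> \<in> Omega n" for \<zeta>
      using V[OF kN that] h by (simp add: abs_divide)
    have vle: "\<delta> * V k \<zeta> / h \<le> \<delta> * (\<Sum>x\<in>box n. Hb k x * tor.za (\<lambda>x. u r (xr n x)) A \<zeta> x * omU (\<lambda>x. u r (xr n x)) \<zeta> (x + axis j 1)) + e"
      if "real k * h \<le> r" "r \<le> real k * h + h" "\<zeta> \<in> Omega n" for r \<zeta>
      using Vle[OF kN that(1) that(2)[unfolded a(2)] that(3)] h by (simp add: pos_divide_le_eq mult.commute)
    note ph = Lyap_step[OF n1 eps(1) eps(2) a(1) h(1) aT C \<delta> R pb IH(1) v vle Hb[OF kN]]
    have e: "(\<lambda>\<zeta>. exp (h * (\<delta> * V k \<zeta> / h)) * evol F n (\<phi> k) h \<zeta>) = \<phi> (Suc k)"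
      unfolding \<phi>_def using h by simp
    have 1: "Lyap (Omega n) (mu (real k * h + h)) (\<phi> (Suc k)) (exp (- C * (real k * h + h)) / 2)
      \<le> Lyap (Omega n) (mu (real k * h)) (\<phi> k) (exp (- C * (real k * h)) / 2) + h * B"
      unfolding e[symmetric] mu_def B_def X_def by (rule ph(1); assumption)
    have "real k * h * B + h * B = real (Suc k) * h * B" by (simp add: algebra_simps)
    then have "Lyap (Omega n) (mu (real (Suc k) * h)) (\<phi> (Suc k)) (exp (- C * (real (Suc k) * h)) / 2) \<le> real (Suc k) * h * B"
      using 1 IH(2) unfolding a(2) by linarith
    moreover have "\<forall>\<zeta>\<in>Omega n. 0 < \<phi> (Suc k) \<zeta>"
      unfolding e[symmetric] by (rule ballI, rule ph(2); assumption)
    ultimately show ?case by blast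
  qed
  have pos: "0 < \<phi> N \<zeta>" if "\<zeta> \<in> Omega n" for \<zeta> using ind[OF order_refl] that by blast
  have "ln (\<Sum>\<zeta>\<in>Omega n. \<phi> N \<zeta>) \<le> Lyap (Omega n) (mu T) (\<phi> N) (exp (- C * T) / 2)"
    by (rule Lyap_ge[OF fO mu_sum[OF T0(2)] mu_pos[OF T0(2)] pos]) (use s1[of T] T_pos in auto)
  also have "\<dots> \<le> T * B" using ind[OF order_refl] unfolding h(2) by blast
  finally have "ln (\<Sum>\<zeta>\<in>Omega n. \<phi> N \<zeta>) \<le> T * B" .
  moreover have "0 < (\<Sum>\<zeta>\<in>Omega n. \<phi> N \<zeta>)" using pos fO by (intro sum_pos) auto
  ultimately show ?thesis unfolding \<phi>_def[symmetric] B_def[symmetric] by (metis exp_ln exp_le_cancel_iff)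
qed

end

lemma interval_integral_bound:
  fixes f :: "real \<Rightarrow> real"
  assumes f: "f \<in> borel_measurable borel" and B: "\<And>r. a < r \<Longrightarrow> r \<le> b \<Longrightarrow> \<bar>f r\<bar> \<le> B" and ab: "a < b"
  shows "integrable lborel (\<lambda>r. indicator {a<..b} r * f r)"
    and "\<bar>\<integral>r. indicator {a<..b} r * f r \<partial>lborel\<bar> \<le> (b - a) * B"
proof -
  have i: "integrable lborel (\<lambda>r. B * indicator {a<..b} r)" by (intro integrable_mult_right integrable_real_indicator) (use ab in auto)
  have B0: "B \<ge> 0" using B[of b] ab by simp
  show int: "integrable lborel (\<lambda>r. indicator {a<..b} r * f r)"
  proof (rule Bochner_Integration.integrable_bound[OF i])
    show "(\<lambda>r. indicator {a<..b} r * f r) \<in> borel_measurable lborel"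
      using f by (intro borel_measurable_times borel_measurable_indicator) auto
    show "AE r in lborel. norm (indicator {a<..b} r * f r) \<le> norm (B * indicator {a<..b} r)"
      using B B0 by (intro AE_I2) (auto simp: indicator_def)
  qed
  have "\<bar>\<integral>r. indicator {a<..b} r * f r \<partial>lborel\<bar> \<le> (\<integral>r. \<bar>indicator {a<..b} r * f r\<bar> \<partial>lborel)"
    by (rule integral_abs_bound)
  also have "\<dots> \<le> (\<integral>r. B * indicator {a<..b} r \<partial>lborel)"
    using B by (intro integral_mono integrable_abs int i) (auto simp: indicator_def)
  also have "\<dots> = (b - a) * B" using ab by simp
  finally show "\<bar>\<integral>r. indicator {a<..b} r * f r \<partial>lborel\<bar> \<le> (b - a) * B" .
qed

section \<open>Removal of the time mesh\<close>

context pde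
begin

text \<open>For fixed n the mesh errors vanish under refinement, by uniform continuity in time of
  finitely many products of normalised variables. The \<open>+ 1\<close> in the condition on \<beta>
  is their budget: 1/2 for freezing these variables in time and 1/2 for the commutation
  error.\<close>

lemma path_tail:
  fixes A :: "(int^'d) set" and j :: 'd and HH :: "real \<Rightarrow> int^'d \<Rightarrow> real" and \<eta> :: "real \<Rightarrow> 'w \<Rightarrow> int^'d \<Rightarrow> bool"
  assumes n1: "n \<ge> 1" and eps: "\<epsilon> > 0" "\<And>t x. t \<in> {0..T} \<Longrightarrow> \<epsilon> \<le> u t x \<and> u t x \<le> 1 - \<epsilon>"
    and C: "C > 0" and \<delta>: "\<delta> = exp (- C * T) / 2" and R: "R \<ge> 0"
    and pb: "production_le A j K n C R"
    and c: "is_ctmc F n M \<eta>"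
    and HHm: "\<And>x. (\<lambda>r. HH r x) \<in> borel_measurable borel"
    and HHb: "\<And>r x. x \<in> box n \<Longrightarrow> \<bar>HH r x\<bar> \<le> K"
    and HH0: "\<And>r x. r \<notin> {0<..T} \<Longrightarrow> HH r x = 0"
    and \<beta>: "\<beta> > 0" "T * (C * R + 1) \<le> \<beta>" "\<delta> * lam = 2 * \<beta>"
  defines "Y \<equiv> \<lambda>r \<xi>. \<Sum>x\<in>box n. HH r x * ((\<Prod>a\<in>A. omg u n \<xi> r (x + a)) * omg u n \<xi> r (x + axis j 1))"
  shows "{\<omega>\<in>space M. lam < (\<integral>r. Y r (\<eta> r \<omega>) \<partial>lborel)} \<in> sets M"
    and "measure M {\<omega>\<in>space M. lam < (\<integral>r. Y r (\<eta> r \<omega>) \<partial>lborel)} \<le> (Hent u n M \<eta> 0 + ln 2) / \<beta>"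
proof -
  interpret prob_space M by (rule is_ctmcD(1)[OF c])
  have tor: "tor n (\<lambda>x. u t (xr n x)) \<epsilon>" if "t \<in> {0..T}" for t
    by (rule tor_u[OF n1 that eps(1) eps(2)[OF that]])
  have fO: "finite (Omega n :: (int^'d \<Rightarrow> bool) set)" by (rule finite_Omega[OF n1])
  have fB: "finite (box n :: (int^'d) set)" by simp
  have d0: "\<delta> > 0" unfolding \<delta> by simp
  have K0: "K \<ge> 0"
  proof -
    have "(0 :: int^'d) \<in> box n" unfolding box_def using n1 by simp
    then show ?thesis using HHb[of 0 0] by simp
  qed
  define \<Theta> where "\<Theta> r \<xi> x = (\<Prod>a\<in>A. omg u n \<xi> r (x + a)) * omg u n \<xi> r (x + axis j 1)" for r \<xi> x
  have Y: "Y r \<xi> = (\<Sum>x\<in>box n. HH r x * \<Theta> r \<xi> x)" for r \<xi> unfolding Y_def \<Theta>_def ..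
  have om: "omg u n \<xi> r z = omU (\<lambda>x. u r (xr n x)) \<xi> z" for \<xi> r z unfolding omg_def omU_def ..
  have \<Theta>za: "h * tor.za (\<lambda>x. u r (xr n x)) A \<xi> x * omU (\<lambda>x. u r (xr n x)) \<xi> (x + axis j 1) = h * \<Theta> r \<xi> x"
    if "r \<in> {0..T}" for h r \<xi> x
    unfolding \<Theta>_def om tor.za_def[OF tor[OF that]] by simp
  have uc: "continuous_on S (\<lambda>r. u r y)" for y and S :: "real set"
    using continuous_on_compose2[OF smooth_cont[OF u_smooth], of S "\<lambda>r. (r, y)"] by (simp add: continuous_on_Pair)
  have um: "(\<lambda>r. u r y) \<in> borel_measurable borel" for y by (rule borel_measurable_continuous_onI[OF uc])
  have \<Theta>m: "(\<lambda>r. \<Theta> r \<xi> x) \<in> borel_measurable borel" for \<xi> x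
    unfolding \<Theta>_def omg_def
    by (intro borel_measurable_times borel_measurable_prod borel_measurable_divide borel_measurable_diff borel_measurable_const um)
  have \<Theta>c: "continuous_on {0..T} (\<lambda>r. \<Theta> r \<xi> x)" for \<xi> x
  proof -
    have "u r y * (1 - u r y) \<noteq> 0" if "r \<in> {0..T}" for r y using eps(1) eps(2)[OF that, of y] by auto
    then show ?thesis unfolding \<Theta>_def omg_def by (intro continuous_intros uc) auto
  qed
  define KY where "KY = real (card (box n :: (int^'d) set)) * (K * ((1/\<epsilon>) ^ card A * (1/\<epsilon>)))"
  have KY0: "KY \<ge> 0" unfolding KY_def using K0 eps(1) by simp
  have Yb: "\<bar>Y r \<xi>\<bar> \<le> KY" for r \<xi>
  proof (cases "r \<in> {0..T}")
    case True
    have o: "\<bar>omg u n \<xi> r z\<bar> \<le> 1/\<epsilon>" for z unfolding om by (rule tor.omU_le[OF tor[OF True]])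
    have "(\<Prod>a\<in>A. \<bar>omg u n \<xi> r (x + a)\<bar>) \<le> (\<Prod>a\<in>A. 1/\<epsilon>)" for x by (intro prod_mono) (use o in auto)
    then have "\<bar>\<Theta> r \<xi> x\<bar> \<le> (1/\<epsilon>) ^ card A * (1/\<epsilon>)" for x
      unfolding \<Theta>_def abs_mult abs_prod using o[of "x + axis j 1"] eps(1) by (intro mult_mono) auto
    then have "\<bar>HH r x * \<Theta> r \<xi> x\<bar> \<le> K * ((1/\<epsilon>) ^ card A * (1/\<epsilon>))" if "x \<in> box n" for x
      unfolding abs_mult using HHb[OF that] K0 by (intro mult_mono) auto
    then have "(\<Sum>x\<in>box n. \<bar>HH r x * \<Theta> r \<xi> x\<bar>) \<le> KY" unfolding KY_def by (intro sum_bounded_above) auto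
    then show ?thesis unfolding Y using sum_abs[of "\<lambda>x. HH r x * \<Theta> r \<xi> x" "box n"] by linarith
  next
    case False
    then have "HH r x = 0" for x by (intro HH0) auto
    then show ?thesis unfolding Y using KY0 by simp
  qed
  have Ym: "(\<lambda>r. Y r \<xi>) \<in> borel_measurable borel" for \<xi>
    unfolding Y by (intro borel_measurable_sum borel_measurable_times HHm \<Theta>m)
  have Y0: "Y r \<xi> = 0" if "r \<notin> {0<..T}" for r \<xi> unfolding Y HH0[OF that] by simp
  define h where "h N = T / real (Suc N)" for N
  have h0: "h N > 0" for N unfolding h_def using T_pos by simp
  have hT: "real (Suc N) * h N = T" for N unfolding h_def by simp
  have h_lim: "h \<longlonglongrightarrow> 0"
    unfolding h_def using tendsto_mult_right_zero[OF LIMSEQ_inverse_real_of_nat, of T] by (simp add: divide_inverse)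
  define I where "I N k = {real k * h N<..real (Suc k) * h N}" for N k
  have Ih: "real (Suc k) * h N - real k * h N = h N" "real k * h N < real (Suc k) * h N" for N k
    using h0[of N] by (auto simp: algebra_simps)
  define V where "V N k \<xi> = (\<integral>r. indicator (I N k) r * Y r \<xi> \<partial>lborel)" for N k \<xi>
  \<comment> \<open>\<open>HH\<close> is merely measurable in time, so its mean over the mesh
    interval is used instead of a value at some instant.\<close>
  define Hb where "Hb N k x = (\<integral>r. indicator (I N k) r * HH r x \<partial>lborel) / h N" for N k x
  have Vb: "\<bar>V N k \<xi>\<bar> \<le> h N * KY" for N k \<xi>
    unfolding V_def I_def using interval_integral_bound(2)[OF Ym[of \<xi>] Yb Ih(2)[of k N]] unfolding Ih(1) by simp
  have Hbb: "\<forall>x\<in>box n. \<bar>Hb N k x\<bar> \<le> K" for N k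
  proof
    fix x :: "int^'d" assume x: "x \<in> box n"
    have "\<bar>\<integral>r. indicator (I N k) r * HH r x \<partial>lborel\<bar> \<le> h N * K"
      unfolding I_def using interval_integral_bound(2)[OF HHm[of x] HHb[OF x] Ih(2)[of k N]] unfolding Ih(1) by simp
    then show "\<bar>Hb N k x\<bar> \<le> K" unfolding Hb_def using h0[of N] by (simp add: abs_divide pos_divide_le_eq mult.commute)
  qed
  define cb where "cb = real (card (box n :: (int^'d) set))"
  \<comment> \<open>The tolerance that makes the freezing error at most 1/2; the added 1 keeps the
    denominator positive when \<open>K\<close> is 0.\<close>
  define e1 where "e1 = 1 / (2 * (\<delta> * (cb * K) + 1))"
  have den: "\<delta> * (cb * K) \<ge> 0" unfolding cb_def using d0 K0 by simp
  have e1: "e1 > 0" "\<delta> * (cb * (K * e1)) \<le> 1/2"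
    unfolding e1_def using den by (auto simp: field_simps)
  have unif: "\<forall>\<^sub>F N in sequentially. \<forall>\<zeta>\<in>Omega n. \<forall>x\<in>box n. \<forall>r\<in>{0..T}. \<forall>r0\<in>{0..T}. \<bar>r - r0\<bar> \<le> h N \<longrightarrow> \<bar>\<Theta> r \<zeta> x - \<Theta> r0 \<zeta> x\<bar> \<le> e1"
  proof (rule eventually_ball_finite[OF fO], rule ballI, rule eventually_ball_finite[OF fB], rule ballI)
    fix \<zeta> :: "int^'d \<Rightarrow> bool" and x :: "int^'d"
    have "uniformly_continuous_on {0..T} (\<lambda>r. \<Theta> r \<zeta> x)" by (rule compact_uniformly_continuous[OF \<Theta>c compact_Icc])
    then obtain d where d: "d > 0" "\<And>r0 r. r0 \<in> {0..T} \<Longrightarrow> r \<in> {0..T} \<Longrightarrow> dist r r0 < d \<Longrightarrow> dist (\<Theta> r \<zeta> x) (\<Theta> r0 \<zeta> x) < e1"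
      using e1(1) unfolding uniformly_continuous_on_def by meson
    have "\<forall>\<^sub>F N in sequentially. h N < d" using order_tendstoD(2)[OF h_lim d(1)] .
    then show "\<forall>\<^sub>F N in sequentially. \<forall>r\<in>{0..T}. \<forall>r0\<in>{0..T}. \<bar>r - r0\<bar> \<le> h N \<longrightarrow> \<bar>\<Theta> r \<zeta> x - \<Theta> r0 \<zeta> x\<bar> \<le> e1"
    proof eventually_elim
      case (elim N)
      show ?case
      proof (intro ballI impI)
        fix r r0 assume "r \<in> {0..T}" "r0 \<in> {0..T}" "\<bar>r - r0\<bar> \<le> h N"
        then show "\<bar>\<Theta> r \<zeta> x - \<Theta> r0 \<zeta> x\<bar> \<le> e1" using d(2)[of r0 r] elim by (simp add: dist_real_def)
      qed
    qed
  qed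
  define X where "X = (\<Sum>k\<in>(box n :: (int^'d) set) \<times> box n. rate F n (fst k) (snd k)) * (2 / \<epsilon> ^ card (box n :: (int^'d) set))"
  have "(\<lambda>N. (exp (2 * (\<delta> * (h N * KY))) - 1) * X) \<longlonglongrightarrow> (exp (2 * (\<delta> * (0 * KY))) - 1) * X"
    by (intro tendsto_intros h_lim)
  then have "(\<lambda>N. (exp (2 * (\<delta> * (h N * KY))) - 1) * X) \<longlonglongrightarrow> 0" by simp
  from order_tendstoD(2)[OF this, of "1/2"] have Xs: "\<forall>\<^sub>F N in sequentially. (exp (2 * (\<delta> * (h N * KY))) - 1) * X < 1/2" by simp
  define XN where "XN N \<omega> = (\<Sum>k<Suc N. V N k (\<eta> (real (Suc k) * h N) \<omega>))" for N \<omega>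
  define bnd where "bnd = (Hent u n M \<eta> 0 + ln 2) / \<beta>"
  have tail: "\<forall>\<^sub>F N in sequentially. measure M {\<omega>\<in>space M. lam < XN N \<omega>} \<le> bnd"
    using unif Xs
  proof eventually_elim
    case (elim N)
    have Vle: "\<delta> * V N k \<zeta> \<le> h N * (\<delta> * (\<Sum>x\<in>box n. Hb N k x * tor.za (\<lambda>x. u r0 (xr n x)) A \<zeta> x * omU (\<lambda>x. u r0 (xr n x)) \<zeta> (x + axis j 1)) + 1/2)"
      if kN: "k < Suc N" and r0: "real k * h N \<le> r0" "r0 \<le> real (Suc k) * h N" and z: "\<zeta> \<in> Omega n" for k r0 \<zeta>
    proof -
      have "real (Suc k) * h N \<le> real (Suc N) * h N" using kN h0[of N] by (intro mult_right_mono) auto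
      then have kT: "real (Suc k) * h N \<le> T" unfolding hT .
      have k0: "0 \<le> real k * h N" using h0[of N] by simp
      have r0T: "r0 \<in> {0..T}" using r0 kT k0 unfolding atLeastAtMost_iff by linarith
      \<comment> \<open>The error made by freezing the normalised variables at \<open>r0\<close>;
        without it the integral contains \<open>HH\<close> alone and equals the block mean
        \<open>Hb\<close> times the mesh size.\<close>
      define f where "f r = (\<Sum>x\<in>box n. HH r x * (\<Theta> r \<zeta> x - \<Theta> r0 \<zeta> x))" for r
      have fm: "f \<in> borel_measurable borel" unfolding f_def[abs_def]
        by (intro borel_measurable_sum borel_measurable_times HHm borel_measurable_diff \<Theta>m borel_measurable_const)
      have fb: "\<bar>f r\<bar> \<le> cb * (K * e1)" if "real k * h N < r" "r \<le> real (Suc k) * h N" for r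
      proof -
        have rT: "r \<in> {0..T}" "\<bar>r - r0\<bar> \<le> h N" using that kT k0 r0 Ih(1)[of k N] unfolding atLeastAtMost_iff by linarith+
        have "\<bar>HH r x * (\<Theta> r \<zeta> x - \<Theta> r0 \<zeta> x)\<bar> \<le> K * e1" if "x \<in> box n" for x
          unfolding abs_mult using HHb[OF that] elim(1) z that rT r0T K0 by (intro mult_mono) auto
        then have "(\<Sum>x\<in>box n. \<bar>HH r x * (\<Theta> r \<zeta> x - \<Theta> r0 \<zeta> x)\<bar>) \<le> cb * (K * e1)"
          unfolding cb_def by (intro sum_bounded_above) auto
        then show ?thesis unfolding f_def using sum_abs[of "\<lambda>x. HH r x * (\<Theta> r \<zeta> x - \<Theta> r0 \<zeta> x)" "box n"] by linarith
      qed
      note fi = interval_integral_bound[OF fm fb Ih(2)[of k N], folded I_def, unfolded Ih(1)]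
      have hi: "integrable lborel (\<lambda>r. \<Theta> r0 \<zeta> x * (indicator (I N k) r * HH r x))" if "x \<in> box n" for x
        unfolding I_def by (intro integrable_mult_right interval_integral_bound(1)[OF HHm[of x] HHb[OF that] Ih(2)[of k N]])
      have "V N k \<zeta> = (\<integral>r. indicator (I N k) r * f r + (\<Sum>x\<in>box n. \<Theta> r0 \<zeta> x * (indicator (I N k) r * HH r x)) \<partial>lborel)"
        unfolding V_def Y f_def
        by (rule Bochner_Integration.integral_cong[OF refl])
           (simp add: sum_distrib_left sum.distrib[symmetric] algebra_simps)
      also have "\<dots> = (\<integral>r. indicator (I N k) r * f r \<partial>lborel) + (\<Sum>x\<in>box n. \<Theta> r0 \<zeta> x * (\<integral>r. indicator (I N k) r * HH r x \<partial>lborel))"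
        using fi(1) hi by (simp add: Bochner_Integration.integral_sum)
      also have "(\<Sum>x\<in>box n. \<Theta> r0 \<zeta> x * (\<integral>r. indicator (I N k) r * HH r x \<partial>lborel)) = h N * (\<Sum>x\<in>box n. Hb N k x * \<Theta> r0 \<zeta> x)"
        unfolding Hb_def sum_distrib_left using h0[of N] by (intro sum.cong refl) simp
      finally have "V N k \<zeta> \<le> h N * (cb * (K * e1)) + h N * (\<Sum>x\<in>box n. Hb N k x * \<Theta> r0 \<zeta> x)"
        using fi(2) by linarith
      then have "\<delta> * V N k \<zeta> \<le> \<delta> * (h N * (cb * (K * e1)) + h N * (\<Sum>x\<in>box n. Hb N k x * \<Theta> r0 \<zeta> x))"
        using d0 by (intro mult_left_mono) auto
      also have "\<dots> = h N * (\<delta> * (\<Sum>x\<in>box n. Hb N k x * \<Theta> r0 \<zeta> x) + \<delta> * (cb * (K * e1)))" by (simp add: algebra_simps)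
      also have "\<dots> \<le> h N * (\<delta> * (\<Sum>x\<in>box n. Hb N k x * \<Theta> r0 \<zeta> x) + 1/2)"
        using e1(2) h0[of N] by (intro mult_left_mono add_left_mono) auto
      finally show ?thesis unfolding \<Theta>za[OF r0T] .
    qed
    have Vw: "\<bar>\<delta> * V N k \<zeta>\<bar> \<le> \<delta> * (h N * KY)" for k \<zeta>
      unfolding abs_mult using Vb d0 by (intro mult_mono) auto
    have "(\<Sum>\<zeta>\<in>Omega n. fkw F n (h N) (\<lambda>k \<zeta>. \<delta> * V N k \<zeta>) (muU n (\<lambda>x. u 0 (xr n x))) (Suc N) \<zeta>)
       \<le> exp (T * (C * R + 1/2 + (exp (2 * (\<delta> * (h N * KY))) - 1) * X))"
      unfolding X_def
      by (rule fkw_bound[where K=K and Hb="Hb N" and A=A and j=j and V="V N", OF n1 eps(1) eps(2) h0 hT C \<delta> R pb Vw Vle Hbb]; assumption)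
    also have "\<dots> \<le> exp \<beta>"
    proof -
      have "T * (C * R + 1/2 + (exp (2 * (\<delta> * (h N * KY))) - 1) * X) \<le> T * (C * R + 1)"
        using elim(2) T_pos by (intro mult_left_mono) auto
      then show ?thesis using \<beta>(2) by simp
    qed
    finally have Z: "(\<Sum>\<zeta>\<in>Omega n. fkw F n (h N) (\<lambda>k \<zeta>. \<delta> * V N k \<zeta>) (muU n (\<lambda>x. u 0 (xr n x))) (Suc N) \<zeta>) \<le> exp \<beta>" .
    have "muU n (\<lambda>x. u 0 (xr n x)) = mu_prod u n 0" unfolding muU_def mu_prod_def by (rule ext) simp
    moreover have "0 \<in> {0..T}" using T_pos by simp
    ultimately show ?case
      using discrete_tail[OF c n1 h0 tor \<beta>(1) d0 \<beta>(3) Z] unfolding XN_def bnd_def Hent_def by simp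
  qed
  have XNm: "XN N \<in> borel_measurable M" for N
  proof -
    have "integrable M (\<lambda>\<omega>. (\<lambda>f. \<Sum>k<Suc N. V N k (f (Suc k))) (hist \<eta> (h N) (Suc N) \<omega>))"
      by (rule hist_integrable(1)[OF c n1 h0])
    moreover have "(\<lambda>f. \<Sum>k<Suc N. V N k (f (Suc k))) (hist \<eta> (h N) (Suc N) \<omega>) = XN N \<omega>" for \<omega>
      unfolding XN_def hist_def by (intro sum.cong refl) simp
    ultimately have "integrable M (XN N)" by simp
    then show ?thesis by (rule borel_measurable_integrable)
  qed
  have XNlim: "(\<lambda>N. XN N \<omega>) \<longlonglongrightarrow> (\<integral>r. Y r (\<eta> r \<omega>) \<partial>lborel)" if w: "\<omega> \<in> space M" for \<omega>
    unfolding XN_def V_def I_def h_def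
    by (rule uniform_grid_limit[where E="Omega n" and B=KY and z="\<lambda>r. \<eta> r \<omega>"])
       (use T_pos is_ctmcD(3,4)[OF c _ w] Ym Yb Y0 in auto)
  have Xm: "(\<lambda>\<omega>. \<integral>r. Y r (\<eta> r \<omega>) \<partial>lborel) \<in> borel_measurable M"
    by (rule borel_measurable_LIMSEQ_real[OF XNlim XNm])
  then show "{\<omega>\<in>space M. lam < (\<integral>r. Y r (\<eta> r \<omega>) \<partial>lborel)} \<in> sets M"
    using borel_measurable_less[OF borel_measurable_const] by simp
  \<comment> \<open>A strict inequality in the limit holds from some index on, so the event lies in
    the increasing union of the \<open>B m\<close>. Each \<open>B m\<close> is contained in the
    event of the single index m, whose probability is eventually bounded.\<close>
  define B where "B m = {\<omega>\<in>space M. \<forall>N\<ge>m. lam < XN N \<omega>}" for m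
  have sN: "{\<omega>\<in>space M. lam < XN N \<omega>} \<in> sets M" for N
    using borel_measurable_less[OF borel_measurable_const XNm] by simp
  have Bs: "B m \<in> sets M" for m
  proof -
    have "B m = space M \<inter> (\<Inter>N\<in>{m..}. {\<omega>\<in>space M. lam < XN N \<omega>})" unfolding B_def by auto
    then show ?thesis using sN by auto
  qed
  have inc: "incseq B" unfolding B_def incseq_def by auto
  have "(\<lambda>m. measure M (B m)) \<longlonglongrightarrow> measure M (\<Union>m. B m)"
    by (rule finite_Lim_measure_incseq) (use Bs inc in auto)
  moreover have "\<forall>\<^sub>F m in sequentially. measure M (B m) \<le> bnd"
    using tail
  proof eventually_elim
    case (elim m)
    have "measure M (B m) \<le> measure M {\<omega>\<in>space M. lam < XN m \<omega>}"
      by (rule finite_measure_mono[OF _ sN]) (auto simp: B_def)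
    then show ?case using elim by simp
  qed
  ultimately have "measure M (\<Union>m. B m) \<le> bnd" by (rule tendsto_upperbound) simp
  moreover have "measure M {\<omega>\<in>space M. lam < (\<integral>r. Y r (\<eta> r \<omega>) \<partial>lborel)} \<le> measure M (\<Union>m. B m)"
  proof (rule finite_measure_mono)
    show "(\<Union>m. B m) \<in> sets M" using Bs by auto
    show "{\<omega>\<in>space M. lam < (\<integral>r. Y r (\<eta> r \<omega>) \<partial>lborel)} \<subseteq> (\<Union>m. B m)"
    proof clarify
      fix \<omega> assume w: "\<omega> \<in> space M" and l: "lam < (\<integral>r. Y r (\<eta> r \<omega>) \<partial>lborel)"
      from order_tendstoD(1)[OF XNlim[OF w] l] obtain m where "\<forall>N\<ge>m. lam < XN N \<omega>"
        unfolding eventually_sequentially by blast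
      then show "\<omega> \<in> (\<Union>m. B m)" using w unfolding B_def by auto
    qed
  qed
  ultimately show "measure M {\<omega>\<in>space M. lam < (\<integral>r. Y r (\<eta> r \<omega>) \<partial>lborel)} \<le> (Hent u n M \<eta> 0 + ln 2) / \<beta>"
    unfolding bnd_def by linarith
qed

end

section \<open>Conclusion\<close>

text \<open>A one-sided tail for \<open>H\<close> and one for its negative, hence the factor
  2.\<close>

lemma (in pde) bad_prob_bound:
  fixes A :: "(int^'d) set" and j :: 'd and H :: "real \<Rightarrow> int^'d \<Rightarrow> real" and \<eta> :: "real \<Rightarrow> 'w \<Rightarrow> int^'d \<Rightarrow> bool"
  assumes n1: "n \<ge> 1" and eps: "\<epsilon> > 0" "\<And>t x. t \<in> {0..T} \<Longrightarrow> \<epsilon> \<le> u t x \<and> u t x \<le> 1 - \<epsilon>"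
    and C: "C > 0" and \<delta>: "\<delta> = exp (- C * T) / 2" and R: "R \<ge> 0"
    and pb: "production_le A j K n C R"
    and c: "is_ctmc F n M \<eta>" and st: "0 \<le> s" "t \<le> T"
    and K: "K > 0" and Hb: "\<forall>r\<in>{0..T}. \<forall>x\<in>box n. \<bar>H r x\<bar> \<le> K"
    and Hm: "\<forall>x. set_borel_measurable borel {0..T} (\<lambda>r. H r x)"
    and \<beta>: "\<beta> > 0" "T * (C * R + 1) \<le> \<beta>" "\<delta> * (lam * real n powr (real CARD('d) / 2)) = 2 * \<beta>"
  shows "bad_prob u n M \<eta> A (axis j 1) H s t lam \<le> 2 * ((Hent u n M \<eta> 0 + ln 2) / \<beta>)"
proof -
  interpret prob_space M by (rule is_ctmcD(1)[OF c])
  define P where "P = real n powr (real CARD('d) / 2)"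
  have P0: "P > 0" unfolding P_def using n1 by simp
  \<comment> \<open>\<open>c\<close> is the sign. The interval is taken open at \<open>s\<close>, so
    that the extension by 0 also vanishes at time 0, as \<open>path_tail\<close> requires.\<close>
  define HH where "HH c r x = c * (indicator {s<..t} r * H r x)" for c r :: real and x
  define Y where "Y c r \<xi> = (\<Sum>x\<in>box n. HH c r x * ((\<Prod>a\<in>A. omg u n \<xi> r (x + a)) * omg u n \<xi> r (x + axis j 1)))" for c r \<xi>
  define bad where "bad c = {\<omega>\<in>space M. lam * P < (\<integral>r. Y c r (\<eta> r \<omega>) \<partial>lborel)}" for c
  have tail: "bad c \<in> sets M \<and> measure M (bad c) \<le> (Hent u n M \<eta> 0 + ln 2) / \<beta>" if c1: "\<bar>c\<bar> = 1" for c
  proof -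
    have m: "(\<lambda>r. HH c r x) \<in> borel_measurable borel" for x
    proof -
      have "(\<lambda>r. c * (indicator {s<..t} r * (indicator {0..T} r *\<^sub>R H r x))) \<in> borel_measurable borel"
        using Hm unfolding set_borel_measurable_def
        by (intro borel_measurable_times borel_measurable_const borel_measurable_indicator) auto
      moreover have "c * (indicator {s<..t} r * (indicator {0..T} r *\<^sub>R H r x)) = HH c r x" for r
        unfolding HH_def using st by (auto simp: indicator_def)
      ultimately show ?thesis by simp
    qed
    have b: "\<bar>HH c r x\<bar> \<le> K" if "x \<in> box n" for r x
      unfolding HH_def abs_mult c1 using Hb that st K by (auto simp: indicator_def)
    have z: "HH c r x = 0" if "r \<notin> {0<..T}" for r x
      unfolding HH_def using that st by (auto simp: indicator_def)
    note pt = path_tail[where HH="HH c" and lam="lam * P" and K=K and A=A and j=j, OF n1 eps(1) eps(2) C \<delta> R pb \<open>is_ctmc F n M \<eta>\<close> m b z \<beta>(1,2) \<beta>(3)[folded P_def]]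
    show ?thesis unfolding bad_def Y_def by (rule conjI; (rule pt(1) | rule pt(2)); assumption)
  qed
  have eq: "set_lebesgue_integral lborel {s..t} (\<lambda>r. integrand u n A (axis j 1) H (\<eta> r \<omega>) r) = (\<integral>r. Y 1 r (\<eta> r \<omega>) \<partial>lborel) / P" for \<omega>
  proof -
    have "set_lebesgue_integral lborel {s..t} (\<lambda>r. integrand u n A (axis j 1) H (\<eta> r \<omega>) r) = (\<integral>r. Y 1 r (\<eta> r \<omega>) / P \<partial>lborel)"
      unfolding set_lebesgue_integral_def
    \<comment> \<open>Passing from the closed to the left-open interval changes the integrand at a
      single point.\<close>
    proof (rule integral_discrete_difference[of "{s}"])
      fix r assume "r \<notin> {s}"
      then have "indicator {s..t} r = (indicator {s<..t} r :: real)" by (auto simp: indicator_def)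
      then show "indicator {s..t} r *\<^sub>R integrand u n A (axis j 1) H (\<eta> r \<omega>) r = Y 1 r (\<eta> r \<omega>) / P"
        unfolding integrand_def Y_def HH_def P_def[symmetric] by (simp add: sum_distrib_left sum_divide_distrib mult_ac)
    qed auto
    then show ?thesis by simp
  qed
  have neg: "(\<integral>r. Y (- 1) r (\<eta> r \<omega>) \<partial>lborel) = - (\<integral>r. Y 1 r (\<eta> r \<omega>) \<partial>lborel)" for \<omega>
  proof -
    have "Y (- 1) r \<xi> = - Y 1 r \<xi>" for r \<xi> unfolding Y_def HH_def by (simp add: sum_negf)
    then show ?thesis by simp
  qed
  have "bad_prob u n M \<eta> A (axis j 1) H s t lam \<le> measure M (bad 1 \<union> bad (- 1))"
    unfolding bad_prob_def
  proof (rule finite_measure_mono)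
    show "{\<omega>\<in>space M. lam < \<bar>set_lebesgue_integral lborel {s..t} (\<lambda>s'. integrand u n A (axis j 1) H (\<eta> s' \<omega>) s')\<bar>} \<subseteq> bad 1 \<union> bad (- 1)"
    proof
      fix \<omega> assume w: "\<omega> \<in> {\<omega>\<in>space M. lam < \<bar>set_lebesgue_integral lborel {s..t} (\<lambda>s'. integrand u n A (axis j 1) H (\<eta> s' \<omega>) s')\<bar>}"
      then have "lam < \<bar>\<integral>r. Y 1 r (\<eta> r \<omega>) \<partial>lborel\<bar> / P" unfolding eq using P0 by (simp add: abs_divide)
      then have "lam * P < \<bar>\<integral>r. Y 1 r (\<eta> r \<omega>) \<partial>lborel\<bar>" using P0 by (simp add: pos_less_divide_eq)
      then show "\<omega> \<in> bad 1 \<union> bad (- 1)" unfolding bad_def neg using w by (auto simp: abs_if split: if_splits)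
    qed
  qed (use tail in auto)
  also have "\<dots> \<le> measure M (bad 1) + measure M (bad (- 1))"
    using tail[of 1] tail[of "- 1"] by (intro measure_Un_le) auto
  also have "\<dots> \<le> 2 * ((Hent u n M \<eta> 0 + ln 2) / \<beta>)"
    unfolding mult_2 using tail[of 1] tail[of "- 1"] by (intro add_mono) auto
  finally show ?thesis .
qed

theorem theorem5p1:
  fixes F :: "real^'d::finite \<Rightarrow> real^'d"
    and u0 :: "real^'d \<Rightarrow> real"
    and u :: "real \<Rightarrow> real^'d \<Rightarrow> real"
    and T :: real
    and A :: "(int^'d) set"
    and b :: "int^'d"
    and M :: "nat \<Rightarrow> 'w measure"
    and \<eta> :: "nat \<Rightarrow> real \<Rightarrow> 'w \<Rightarrow> (int^'d \<Rightarrow> bool)"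
    and Hs :: "nat \<Rightarrow> real \<Rightarrow> int^'d \<Rightarrow> real"
  assumes dim: "CARD('d) \<le> 3"
    and F_smooth: "\<forall>i. smooth_fun (\<lambda>x. F x $ i)"
    and F_per: "\<forall>x i. F (x + axis i 1) = F x"
    and u0_smooth: "smooth_fun u0"
    and u0_per: "\<forall>x i. u0 (x + axis i 1) = u0 x"
    and u0_bounds: "\<exists>\<epsilon>0>0. \<forall>x. \<epsilon>0 \<le> u0 x \<and> u0 x \<le> 1 - \<epsilon>0"
    and T_pos: "T > 0"
    and u_smooth: "smooth_fun (\<lambda>p::real \<times> (real^'d). u (fst p) (snd p))"
    and u_init: "u 0 = u0"
    and u_per: "\<forall>t\<in>{0..T}. \<forall>x i. u t (x + axis i 1) = u t x"
    and u_pde: "\<forall>t\<in>{0..T}. \<forall>x. deriv (\<lambda>\<tau>. u \<tau> x) t =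
                  (\<Sum>i\<in>UNIV. pd i (pd i (u t)) x)
                  - 2 * (\<Sum>i\<in>UNIV. pd i (\<lambda>y. u t y * (1 - u t y) * F y $ i) x)"
    and chain: "\<forall>n\<ge>1. is_ctmc F n (M n) (\<eta> n)"
    and A_ne: "A \<noteq> {}" and A_fin: "finite A"
    and A_nonpos: "\<forall>a\<in>A. \<forall>i. a $ i \<le> 0"
    and b_basis: "b \<in> basisZ"
    and H_bdd: "\<exists>K. \<forall>n. \<forall>s\<in>{0..T}. \<forall>x\<in>box n. \<bar>Hs n s x\<bar> \<le> K"
    and H_meas: "\<forall>n x. set_borel_measurable borel {0..T} (\<lambda>s. Hs n s x)"
    and entropy0: "(\<lambda>n. Hent u n (M n) (\<eta> n) 0 / real n powr (real CARD('d) / 2)) \<longlonglongrightarrow> 0"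
  shows "(\<forall>s t lam. 0 \<le> s \<and> s < t \<and> t \<le> T \<and> lam > 0 \<longrightarrow>
            (\<lambda>n. bad_prob u n (M n) (\<eta> n) A b (Hs n) s t lam) \<longlonglongrightarrow> 0)
       \<and> (\<forall>K>0. \<forall>s t lam. 0 \<le> s \<and> s < t \<and> t \<le> T \<and> lam > 0 \<longrightarrow>
            (\<forall>\<epsilon>>0. \<exists>N. \<forall>n\<ge>N. \<forall>H::real \<Rightarrow> int^'d \<Rightarrow> real.
               (\<forall>s'\<in>{0..T}. \<forall>x\<in>box n. \<bar>H s' x\<bar> \<le> K) \<and>
               (\<forall>x. set_borel_measurable borel {0..T} (\<lambda>s'. H s' x)) \<longrightarrow>
               bad_prob u n (M n) (\<eta> n) A b H s t lam < \<epsilon>))"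
proof -
  interpret pde F u0 u T
    by unfold_locales (fact F_smooth u0_bounds F_per T_pos u_smooth u_init u_per u_pde)+
  obtain j where b: "b = axis j 1" using b_basis unfolding basisZ_def by auto
  obtain \<epsilon> where eps: "\<epsilon> > 0" "\<And>t x. t \<in> {0..T} \<Longrightarrow> \<epsilon> \<le> u t x \<and> u t x \<le> 1 - \<epsilon>"
    using u_bounds by blast
  define d where "d = real CARD('d) / 2"
  have d0: "d > 0" unfolding d_def by simp
  \<comment> \<open>The uniform statement comes first: the threshold for n depends on
    \<open>H\<close> only through \<open>K\<close>, so the first claim follows by
    specialisation.\<close>
  have uniform: "\<exists>N. \<forall>n\<ge>N. \<forall>H::real \<Rightarrow> int^'d \<Rightarrow> real.
               (\<forall>s'\<in>{0..T}. \<forall>x\<in>box n. \<bar>H s' x\<bar> \<le> K) \<and>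
               (\<forall>x. set_borel_measurable borel {0..T} (\<lambda>s'. H s' x)) \<longrightarrow>
               bad_prob u n (M n) (\<eta> n) A b H s t lam < e"
    if K: "K > 0" and st: "0 \<le> s" "s < t" "t \<le> T" and lam: "lam > 0" and e: "e > 0" for K s t lam e :: real
  proof -
    obtain C n0 where C: "C > 0" "n0 \<ge> 1" and pb: "\<And>n. n \<ge> n0 \<Longrightarrow> production_le A j K n C (real n powr (real CARD('d) / 2 - 1/10))"
      using production_bound[OF dim A_fin A_ne _ K eps(1) eps(2), of j] A_nonpos by blast
    define \<delta> where "\<delta> = exp (- C * T) / 2"
    have dl: "\<delta> * lam > 0" unfolding \<delta>_def using lam by simp
    have pw: "(\<lambda>n. real n powr - a) \<longlonglongrightarrow> 0" if "a > 0" for a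
      by (rule tendsto_neg_powr[OF _ filterlim_real_sequentially]) (use that in simp)
    have "(\<lambda>n. T * (C * real n powr - (1/10) + real n powr - d)) \<longlonglongrightarrow> T * (C * 0 + 0)"
      by (intro tendsto_intros pw) (use d0 in auto)
    then have 1: "\<forall>\<^sub>F n in sequentially. T * (C * real n powr - (1/10) + real n powr - d) < \<delta> * lam / 2"
      by (rule order_tendstoD(2)) (use dl in simp)
    have "(\<lambda>n. 4 / (\<delta> * lam) * (Hent u n (M n) (\<eta> n) 0 / real n powr d + ln 2 * real n powr - d)) \<longlonglongrightarrow> 4 / (\<delta> * lam) * (0 + ln 2 * 0)"
      by (intro tendsto_intros pw d0 entropy0[folded d_def])
    then have 2: "\<forall>\<^sub>F n in sequentially. 4 / (\<delta> * lam) * (Hent u n (M n) (\<eta> n) 0 / real n powr d + ln 2 * real n powr - d) < e"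
      by (rule order_tendstoD(2)) (use e in simp)
    have "\<forall>\<^sub>F n in sequentially. \<forall>H::real \<Rightarrow> int^'d \<Rightarrow> real.
               (\<forall>s'\<in>{0..T}. \<forall>x\<in>box n. \<bar>H s' x\<bar> \<le> K) \<and>
               (\<forall>x. set_borel_measurable borel {0..T} (\<lambda>s'. H s' x)) \<longrightarrow>
               bad_prob u n (M n) (\<eta> n) A b H s t lam < e"
      using 1 2 eventually_ge_at_top[of n0]
    proof eventually_elim
      case (elim n)
      have n1: "n \<ge> 1" using elim(3) C(2) by simp
      define P where "P = real n powr d"
      have P0: "P > 0" unfolding P_def using n1 by simp
      define R where "R = real n powr (real CARD('d) / 2 - 1/10)"
      \<comment> \<open>Half of \<open>\<delta> * lam\<close> times n^(d/2). This scale dominates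
        n^(d/2 - 1/10), so the condition on \<beta> holds for large n, and by hypothesis the initial
        entropy is negligible against it.\<close>
      define \<beta> where "\<beta> = \<delta> * lam * P / 2"
      have Pi: "real n powr - d = 1 / P" unfolding P_def by (simp add: powr_minus_divide)
      have RP: "R = P * real n powr - (1/10)" unfolding R_def P_def d_def powr_add[symmetric] by simp
      have "T * (C * R + 1) = P * (T * (C * real n powr - (1/10) + real n powr - d))"
        unfolding RP Pi using P0 by (simp add: field_simps)
      also have "\<dots> \<le> P * (\<delta> * lam / 2)" using elim(1) P0 by (intro mult_left_mono) auto
      finally have \<beta>2: "T * (C * R + 1) \<le> \<beta>" unfolding \<beta>_def by (simp add: mult_ac)
      have \<beta>1: "\<beta> > 0" unfolding \<beta>_def using dl P0 by simp
      have \<beta>3: "\<delta> * (lam * real n powr (real CARD('d) / 2)) = 2 * \<beta>" unfolding \<beta>_def P_def d_def by simp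
      have R0: "R \<ge> 0" unfolding R_def by simp
      have c: "is_ctmc F n (M n) (\<eta> n)" using chain n1 by blast
      have val: "2 * ((Hent u n (M n) (\<eta> n) 0 + ln 2) / \<beta>) < e"
      proof -
        have "2 * ((Hent u n (M n) (\<eta> n) 0 + ln 2) / \<beta>) = 4 / (\<delta> * lam) * (Hent u n (M n) (\<eta> n) 0 / P + ln 2 * (1 / P))"
          unfolding \<beta>_def using dl P0 by (simp add: field_simps)
        then show ?thesis using elim(2) unfolding Pi P_def[symmetric] by simp
      qed
      show ?case
      proof (intro allI impI, elim conjE)
        fix H :: "real \<Rightarrow> int^'d \<Rightarrow> real"
        assume H: "\<forall>s'\<in>{0..T}. \<forall>x\<in>box n. \<bar>H s' x\<bar> \<le> K" "\<forall>x. set_borel_measurable borel {0..T} (\<lambda>s'. H s' x)"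
        have "bad_prob u n (M n) (\<eta> n) A b H s t lam \<le> 2 * ((Hent u n (M n) (\<eta> n) 0 + ln 2) / \<beta>)"
          unfolding b
          by (rule bad_prob_bound[where K=K and A=A and j=j, OF n1 eps(1) eps(2) C(1) \<delta>_def R0 pb[OF elim(3), folded R_def] c st(1) st(3) K H \<beta>1 \<beta>2 \<beta>3]; assumption)
        then show "bad_prob u n (M n) (\<eta> n) A b H s t lam < e" using val by linarith
      qed
    qed
    then show ?thesis unfolding eventually_sequentially .
  qed
  show ?thesis
  proof (intro conjI allI impI)
    fix s t lam :: real
    assume a: "0 \<le> s \<and> s < t \<and> t \<le> T \<and> lam > 0"
    obtain K where K: "\<forall>n. \<forall>s\<in>{0..T}. \<forall>x\<in>box n. \<bar>Hs n s x\<bar> \<le> K" using H_bdd by blast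
    \<comment> \<open>The given bound may be 0, whereas the uniform statement asks for a positive
      one.\<close>
    have K1: "\<bar>K\<bar> + 1 > 0" by simp
    have KK: "\<bar>Hs n s x\<bar> \<le> \<bar>K\<bar> + 1" if "s \<in> {0..T}" "x \<in> box n" for n s x
    proof -
      have "\<bar>Hs n s x\<bar> \<le> K" using K that by blast
      then show ?thesis by linarith
    qed
    show "(\<lambda>n. bad_prob u n (M n) (\<eta> n) A b (Hs n) s t lam) \<longlonglongrightarrow> 0"
    proof (rule LIMSEQ_I)
      fix e :: real assume "e > 0"
      then obtain N where N: "\<And>n H. n \<ge> N \<Longrightarrow> (\<forall>s'\<in>{0..T}. \<forall>x\<in>box n. \<bar>H s' x\<bar> \<le> \<bar>K\<bar> + 1) \<and>
               (\<forall>x. set_borel_measurable borel {0..T} (\<lambda>s'. H s' x)) \<Longrightarrow> bad_prob u n (M n) (\<eta> n) A b H s t lam < e"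
        using uniform[OF K1, of s t lam e] a by blast
      show "\<exists>N. \<forall>n\<ge>N. norm (bad_prob u n (M n) (\<eta> n) A b (Hs n) s t lam - 0) < e"
      proof (intro exI[of _ N] allI impI)
        fix n assume "n \<ge> N"
        from N[OF this, of "Hs n"] have "bad_prob u n (M n) (\<eta> n) A b (Hs n) s t lam < e" using KK H_meas by blast
        moreover have "bad_prob u n (M n) (\<eta> n) A b (Hs n) s t lam \<ge> 0" unfolding bad_prob_def by simp
        ultimately show "norm (bad_prob u n (M n) (\<eta> n) A b (Hs n) s t lam - 0) < e" by simp
      qed
    qed
  next
    fix K s t lam e :: real
    assume "K > 0" "0 \<le> s \<and> s < t \<and> t \<le> T \<and> lam > 0" "e > 0"
    then show "\<exists>N. \<forall>n\<ge>N. \<forall>H::real \<Rightarrow> int^'d \<Rightarrow> real.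
               (\<forall>s'\<in>{0..T}. \<forall>x\<in>box n. \<bar>H s' x\<bar> \<le> K) \<and>
               (\<forall>x. set_borel_measurable borel {0..T} (\<lambda>s'. H s' x)) \<longrightarrow>
               bad_prob u n (M n) (\<eta> n) A b H s t lam < e"
      using uniform[of K s t lam e] by blast
  qed
qed

end
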